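(* Let $P$ be a polynomial representation over the finite field $K$. For any subset $X$ of $P$ there is a unique decomposition (up to reordering) $$X=X_1\cup\ldots\cup X_k$$ where all $X_i$ are irreducible subsets of $P$ and none is contained in any other.
   Context: Let $\mathbf{Vec}$ be the category of finite-dimensional vector spaces over the finite field $K$. For $V\in\mathbf{Vec}$, $K[V]$ denotes the $K$-algebra of all functions $V\to K$, and $K[V]_{\le d}$ the subspace of functions given by a polynomial of degree at most $d$ in linear coordinates ($K[V]_{\le -1}=\{0\}$). A polynomial (generic) representation is a functor $P:\mathbf{Vec}\to\mathbf{Vec}$ for which there exists $d$ such that for all $U,V\in\mathbf{Vec}$ the map $P:\mathrm{Hom}(U,V)\to\mathrm{Hom}(P(U),P(V))$ lies in $K[\mathrm{Hom}(U,V)]_{\le d}\otimes\mathrm{Hom}(P(U),P(V))$. A subset $X$ of $P$ is the data of a subset $X(V)$ of $P(V)$ for every $V\in\mathbf{Vec}$ such that $P(\phi)X(V)\subseteq X(W)$ for all $V,W\in\mathbf{Vec}$ and all $\phi\in\mathrm{Hom}(V,W)$. Inclusions, equalities and unions of subsets are meant for every $V$ separately. A subset $X$ of $P$ is called irreducible if $X(0)\ne\emptyset$ and if, whenever $X_1,X_2$ are subsets of $P$ such that $X(V)=X_1(V)\cup X_2(V)$ for all $V\in\mathbf{Vec}$, it follows that $X=X_1$ or $X=X_2$. (The empty decomposition, $k=0$, is allowed for the empty subset.) *)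

theory Defs
  imports "Jordan_Normal_Form.Missing_VectorSpace"
begin

text \<open>
  The finite-dimensional vector spaces over \<open>K\<close> whose underlying sets consist of
  elements of \<open>'v\<close>.  The type \<open>'v\<close> plays the role of a universe: if it is infinite
  and \<open>K\<close> is finite, then every finite-dimensional \<open>K\<close>-vector space has an
  isomorphic copy here.
\<close>

definition Vec :: "('k, 'm) ring_scheme \<Rightarrow> ('k, 'v) module set" where
  "Vec K = {V. vectorspace K V \<and> vectorspace.fin_dim K V}"

text \<open>
  Linear maps are taken extensional outside the domain, so that equality of
  HOL functions is equality of morphisms.
\<close>

definition Hom ::
    "('k, 'm) ring_scheme \<Rightarrow> ('k, 'a) module \<Rightarrow> ('k, 'b) module \<Rightarrow> ('a \<Rightarrow> 'b) set" where
  "Hom K U V = module_hom K U V \<inter> extensional (carrier U)"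

text \<open>
  The record type \<^typ>\<open>('k, 'v) module\<close> extends the type of rings; its fields
  \<^const>\<open>mult\<close> and \<^const>\<open>one\<close> have no meaning for a module.
\<close>

definition Hom_space ::
    "('k, 'm) ring_scheme \<Rightarrow> ('k, 'a) module \<Rightarrow> ('k, 'b) module \<Rightarrow> ('k, 'a \<Rightarrow> 'b) module" where
  "Hom_space K U V =
    \<lparr>carrier = Hom K U V,
     mult = undefined,
     one = undefined,
     zero = (\<lambda>u\<in>carrier U. \<zero>\<^bsub>V\<^esub>),
     add = (\<lambda>f g. \<lambda>u\<in>carrier U. f u \<oplus>\<^bsub>V\<^esub> g u),
     smult = (\<lambda>c f. \<lambda>u\<in>carrier U. c \<odot>\<^bsub>V\<^esub> f u)\<rparr>"

text \<open>
  A system of linear coordinates is a linear isomorphism \<open>x\<close> from \<open>V\<close> onto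
  \<open>K\<^sup>n\<close>; the \<open>i\<close>-th coordinate of \<open>v\<close> is \<open>x v i\<close>.
\<close>

definition linear_coordinates ::
    "('k, 'm) ring_scheme \<Rightarrow> ('k, 'a) module \<Rightarrow> nat \<Rightarrow> ('a \<Rightarrow> nat \<Rightarrow> 'k) \<Rightarrow> bool" where
  "linear_coordinates K V n x \<longleftrightarrow>
     x \<in> module_hom K V (ring.func_space K {..<n}) \<and>
     bij_betw x (carrier V) (carrier (ring.func_space K {..<n}))"

text \<open>
  The exponent vectors of the monomials of degree at most \<open>d\<close> in \<open>n\<close> variables.
\<close>

definition exponents :: "nat \<Rightarrow> int \<Rightarrow> (nat \<Rightarrow> nat) set" where
  "exponents n d = {e \<in> {..<n} \<rightarrow>\<^sub>E UNIV. int (\<Sum>i<n. e i) \<le> d}"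

text \<open>
  \<open>K[V]\<^bsub>\<le>d\<^esub>\<close>. For negative \<open>d\<close> the sum is empty and only the zero function remains.
\<close>

definition polynomial_functions ::
    "('k, 'm) ring_scheme \<Rightarrow> ('k, 'a) module \<Rightarrow> int \<Rightarrow> ('a \<Rightarrow> 'k) set" where
  "polynomial_functions K V d =
    {f \<in> carrier V \<rightarrow>\<^sub>E carrier K.
       \<exists>n x c. linear_coordinates K V n x \<and>
         c \<in> exponents n d \<rightarrow> carrier K \<and>
         (\<forall>v\<in>carrier V. f v =
            (\<Oplus>\<^bsub>K\<^esub>e\<in>exponents n d.
               c e \<otimes>\<^bsub>K\<^esub> (\<Otimes>\<^bsub>K\<^esub>i\<in>{..<n}. x v i [^]\<^bsub>K\<^esub> e i)))}"

text \<open>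
  The maps from \<open>V\<close> to \<open>W\<close> that lie in \<open>K[V]\<^bsub>\<le>d\<^esub> \<otimes> W\<close>, where \<open>f \<otimes> w\<close> is identified with
  the map \<open>v \<mapsto> f(v) w\<close>.
\<close>

definition polynomial_maps ::
    "('k, 'm) ring_scheme \<Rightarrow> ('k, 'a) module \<Rightarrow> ('k, 'b) module \<Rightarrow> int \<Rightarrow> ('a \<Rightarrow> 'b) set" where
  "polynomial_maps K V W d =
    {F \<in> carrier V \<rightarrow> carrier W.
       \<exists>(n::nat) f w. (\<forall>j<n. f j \<in> polynomial_functions K V d \<and> w j \<in> carrier W) \<and>
         (\<forall>v\<in>carrier V. F v = (\<Oplus>\<^bsub>W\<^esub>j\<in>{..<n}. f j v \<odot>\<^bsub>W\<^esub> w j))}"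

record ('k, 'v) vec_functor =
  Obj :: "('k, 'v) module \<Rightarrow> ('k, 'v) module"
  Arr :: "('k, 'v) module \<Rightarrow> ('k, 'v) module \<Rightarrow> ('v \<Rightarrow> 'v) \<Rightarrow> 'v \<Rightarrow> 'v"

locale polynomial_representation =
  fixes K :: "('k, 'm) ring_scheme"
    and P :: "('k, 'v) vec_functor"
  assumes Obj_closed: "V \<in> Vec K \<Longrightarrow> Obj P V \<in> Vec K"
    and Arr_closed: "\<lbrakk>U \<in> Vec K; V \<in> Vec K; \<phi> \<in> Hom K U V\<rbrakk>
      \<Longrightarrow> Arr P U V \<phi> \<in> Hom K (Obj P U) (Obj P V)"
    and Arr_id: "V \<in> Vec K
      \<Longrightarrow> Arr P V V (\<lambda>v\<in>carrier V. v) = (\<lambda>p\<in>carrier (Obj P V). p)"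
    and Arr_compose:
      "\<lbrakk>U \<in> Vec K; V \<in> Vec K; W \<in> Vec K; \<phi> \<in> Hom K U V; \<psi> \<in> Hom K V W\<rbrakk>
      \<Longrightarrow> Arr P U W (compose (carrier U) \<psi> \<phi>)
        = compose (carrier (Obj P U)) (Arr P V W \<psi>) (Arr P U V \<phi>)"
    and polynomial:
      "\<exists>d. \<forall>U\<in>Vec K. \<forall>V\<in>Vec K.
        Arr P U V \<in> polynomial_maps K (Hom_space K U V) (Hom_space K (Obj P U) (Obj P V)) d"

text \<open>
  A subset of \<open>P\<close> is a family indexed by \<^term>\<open>Vec K\<close>. The irrelevant values outside
  \<^term>\<open>Vec K\<close> are fixed to be empty, so that equality of HOL functions is
  equality of subsets of \<open>P\<close>.
\<close>

definition rep_subset ::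
    "('k, 'm) ring_scheme \<Rightarrow> ('k, 'v) vec_functor \<Rightarrow> (('k, 'v) module \<Rightarrow> 'v set) \<Rightarrow> bool" where
  "rep_subset K P X \<longleftrightarrow>
     (\<forall>V\<in>Vec K. X V \<subseteq> carrier (Obj P V)) \<and>
     (\<forall>V\<in>Vec K. \<forall>W\<in>Vec K. \<forall>\<phi>\<in>Hom K V W. Arr P V W \<phi> ` X V \<subseteq> X W) \<and>
     (\<forall>V. V \<notin> Vec K \<longrightarrow> X V = {})"

text \<open>
  \<open>X(0) \<noteq> \<emptyset>\<close> is required for every zero space; as they are all isomorphic, it
  does not matter which one is meant by \<open>0\<close>.
\<close>

definition irreducible_rep_subset ::
    "('k, 'm) ring_scheme \<Rightarrow> ('k, 'v) vec_functor \<Rightarrow> (('k, 'v) module \<Rightarrow> 'v set) \<Rightarrow> bool" where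
  "irreducible_rep_subset K P X \<longleftrightarrow>
     rep_subset K P X \<and>
     (\<forall>Z\<in>Vec K. carrier Z = {\<zero>\<^bsub>Z\<^esub>} \<longrightarrow> X Z \<noteq> {}) \<and>
     (\<forall>X1 X2. rep_subset K P X1 \<longrightarrow> rep_subset K P X2 \<longrightarrow>
        (\<forall>V\<in>Vec K. X V = X1 V \<union> X2 V) \<longrightarrow> X = X1 \<or> X = X2)"

definition irreducible_decomposition ::
    "('k, 'm) ring_scheme \<Rightarrow> ('k, 'v) vec_functor \<Rightarrow> (('k, 'v) module \<Rightarrow> 'v set)
      \<Rightarrow> (('k, 'v) module \<Rightarrow> 'v set) list \<Rightarrow> bool" where
  "irreducible_decomposition K P X Xs \<longleftrightarrow>
     (\<forall>i<length Xs. irreducible_rep_subset K P (Xs ! i)) \<and>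
     (\<forall>V\<in>Vec K. X V = (\<Union>i<length Xs. (Xs ! i) V)) \<and>
     (\<forall>i<length Xs. \<forall>j<length Xs. i \<noteq> j \<longrightarrow> \<not> (\<forall>V\<in>Vec K. (Xs ! i) V \<subseteq> (Xs ! j) V))"

end

theory Submission
  imports
    Complex_Main
    "HOL-Library.Function_Algebras"
    "HOL-Library.Ramsey"
    "HOL-Algebra.Elementary_Groups"
    "HOL-Algebra.Multiplicative_Group"
    Defs
begin

text \<open>
  It suffices that the elements of \<open>P\<close> are well-quasi-ordered by \<open>p \<le> q\<close> iff \<open>q\<close> is mapped to \<open>p\<close> by some
  linear map: then subsets of \<open>P\<close> satisfy the descending chain condition. The functor \<open>P\<close> is regarded as a
  functor from an additive category with finite Hom groups to finite abelian groups, on which Hom acts with bounded additive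
  degree. By induction on this degree, the shifts \<open>W \<mapsto> P (U \<oplus> W)\<close> are well-quasi-ordered modulo the image of \<open>P W\<close>.
  One then shrinks this subfunctor through simple steps \<open>M / M'\<close>, detected by a single character \<open>\<theta>\<close>. In a bad sequence modulo
  \<open>M'\<close> the phase functions \<open>\<theta> (\<psi> p)\<close> of \<open>\<psi>\<close> are biased, and one may assume that their Gowers norms are nearly constant along the
  sequence. Each of them is nearly captured by a random subgroup of bounded rank; adjoining the
  corresponding map to the element, the well-quasi-order modulo \<open>M\<close> gives \<open>\<alpha>\<close> with
  \<open>\<alpha> p\<^sub>j = p\<^sub>i + r\<close> and \<open>r \<in> M\<close>, compatibly with the captured data. Comparing averages, the phase function of \<open>r\<close> is nearly
  of absolute mean \<open>1\<close>, hence constant, so \<open>r \<in> M'\<close>: a contradiction.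
\<close>

section \<open>Averages and Gowers norms\<close>

text \<open>Modulo \<open>M\<close> nothing is known of the error \<open>r\<close> except that it
  lies in \<open>M\<close>, and the groups \<open>hom (V j) U\<close> on which the phases live grow
  with \<open>j\<close>, so finitely much data cannot fix a phase. What can be carried along is a
  map from \<open>V j\<close> to one fixed object. A bounded number of random maps to
  \<open>U\<close> suffices: Gowers averages, averaged over cosets, can only grow when a group is
  replaced by a subgroup, and the expected growth tends to 0 with the size of the sample. A
  polynomial phase whose averages of all positive orders hardly grow has nearly the same mean on the
  subgroup. This is used for the subgroup generated by the data adjoined to \<open>p j\<close> and
  the image of \<alpha>, where the phase of \<open>p j\<close> is that of \<open>p i\<close> times
  that of \<open>r\<close>; equal means leave the phase of \<open>r\<close> no room to oscillate.
  All constants depend on \<open>U\<close> and the degree, never on \<open>j\<close>, so they are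
  fixed before the pair \<open>i\<close>, \<open>j\<close> is found. The descent through simple
  steps ends because bounded degree modulo \<open>N\<close> makes a subfunctor containing
  \<open>N\<close> determined by its value at one object: the action of an identity follows from
  that of maps through a bounded power of the line.\<close>

definition fsub :: "'a::ab_group_add set \<Rightarrow> bool" where
  "fsub A \<longleftrightarrow> finite A \<and> 0 \<in> A \<and> (\<forall>x\<in>A. \<forall>y\<in>A. x - y \<in> A)"

lemma fsub_finite: "fsub A \<Longrightarrow> finite A"
  and fsub_0: "fsub A \<Longrightarrow> 0 \<in> A"
  and fsub_diff: "fsub A \<Longrightarrow> x \<in> A \<Longrightarrow> y \<in> A \<Longrightarrow> x - y \<in> A"
  by (auto simp: fsub_def)

lemma fsub_neg: "fsub A \<Longrightarrow> x \<in> A \<Longrightarrow> - x \<in> A"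
  using fsub_diff[of A 0 x] fsub_0 by auto

lemma fsub_add: "fsub A \<Longrightarrow> x \<in> A \<Longrightarrow> y \<in> A \<Longrightarrow> x + y \<in> A"
  using fsub_diff[of A x "- y"] fsub_neg by auto

lemma fsub_sum: "fsub B \<Longrightarrow> (\<And>k. k \<in> K \<Longrightarrow> x k \<in> B) \<Longrightarrow> sum x K \<in> B"
  by (induction K rule: infinite_finite_induct) (auto simp: fsub_0 fsub_add)

lemma fsub_nonempty: "fsub A \<Longrightarrow> A \<noteq> {}"
  using fsub_0 by auto

lemma fsub_card_pos: "fsub A \<Longrightarrow> card A > 0"
  using fsub_nonempty fsub_finite by (metis card_gt_0_iff)

lemma fsub_image:
  assumes "fsub A" and "\<And>x y. x \<in> A \<Longrightarrow> y \<in> A \<Longrightarrow> T (x - y) = T x - T y"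
  shows "fsub (T ` A)"
proof -
  have "T 0 = 0" using assms(2)[of 0 0] fsub_0[OF assms(1)] by simp
  then have "0 \<in> T ` A" using fsub_0[OF assms(1)] by (metis image_eqI)
  moreover have "x - y \<in> T ` A" if "x \<in> T ` A" "y \<in> T ` A" for x y
    using that assms fsub_diff by (force simp: image_iff)
  ultimately show ?thesis using assms(1) by (auto simp: fsub_def)
qed

definition ssum :: "'a::ab_group_add set \<Rightarrow> 'a set \<Rightarrow> 'a set" where
  "ssum A B = (\<lambda>(a, b). a + b) ` (A \<times> B)"

lemma ssumI: "a \<in> A \<Longrightarrow> b \<in> B \<Longrightarrow> a + b \<in> ssum A B"
  by (force simp: ssum_def)

lemma ssumE: "x \<in> ssum A B \<Longrightarrow> (\<And>a b. a \<in> A \<Longrightarrow> b \<in> B \<Longrightarrow> x = a + b \<Longrightarrow> P) \<Longrightarrow> P"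
  by (auto simp: ssum_def)

lemma fsub_ssum: "fsub A \<Longrightarrow> fsub B \<Longrightarrow> fsub (ssum A B)"
proof -
  assume a: "fsub A" "fsub B"
  have "x - y \<in> ssum A B" if "x \<in> ssum A B" "y \<in> ssum A B" for x y
  proof -
    obtain a b a' b' where "a \<in> A" "b \<in> B" "x = a + b" "a' \<in> A" "b' \<in> B" "y = a' + b'"
      using \<open>x \<in> ssum A B\<close> \<open>y \<in> ssum A B\<close> by (auto elim!: ssumE)
    then have "x - y = (a - a') + (b - b')" "a - a' \<in> A" "b - b' \<in> B" using a fsub_diff by auto
    then show ?thesis using ssumI by metis
  qed
  moreover have "0 \<in> ssum A B" using ssumI[of 0 A 0 B] a fsub_0 by auto
  moreover have "finite (ssum A B)" using a by (auto simp: ssum_def fsub_def)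
  ultimately show ?thesis by (auto simp: fsub_def)
qed

lemma ssum_subset: "fsub H \<Longrightarrow> A \<subseteq> H \<Longrightarrow> B \<subseteq> H \<Longrightarrow> ssum A B \<subseteq> H"
  by (auto elim!: ssumE intro!: fsub_add)

lemma ssum_left: "fsub B \<Longrightarrow> A \<subseteq> ssum A B"
  using ssumI[of _ A 0 B] fsub_0 by fastforce

lemma ssum_right: "fsub A \<Longrightarrow> B \<subseteq> ssum A B"
  using ssumI[of 0 A _ B] fsub_0 by fastforce

definition avg :: "'a set \<Rightarrow> ('a \<Rightarrow> 'b::real_vector) \<Rightarrow> 'b" where
  "avg A f = (\<Sum>x\<in>A. f x) /\<^sub>R real (card A)"

lemma avg_cong: "(\<And>x. x \<in> A \<Longrightarrow> f x = g x) \<Longrightarrow> avg A f = avg A g"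
  by (simp add: avg_def)

lemma avg_add: "avg A (\<lambda>x. f x + g x) = avg A f + avg A g"
  by (simp add: avg_def sum.distrib scaleR_add_right)

lemma avg_diff: "avg A (\<lambda>x. f x - g x) = avg A f - avg A g"
  by (simp add: avg_def sum_subtractf scaleR_diff_right)

lemma avg_const: "finite A \<Longrightarrow> A \<noteq> {} \<Longrightarrow> avg A (\<lambda>x. c) = c"
  by (simp add: avg_def sum_constant_scaleR card_gt_0_iff)

lemma avg_mult_left: "avg A (\<lambda>x. c * f x) = c * avg A f"
  for f :: "'a \<Rightarrow> 'b::real_algebra"
  by (simp add: avg_def sum_distrib_left)

lemma avg_mult_right: "avg A (\<lambda>x. f x * c) = avg A f * c"
  for f :: "'a \<Rightarrow> 'b::real_algebra"
  by (simp add: avg_def sum_distrib_right)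

lemma avg_mono: "(\<And>x. x \<in> A \<Longrightarrow> f x \<le> g x) \<Longrightarrow> avg A f \<le> avg A g"
  for f :: "'a \<Rightarrow> real"
  by (simp add: avg_def sum_mono mult_left_mono)

lemma avg_nonneg: "(\<And>x. x \<in> A \<Longrightarrow> 0 \<le> f x) \<Longrightarrow> 0 \<le> avg A f"
  for f :: "'a \<Rightarrow> real"
  by (simp add: avg_def sum_nonneg)

lemma avg_le: "finite A \<Longrightarrow> A \<noteq> {} \<Longrightarrow> (\<And>x. x \<in> A \<Longrightarrow> f x \<le> c) \<Longrightarrow> avg A f \<le> c"
  for f :: "'a \<Rightarrow> real"
  using avg_mono[of A f "\<lambda>_. c"] avg_const[of A c] by simp

lemma avg_swap: "avg A (\<lambda>x. avg B (\<lambda>y. f x y)) = avg B (\<lambda>y. avg A (\<lambda>x. f x y))"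
  unfolding avg_def scaleR_sum_right[symmetric] by (subst sum.swap) simp

lemma avg_shift:
  assumes "fsub A" "a \<in> A"
  shows "avg A (\<lambda>x. f (x + a)) = avg A f"
proof -
  have "bij_betw (\<lambda>x. x + a) A A"
    by (rule bij_betw_byWitness[where f' = "\<lambda>x. x - a"]) (use assms fsub_add fsub_diff in auto)
  then have "(\<Sum>x\<in>A. f (x + a)) = (\<Sum>x\<in>A. f x)" by (rule sum.reindex_bij_betw)
  then show ?thesis by (simp add: avg_def)
qed

lemma avg_shift': "fsub A \<Longrightarrow> a \<in> A \<Longrightarrow> avg A (\<lambda>x. f (a + x)) = avg A f"
  using avg_shift[of A a f] by (simp add: add.commute)

lemma avg_bij: "bij_betw h A B \<Longrightarrow> avg A (\<lambda>x. f (h x)) = avg B f"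
  by (simp add: avg_def sum.reindex_bij_betw bij_betw_same_card)

lemma norm_avg_le: "norm (avg A f) \<le> avg A (\<lambda>x. norm (f x))"
  for f :: "'a \<Rightarrow> 'b::real_normed_vector"
  unfolding avg_def by (simp add: divide_inverse norm_sum mult_left_mono)

lemma Re_avg: "Re (avg A f) = avg A (\<lambda>x. Re (f x))"
  by (simp add: avg_def)

lemma cnj_avg: "cnj (avg A f) = avg A (\<lambda>x. cnj (f x))"
  by (simp add: avg_def)

lemma avg_ex_le: "finite A \<Longrightarrow> A \<noteq> {} \<Longrightarrow> avg A f \<le> c \<Longrightarrow> \<exists>x\<in>A. f x \<le> c"
  for f :: "'a \<Rightarrow> real"
proof (rule ccontr)
  assume a: "finite A" "A \<noteq> {}" "avg A f \<le> c" "\<not> (\<exists>x\<in>A. f x \<le> c)"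
  then have "(\<Sum>x\<in>A. f x) > (\<Sum>x\<in>A. c)" by (intro sum_strict_mono) auto
  moreover have "card A > 0" using a by auto
  ultimately show False using a by (simp add: avg_def field_simps)
qed

lemma avg_square_le: "finite A \<Longrightarrow> A \<noteq> {} \<Longrightarrow> (avg A f)\<^sup>2 \<le> avg A (\<lambda>x. (f x)\<^sup>2)"
  for f :: "'a \<Rightarrow> real"
proof -
  assume A: "finite A" "A \<noteq> {}"
  define c where "c = avg A f"
  have "0 \<le> avg A (\<lambda>x. (f x - c)\<^sup>2)" by (rule avg_nonneg) simp
  also have "avg A (\<lambda>x. (f x - c)\<^sup>2) = avg A (\<lambda>x. ((f x)\<^sup>2 - (2 * c) * f x) + c\<^sup>2)"
    by (simp add: power2_eq_square algebra_simps)
  also have "\<dots> = avg A (\<lambda>x. (f x)\<^sup>2) - 2 * c * avg A f + c\<^sup>2"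
    using A by (simp add: avg_add avg_diff avg_mult_left avg_const)
  finally show ?thesis by (simp add: c_def power2_eq_square)
qed

text \<open>Representations as \<open>a + b\<close> are not counted. The double average is invariant
  under translation of the argument of \<open>F\<close> by elements of \<open>ssum A B\<close>;
  averaging over these translations and exchanging the order leaves the average over
  \<open>ssum A B\<close>. \<open>avg_image\<close> is proved in the same way.\<close>

lemma avg_ssum:
  assumes "fsub A" "fsub B"
  shows "avg (ssum A B) F = avg A (\<lambda>a. avg B (\<lambda>b. F (a + b)))"
proof -
  let ?C = "ssum A B"
  have C: "fsub ?C" by (rule fsub_ssum[OF assms])
  have "avg A (\<lambda>a. avg B (\<lambda>b. F (a + b))) = avg ?C (\<lambda>x. avg A (\<lambda>a. avg B (\<lambda>b. F (x + (a + b)))))"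
  proof -
    have "avg A (\<lambda>a. avg B (\<lambda>b. F (x + (a + b)))) = avg A (\<lambda>a. avg B (\<lambda>b. F (a + b)))" if xC: "x \<in> ?C" for x
    proof -
      obtain a0 b0 where x: "a0 \<in> A" "b0 \<in> B" "x = a0 + b0" using xC unfolding ssum_def by auto
      have "avg A (\<lambda>a. avg B (\<lambda>b. F (x + (a + b)))) = avg A (\<lambda>a. avg B (\<lambda>b. F ((a + a0) + (b + b0))))"
        by (simp add: x algebra_simps)
      also have "\<dots> = avg A (\<lambda>a. avg B (\<lambda>b. F ((a + a0) + b)))"
      proof (rule avg_cong)
        fix a
        show "avg B (\<lambda>b. F ((a + a0) + (b + b0))) = avg B (\<lambda>b. F ((a + a0) + b))"
          by (rule avg_shift[OF assms(2) x(2), where f = "\<lambda>b. F ((a + a0) + b)"])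
      qed
      also have "\<dots> = avg A (\<lambda>a. avg B (\<lambda>b. F (a + b)))"
        by (rule avg_shift[OF assms(1) x(1), where f = "\<lambda>a. avg B (\<lambda>b. F (a + b))"])
      finally show ?thesis .
    qed
    then have "avg ?C (\<lambda>x. avg A (\<lambda>a. avg B (\<lambda>b. F (x + (a + b))))) = avg ?C (\<lambda>x. avg A (\<lambda>a. avg B (\<lambda>b. F (a + b))))"
      by (rule avg_cong)
    then show ?thesis by (simp add: avg_const fsub_finite[OF C] fsub_nonempty[OF C])
  qed
  also have "\<dots> = avg A (\<lambda>a. avg B (\<lambda>b. avg ?C (\<lambda>x. F (x + (a + b)))))"
    by (subst avg_swap) (simp add: avg_swap[of ?C B])
  also have "\<dots> = avg A (\<lambda>a. avg B (\<lambda>b. avg ?C F))"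
    by (intro avg_cong avg_shift[OF C] ssumI)
  also have "\<dots> = avg ?C F"
    using assms by (simp add: avg_const fsub_finite fsub_nonempty)
  finally show ?thesis by simp
qed

lemma avg_image:
  fixes T :: "'a::ab_group_add \<Rightarrow> 'b::ab_group_add"
  assumes "fsub A" and T: "\<And>x y. x \<in> A \<Longrightarrow> y \<in> A \<Longrightarrow> T (x - y) = T x - T y"
  shows "avg (T ` A) F = avg A (\<lambda>a. F (T a))"
proof -
  let ?C = "T ` A"
  have C: "fsub ?C" by (rule fsub_image[OF assms])
  have T0: "T 0 = 0" using T[of 0 0] fsub_0[OF assms(1)] by simp
  have Tn: "T (- x) = - T x" if "x \<in> A" for x using T[of 0 x] fsub_0[OF assms(1)] that T0 by simp
  have Ta: "T (x + y) = T x + T y" if "x \<in> A" "y \<in> A" for x y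
    using T[of x "- y"] Tn[of y] fsub_neg[OF assms(1)] that by simp
  have "avg A (\<lambda>a. F (T a)) = avg ?C (\<lambda>x. avg A (\<lambda>a. F (x + T a)))"
  proof -
    have "avg A (\<lambda>a. F (x + T a)) = avg A (\<lambda>a. F (T a))" if xC: "x \<in> ?C" for x
    proof -
      obtain a0 where x: "a0 \<in> A" "x = T a0" using xC by auto
      have "avg A (\<lambda>a. F (x + T a)) = avg A (\<lambda>a. F (T (a + a0)))"
        by (rule avg_cong) (simp add: x Ta add.commute)
      also have "\<dots> = avg A (\<lambda>a. F (T a))"
        by (rule avg_shift[OF assms(1) x(1), where f = "\<lambda>a. F (T a)"])
      finally show ?thesis .
    qed
    then have "avg ?C (\<lambda>x. avg A (\<lambda>a. F (x + T a))) = avg ?C (\<lambda>x. avg A (\<lambda>a. F (T a)))"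
      by (rule avg_cong)
    then show ?thesis by (simp only: avg_const[OF fsub_finite[OF C] fsub_nonempty[OF C]])
  qed
  also have "\<dots> = avg A (\<lambda>a. avg ?C (\<lambda>x. F (x + T a)))" by (rule avg_swap)
  also have "\<dots> = avg A (\<lambda>a. avg ?C F)" by (intro avg_cong avg_shift[OF C] imageI)
  also have "\<dots> = avg ?C F"
    using assms by (simp add: avg_const fsub_finite fsub_nonempty)
  finally show ?thesis by simp
qed

section \<open>Gowers averages and their behaviour under passage to subgroups\<close>

definition dlt :: "'a::ab_group_add \<Rightarrow> ('a \<Rightarrow> complex) \<Rightarrow> 'a \<Rightarrow> complex" where
  "dlt h f = (\<lambda>x. f (x + h) * cnj (f x))"

definition sh :: "'a::ab_group_add \<Rightarrow> ('a \<Rightarrow> 'b) \<Rightarrow> 'a \<Rightarrow> 'b" where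
  "sh y f = (\<lambda>x. f (x + y))"

lemma sh_sh: "sh z (sh y f) = sh (z + y) f"
  by (simp add: sh_def add.assoc)

lemma sh_0: "sh 0 f = f"
  by (simp add: sh_def)

lemma dlt_sh: "dlt h (sh y f) = sh y (dlt h f)"
  by (simp add: dlt_def sh_def fun_eq_iff algebra_simps)

text \<open>For \<open>k \<ge> 1\<close> this is the Gowers uniformity norm of order
  \<open>k\<close> on \<open>L\<close> raised to the power \<open>2 ^ k\<close>. Without the root it
  is an average over derivative directions, which every recursion below uses. \<open>Re\<close>
  matters for \<open>k = 0\<close> only; higher orders are real anyway.\<close>

fun gow :: "nat \<Rightarrow> 'a::ab_group_add set \<Rightarrow> ('a \<Rightarrow> complex) \<Rightarrow> real" where
  "gow 0 L f = Re (avg L f)"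
| "gow (Suc k) L f = avg L (\<lambda>h. gow k L (dlt h f))"

text \<open>Polarisation of \<open>gow (Suc k)\<close> in a single direction:
  \<open>gow2 k L f f\<close> is \<open>gow (Suc k) L f\<close>. For two translates of one function
  it measures the correlation of two cosets of \<open>L\<close>.\<close>

definition gow2 :: "nat \<Rightarrow> 'a::ab_group_add set \<Rightarrow> ('a \<Rightarrow> complex) \<Rightarrow> ('a \<Rightarrow> complex) \<Rightarrow> real" where
  "gow2 k L u v = avg L (\<lambda>h. gow k L (\<lambda>x. u (x + h) * cnj (v x)))"

lemma gow_Suc: "gow (Suc k) L f = gow2 k L f f"
  by (simp add: gow2_def dlt_def)

lemma gow_cong:
  assumes "fsub L" "\<And>x. x \<in> L \<Longrightarrow> u x = v x"
  shows "gow k L u = gow k L v"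
  using assms(2)
proof (induction k arbitrary: u v)
  case 0
  then show ?case by (auto intro!: arg_cong[where f = Re] avg_cong)
next
  case (Suc k)
  show ?case
    by (auto intro!: avg_cong Suc.IH simp: dlt_def Suc.prems fsub_add[OF assms(1)])
qed

lemma gow_shift:
  assumes "fsub L" "l \<in> L"
  shows "gow k L (sh l f) = gow k L f"
proof (induction k arbitrary: f)
  case 0
  show ?case using avg_shift[OF assms, of f] by (simp add: sh_def)
next
  case (Suc k)
  show ?case by (simp add: dlt_sh Suc)
qed

lemma gow_image:
  assumes "fsub A" and T: "\<And>x y. x \<in> A \<Longrightarrow> y \<in> A \<Longrightarrow> T (x - y) = T x - T y"
  shows "gow k (T ` A) f = gow k A (\<lambda>x. f (T x))"
proof (induction k arbitrary: f)
  case 0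
  show ?case by (simp add: avg_image[OF assms])
next
  case (Suc k)
  have T0: "T 0 = 0" using T[of 0 0] fsub_0[OF assms(1)] by simp
  have Tn: "T (- x) = - T x" if "x \<in> A" for x using T[of 0 x] fsub_0[OF assms(1)] that T0 by simp
  have Ta: "T (x + y) = T x + T y" if "x \<in> A" "y \<in> A" for x y
    using T[of x "- y"] Tn[of y] fsub_neg[OF assms(1)] that by simp
  show ?case
    by (auto simp: avg_image[OF assms] Suc dlt_def Ta intro!: avg_cong gow_cong[OF assms(1)])
qed

lemma gow_scale:
  assumes "norm c = 1"
  shows "gow (Suc k) L (\<lambda>x. c * f x) = gow (Suc k) L f"
proof -
  have "c * cnj c = 1" using assms by (simp add: complex_mult_cnj cmod_def complex_eq_iff)
  then have "dlt h (\<lambda>x. c * f x) = dlt h f" for h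
    unfolding dlt_def by (simp add: fun_eq_iff)
  then show ?thesis by simp
qed

lemma gow_bound:
  assumes "fsub L" "\<And>x. x \<in> L \<Longrightarrow> norm (f x) \<le> 1"
  shows "\<bar>gow k L f\<bar> \<le> 1"
  using assms(2)
proof (induction k arbitrary: f)
  case 0
  have "norm (avg L f) \<le> avg L (\<lambda>x. norm (f x))" by (rule norm_avg_le)
  also have "\<dots> \<le> 1" by (rule avg_le) (use 0 assms(1) in \<open>auto simp: fsub_finite fsub_nonempty\<close>)
  finally show ?case using abs_Re_le_cmod[of "avg L f"] by simp
next
  case (Suc k)
  have "\<bar>gow k L (dlt h f)\<bar> \<le> 1" if "h \<in> L" for h
    by (rule Suc.IH) (use that Suc.prems assms(1) in \<open>auto simp: dlt_def norm_mult fsub_add intro!: mult_le_one\<close>)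
  then have "norm (avg L (\<lambda>h. gow k L (dlt h f))) \<le> 1"
    using norm_avg_le[of L "\<lambda>h. gow k L (dlt h f)"] avg_le[of L "\<lambda>h. norm (gow k L (dlt h f))" 1] assms(1)
    by (auto simp: fsub_finite fsub_nonempty)
  then show ?case by simp
qed

lemma gow2_0:
  assumes "fsub L"
  shows "gow2 0 L u v = Re (avg L u * cnj (avg L v))"
proof -
  have "gow2 0 L u v = Re (avg L (\<lambda>h. avg L (\<lambda>x. u (x + h) * cnj (v x))))"
    by (simp add: gow2_def Re_avg)
  also have "avg L (\<lambda>h. avg L (\<lambda>x. u (x + h) * cnj (v x))) = avg L (\<lambda>x. avg L (\<lambda>h. u (x + h)) * cnj (v x))"
    by (subst avg_swap) (simp add: avg_mult_right)
  also have "\<dots> = avg L (\<lambda>x. avg L u * cnj (v x))"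
    by (intro avg_cong) (simp add: avg_shift'[OF assms])
  also have "\<dots> = avg L u * cnj (avg L v)" by (simp add: avg_mult_left cnj_avg)
  finally show ?thesis .
qed

lemma gow_1: "fsub L \<Longrightarrow> gow (Suc 0) L f = (norm (avg L f))\<^sup>2"
  by (simp add: gow_Suc gow2_0 complex_mult_cnj cmod_power2 del: gow.simps)

text \<open>For \<open>k = 0\<close> the right-hand side is the square of
  \<open>norm (avg L u - avg L v)\<close>. A further derivative costs one Cauchy-Schwarz in its
  direction \<open>h\<close>; the mixed terms fit because deriving
  \<open>u (x + g) * cnj (v x)\<close> in direction \<open>h\<close> gives the same mixed product of
  \<open>dlt h u\<close> and \<open>dlt h v\<close>.\<close>

lemma gow_diff_square:
  assumes "fsub L"
  shows "(gow k L u - gow k L v)\<^sup>2 \<le> gow (Suc k) L u + gow (Suc k) L v - 2 * gow2 k L u v"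
proof (induction k arbitrary: u v)
  case 0
  have "(gow 0 L u - gow 0 L v)\<^sup>2 \<le> (norm (avg L u - avg L v))\<^sup>2"
    using power_mono[OF abs_Re_le_cmod[of "avg L u - avg L v"], of 2] by simp
  also have "\<dots> = gow (Suc 0) L u + gow (Suc 0) L v - 2 * gow2 0 L u v"
    unfolding gow_1[OF assms] gow2_0[OF assms] cmod_power2 by (simp add: power2_eq_square algebra_simps)
  finally show ?case .
next
  case (Suc k)
  have "(gow (Suc k) L u - gow (Suc k) L v)\<^sup>2 = (avg L (\<lambda>h. gow k L (dlt h u) - gow k L (dlt h v)))\<^sup>2"
    by (simp add: avg_diff)
  also have "\<dots> \<le> avg L (\<lambda>h. (gow k L (dlt h u) - gow k L (dlt h v))\<^sup>2)"
    by (rule avg_square_le) (auto simp: assms fsub_finite fsub_nonempty)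
  also have "\<dots> \<le> avg L (\<lambda>h. (gow (Suc k) L (dlt h u) + gow (Suc k) L (dlt h v)) - 2 * gow2 k L (dlt h u) (dlt h v))"
    by (rule avg_mono) (use Suc in auto)
  also have "\<dots> = gow (Suc (Suc k)) L u + gow (Suc (Suc k)) L v - 2 * avg L (\<lambda>h. gow2 k L (dlt h u) (dlt h v))"
    by (simp only: avg_diff avg_add avg_mult_left gow.simps(2)[of "Suc k"])
  also have "avg L (\<lambda>h. gow2 k L (dlt h u) (dlt h v)) = gow2 (Suc k) L u v"
  proof -
    have *: "(\<lambda>x. dlt h u (x + g) * cnj (dlt h v x)) = dlt h (\<lambda>x. u (x + g) * cnj (v x))" for h g
      by (simp add: dlt_def fun_eq_iff algebra_simps)
    show ?thesis unfolding gow2_def * by (subst avg_swap) simp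
  qed
  finally show ?case .
qed

lemma gow2_le:
  assumes "fsub L"
  shows "2 * gow2 k L u v \<le> gow (Suc k) L u + gow (Suc k) L v"
  using gow_diff_square[OF assms, of k u v] by (smt (verit) zero_le_power2)

lemma gow_square_le:
  assumes "fsub L"
  shows "(gow k L f)\<^sup>2 \<le> gow (Suc k) L f"
proof -
  have g0: "gow k L (\<lambda>_. 0) = 0" for k by (induction k) (simp_all add: dlt_def avg_def)
  have "gow2 k L f (\<lambda>_. 0) = 0" by (simp add: gow2_def g0) (simp add: avg_def)
  then show ?thesis using gow_diff_square[OF assms, of k f "\<lambda>_. 0"] g0[of "Suc k"] by (simp add: g0 del: gow.simps)
qed

lemma gow_Suc_nonneg: "fsub L \<Longrightarrow> 0 \<le> gow (Suc k) L f"
  using gow_square_le[of L k f] zero_le_power2 order_trans by blast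

lemma gow2_shift1:
  assumes "fsub L" "l \<in> L"
  shows "gow2 k L (sh l u) v = gow2 k L u v"
proof -
  have "gow2 k L (sh l u) v = avg L (\<lambda>h. gow k L (\<lambda>x. u (x + (h + l)) * cnj (v x)))"
    by (simp add: gow2_def sh_def add.assoc)
  also have "\<dots> = gow2 k L u v"
    unfolding gow2_def by (rule avg_shift[OF assms, where f = "\<lambda>h. gow k L (\<lambda>x. u (x + h) * cnj (v x))"])
  finally show ?thesis .
qed

lemma gow2_shift2:
  assumes "fsub L" "l \<in> L"
  shows "gow2 k L u (sh l v) = gow2 k L u v"
proof -
  have "gow k L (\<lambda>x. u (x + h) * cnj (sh l v x)) = gow k L (\<lambda>x. u (x + (h + - l)) * cnj (v x))" for h
    using gow_shift[OF assms, of k "\<lambda>x. u (x + (h + - l)) * cnj (v x)"] by (simp add: sh_def add.assoc add.left_commute)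
  then have "gow2 k L u (sh l v) = avg L (\<lambda>h. gow k L (\<lambda>x. u (x + (h + - l)) * cnj (v x)))"
    by (simp add: gow2_def)
  also have "\<dots> = gow2 k L u v"
    unfolding gow2_def
    by (rule avg_shift[OF assms(1) fsub_neg[OF assms], where f = "\<lambda>h. gow k L (\<lambda>x. u (x + h) * cnj (v x))"])
  finally show ?thesis .
qed

lemma avg_avg_shift:
  assumes "fsub L'" "L \<subseteq> L'" "fsub L"
  shows "avg L' F = avg L' (\<lambda>h. avg L (\<lambda>l. F (h + l)))"
proof -
  have "avg L' (\<lambda>h. avg L (\<lambda>l. F (h + l))) = avg L (\<lambda>l. avg L' (\<lambda>h. F (h + l)))" by (rule avg_swap)
  also have "\<dots> = avg L (\<lambda>l. avg L' F)" by (rule avg_cong, rule avg_shift) (use assms in auto)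
  finally show ?thesis using assms by (simp add: avg_const fsub_finite fsub_nonempty)
qed

text \<open>A direction averaged over \<open>L'\<close> may first be averaged over its coset of
  \<open>L\<close>; derivatives in the directions \<open>h + l\<close> then become the mixed average
  of two translates. The mixed form is kept, since \<open>gow_stable\<close> needs more than the
  bound by pure averages.\<close>

lemma gow_cosets_aux:
  assumes "fsub L'" "L \<subseteq> L'" "fsub L"
    and IH: "\<And>f. gow k L' f \<le> avg L' (\<lambda>y. gow k L (sh y f))"
  shows "gow (Suc k) L' f \<le> avg L' (\<lambda>h. avg L' (\<lambda>z. gow2 k L (sh (z + h) f) (sh z f)))"
proof -
  have "gow (Suc k) L' f \<le> avg L' (\<lambda>h. avg L' (\<lambda>z. gow k L (sh z (dlt h f))))"
    by (simp add: IH avg_mono)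
  also have "\<dots> = avg L' (\<lambda>h. avg L (\<lambda>l. avg L' (\<lambda>z. gow k L (sh z (dlt (h + l) f)))))"
    by (rule avg_avg_shift[OF assms(1-3)])
  also have "\<dots> = avg L' (\<lambda>h. avg L' (\<lambda>z. avg L (\<lambda>l. gow k L (sh z (dlt (h + l) f)))))"
    by (intro avg_cong avg_swap)
  also have "\<dots> = avg L' (\<lambda>h. avg L' (\<lambda>z. gow2 k L (sh (z + h) f) (sh z f)))"
    unfolding gow2_def by (intro avg_cong arg_cong[where f = "gow k L"]) (simp add: sh_def dlt_def fun_eq_iff algebra_simps)
  finally show ?thesis .
qed

text \<open>Restricting to cosets discards cancellation between them: the mixed average of two
  cosets is at most the mean of the two pure ones (\<open>gow2_le\<close>), and both pure terms have
  the same average over \<open>L'\<close>.\<close>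

lemma gow_cosets:
  assumes "fsub L'" "L \<subseteq> L'" "fsub L"
  shows "gow k L' f \<le> avg L' (\<lambda>y. gow k L (sh y f))"
proof (induction k arbitrary: f)
  case 0
  have "avg L' (\<lambda>y. gow 0 L (sh y f)) = Re (avg L' (\<lambda>y. avg L (\<lambda>x. f (y + x))))"
    by (simp add: Re_avg sh_def add.commute)
  also have "\<dots> = gow 0 L' f" using avg_avg_shift[OF assms, of f] by simp
  finally show ?case by simp
next
  case (Suc k)
  have "gow (Suc k) L' f \<le> avg L' (\<lambda>h. avg L' (\<lambda>z. gow2 k L (sh (z + h) f) (sh z f)))"
    by (rule gow_cosets_aux[OF assms Suc])
  also have "\<dots> \<le> avg L' (\<lambda>h. avg L' (\<lambda>z. (1/2) * (gow (Suc k) L (sh (z + h) f) + gow (Suc k) L (sh z f))))"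
    by (intro avg_mono) (use gow2_le[OF assms(3), of k] in \<open>simp del: gow.simps add: mult.commute\<close>)
  also have "\<dots> = (1/2) * (avg L' (\<lambda>h. avg L' (\<lambda>z. gow (Suc k) L (sh (z + h) f))) + avg L' (\<lambda>h. avg L' (\<lambda>z. gow (Suc k) L (sh z f))))"
    by (simp only: avg_mult_left avg_add)
  also have "avg L' (\<lambda>h. avg L' (\<lambda>z. gow (Suc k) L (sh (z + h) f))) = avg L' (\<lambda>h. avg L' (\<lambda>z. gow (Suc k) L (sh z f)))"
    by (rule avg_cong, rule avg_shift[OF assms(1), where f = "\<lambda>z. gow (Suc k) L (sh z f)"])
  also have "avg L' (\<lambda>h. avg L' (\<lambda>z. gow (Suc k) L (sh z f))) = avg L' (\<lambda>z. gow (Suc k) L (sh z f))"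
    by (rule avg_const) (use assms in \<open>auto simp: fsub_finite fsub_nonempty\<close>)
  finally show ?case by (simp del: gow.simps)
qed

text \<open>The hypotheses say that \<open>gow_cosets\<close> is nearly an equality for
  \<open>L\<close> in \<open>ssum L B\<close>. Then the mixed averages of all pairs of cosets are
  nearly maximal in the mean, hence each of them is, as there are at most \<open>c\<^sup>2\<close>
  pairs; \<open>gow_diff_square\<close> turns this into closeness one order lower.\<close>

lemma gow_stable:
  assumes L: "fsub L" and B: "fsub B" and y: "y \<in> B" and c: "real (card B) \<le> c"
    and up: "\<And>z. z \<in> B \<Longrightarrow> gow (Suc k) L (sh z f) \<le> N + \<eta>"
    and lo: "N - \<eta> \<le> gow (Suc k) (ssum L B) f" and "\<eta> \<ge> 0"
  shows "(gow k L (sh y f) - gow k L f)\<^sup>2 \<le> 6 * c\<^sup>2 * \<eta>"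
proof -
  define G where "G h z = gow2 k L (sh (z + h) f) (sh z f)" for h z
  let ?n = "real (card B)"
  have n: "?n \<ge> 1" using fsub_card_pos[OF B] by simp
  have LB: "fsub (ssum L B)" "L \<subseteq> ssum L B" using fsub_ssum[OF L B] ssum_left[OF B, of L] by auto
  \<comment> \<open>\<open>G\<close> depends only on the cosets of \<open>L\<close>, so the averages
    over \<open>ssum L B\<close> collapse to averages over \<open>B\<close>, whose number of terms
    is bounded by \<open>c\<close>.\<close>
  have inv: "G (l + h) (l' + z) = G h z" if "l \<in> L" "l' \<in> L" for l h l' z
  proof -
    have a: "sh (l' + z + (l + h)) f = sh (l' + l) (sh (z + h) f)" by (simp add: sh_sh algebra_simps)
    have b: "sh (l' + z) f = sh l' (sh z f)" by (simp add: sh_sh)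
    have "l' + l \<in> L" using that fsub_add L by auto
    then show ?thesis unfolding G_def a b using gow2_shift1[OF L] gow2_shift2[OF L] that by metis
  qed
  have "gow (Suc k) (ssum L B) f \<le> avg (ssum L B) (\<lambda>h. avg (ssum L B) (\<lambda>z. G h z))"
    unfolding G_def by (rule gow_cosets_aux[OF LB L gow_cosets[OF LB L]])
  also have "\<dots> = avg L (\<lambda>l. avg B (\<lambda>h. avg L (\<lambda>l'. avg B (\<lambda>z. G (l + h) (l' + z)))))"
    by (simp add: avg_ssum[OF L B])
  also have "\<dots> = avg L (\<lambda>l. avg B (\<lambda>h. avg L (\<lambda>l'. avg B (\<lambda>z. G h z))))"
    by (intro avg_cong) (simp add: inv)
  also have "\<dots> = avg B (\<lambda>h. avg B (\<lambda>z. G h z))"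
    using L by (simp add: avg_const fsub_finite fsub_nonempty)
  finally have 1: "N - \<eta> \<le> avg B (\<lambda>h. avg B (\<lambda>z. G h z))" using lo by simp
  have Gle: "G h z \<le> N + \<eta>" if "h \<in> B" "z \<in> B" for h z
    using gow2_le[OF L, of k "sh (z + h) f" "sh z f"] up[of z] up[of "z + h"] that fsub_add[OF B] by (auto simp: G_def simp del: gow.simps)
  have "2 * \<eta> \<ge> avg B (\<lambda>h. avg B (\<lambda>z. N + \<eta> - G h z))"
    using 1 B by (simp add: avg_diff avg_add avg_const fsub_finite fsub_nonempty)
  also have "avg B (\<lambda>h. avg B (\<lambda>z. N + \<eta> - G h z)) = (\<Sum>h\<in>B. \<Sum>z\<in>B. N + \<eta> - G h z) / (?n * ?n)"
    by (simp add: avg_def sum_distrib_left[symmetric] divide_inverse)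
  finally have 2: "(\<Sum>h\<in>B. \<Sum>z\<in>B. N + \<eta> - G h z) \<le> 2 * \<eta> * (?n * ?n)"
    using n by (simp add: field_simps)
  have fB: "finite B" using B fsub_finite by auto
  \<comment> \<open>All deficits are nonnegative, so the single one at the pair \<open>y\<close>,
    \<open>0\<close> is at most their sum.\<close>
  have "N + \<eta> - G y 0 \<le> (\<Sum>z\<in>B. N + \<eta> - G y z)"
    by (rule member_le_sum) (use fB Gle y fsub_0[OF B] in auto)
  also have "\<dots> \<le> (\<Sum>h\<in>B. \<Sum>z\<in>B. N + \<eta> - G h z)"
    by (rule member_le_sum[where f = "\<lambda>h. \<Sum>z\<in>B. N + \<eta> - G h z"]) (use fB Gle y in \<open>auto intro!: sum_nonneg\<close>)
  finally have 3: "N + \<eta> - G y 0 \<le> 2 * \<eta> * (?n * ?n)" using 2 by simp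
  define w q where "w = \<eta> * (?n * ?n)" and "q = \<eta> * c\<^sup>2"
  have "?n * ?n \<le> c\<^sup>2" using c n by (simp add: power2_eq_square mult_mono)
  then have wq: "w \<le> q" unfolding w_def q_def using \<open>\<eta> \<ge> 0\<close> by (intro mult_left_mono) auto
  have w0: "0 \<le> w" unfolding w_def using \<open>\<eta> \<ge> 0\<close> by simp
  have D: "(gow k L (sh y f) - gow k L f)\<^sup>2 \<le> 2 * (N + \<eta>) - 2 * G y 0"
    using gow_diff_square[OF L, of k "sh y f" f] up[OF y] up[OF fsub_0[OF B]]
    by (simp add: G_def sh_0 del: gow.simps)
  have "N + \<eta> - G y 0 \<le> 2 * w" using 3 by (simp add: w_def mult.assoc)
  then have "2 * (N + \<eta>) - 2 * G y 0 \<le> 4 * w" by simp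
  also have "\<dots> \<le> 6 * q" using wq w0 by linarith
  finally have "(gow k L (sh y f) - gow k L f)\<^sup>2 \<le> 6 * q" using D by linarith
  then show ?thesis by (simp add: q_def mult_ac)
qed

text \<open>The subgroup \<open>H'\<close> sees all averages of \<open>f\<close> up to order
  \<open>e\<close> almost correctly. Only the upper bound is demanded; the lower one holds on
  average over cosets by \<open>gow_cosets\<close>. The clause on \<open>B\<close> replaces a bound
  on the size of \<open>H\<close>: two cosets of \<open>L\<close> are always compared inside a group
  containing at most \<open>c\<close> of them. The clause \<open>gow e = 1\<close> is what phase
  polynomials of degree below \<open>e\<close> satisfy.\<close>

definition nearly_captured ::
    "nat \<Rightarrow> real \<Rightarrow> real \<Rightarrow> 'a::ab_group_add set \<Rightarrow> 'a set \<Rightarrow> ('a \<Rightarrow> complex) \<Rightarrow> bool" where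
  "nearly_captured e c \<delta> H H' f \<longleftrightarrow>
     fsub H \<and> fsub H' \<and> H' \<subseteq> H \<and>
     (\<forall>y\<in>H. \<exists>B. fsub B \<and> B \<subseteq> H \<and> y \<in> B \<and> real (card B) \<le> c) \<and>
     (\<forall>L y. fsub L \<longrightarrow> L \<subseteq> H \<longrightarrow> y \<in> H \<longrightarrow> gow e L (sh y f) = 1) \<and>
     (\<forall>k. 1 \<le> k \<longrightarrow> k \<le> e \<longrightarrow> gow k H' f \<le> gow k H f + \<delta>)"

lemma nearly_captured_mono:
  "nearly_captured e c \<delta> H H' f \<Longrightarrow> \<delta> \<le> \<delta>' \<Longrightarrow> nearly_captured e c \<delta>' H H' f"
  unfolding nearly_captured_def by (meson add_left_mono order_trans)

text \<open>Descent in the order, starting at \<open>e\<close>, where every value is 1. If order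
  \<open>k + 1\<close> is almost constant over all intermediate groups and their cosets,
  \<open>gow_stable\<close> makes order \<open>k\<close> almost equal on all cosets of one group.
  Then \<open>gow k\<close> increases from \<open>H\<close> to \<open>L\<close> to \<open>H'\<close>
  up to small errors by \<open>gow_cosets\<close>, and the captured bound at \<open>H'\<close>
  closes the circle.\<close>

lemma gow_capture:
  fixes c :: real
  assumes "c \<ge> 1"
  shows "t < e \<Longrightarrow> 0 < \<eta> \<Longrightarrow> \<exists>\<delta>>0. \<forall>(H::'a::ab_group_add set) H' f. nearly_captured e c \<delta> H H' f \<longrightarrow>
    (\<forall>L y. fsub L \<longrightarrow> H' \<subseteq> L \<longrightarrow> L \<subseteq> H \<longrightarrow> y \<in> H \<longrightarrow> \<bar>gow (e - t) L (sh y f) - gow (e - t) H f\<bar> \<le> \<eta>)"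
proof (induction t arbitrary: \<eta>)
  case 0
  have "\<bar>gow e L (sh y f) - gow e H f\<bar> \<le> \<eta>"
    if "nearly_captured e c 1 H H' f" "fsub L" "H' \<subseteq> L" "L \<subseteq> H" "y \<in> H" for L y f and H H' :: "'a set"
  proof -
    have "gow e L (sh y f) = 1" using that unfolding nearly_captured_def by blast
    moreover have "gow e H (sh 0 f) = 1" using that fsub_0 unfolding nearly_captured_def by blast
    ultimately show ?thesis using 0 by (simp add: sh_0)
  qed
  then show ?case by (intro exI[of _ 1]) simp
next
  case (Suc t)
  define k where "k = e - Suc t"
  have k: "e - t = Suc k" "1 \<le> k \<or> k = 0" "k \<le> e" using Suc.prems by (auto simp: k_def)
  have k1: "1 \<le> k" using Suc.prems by (simp add: k_def)
  \<comment> \<open>The value for which \<open>gow_stable\<close> yields a deviation of \<eta>/3.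
    The three thirds are spent on the cosets of \<open>H'\<close>, on the excess \<delta> of
    \<open>H'\<close> over \<open>H\<close>, and on the translation by \<open>y\<close>.\<close>
  define \<eta>' where "\<eta>' = (\<eta>/3)\<^sup>2 / (6 * c\<^sup>2)"
  have \<eta>': "0 < \<eta>'" "6 * c\<^sup>2 * \<eta>' = (\<eta>/3)\<^sup>2" using Suc.prems assms by (auto simp: \<eta>'_def)
  obtain \<delta>0 where \<delta>0: "\<delta>0 > 0" and IH: "\<And>(H::'a set) H' f L y. nearly_captured e c \<delta>0 H H' f \<Longrightarrow>
     fsub L \<Longrightarrow> H' \<subseteq> L \<Longrightarrow> L \<subseteq> H \<Longrightarrow> y \<in> H \<Longrightarrow> \<bar>gow (Suc k) L (sh y f) - gow (Suc k) H f\<bar> \<le> \<eta>'"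
    using Suc.IH[of \<eta>'] Suc.prems \<eta>'(1) unfolding k by (auto simp del: gow.simps)
  define \<delta> where "\<delta> = min \<delta>0 (\<eta>/3)"
  have "\<bar>gow k L (sh y f) - gow k H f\<bar> \<le> \<eta>"
    if nc: "nearly_captured e c \<delta> H H' f" and L: "fsub L" "H' \<subseteq> L" "L \<subseteq> H" and y: "y \<in> H"
    for L y f and H H' :: "'a set"
  proof -
    have nc0: "nearly_captured e c \<delta>0 H H' f" by (rule nearly_captured_mono[OF nc]) (simp add: \<delta>_def)
    have H: "fsub H" "fsub H'" "H' \<subseteq> H" using nc by (auto simp: nearly_captured_def)
    have cos: "\<bar>gow k L (sh y f) - gow k L f\<bar> \<le> \<eta>/3"
      if L: "fsub L" "H' \<subseteq> L" "L \<subseteq> H" and y: "y \<in> H" for L y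
    proof -
      obtain B where B: "fsub B" "B \<subseteq> H" "y \<in> B" "real (card B) \<le> c"
        using nc y unfolding nearly_captured_def by blast
      have "(gow k L (sh y f) - gow k L f)\<^sup>2 \<le> 6 * c\<^sup>2 * \<eta>'"
      proof (rule gow_stable[OF L(1) B(1,3,4), where N = "gow (Suc k) H f"])
        show "gow (Suc k) L (sh z f) \<le> gow (Suc k) H f + \<eta>'" if "z \<in> B" for z
          using IH[OF nc0 L, of z] that B(2) by (auto simp del: gow.simps)
        \<comment> \<open>\<open>ssum L B\<close> is again an intermediate group, so the induction
          hypothesis covers it; this is why all intermediate groups are treated at once.\<close>
        have "\<bar>gow (Suc k) (ssum L B) (sh 0 f) - gow (Suc k) H f\<bar> \<le> \<eta>'"
          using L B H fsub_0[OF H(1)] ssum_left[OF B(1), of L]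
          by (intro IH[OF nc0] fsub_ssum ssum_subset) (auto simp del: gow.simps)
        then show "gow (Suc k) H f - \<eta>' \<le> gow (Suc k) (ssum L B) f" by (simp add: sh_0 del: gow.simps)
      qed (use \<eta>' in auto)
      then have "(gow k L (sh y f) - gow k L f)\<^sup>2 \<le> (\<eta>/3)\<^sup>2" by (simp add: \<eta>'(2))
      then show ?thesis using Suc.prems(2) abs_le_square_iff[of _ "\<eta>/3"] by (metis abs_of_pos divide_pos_pos zero_less_numeral)
    qed
    have "gow k H f \<le> avg H (\<lambda>y. gow k L (sh y f))" by (rule gow_cosets[OF H(1) L(3,1)])
    also have "\<dots> \<le> gow k L f + \<eta>/3"
    proof (rule avg_le)
      show "gow k L (sh y f) \<le> gow k L f + \<eta>/3" if "y \<in> H" for y using cos[OF L that] by linarith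
    qed (use H(1) in \<open>auto simp: fsub_finite fsub_nonempty\<close>)
    finally have 1: "gow k H f \<le> gow k L f + \<eta>/3" .
    have "gow k L f \<le> avg L (\<lambda>y. gow k H' (sh y f))" by (rule gow_cosets[OF L(1,2) H(2)])
    also have "\<dots> \<le> gow k H' f + \<eta>/3"
    proof (rule avg_le)
      show "gow k H' (sh y f) \<le> gow k H' f + \<eta>/3" if "y \<in> L" for y
        using cos[OF H(2) order_refl H(3) subsetD[OF L(3) that]] by linarith
    qed (use L(1) in \<open>auto simp: fsub_finite fsub_nonempty\<close>)
    also have "gow k H' f \<le> gow k H f + \<delta>" using nc k1 k(3) by (simp add: nearly_captured_def)
    finally have "gow k L f \<le> gow k H f + \<eta>/3 + \<eta>/3" by (simp add: \<delta>_def)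
    with 1 cos[OF L y] show ?thesis by linarith
  qed
  moreover have "\<delta> > 0" using \<delta>0 Suc.prems by (simp add: \<delta>_def)
  ultimately show ?case unfolding k_def[symmetric] by blast
qed

text \<open>\<open>gow_capture\<close> at order 1 controls the modulus of the mean on every coset.
  One further use of \<open>gow_stable\<close>, from order 1 to order 0, controls the mean itself,
  and averaging over the cosets of \<open>H'\<close> gives the mean on \<open>H\<close>.\<close>

lemma avg_capture:
  fixes c :: real
  assumes "c \<ge> 1" "1 \<le> e" "0 < \<eta>"
  shows "\<exists>\<delta>>0. \<forall>(H::'a::ab_group_add set) H' f. nearly_captured e c \<delta> H H' f \<longrightarrow> norm (avg H' f - avg H f) \<le> \<eta>"
proof -
  define \<eta>' where "\<eta>' = \<eta>\<^sup>2 / (6 * c\<^sup>2)"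
  have \<eta>': "0 < \<eta>'" "6 * c\<^sup>2 * \<eta>' = \<eta>\<^sup>2" using assms by (auto simp: \<eta>'_def)
  have "e - 1 < e" "e - (e - 1) = Suc 0" using assms(2) by auto
  then obtain \<delta> where \<delta>: "\<delta> > 0" and cap: "\<And>(H::'a set) H' f L y. nearly_captured e c \<delta> H H' f \<Longrightarrow>
     fsub L \<Longrightarrow> H' \<subseteq> L \<Longrightarrow> L \<subseteq> H \<Longrightarrow> y \<in> H \<Longrightarrow> \<bar>gow (Suc 0) L (sh y f) - gow (Suc 0) H f\<bar> \<le> \<eta>'"
    using gow_capture[OF assms(1), of "e - 1" e \<eta>', where 'a = 'a] \<eta>'(1) by (auto simp del: gow.simps)
  have "norm (avg H' f - avg H f) \<le> \<eta>" if nc: "nearly_captured e c \<delta> H H' f" for H H' :: "'a set" and f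
  proof -
    have H: "fsub H" "fsub H'" "H' \<subseteq> H" using nc by (auto simp: nearly_captured_def)
    have cos: "norm (avg H' f - avg H' (sh y f)) \<le> \<eta>" if y: "y \<in> H" for y
    proof -
      define D where "D = avg H' (sh y f) - avg H' f"
      \<comment> \<open>Order 0 sees only real parts. The factor \<open>u\<close> turns the
        difference \<open>D\<close> of the two means into a nonnegative real number and leaves order
        1 unchanged by \<open>gow_scale\<close>.\<close>
      define u where "u = (if D = 0 then 1 else cnj D / of_real (norm D))"
      have u: "norm u = 1" by (simp add: u_def norm_divide)
      have uD: "u * D = of_real (norm D)"
        by (simp add: u_def complex_norm_square[symmetric] mult.commute[of "cnj D"] power2_eq_square)
      define g where "g = (\<lambda>x. u * f x)"
      have gs: "sh z g = (\<lambda>x. u * sh z f x)" for z by (simp add: g_def sh_def)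
      have gg: "gow (Suc 0) L (sh z g) = gow (Suc 0) L (sh z f)" for L z
        unfolding gs by (rule gow_scale[OF u])
      have gg0: "gow (Suc 0) L g = gow (Suc 0) L f" for L
        unfolding g_def by (rule gow_scale[OF u])
      obtain B where B: "fsub B" "B \<subseteq> H" "y \<in> B" "real (card B) \<le> c"
        using nc y unfolding nearly_captured_def by blast
      have "(gow 0 H' (sh y g) - gow 0 H' g)\<^sup>2 \<le> 6 * c\<^sup>2 * \<eta>'"
      proof (rule gow_stable[OF H(2) B(1,3,4), where N = "gow (Suc 0) H f"])
        show "gow (Suc 0) H' (sh z g) \<le> gow (Suc 0) H f + \<eta>'" if "z \<in> B" for z
          using cap[OF nc H(2) order_refl H(3), of z] that B(2) unfolding gg by (auto simp del: gow.simps)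
        have "\<bar>gow (Suc 0) (ssum H' B) (sh 0 f) - gow (Suc 0) H f\<bar> \<le> \<eta>'"
          using B H fsub_0[OF H(1)] ssum_left[OF B(1), of H']
          by (intro cap[OF nc] fsub_ssum ssum_subset) (auto simp del: gow.simps)
        then show "gow (Suc 0) H f - \<eta>' \<le> gow (Suc 0) (ssum H' B) g" unfolding gg0 by (simp add: sh_0 del: gow.simps)
      qed (use \<eta>' in auto)
      moreover have "gow 0 H' (sh y g) - gow 0 H' g = Re (u * D)"
        unfolding gs by (simp add: g_def D_def avg_mult_left algebra_simps)
      ultimately have "(norm D)\<^sup>2 \<le> \<eta>\<^sup>2" by (simp add: uD \<eta>'(2))
      then have "norm D \<le> \<eta>" using assms(3) by (simp add: abs_le_square_iff[symmetric])
      then show ?thesis by (simp add: D_def norm_minus_commute)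
    qed
    have "avg H f = avg H (\<lambda>y. avg H' (\<lambda>x. f (y + x)))" by (rule avg_avg_shift[OF H(1,3,2)])
    also have "\<dots> = avg H (\<lambda>y. avg H' (sh y f))" by (simp add: sh_def add.commute)
    finally have "avg H' f - avg H f = avg H (\<lambda>y. avg H' f - avg H' (sh y f))"
      using H(1) by (simp add: avg_diff avg_const fsub_finite fsub_nonempty)
    also have "norm \<dots> \<le> avg H (\<lambda>y. norm (avg H' f - avg H' (sh y f)))" by (rule norm_avg_le)
    also have "\<dots> \<le> \<eta>" by (rule avg_le) (use cos H(1) in \<open>auto simp: fsub_finite fsub_nonempty\<close>)
    finally show ?thesis .
  qed
  with \<delta> show ?thesis by blast
qed

section \<open>Phase polynomials; \<open>mdeg e\<close> means degree below \<open>e\<close>\<close>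

fun mdeg :: "nat \<Rightarrow> 'a::ab_group_add set \<Rightarrow> ('a \<Rightarrow> complex) \<Rightarrow> bool" where
  "mdeg 0 A f \<longleftrightarrow> (\<forall>x\<in>A. f x = 1)"
| "mdeg (Suc e) A f \<longleftrightarrow> (\<forall>h\<in>A. mdeg e A (dlt h f))"

lemma mdeg_gow:
  assumes "fsub H" "fsub L" "L \<subseteq> H" "y \<in> H"
  shows "mdeg e H f \<Longrightarrow> gow e L (sh y f) = 1"
proof (induction e arbitrary: f)
  case 0
  then have "avg L (sh y f) = avg L (\<lambda>_. 1)"
    using assms fsub_add by (intro avg_cong) (force simp: sh_def)
  then show ?case using assms by (simp add: avg_const fsub_finite fsub_nonempty)
next
  case (Suc e)
  have "gow (Suc e) L (sh y f) = avg L (\<lambda>_. 1)"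
    using Suc assms(3) by (auto simp: dlt_sh intro!: avg_cong)
  then show ?case using assms by (simp add: avg_const fsub_finite fsub_nonempty del: gow.simps)
qed

text \<open>A mean of modulus near 1 puts \<open>f\<close> near that mean in the square norm, so
  every derivative has a mean near 1 and is constant by induction. Hence \<open>f\<close> is a
  character up to a constant factor, and a nontrivial character has mean 0.\<close>

lemma phase_constant:
  assumes H: "fsub H"
  shows "mdeg (Suc e) H f \<Longrightarrow> (\<And>x. x \<in> H \<Longrightarrow> norm (f x) = 1) \<Longrightarrow> norm (avg H f) > 1 - 1 / 4 ^ e \<Longrightarrow> x \<in> H \<Longrightarrow> f x = f 0"
proof (induction e arbitrary: f x)
  case 0
  have "f (0 + x) * cnj (f 0) = 1" using 0(1,4) fsub_0[OF H] unfolding mdeg.simps dlt_def by blast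
  moreover have "f 0 * cnj (f 0) = 1" using 0(2)[OF fsub_0[OF H]] complex_norm_square[of "f 0"] by simp
  ultimately have "(f x - f 0) * cnj (f 0) = 0" by (simp add: algebra_simps)
  moreover have "f 0 \<noteq> 0" using 0(2)[OF fsub_0[OF H]] by auto
  ultimately show ?case by simp
next
  case (Suc e)
  define a where "a = avg H f"
  have ne: "finite H" "H \<noteq> {}" using H by (auto simp: fsub_finite fsub_nonempty)
  have dist: "avg H (\<lambda>x. (norm (f x - a))\<^sup>2) = 1 - (norm a)\<^sup>2"
  proof -
    have "avg H (\<lambda>x. (norm (f x - a))\<^sup>2) = avg H (\<lambda>x. (1 + (norm a)\<^sup>2) - 2 * Re (f x * cnj a))"
    proof (rule avg_cong)
      fix x assume "x \<in> H"
      then have "(norm (f x))\<^sup>2 = 1" using Suc.prems by simp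
      then show "(norm (f x - a))\<^sup>2 = (1 + (norm a)\<^sup>2) - 2 * Re (f x * cnj a)"
        unfolding cmod_power2 by (simp add: power2_eq_square algebra_simps)
    qed
    also have "\<dots> = (1 + (norm a)\<^sup>2) - 2 * Re (avg H f * cnj a)"
      by (simp only: avg_diff avg_const[OF ne] avg_mult_left avg_mult_right[symmetric] Re_avg)
    also have "Re (avg H f * cnj a) = (norm a)\<^sup>2" unfolding cmod_power2 a_def by (simp add: power2_eq_square)
    finally show ?thesis by simp
  qed
  have a1: "norm a \<le> 1"
    using norm_avg_le[of H f] avg_le[OF ne, of "\<lambda>x. norm (f x)" 1] Suc.prems(2) by (force simp: a_def)
  have const: "dlt h f z = dlt h f 0" if h: "h \<in> H" and z: "z \<in> H" for h z
  proof (rule Suc.IH[OF _ _ _ z])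
    show "mdeg (Suc e) H (dlt h f)" using Suc.prems h by simp
    show "norm (dlt h f x) = 1" if "x \<in> H" for x
      using that h Suc.prems(2) fsub_add[OF H] by (simp add: dlt_def norm_mult)
    have "2 - 2 * Re (avg H (dlt h f)) = avg H (\<lambda>x. (norm (f (x + h) - f x))\<^sup>2)"
    proof -
      have "avg H (\<lambda>x. (norm (f (x + h) - f x))\<^sup>2) = avg H (\<lambda>x. 2 - 2 * Re (dlt h f x))"
      proof (rule avg_cong)
        fix x assume "x \<in> H"
        then have "(norm (f x))\<^sup>2 = 1" "(norm (f (x + h)))\<^sup>2 = 1" using Suc.prems h fsub_add[OF H] by auto
        then show "(norm (f (x + h) - f x))\<^sup>2 = 2 - 2 * Re (dlt h f x)"
          unfolding cmod_power2 dlt_def by (simp add: power2_eq_square algebra_simps)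
      qed
      also have "\<dots> = 2 - 2 * Re (avg H (dlt h f))"
        by (simp only: avg_diff avg_const[OF ne] avg_mult_left Re_avg)
      finally show ?thesis by simp
    qed
    also have "\<dots> \<le> avg H (\<lambda>x. 2 * (norm (f (x + h) - a))\<^sup>2 + 2 * (norm (f x - a))\<^sup>2)"
    proof (rule avg_mono)
      fix x
      have "norm (f (x + h) - f x) \<le> norm (f (x + h) - a) + norm (f x - a)"
        by (metis norm_minus_commute norm_triangle_sub diff_add_cancel norm_diff_triangle_le order_refl)
      then have "(norm (f (x + h) - f x))\<^sup>2 \<le> (norm (f (x + h) - a) + norm (f x - a))\<^sup>2"
        by (intro power_mono) auto
      also have "\<dots> \<le> 2 * (norm (f (x + h) - a))\<^sup>2 + 2 * (norm (f x - a))\<^sup>2"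
        using sum_squares_bound[of "norm (f (x + h) - a)" "norm (f x - a)"] by (simp add: power2_eq_square algebra_simps)
      finally show "(norm (f (x + h) - f x))\<^sup>2 \<le> 2 * (norm (f (x + h) - a))\<^sup>2 + 2 * (norm (f x - a))\<^sup>2" .
    qed
    also have "\<dots> = 4 * (1 - (norm a)\<^sup>2)"
      using avg_shift[OF H h, of "\<lambda>x. (norm (f x - a))\<^sup>2"] by (simp add: avg_add avg_mult_left dist)
    \<comment> \<open>The defect \<open>1 - norm a\<close> grows at most fourfold when passing to a
      derivative, which explains the threshold \<open>1 / 4 ^ e\<close>.\<close>
    also have "\<dots> \<le> 8 * (1 - norm a)"
      using zero_le_power2[of "1 - norm a"] by (simp add: power2_eq_square algebra_simps)
    also have "\<dots> < 8 * (1 / 4 ^ Suc e)" using Suc.prems(3) by (simp add: a_def)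
    finally have "Re (avg H (dlt h f)) > 1 - 1 / 4 ^ e" by simp
    then show "norm (avg H (dlt h f)) > 1 - 1 / 4 ^ e"
      using complex_Re_le_cmod[of "avg H (dlt h f)"] by linarith
  qed
  have n0: "f 0 * cnj (f 0) = 1" using Suc.prems(2)[OF fsub_0[OF H]] complex_norm_square[of "f 0"] by simp
  have "f (z + x) = f x * cnj (f 0) * f z" if z: "z \<in> H" for z
  proof -
    have zz: "cnj (f z) * f z = 1"
      using Suc.prems(2)[OF z] complex_norm_square[of "f z"] by (simp add: mult.commute)
    have "f (z + x) * cnj (f z) = f x * cnj (f 0)" using const[OF Suc.prems(4) z] by (simp add: dlt_def)
    then have "f (z + x) * (cnj (f z) * f z) = f x * cnj (f 0) * f z" by (simp add: mult.assoc[symmetric])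
    then show ?thesis by (simp add: zz)
  qed
  \<comment> \<open>Translation by \<open>x\<close> multiplies \<open>f\<close> by a constant and
    preserves the nonzero mean, so the constant is 1.\<close>
  then have "avg H (\<lambda>z. f (z + x)) = avg H (\<lambda>z. (f x * cnj (f 0)) * f z)" by (rule avg_cong)
  then have "a = (f x * cnj (f 0)) * a" by (simp add: avg_shift[OF H Suc.prems(4)] avg_mult_left a_def)
  moreover have "a \<noteq> 0"
  proof
    assume "a = 0"
    then have "(1::real) < 1 / 4 ^ Suc e" using Suc.prems(3) by (simp add: a_def)
    moreover have "(1::real) \<le> 4 ^ Suc e" by (rule one_le_power) simp
    ultimately show False by (simp add: field_simps)
  qed
  ultimately have "f x * cnj (f 0) = 1" by simp
  with n0 have "(f x - f 0) * cnj (f 0) = 0" by (simp add: algebra_simps)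
  moreover have "f 0 \<noteq> 0" using n0 by auto
  ultimately show ?case by simp
qed

section \<open>Random subgroups\<close>

text \<open>The model is \<open>hom V U\<close> with the scalars of the field acting on it.
  Bijectivity of the nonzero scalars makes \<open>sc s g\<close> uniformly distributed for uniform
  \<open>g\<close>, and having two scalars guarantees that a nonzero one occurs.\<close>

locale scaled_group =
  fixes H :: "'a::ab_group_add set" and S :: "'s::ab_group_add set" and sc :: "'s \<Rightarrow> 'a \<Rightarrow> 'a"
  assumes H: "fsub H" and S: "fsub S" and S2: "card S \<ge> 2"
    and sc_closed: "s \<in> S \<Longrightarrow> g \<in> H \<Longrightarrow> sc s g \<in> H"
    and sc_diff: "s \<in> S \<Longrightarrow> t \<in> S \<Longrightarrow> g \<in> H \<Longrightarrow> sc (s - t) g = sc s g - sc t g"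
    and sc_bij: "s \<in> S \<Longrightarrow> s \<noteq> 0 \<Longrightarrow> bij_betw (sc s) H H"
begin

definition orb :: "'a \<Rightarrow> 'a set" where "orb g = (\<lambda>s. sc s g) ` S"

definition coset_gow :: "nat \<Rightarrow> 'a set \<Rightarrow> ('a \<Rightarrow> complex) \<Rightarrow> real" where
  "coset_gow k L f = avg H (\<lambda>y. gow k L (sh y f))"

primrec grow :: "'a set \<Rightarrow> 'a list \<Rightarrow> 'a set" where
  "grow L [] = L"
| "grow L (g # gs) = grow (ssum L (orb g)) gs"

text \<open>The expected value of \<open>F\<close> after adjoining to \<open>L\<close> the scalar
  multiples of \<open>T\<close> independent uniform elements of \<open>H\<close>;
  \<open>grow\<close> is one outcome of this experiment.\<close>

primrec rnd :: "nat \<Rightarrow> ('a set \<Rightarrow> real) \<Rightarrow> 'a set \<Rightarrow> real" where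
  "rnd 0 F L = F L"
| "rnd (Suc T) F L = avg H (\<lambda>g. rnd T F (ssum L (orb g)))"

lemma Hne: "finite H" "H \<noteq> {}"
  using H by (auto simp: fsub_finite fsub_nonempty)

lemma orb_fsub: "g \<in> H \<Longrightarrow> fsub (orb g)"
  unfolding orb_def by (rule fsub_image[OF S]) (rule sc_diff)

lemma orb_subset: "g \<in> H \<Longrightarrow> orb g \<subseteq> H"
  by (auto simp: orb_def sc_closed)

lemma grow_subset:
  assumes "fsub L'"
  shows "L \<subseteq> L' \<Longrightarrow> (\<And>g. g \<in> set gs \<Longrightarrow> orb g \<subseteq> L') \<Longrightarrow> grow L gs \<subseteq> L'"
  by (induction gs arbitrary: L) (auto simp: ssum_subset[OF assms])

lemma grow_fsub: "fsub L \<Longrightarrow> set gs \<subseteq> H \<Longrightarrow> fsub (grow L gs)"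
  by (induction gs arbitrary: L) (auto simp: fsub_ssum orb_fsub)

lemma coset_gow_mono:
  assumes "fsub L" "fsub L'" "L \<subseteq> L'" "L' \<subseteq> H"
  shows "coset_gow k L' f \<le> coset_gow k L f"
proof -
  have "coset_gow k L' f \<le> avg H (\<lambda>y. avg L' (\<lambda>z. gow k L (sh z (sh y f))))"
    unfolding coset_gow_def by (rule avg_mono) (rule gow_cosets[OF assms(2,3,1)])
  also have "\<dots> = avg H (\<lambda>y. avg L' (\<lambda>z. gow k L (sh (y + z) f)))"
    by (simp add: sh_sh add.commute)
  also have "\<dots> = avg L' (\<lambda>z. avg H (\<lambda>y. gow k L (sh (y + z) f)))"
    by (rule avg_swap)
  also have "\<dots> = avg L' (\<lambda>z. avg H (\<lambda>y. gow k L (sh y f)))"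
    by (rule avg_cong, rule avg_shift[OF H, where f = "\<lambda>y. gow k L (sh y f)"]) (use assms in auto)
  also have "\<dots> = coset_gow k L f"
    using assms by (simp add: coset_gow_def avg_const fsub_finite fsub_nonempty)
  finally show ?thesis .
qed

lemma gow_le_coset_gow: "fsub L \<Longrightarrow> L \<subseteq> H \<Longrightarrow> gow k H f \<le> coset_gow k L f"
  unfolding coset_gow_def by (rule gow_cosets[OF H])

lemma coset_gow_0:
  assumes "fsub L" "L \<subseteq> H"
  shows "coset_gow 0 L f = gow 0 H f"
  using avg_avg_shift[OF H assms(2,1), of f] by (simp add: coset_gow_def Re_avg[symmetric] sh_def add.commute)

lemma coset_gow_Suc: "coset_gow (Suc k) L f = avg L (\<lambda>h. coset_gow k L (dlt h f))"
  unfolding coset_gow_def by (simp add: dlt_sh) (rule avg_swap)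

text \<open>A uniform element of \<open>ssum L (orb g)\<close> is \<open>l + sc s g\<close>. With
  probability \<open>1 / card S\<close> the scalar is 0 and the direction stays in \<open>L\<close>;
  otherwise it is uniform in \<open>H\<close>, as in the average of order \<open>Suc k\<close> over
  all of \<open>H\<close>. The inner average of order \<open>k\<close> over the larger group is
  bounded by the one over \<open>L\<close>.\<close>

lemma coset_gow_step:
  assumes L: "fsub L" "L \<subseteq> H"
  shows "avg H (\<lambda>g. coset_gow (Suc k) (ssum L (orb g)) f)
    \<le> (1 / card S) * coset_gow (Suc k) L f + (1 - 1 / card S) * avg H (\<lambda>z. coset_gow k L (dlt z f))"
proof -
  define G where "G h = coset_gow k L (dlt h f)" for h
  let ?n = "real (card S)"
  have Sf: "finite S" "0 \<in> S" "S \<noteq> {}" using S by (auto simp: fsub_finite fsub_0 fsub_nonempty)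
  have inner: "coset_gow (Suc k) (ssum L (orb g)) f \<le> avg L (\<lambda>l. avg S (\<lambda>s. G (l + sc s g)))" if g: "g \<in> H" for g
  proof -
    have "coset_gow (Suc k) (ssum L (orb g)) f \<le> avg (ssum L (orb g)) G"
      unfolding coset_gow_Suc G_def
    proof (rule avg_mono)
      show "coset_gow k (ssum L (orb g)) (dlt h f) \<le> coset_gow k L (dlt h f)" for h
        by (rule coset_gow_mono[OF L(1) fsub_ssum[OF L(1) orb_fsub[OF g]] ssum_left[OF orb_fsub[OF g]]
              ssum_subset[OF H L(2) orb_subset[OF g]]])
    qed
    also have "\<dots> = avg L (\<lambda>l. avg (orb g) (\<lambda>b. G (l + b)))" by (rule avg_ssum[OF L(1) orb_fsub[OF g]])
    also have "\<dots> = avg L (\<lambda>l. avg S (\<lambda>s. G (l + sc s g)))"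
      unfolding orb_def by (rule avg_cong, rule avg_image[OF S]) (use g in \<open>auto simp: sc_diff\<close>)
    finally show ?thesis .
  qed
  have z: "avg H (\<lambda>g. avg L (\<lambda>l. G (l + sc s g))) = avg H G" if "s \<in> S - {0}" for s
  proof -
    have "avg H (\<lambda>g. avg L (\<lambda>l. G (l + sc s g))) = avg H (\<lambda>g. avg L (\<lambda>l. G (l + g)))"
      using that by (intro avg_bij[where f = "\<lambda>g. avg L (\<lambda>l. G (l + g))"] sc_bij) auto
    also have "\<dots> = avg H (\<lambda>g. avg L (\<lambda>l. G (g + l)))" by (simp add: add.commute)
    also have "\<dots> = avg H G" by (rule avg_avg_shift[OF H L(2,1), symmetric])
    finally show ?thesis .
  qed
  have s0: "avg H (\<lambda>g. avg L (\<lambda>l. G (l + sc 0 g))) = coset_gow (Suc k) L f"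
  proof -
    have "sc 0 g = 0" if "g \<in> H" for g using sc_diff[of 0 0 g] Sf that by simp
    then have "avg H (\<lambda>g. avg L (\<lambda>l. G (l + sc 0 g))) = avg H (\<lambda>g. avg L G)" by (intro avg_cong) simp
    then show ?thesis by (simp add: avg_const Hne coset_gow_Suc G_def[abs_def])
  qed
  have "avg H (\<lambda>g. coset_gow (Suc k) (ssum L (orb g)) f) \<le> avg H (\<lambda>g. avg L (\<lambda>l. avg S (\<lambda>s. G (l + sc s g))))"
    by (rule avg_mono) (rule inner)
  also have "\<dots> = avg S (\<lambda>s. avg H (\<lambda>g. avg L (\<lambda>l. G (l + sc s g))))"
    unfolding avg_swap[of L S] by (rule avg_swap)
  also have "\<dots> = (coset_gow (Suc k) L f + (\<Sum>s\<in>S - {0}. avg H G)) / ?n"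
    using Sf z by (simp add: avg_def[of S] sum.remove[of S 0] s0 divide_inverse)
  also have "\<dots> = (1 / ?n) * coset_gow (Suc k) L f + (1 - 1 / ?n) * avg H G"
    using S2 Sf by (simp add: field_simps of_nat_diff)
  finally show ?thesis by (simp add: G_def[abs_def])
qed

text \<open>Exposes the last step of the experiment, where the subgroup is arbitrary, so that
  \<open>coset_gow_step\<close> applies inside the expectation.\<close>

lemma rnd_last: "rnd (Suc T) F L = rnd T (\<lambda>L. avg H (\<lambda>g. F (ssum L (orb g)))) L"
  by (induction T arbitrary: L) auto

lemma rnd_mono:
  assumes "\<And>L. fsub L \<Longrightarrow> L \<subseteq> H \<Longrightarrow> F L \<le> G L"
  shows "fsub L \<Longrightarrow> L \<subseteq> H \<Longrightarrow> rnd T F L \<le> rnd T G L"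
proof (induction T arbitrary: L)
  case (Suc T)
  show ?case unfolding rnd.simps
    by (rule avg_mono) (intro Suc.IH fsub_ssum ssum_subset H Suc.prems orb_fsub orb_subset; assumption)
qed (simp add: assms)

lemma rnd_lin: "rnd T (\<lambda>L. a * F L + b * G L) L = a * rnd T F L + b * rnd T G L"
  by (induction T arbitrary: L) (auto simp: avg_add avg_mult_left)

lemma rnd_avg: "rnd T (\<lambda>L. avg H (\<lambda>z. F z L)) L = avg H (\<lambda>z. rnd T (F z) L)"
proof (induction T arbitrary: L)
  case (Suc T)
  show ?case unfolding rnd.simps Suc by (rule avg_swap)
qed simp

lemma rnd_const: "rnd T (\<lambda>L. c) L = c"
  by (induction T arbitrary: L) (auto simp: avg_const Hne)

lemma rnd_sum: "finite K \<Longrightarrow> rnd T (\<lambda>L. \<Sum>k\<in>K. F k L) L = (\<Sum>k\<in>K. rnd T (F k) L)"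
proof (induction K rule: finite_induct)
  case empty
  then show ?case by (simp add: rnd_const)
next
  case (insert k K)
  then show ?case using rnd_lin[of T 1 "F k" 1 "\<lambda>L. \<Sum>k\<in>K. F k L" L] by simp
qed

lemma rnd_ex: "rnd T F L \<le> c \<Longrightarrow> \<exists>gs. length gs = T \<and> set gs \<subseteq> H \<and> F (grow L gs) \<le> c"
proof (induction T arbitrary: L)
  case (Suc T)
  then obtain g where g: "g \<in> H" "rnd T F (ssum L (orb g)) \<le> c"
    using avg_ex_le[OF Hne, of "\<lambda>g. rnd T F (ssum L (orb g))" c] by auto
  with Suc.IH obtain gs where "length gs = T" "set gs \<subseteq> H" "F (grow (ssum L (orb g)) gs) \<le> c" by blast
  with g show ?case by (intro exI[of _ "g # gs"]) simp
qed simp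

end

text \<open>Error after \<open>T\<close> random steps at order \<open>k\<close>, read off from
  \<open>coset_gow_step\<close>: half of the old error at the same order, since
  \<open>1 / card S \<le> 1 / 2\<close>, plus the error one order lower. Order 0 is exact, and 2
  bounds every initial error.\<close>

fun samperr :: "nat \<Rightarrow> nat \<Rightarrow> real" where
  "samperr 0 T = 0"
| "samperr (Suc k) 0 = 2"
| "samperr (Suc k) (Suc T) = samperr (Suc k) T / 2 + samperr k T"

lemma samperr_nonneg: "0 \<le> samperr k T"
  by (induction k T rule: samperr.induct) auto

lemma halving_tendsto_0:
  fixes a b :: "nat \<Rightarrow> real"
  assumes "b \<longlonglongrightarrow> 0" and a: "\<And>n. a (Suc n) = a n / 2 + b n" and "\<And>n. 0 \<le> a n"
  shows "a \<longlonglongrightarrow> 0"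
proof (rule LIMSEQ_I)
  fix r :: real assume r: "0 < r"
  obtain N where N: "\<And>n. n \<ge> N \<Longrightarrow> norm (b n) < r / 4" using LIMSEQ_D[OF assms(1), of "r/4"] r by auto
  have bd: "a (N + m) \<le> a N / 2 ^ m + r / 2" for m
  proof (induction m)
    case (Suc m)
    have "a (N + Suc m) \<le> (a N / 2 ^ m + r / 2) / 2 + b (N + m)" using Suc by (simp add: a)
    also have "\<dots> \<le> (a N / 2 ^ m + r / 2) / 2 + r / 4" using N[of "N + m"] by simp
    also have "\<dots> = a N / 2 ^ Suc m + r / 2" by (simp add: field_simps)
    finally show ?case .
  qed (use r in simp)
  have "(\<lambda>m. a N * (1/2) ^ m) \<longlonglongrightarrow> a N * 0"
    by (intro tendsto_intros LIMSEQ_realpow_zero) auto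
  then obtain M where M: "\<And>m. m \<ge> M \<Longrightarrow> norm (a N * (1/2) ^ m) < r / 2"
    using LIMSEQ_D[of "\<lambda>m. a N * (1/2) ^ m" 0 "r/2"] r by auto
  show "\<exists>no. \<forall>n\<ge>no. norm (a n - 0) < r"
  proof (intro exI allI impI)
    fix n assume n: "n \<ge> N + M"
    have "a n \<le> a N / 2 ^ (n - N) + r / 2" using bd[of "n - N"] n by simp
    also have "a N / 2 ^ (n - N) + r / 2 < r / 2 + r / 2"
    proof -
      have "a N / 2 ^ (n - N) = a N * (1/2) ^ (n - N)" by (simp add: power_divide)
      also have "\<dots> < r / 2" using abs_less_iff[THEN iffD1, OF M[of "n - N", unfolded real_norm_def]] n by auto
      finally show ?thesis by (rule add_strict_right_mono)
    qed
    finally show "norm (a n - 0) < r" using assms(3)[of n] by simp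
  qed
qed

lemma samperr_tendsto: "samperr k \<longlonglongrightarrow> 0"
proof (induction k)
  case (Suc k)
  show ?case by (rule halving_tendsto_0[OF Suc]) (auto simp: samperr_nonneg)
qed (simp add: LIMSEQ_def)

context scaled_group
begin

text \<open>In \<open>coset_gow_step\<close> the terms of order \<open>k\<close>, averaged over all
  directions \<open>z\<close>, tend to \<open>gow (Suc k) H f\<close>; what is left over obeys the
  recursion of \<open>samperr\<close>.\<close>

lemma rnd_coset_gow:
  assumes L: "fsub L" "L \<subseteq> H"
  shows "(\<And>x. x \<in> H \<Longrightarrow> norm (f x) \<le> 1) \<Longrightarrow> rnd T (\<lambda>L. coset_gow k L f) L \<le> gow k H f + samperr k T"
proof (induction k T arbitrary: f rule: samperr.induct)
  case (1 T)
  have "rnd T (\<lambda>L. coset_gow 0 L f) L \<le> rnd T (\<lambda>L. gow 0 H f) L"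
    by (rule rnd_mono[OF _ L]) (simp add: coset_gow_0)
  then show ?case by (simp add: rnd_const)
next
  case (2 k)
  have "gow (Suc k) L (sh y f) \<le> 1" if "y \<in> H" for y
  proof -
    have "norm (sh y f x) \<le> 1" if "x \<in> L" for x
      unfolding sh_def using that \<open>y \<in> H\<close> L(2) by (intro 2 fsub_add[OF H]) auto
    from gow_bound[OF L(1), of "sh y f" "Suc k", OF this] show ?thesis by (simp del: gow.simps)
  qed
  then have "coset_gow (Suc k) L f \<le> 1" unfolding coset_gow_def by (intro avg_le Hne)
  then show ?case using gow_Suc_nonneg[OF H, of k f] by (simp del: gow.simps)
next
  case (3 k T)
  define s where "s = real (card S)"
  have s: "s \<ge> 2" using S2 by (simp add: s_def)
  have "rnd (Suc T) (\<lambda>L. coset_gow (Suc k) L f) L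
    \<le> rnd T (\<lambda>L. (1 / s) * coset_gow (Suc k) L f + (1 - 1 / s) * avg H (\<lambda>z. coset_gow k L (dlt z f))) L"
    unfolding rnd_last s_def by (rule rnd_mono[OF _ L]) (rule coset_gow_step)
  also have "\<dots> = (1 / s) * rnd T (\<lambda>L. coset_gow (Suc k) L f) L + (1 - 1 / s) * avg H (\<lambda>z. rnd T (\<lambda>L. coset_gow k L (dlt z f)) L)"
    by (simp only: rnd_lin rnd_avg)
  also have "\<dots> \<le> (1 / s) * (gow (Suc k) H f + samperr (Suc k) T) + (1 - 1 / s) * avg H (\<lambda>z. gow k H (dlt z f) + samperr k T)"
  proof (intro add_mono mult_left_mono avg_mono)
    show "rnd T (\<lambda>L. coset_gow (Suc k) L f) L \<le> gow (Suc k) H f + samperr (Suc k) T"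
      by (rule "3.IH"(1)) (rule "3.prems")
    show "rnd T (\<lambda>L. coset_gow k L (dlt z f)) L \<le> gow k H (dlt z f) + samperr k T" if "z \<in> H" for z
      by (rule "3.IH"(2)) (use that fsub_add[OF H] "3.prems" in \<open>auto simp: dlt_def norm_mult intro!: mult_le_one\<close>)
  qed (use s in auto)
  also have "\<dots> = gow (Suc k) H f + samperr (Suc k) T / s + samperr k T - samperr k T / s"
  proof -
    have e: "avg H (\<lambda>z. gow k H (dlt z f) + samperr k T) = gow (Suc k) H f + samperr k T"
      by (simp add: avg_add avg_const Hne)
    show ?thesis unfolding e using s by (simp add: field_simps del: gow.simps samperr.simps)
  qed
  also have "\<dots> \<le> gow (Suc k) H f + samperr (Suc k) (Suc T)"
  proof -
    have "samperr (Suc k) T / s \<le> samperr (Suc k) T / 2"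
      by (rule frac_le[OF samperr_nonneg order_refl _ s]) simp
    moreover have "0 \<le> samperr k T / s" using s samperr_nonneg[of k T] by simp
    ultimately show ?thesis by (simp only: samperr.simps(3))
  qed
  finally show ?case .
qed

end

text \<open>The number \<open>T\<close> depends on \<delta> and \<open>e\<close> alone, not on the
  group. By \<open>coset_gow_mono\<close> the bound for the sampled subgroup passes to every larger
  \<open>L\<close>, so it can be used for the image of a whole Hom group.\<close>

theorem sampling:
  assumes "0 < \<delta>"
  obtains T where "\<And>(H::'a::ab_group_add set) (S::'s::ab_group_add set) sc (f::'a \<Rightarrow> complex). scaled_group H S sc \<Longrightarrow>
    (\<And>x. x \<in> H \<Longrightarrow> norm (f x) \<le> 1) \<Longrightarrow>
    \<exists>gs. length gs = T \<and> set gs \<subseteq> H \<and> (\<forall>L k. fsub L \<longrightarrow> L \<subseteq> H \<longrightarrow> (\<forall>g\<in>set gs. \<forall>s\<in>S. sc s g \<in> L) \<longrightarrow>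
      1 \<le> k \<longrightarrow> k \<le> e \<longrightarrow> avg H (\<lambda>y. gow k L (sh y f)) \<le> gow k H f + \<delta>)"
proof -
  have "(\<lambda>T. \<Sum>k\<in>{1..e}. samperr k T) \<longlonglongrightarrow> (\<Sum>k\<in>{1..e}. 0)"
    by (intro tendsto_sum samperr_tendsto)
  then obtain T where T: "(\<Sum>k\<in>{1..e}. samperr k T) < \<delta>"
    using LIMSEQ_D[of "\<lambda>T. \<Sum>k\<in>{1..e}. samperr k T" 0 \<delta>] assms by (auto simp: abs_less_iff)
  show ?thesis
  proof (rule that[of T])
    fix H :: "'a set" and S :: "'s set" and sc and f :: "'a \<Rightarrow> complex"
    assume "scaled_group H S sc" and f: "\<And>x. x \<in> H \<Longrightarrow> norm (f x) \<le> 1"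
    then interpret scaled_group H S sc by simp
    have Z: "fsub {0::'a}" "{0} \<subseteq> H" using fsub_0[OF H] by (auto simp: fsub_def)
    \<comment> \<open>All excesses are nonnegative by \<open>gow_le_coset_gow\<close>, so a bound on
      the expectation of their sum yields one sample that serves every order simultaneously.\<close>
    define F where "F L = (\<Sum>k\<in>{1..e}. coset_gow k L f + - gow k H f)" for L
    have "rnd T F {0} = (\<Sum>k\<in>{1..e}. rnd T (\<lambda>L. 1 * coset_gow k L f + 1 * - gow k H f) {0})"
      unfolding F_def by (subst rnd_sum) auto
    also have "\<dots> = (\<Sum>k\<in>{1..e}. rnd T (\<lambda>L. coset_gow k L f) {0} - gow k H f)"
      by (simp only: rnd_lin rnd_const) simp
    also have "\<dots> \<le> (\<Sum>k\<in>{1..e}. samperr k T)"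
      by (rule sum_mono) (use rnd_coset_gow[OF Z f] in \<open>auto simp: algebra_simps\<close>)
    also have "\<dots> \<le> \<delta>" using T by simp
    finally obtain gs where gs: "length gs = T" "set gs \<subseteq> H" "F (grow {0} gs) \<le> \<delta>"
      using rnd_ex by blast
    have "avg H (\<lambda>y. gow k L (sh y f)) \<le> gow k H f + \<delta>"
      if L: "fsub L" "L \<subseteq> H" "\<forall>g\<in>set gs. \<forall>s\<in>S. sc s g \<in> L" and k: "1 \<le> k" "k \<le> e" for L k
    proof -
      have gr: "fsub (grow {0} gs)" "grow {0} gs \<subseteq> L"
        using grow_fsub[OF Z(1) gs(2)] grow_subset[OF L(1), of "{0}" gs] L(3) fsub_0[OF L(1)] by (auto simp: orb_def)
      have gH: "grow {0} gs \<subseteq> H" using gr L by auto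
      have "coset_gow k (grow {0} gs) f + - gow k H f \<le> F (grow {0} gs)"
        unfolding F_def by (rule member_le_sum) (use k gow_le_coset_gow[OF gr(1) gH] in auto)
      moreover have "coset_gow k L f \<le> coset_gow k (grow {0} gs) f"
        by (rule coset_gow_mono[OF gr(1) L(1) gr(2) L(2)])
      ultimately show ?thesis using gs(3) by (simp add: coset_gow_def)
    qed
    with gs show "\<exists>gs. length gs = T \<and> set gs \<subseteq> H \<and> (\<forall>L k. fsub L \<longrightarrow> L \<subseteq> H \<longrightarrow> (\<forall>g\<in>set gs. \<forall>s\<in>S. sc s g \<in> L) \<longrightarrow>
      1 \<le> k \<longrightarrow> k \<le> e \<longrightarrow> avg H (\<lambda>y. gow k L (sh y f)) \<le> gow k H f + \<delta>)"
      by blast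
  qed
qed

section \<open>Maps of finite additive degree\<close>

text \<open>Degree below \<open>e\<close> modulo \<open>N\<close>, the additive counterpart of
  \<open>mdeg\<close>. In contrast to polynomial degree it makes sense for maps between abelian
  groups without coordinates and relative to a subgroup of values.\<close>

fun pdeg :: "nat \<Rightarrow> 'a::ab_group_add set \<Rightarrow> 'p::ab_group_add set \<Rightarrow> ('a \<Rightarrow> 'p) \<Rightarrow> bool" where
  "pdeg 0 A N \<Phi> \<longleftrightarrow> (\<forall>x\<in>A. \<Phi> x \<in> N)"
| "pdeg (Suc e) A N \<Phi> \<longleftrightarrow> (\<forall>h\<in>A. pdeg e A N (\<lambda>x. \<Phi> (x + h) - \<Phi> x))"

lemma pdeg_mono: "N \<subseteq> N' \<Longrightarrow> pdeg e A N \<Phi> \<Longrightarrow> pdeg e A N' \<Phi>"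
  by (induction e arbitrary: \<Phi>) auto

lemma pdeg_cong:
  assumes "fsub A"
  shows "(\<And>x. x \<in> A \<Longrightarrow> \<Phi> x = \<Psi> x) \<Longrightarrow> pdeg e A N \<Phi> \<longleftrightarrow> pdeg e A N \<Psi>"
proof (induction e arbitrary: \<Phi> \<Psi>)
  case (Suc e)
  have "pdeg e A N (\<lambda>x. \<Phi> (x + h) - \<Phi> x) \<longleftrightarrow> pdeg e A N (\<lambda>x. \<Psi> (x + h) - \<Psi> x)" if "h \<in> A" for h
    by (rule Suc.IH) (use that Suc.prems fsub_add[OF assms] in auto)
  then show ?case by auto
qed auto

lemma pdeg_diff_const:
  assumes "fsub N"
  shows "pdeg e A N \<Phi> \<Longrightarrow> x0 \<in> A \<Longrightarrow> pdeg e A N (\<lambda>x. \<Phi> x - \<Phi> x0)"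
  by (cases e) (auto simp: fsub_diff[OF assms])

lemma pdeg_affine:
  assumes A: "fsub A" and B: "fsub B" and c: "c \<in> B"
    and T: "\<And>x. x \<in> A \<Longrightarrow> T x \<in> B" "\<And>x y. x \<in> A \<Longrightarrow> y \<in> A \<Longrightarrow> T (x + y) = T x + T y"
  shows "pdeg e B N \<Phi> \<Longrightarrow> pdeg e A N (\<lambda>x. \<Phi> (c + T x))"
proof (induction e arbitrary: \<Phi>)
  case 0
  then show ?case using T c fsub_add[OF B] by auto
next
  case (Suc e)
  have "pdeg e A N (\<lambda>x. \<Phi> (c + T (x + h)) - \<Phi> (c + T x))" if h: "h \<in> A" for h
  proof -
    have "pdeg e A N (\<lambda>x. (\<lambda>y. \<Phi> (y + T h) - \<Phi> y) (c + T x))"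
      using Suc.prems T(1)[OF h] by (intro Suc.IH) auto
    then show ?thesis
      using pdeg_cong[OF A, of "\<lambda>x. \<Phi> (c + T (x + h)) - \<Phi> (c + T x)" "\<lambda>x. \<Phi> (c + T x + T h) - \<Phi> (c + T x)" e N]
      by (simp add: T(2) h add.assoc)
  qed
  then show ?case by simp
qed

section \<open>Recurrence along subset sums and the density of fibres\<close>

fun return_bound :: "nat \<Rightarrow> nat \<Rightarrow> nat \<Rightarrow> nat" where
  "return_bound 0 n c = 1"
| "return_bound (Suc e) n c = (\<Sum>r<c ^ n. return_bound e (n * r) c)"

context
  fixes A :: "'a::ab_group_add set" and Y N :: "'p::ab_group_add set"
  assumes A: "fsub A" and Y: "fsub Y" and N: "fsub N"
begin

text \<open>A finite form of polynomial recurrence. Several maps are treated simultaneously because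
  lowering the degree multiplies their number, and the start \<open>M\<close> of the window is free
  so that disjoint blocks can be found one after the other.\<close>

definition returns :: "nat \<Rightarrow> bool" where
  "returns e \<longleftrightarrow> (\<forall>n \<Phi> h M. (\<forall>i<n. pdeg e A N (\<Phi> i) \<and> (\<forall>x\<in>A. \<Phi> i x \<in> Y) \<and> \<Phi> i 0 \<in> N) \<longrightarrow>
     (\<forall>j::nat. h j \<in> A) \<longrightarrow>
     (\<exists>I\<subseteq>{M..<M + return_bound e n (card Y)}. I \<noteq> {} \<and> (\<forall>i<n. \<Phi> i (\<Sum>j\<in>I. h j) \<in> N)))"

text \<open>Additivity is required on runs \<open>a..b\<close> of consecutive blocks only; these are
  the differences of partial sums that the pigeonhole in the proof of \<open>returns\<close>
  compares.\<close>

definition blocks :: "nat \<Rightarrow> (nat \<Rightarrow> 'a \<Rightarrow> 'p) \<Rightarrow> (nat \<Rightarrow> 'a) \<Rightarrow> nat \<Rightarrow> nat set \<Rightarrow> (nat \<Rightarrow> nat set) \<Rightarrow> bool" where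
  "blocks n \<Phi> h r R I \<longleftrightarrow> (\<forall>k<r. I k \<subseteq> R \<and> I k \<noteq> {}) \<and> (\<forall>k<r. \<forall>l<r. k \<noteq> l \<longrightarrow> I k \<inter> I l = {}) \<and>
      (\<forall>i<n. \<forall>b<r. \<forall>a\<le>b. \<Phi> i (\<Sum>k=a..b. sum h (I k)) - (\<Sum>k=a..b. \<Phi> i (sum h (I k))) \<in> N)"

lemma blocksD:
  assumes "blocks n \<Phi> h r R I"
  shows "k < r \<Longrightarrow> I k \<subseteq> R" "k < r \<Longrightarrow> I k \<noteq> {}" "k < r \<Longrightarrow> l < r \<Longrightarrow> k \<noteq> l \<Longrightarrow> I k \<inter> I l = {}"
    "i < n \<Longrightarrow> b < r \<Longrightarrow> a \<le> b \<Longrightarrow> \<Phi> i (\<Sum>k=a..b. sum h (I k)) - (\<Sum>k=a..b. \<Phi> i (sum h (I k))) \<in> N"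
  using assms unfolding blocks_def by auto

text \<open>The next block is chosen by recurrence for the derivatives of the maps in the directions
  \<open>s a\<close>, the sums over all runs ending at the previous block; their return to
  \<open>N\<close> is additivity for the runs ending at the new block. There are
  \<open>n * r\<close> of them, of degree one less.\<close>

lemma additive_blocks:
  assumes ret: "returns e"
    and \<Phi>: "\<And>i. i < n \<Longrightarrow> pdeg (Suc e) A N (\<Phi> i)" "\<And>i x. i < n \<Longrightarrow> x \<in> A \<Longrightarrow> \<Phi> i x \<in> Y" "\<And>i. i < n \<Longrightarrow> \<Phi> i 0 \<in> N"
    and h: "\<And>j::nat. h j \<in> A"
  shows "\<exists>I. blocks n \<Phi> h r {M..<M + (\<Sum>r'<r. return_bound e (n * r') (card Y))} I"
proof (induction r)
  case 0
  show ?case by (simp add: blocks_def)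
next
  case (Suc r)
  define m where "m = (\<Sum>r'<r. return_bound e (n * r') (card Y))"
  define m' where "m' = return_bound e (n * r) (card Y)"
  obtain I where "blocks n \<Phi> h r {M..<M + m} I"
    using Suc.IH unfolding m_def by blast
  note I = blocksD[OF this]
  define s where "s a = (\<Sum>k\<in>{a..<r}. sum h (I k))" for a
  have sA: "s a \<in> A" for a unfolding s_def by (intro fsub_sum A h)
  \<comment> \<open>The pair of a map \<open>i\<close> and a start \<open>a\<close> is coded as
    \<open>t = i * r + a\<close>. Subtracting the value at 0 meets the condition of
    \<open>returns\<close> at 0 and keeps the degree bound.\<close>
  define \<Psi> where "\<Psi> t = (\<lambda>y. (\<Phi> (t div r) (y + s (t mod r)) - \<Phi> (t div r) y) - (\<Phi> (t div r) (0 + s (t mod r)) - \<Phi> (t div r) 0))" for t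
  have "pdeg e A N (\<Psi> t) \<and> (\<forall>x\<in>A. \<Psi> t x \<in> Y) \<and> \<Psi> t 0 \<in> N" if t: "t < n * r" for t
  proof -
    have ti: "t div r < n" using t by (simp add: less_mult_imp_div_less)
    have "pdeg e A N (\<lambda>y. \<Phi> (t div r) (y + s (t mod r)) - \<Phi> (t div r) y)"
      using \<Phi>(1)[OF ti] sA by simp
    from pdeg_diff_const[OF N this fsub_0[OF A]] have "pdeg e A N (\<Psi> t)" by (simp add: \<Psi>_def)
    moreover have "\<Psi> t x \<in> Y" if "x \<in> A" for x
      unfolding \<Psi>_def using \<Phi>(2)[OF ti] that sA fsub_add[OF A] fsub_0[OF A] by (intro fsub_diff[OF Y]) auto
    ultimately show ?thesis by (simp add: \<Psi>_def fsub_0[OF N])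
  qed
  then have "\<exists>I\<subseteq>{M + m..<M + m + m'}. I \<noteq> {} \<and> (\<forall>t<n * r. \<Psi> t (sum h I) \<in> N)"
    using ret[unfolded returns_def, rule_format, of "n * r" \<Psi> h "M + m"] h by (simp add: m'_def)
  then obtain I' where I': "I' \<subseteq> {M + m..<M + m + m'}" "I' \<noteq> {}" "\<And>t. t < n * r \<Longrightarrow> \<Psi> t (sum h I') \<in> N"
    by blast
  define J where "J = I(r := I')"
  have Jr: "J r = I'" and Jk: "\<And>k. k < r \<Longrightarrow> J k = I k" by (auto simp: J_def)
  have "J k \<subseteq> {M..<M + (m + m')} \<and> J k \<noteq> {}" if "k < Suc r" for k
  proof (cases "k = r")
    case True
    then show ?thesis using I'(1,2) by (force simp: J_def)
  next
    case False
    then have "k < r" using that by simp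
    then show ?thesis using I(1)[of k] I(2)[of k] by (force simp: Jk)
  qed
  moreover have "J k \<inter> J l = {}" if "k < Suc r" "l < Suc r" "k \<noteq> l" for k l
  proof -
    have *: "I k \<inter> I' = {}" if "k < r" for k using I(1)[OF that] I'(1) by fastforce
    show ?thesis using that I(3)[of k l] *[of k] *[of l] by (auto simp: J_def less_Suc_eq)
  qed
  moreover have "\<Phi> i (\<Sum>k=a..b. sum h (J k)) - (\<Sum>k=a..b. \<Phi> i (sum h (J k))) \<in> N" if i: "i < n" and b: "b < Suc r" "a \<le> b" for i b a
  proof (cases "b = r")
    case False
    then have "(\<Sum>k=a..b. sum h (J k)) = (\<Sum>k=a..b. sum h (I k))" "(\<Sum>k=a..b. \<Phi> i (sum h (J k))) = (\<Sum>k=a..b. \<Phi> i (sum h (I k)))"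
      using b by (auto intro!: sum.cong simp: Jk)
    then show ?thesis using I(4)[OF i _ b(2)] b False by simp
  next
    case True
    show ?thesis
    proof (cases "a = r")
      case True
      then show ?thesis using \<open>b = r\<close> fsub_0[OF N] by simp
    next
      case False
      then have ar: "a < r" using b by simp
      define x where "x = sum h I'"
      have split: "(\<Sum>k=a..r. g k) = (\<Sum>k=a..r - 1. g k) + g r" "{a..r - 1} = {a..<r}" for g :: "nat \<Rightarrow> 'z::comm_monoid_add"
        using ar by (cases r; auto)+
      have e1: "(\<Sum>k=a..b. sum h (J k)) = s a + x"
        using ar unfolding \<open>b = r\<close> split(1) unfolding split(2) s_def by (auto simp: Jr Jk x_def intro!: sum.cong)
      have e2: "(\<Sum>k=a..b. \<Phi> i (sum h (J k))) = (\<Sum>k=a..r - 1. \<Phi> i (sum h (I k))) + \<Phi> i x"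
        using ar unfolding \<open>b = r\<close> split(1) by (auto simp: Jr Jk x_def intro!: sum.cong)
      have e3: "\<Phi> i (s a) - (\<Sum>k=a..r - 1. \<Phi> i (sum h (I k))) \<in> N"
        using I(4)[OF i, of "r - 1" a] ar by (simp add: s_def split(2)[symmetric] del: split(2))
      have "i * r + a < Suc i * r" using ar by simp
      also have "\<dots> \<le> n * r" using i by (intro mult_right_mono) auto
      finally have t: "i * r + a < n * r" .
      have t': "(i * r + a) div r = i" "(i * r + a) mod r = a" using ar by auto
      have "\<Psi> (i * r + a) x \<in> N" using I'(3)[OF t] by (simp add: x_def)
      then have "(\<Phi> i (x + s a) - \<Phi> i x) - (\<Phi> i (s a) - \<Phi> i 0) \<in> N" by (simp add: \<Psi>_def t' ar)
      from fsub_diff[OF N fsub_add[OF N this e3] \<Phi>(3)[OF i]]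
      have "\<Phi> i (s a + x) - ((\<Sum>k=a..r - 1. \<Phi> i (sum h (I k))) + \<Phi> i x) \<in> N" by (simp add: algebra_simps)
      then show ?thesis by (simp only: e1 e2)
    qed
  qed
  ultimately have "blocks n \<Phi> h (Suc r) {M..<M + (m + m')} J" unfolding blocks_def by blast
  then show ?case unfolding sum.lessThan_Suc m_def[symmetric] m'_def[symmetric] by blast
qed

lemma returns: "returns e"
proof (induction e)
  case 0
  show ?case unfolding returns_def
  proof (intro allI impI)
    fix n :: nat and \<Phi> :: "nat \<Rightarrow> 'a \<Rightarrow> 'p" and h :: "nat \<Rightarrow> 'a" and M :: nat
    assume "\<forall>i<n. pdeg 0 A N (\<Phi> i) \<and> (\<forall>x\<in>A. \<Phi> i x \<in> Y) \<and> \<Phi> i 0 \<in> N" "\<forall>j. h j \<in> A"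
    then show "\<exists>I\<subseteq>{M..<M + return_bound 0 n (card Y)}. I \<noteq> {} \<and> (\<forall>i<n. \<Phi> i (\<Sum>j\<in>I. h j) \<in> N)"
      by (intro exI[of _ "{M}"]) auto
  qed
next
  case (Suc e)
  show ?case unfolding returns_def
  proof (intro allI impI)
    fix n :: nat and \<Phi> :: "nat \<Rightarrow> 'a \<Rightarrow> 'p" and h :: "nat \<Rightarrow> 'a" and M :: nat
    assume \<Phi>: "\<forall>i<n. pdeg (Suc e) A N (\<Phi> i) \<and> (\<forall>x\<in>A. \<Phi> i x \<in> Y) \<and> \<Phi> i 0 \<in> N" and h: "\<forall>j. h j \<in> A"
    \<comment> \<open>With \<open>r\<close> blocks there are \<open>r + 1\<close> families of
      partial sums but at most \<open>r\<close> possible values; two equal ones, at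
      \<open>a < b\<close>, make the sum over the run from \<open>a\<close> to \<open>b - 1\<close>
      vanish.\<close>
    define r where "r = card Y ^ n"
    have "\<exists>I. blocks n \<Phi> h r {M..<M + return_bound (Suc e) n (card Y)} I"
      unfolding r_def return_bound.simps by (rule additive_blocks[OF Suc]) (use \<Phi> h in auto)
    then obtain I where "blocks n \<Phi> h r {M..<M + return_bound (Suc e) n (card Y)} I" by blast
    note I = blocksD[OF this]
    have hI: "sum h J \<in> A" for J using fsub_sum[OF A, of J h] h by blast
    define P where "P b = (\<lambda>i\<in>{..<n}. \<Sum>k<b. \<Phi> i (sum h (I k)))" for b
    have "P ` {..r} \<subseteq> {..<n} \<rightarrow>\<^sub>E Y"
    proof -
      have "P b \<in> {..<n} \<rightarrow>\<^sub>E Y" for b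
        unfolding P_def using \<Phi> hI by (intro restrict_PiE_iff[THEN iffD2] ballI fsub_sum Y) auto
      then show ?thesis by blast
    qed
    then have "card (P ` {..r}) \<le> r"
      using card_mono[of "{..<n} \<rightarrow>\<^sub>E Y" "P ` {..r}"] fsub_finite[OF Y] by (auto simp: card_PiE r_def finite_PiE)
    then have "\<not> inj_on P {..r}" by (metis card_atMost card_image not_less_eq_eq order_refl)
    then obtain a b where ab: "a < b" "b \<le> r" "P a = P b"
      unfolding inj_on_def by (metis atMost_iff linorder_neqE_nat)
    define J where "J = (\<Union>k\<in>{a..b - 1}. I k)"
    have kr: "k < r" if "k \<in> {a..b - 1}" for k using that ab by auto
    have JM: "J \<subseteq> {M..<M + return_bound (Suc e) n (card Y)}" unfolding J_def using I(1) kr by blast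
    moreover have "J \<noteq> {}" using I(2)[of a] ab by (force simp: J_def)
    moreover have "\<Phi> i (sum h J) \<in> N" if i: "i < n" for i
    proof -
      have "sum h J = (\<Sum>k=a..b - 1. sum h (I k))"
        unfolding J_def
      proof (rule sum.UNION_disjoint)
        show "\<forall>k\<in>{a..b - 1}. finite (I k)" using I(1) kr by (meson finite_atLeastLessThan finite_subset)
        show "\<forall>k\<in>{a..b - 1}. \<forall>l\<in>{a..b - 1}. k \<noteq> l \<longrightarrow> I k \<inter> I l = {}" using I(3) kr by blast
      qed simp
      then have "\<Phi> i (sum h J) - (\<Sum>k=a..b - 1. \<Phi> i (sum h (I k))) \<in> N"
        using I(4)[OF i, of "b - 1" a] ab by auto
      moreover have "(\<Sum>k=a..b - 1. \<Phi> i (sum h (I k))) = 0"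
      proof -
        have "(\<Sum>k<a. \<Phi> i (sum h (I k))) = (\<Sum>k<b. \<Phi> i (sum h (I k)))"
          using fun_cong[OF ab(3), of i] i by (simp add: P_def)
        moreover have "(\<Sum>k<b. \<Phi> i (sum h (I k))) = (\<Sum>k<a. \<Phi> i (sum h (I k))) + (\<Sum>k\<in>{a..b - 1}. \<Phi> i (sum h (I k)))"
        proof -
          have "{a..b - 1} = {a..<b}" using ab by auto
          moreover have "a \<le> b" using ab by simp
          ultimately show ?thesis
            using sum.atLeastLessThan_concat[of 0 a b "\<lambda>k. \<Phi> i (sum h (I k))"] by (simp only: lessThan_atLeast0 le0)
        qed
        ultimately show ?thesis by (metis add_cancel_left_right)
      qed
      ultimately show ?thesis by simp
    qed
    ultimately show "\<exists>I\<subseteq>{M..<M + return_bound (Suc e) n (card Y)}. I \<noteq> {} \<and> (\<forall>i<n. \<Phi> i (\<Sum>j\<in>I. h j) \<in> N)"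
      by blast
  qed
qed

text \<open>If the fibre over \<open>N\<close> were too thin, elements could be chosen greedily so
  that no nonempty subset sum enters it, against \<open>returns\<close>: after \<open>r\<close>
  choices the next one has to avoid at most \<open>2 ^ r\<close> translates of the fibre.\<close>

lemma fibre_density_0:
  assumes \<Phi>: "pdeg e A N \<Phi>" "\<And>x. x \<in> A \<Longrightarrow> \<Phi> x \<in> Y" "\<Phi> 0 \<in> N"
  shows "card A \<le> 2 ^ return_bound e 1 (card Y) * card {x \<in> A. \<Phi> x \<in> N}"
proof (rule ccontr)
  define m where "m = return_bound e 1 (card Y)"
  define G where "G = {x \<in> A. \<Phi> x \<in> N}"
  assume "\<not> ?thesis"
  then have lt: "2 ^ m * card G < card A" by (simp add: m_def G_def)
  have "r \<le> m \<Longrightarrow> \<exists>h. (\<forall>j::nat. h j \<in> A) \<and> (\<forall>I\<subseteq>{..<r}. I \<noteq> {} \<longrightarrow> sum h I \<notin> G)" for r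
  proof (induction r)
    case 0
    show ?case using fsub_0[OF A] by (intro exI[of _ "\<lambda>_. 0"]) auto
  next
    case (Suc r)
    then obtain h where h: "\<And>j::nat. h j \<in> A" "\<And>I. I \<subseteq> {..<r} \<Longrightarrow> I \<noteq> {} \<Longrightarrow> sum h I \<notin> G" by auto
    define B where "B = (\<Union>I\<in>Pow {..<r}. (\<lambda>x. x - sum h I) ` G)"
    have fG: "finite G" using fsub_finite[OF A] by (simp add: G_def)
    have "card B \<le> (\<Sum>I\<in>Pow {..<r}. card ((\<lambda>x. x - sum h I) ` G))"
      unfolding B_def by (rule card_UN_le) simp
    also have "\<dots> \<le> (\<Sum>I\<in>Pow {..<r}. card G)" by (intro sum_mono card_image_le fG)
    also have "\<dots> = 2 ^ r * card G" by (simp add: card_Pow)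
    also have "\<dots> \<le> 2 ^ m * card G" using Suc.prems by (intro mult_right_mono power_increasing) auto
    finally have "card B < card A" using lt by simp
    moreover have "finite B" using fG by (auto simp: B_def)
    ultimately obtain z where z: "z \<in> A" "z \<notin> B" by (meson card_mono not_less subsetI)
    define h' where "h' = h(r := z)"
    have "sum h' I \<notin> G" if I: "I \<subseteq> {..<Suc r}" "I \<noteq> {}" for I
    proof (cases "r \<in> I")
      case False
      then have "I \<subseteq> {..<r}" using I(1) by (auto simp: less_Suc_eq)
      moreover have "sum h' I = sum h I" using False by (intro sum.cong) (auto simp: h'_def)
      ultimately show ?thesis using h(2)[of I] I(2) by simp
    next
      case True
      have fI: "finite I" using I(1) finite_subset by blast
      have "I - {r} \<subseteq> {..<r}" using I(1) by (auto simp: less_Suc_eq)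
      moreover have "sum h' I = z + sum h (I - {r})"
        using True fI by (auto simp: sum.remove[of I r] h'_def intro!: sum.cong)
      moreover have "z + sum h (I - {r}) \<notin> G" if "I - {r} \<subseteq> {..<r}"
      proof
        assume "z + sum h (I - {r}) \<in> G"
        then have "(z + sum h (I - {r})) - sum h (I - {r}) \<in> B" unfolding B_def using that by blast
        then show False using z(2) by simp
      qed
      ultimately show ?thesis by simp
    qed
    moreover have "h' j \<in> A" for j using h(1) z(1) by (simp add: h'_def)
    ultimately show ?case by blast
  qed
  then obtain h where h: "\<And>j::nat. h j \<in> A" "\<And>I. I \<subseteq> {..<m} \<Longrightarrow> I \<noteq> {} \<Longrightarrow> sum h I \<notin> G" by blast
  have "\<exists>I\<subseteq>{0..<return_bound e 1 (card Y)}. I \<noteq> {} \<and> \<Phi> (sum h I) \<in> N"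
    using returns[of e, unfolded returns_def, THEN spec, of 1, THEN spec, of "\<lambda>_. \<Phi>", THEN spec, of h, THEN spec, of 0]
      \<Phi> h(1) by simp
  then obtain I where I: "I \<subseteq> {..<m}" "I \<noteq> {}" "\<Phi> (sum h I) \<in> N" by (auto simp: m_def lessThan_atLeast0)
  moreover have "sum h I \<in> A" using fsub_sum[OF A, of I h] h(1) by blast
  ultimately show False using h(2)[OF I(1,2)] by (simp add: G_def)
qed

lemma fibre_density:
  assumes \<Phi>: "pdeg e A N \<Phi>" "\<And>x. x \<in> A \<Longrightarrow> \<Phi> x \<in> Y" and x0: "x0 \<in> A" "\<Phi> x0 \<in> N"
  shows "card A \<le> 2 ^ return_bound e 1 (card Y) * card {x \<in> A. \<Phi> x \<in> N}"
proof -
  have "card A \<le> 2 ^ return_bound e 1 (card Y) * card {x \<in> A. \<Phi> (x0 + x) \<in> N}"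
    by (rule fibre_density_0) (use pdeg_affine[OF A A x0(1), of "\<lambda>x. x" e N \<Phi>] \<Phi> x0 fsub_add[OF A] in auto)
  moreover have "bij_betw (\<lambda>x. x0 + x) {x \<in> A. \<Phi> (x0 + x) \<in> N} {x \<in> A. \<Phi> x \<in> N}"
    by (rule bij_betw_byWitness[where f' = "\<lambda>x. x - x0"]) (use x0 fsub_add[OF A] fsub_diff[OF A] in auto)
  ultimately show ?thesis by (simp add: bij_betw_same_card)
qed

end

section \<open>Characters of finite abelian groups\<close>

definition character_on :: "('a, 'b) monoid_scheme \<Rightarrow> 'a set \<Rightarrow> ('a \<Rightarrow> complex) \<Rightarrow> bool" where
  "character_on G T \<theta> \<longleftrightarrow> (\<forall>a\<in>T. \<forall>b\<in>T. \<theta> (a \<otimes>\<^bsub>G\<^esub> b) = \<theta> a * \<theta> b) \<and> (\<forall>a\<in>T. norm (\<theta> a) = 1)"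

lemma (in group) subgroup_nat_pow: "subgroup T G \<Longrightarrow> a \<in> T \<Longrightarrow> a [^] (n::nat) \<in> T"
  by (induction n) (auto simp: subgroup.one_closed subgroup.m_closed)

lemma (in comm_group) character_on_pow:
  assumes "character_on G T \<theta>" "subgroup T G" "a \<in> T"
  shows "\<theta> (a [^] (n::nat)) = \<theta> a ^ n"
proof (induction n)
  case 0
  have "\<theta> (\<one> \<otimes> \<one>) = \<theta> \<one> * \<theta> \<one>" "norm (\<theta> \<one>) = 1"
    using assms(1) subgroup.one_closed[OF assms(2)] unfolding character_on_def by blast+
  then have "\<theta> \<one> = \<theta> \<one> * \<theta> \<one>" "\<theta> \<one> \<noteq> 0" by auto
  then show ?case by simp
next
  case (Suc n)
  have "a [^] n \<in> T" using assms(2,3) by (simp add: subgroup_nat_pow)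
  then show ?case using assms(1,3) Suc unfolding character_on_def by simp
qed

text \<open>The exponent \<open>m\<close> is the order of \<open>g\<close> modulo \<open>T\<close>,
  so the only obstruction to prescribing the value \<open>z\<close> at \<open>g\<close> is the
  relation given by \<open>g [^] m\<close>.\<close>

lemma (in comm_group) character_extend:
  assumes fin: "finite (carrier G)" and T: "subgroup T G" and \<theta>: "character_on G T \<theta>" and g: "g \<in> carrier G"
    and m: "0 < m" "g [^] m \<in> T" "\<And>j::nat. 0 < j \<Longrightarrow> g [^] j \<in> T \<Longrightarrow> m \<le> j"
    and z: "z ^ m = \<theta> (g [^] m)"
  obtains T' \<theta>' where "subgroup T' G" "T \<subseteq> T'" "g \<in> T'" "character_on G T' \<theta>'" "\<And>a. a \<in> T \<Longrightarrow> \<theta>' a = \<theta> a" "\<theta>' g = z"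
proof -
  note Tc = subgroup.mem_carrier[OF T]
  have nz: "norm z = 1"
  proof -
    have "norm z ^ m = 1" using \<theta> m(2) z unfolding character_on_def by (metis norm_power)
    then show ?thesis using m(1) power_eq_iff_eq_base[of m "norm z" 1] by simp
  qed
  \<comment> \<open>Two representations of one element differ by a power of \<open>g\<close> lying
    in \<open>T\<close>; minimality of \<open>m\<close> makes \<open>m\<close> divide its exponent,
    and on such powers \<theta> agrees with the powers of \<open>z\<close>.\<close>
  have wd: "\<theta> t * z ^ i = \<theta> t' * z ^ j"
    if t: "t \<in> T" "t' \<in> T" "t \<otimes> g [^] i = t' \<otimes> g [^] j" and ij: "i \<le> j" for t t' and i j :: nat
  proof -
    define k where "k = j - i"
    have "t \<otimes> g [^] i = (t' \<otimes> g [^] k) \<otimes> g [^] i"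
      using t Tc g ij by (simp add: k_def nat_pow_mult m_assoc)
    then have tk: "t = t' \<otimes> g [^] k" using t Tc g by (simp add: right_cancel)
    then have "inv t' \<otimes> t = g [^] k" using t Tc g by (simp add: inv_solve_left')
    then have gk: "g [^] k \<in> T" using t T by (metis subgroup.m_closed subgroup.m_inv_closed)
    define q where "q = k div m"
    have gq: "(g [^] m) [^] q \<in> T" using m(2) T by (simp add: subgroup_nat_pow)
    have "g [^] k = (g [^] m) [^] q \<otimes> g [^] (k mod m)"
      using g by (simp add: nat_pow_pow nat_pow_mult q_def)
    then have "inv ((g [^] m) [^] q) \<otimes> g [^] k = g [^] (k mod m)"
      using g by (simp add: inv_solve_left')
    then have "g [^] (k mod m) \<in> T" using gk gq T by (metis subgroup.m_closed subgroup.m_inv_closed)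
    then have "k mod m = 0" using m(1) m(3)[of "k mod m"] by (meson gr0I mod_less_divisor not_le)
    then have k: "k = m * q" unfolding q_def by auto
    have "\<theta> (g [^] k) = z ^ k"
      using character_on_pow[OF \<theta> T m(2), of q] g by (simp add: k nat_pow_pow z[symmetric] power_mult)
    then have "\<theta> t = \<theta> t' * z ^ k"
      using \<theta> t gk unfolding tk character_on_def by auto
    then show ?thesis using ij by (simp add: k_def mult.assoc power_add[symmetric])
  qed
  have wd': "\<theta> t * z ^ i = \<theta> t' * z ^ j"
    if "t \<in> T" "t' \<in> T" "t \<otimes> g [^] i = t' \<otimes> g [^] j" for t t' and i j :: nat
    using wd[of t t' i j] wd[of t' t j i] that by (cases "i \<le> j") auto
  define T' where "T' = {t \<otimes> g [^] (i::nat) | t i. t \<in> T}"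
  define \<theta>' where "\<theta>' a = (SOME w. \<exists>t i. t \<in> T \<and> a = t \<otimes> g [^] (i::nat) \<and> w = \<theta> t * z ^ i)" for a
  have \<theta>': "\<theta>' (t \<otimes> g [^] i) = \<theta> t * z ^ i" if t: "t \<in> T" for t and i :: nat
  proof -
    have "\<exists>t' j. t' \<in> T \<and> t \<otimes> g [^] i = t' \<otimes> g [^] (j::nat) \<and> \<theta>' (t \<otimes> g [^] i) = \<theta> t' * z ^ j"
      unfolding \<theta>'_def by (rule someI_ex) (use t in blast)
    then show ?thesis using wd'[OF t] by auto
  qed
  have mult: "(t \<otimes> g [^] i) \<otimes> (t' \<otimes> g [^] j) = (t \<otimes> t') \<otimes> g [^] (i + j)" if "t \<in> T" "t' \<in> T" for t t' and i j :: nat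
    using that Tc g by (simp add: nat_pow_mult[symmetric] m_ac)
  have T'sub: "subgroup T' G"
  proof (rule subgroupI)
    show "T' \<subseteq> carrier G" using Tc g by (auto simp: T'_def)
    show "T' \<noteq> {}" using subgroup.one_closed[OF T] by (auto simp: T'_def)
    show "inv a \<in> T'" if aT: "a \<in> T'" for a
    proof -
      obtain t and i :: nat where a: "t \<in> T" "a = t \<otimes> g [^] i" using aT by (auto simp: T'_def)
      \<comment> \<open>\<open>T'\<close> is built from natural exponents only, so the inverse of
        \<open>g [^] i\<close> is written as a nonnegative power with the help of the group
        order.\<close>
      define n where "n = order G * i - i"
      have "order G > 0" using fin by (simp add: order_gt_0_iff_finite)
      then have "i + n = order G * i" by (simp add: n_def)
      then have "g [^] i \<otimes> g [^] n = (g [^] order G) [^] i" using g by (simp add: nat_pow_mult nat_pow_pow)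
      also have "\<dots> = \<one>" using pow_order_eq_1[OF g] by simp
      finally have "a \<otimes> (inv t \<otimes> g [^] n) = \<one>"
        using a Tc g by (simp add: m_ac)
      then have "inv a = inv t \<otimes> g [^] n" using a Tc g by (intro inv_unique'[symmetric]) (auto simp: m_comm)
      then show ?thesis using subgroup.m_inv_closed[OF T a(1)] by (auto simp: T'_def)
    qed
    show "a \<otimes> b \<in> T'" if ab: "a \<in> T'" "b \<in> T'" for a b
    proof -
      obtain t i t' j where "t \<in> T" "a = t \<otimes> g [^] (i::nat)" "t' \<in> T" "b = t' \<otimes> g [^] (j::nat)"
        using ab by (auto simp: T'_def)
      then show ?thesis using mult[of t t' i j] subgroup.m_closed[OF T] by (auto simp: T'_def)
    qed
  qed
  have "character_on G T' \<theta>'"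
    unfolding character_on_def
  proof (intro conjI ballI)
    fix a b assume ab: "a \<in> T'" "b \<in> T'"
    obtain t i t' j where "t \<in> T" "a = t \<otimes> g [^] (i::nat)" "t' \<in> T" "b = t' \<otimes> g [^] (j::nat)"
      using ab by (auto simp: T'_def)
    then show "\<theta>' (a \<otimes> b) = \<theta>' a * \<theta>' b"
      using \<theta> subgroup.m_closed[OF T] by (simp add: mult \<theta>' power_add character_on_def)
  next
    fix a assume "a \<in> T'"
    then obtain t i where "t \<in> T" "a = t \<otimes> g [^] (i::nat)" by (auto simp: T'_def)
    then show "norm (\<theta>' a) = 1" using \<theta> nz by (simp add: \<theta>' norm_mult norm_power character_on_def)
  qed
  moreover have "\<theta>' a = \<theta> a" if "a \<in> T" for a using \<theta>'[OF that, of 0] Tc[OF that] by simp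
  moreover have "a \<in> T'" if "a \<in> T" for a
    unfolding T'_def using that Tc[OF that] by (auto intro!: exI[of _ a] exI[of _ "0::nat"])
  moreover have one: "\<theta> \<one> = 1"
    using character_on_pow[OF \<theta> T subgroup.one_closed[OF T], of 0] by simp
  moreover have "\<theta>' g = z" using \<theta>'[OF subgroup.one_closed[OF T], of 1] g one by simp
  moreover have "g \<in> T'" unfolding T'_def using subgroup.one_closed[OF T] g by (auto intro!: exI[of _ \<one>] exI[of _ "1::nat"])
  ultimately show ?thesis using that[of T' \<theta>'] T'sub by blast
qed

lemma (in comm_group) character_extend_exists:
  assumes fin: "finite (carrier G)" and T: "subgroup T G" and g: "g \<in> carrier G"
  obtains m :: nat where "0 < m" "g [^] m \<in> T" "\<And>j::nat. 0 < j \<Longrightarrow> g [^] j \<in> T \<Longrightarrow> m \<le> j"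
proof -
  have "0 < order G \<and> g [^] order G \<in> T"
    using fin pow_order_eq_1[OF g] subgroup.one_closed[OF T] by (simp add: order_gt_0_iff_finite)
  then have "0 < (LEAST m::nat. 0 < m \<and> g [^] m \<in> T) \<and> g [^] (LEAST m::nat. 0 < m \<and> g [^] m \<in> T) \<in> T"
    by (rule LeastI[of "\<lambda>m::nat. 0 < m \<and> g [^] m \<in> T"])
  then show ?thesis
    using that[of "LEAST m::nat. 0 < m \<and> g [^] m \<in> T"] Least_le[of "\<lambda>m::nat. 0 < m \<and> g [^] m \<in> T"] by blast
qed

lemma complex_root_exists:
  assumes "0 < m"
  shows "\<exists>z::complex. z ^ m = w"
proof (cases "w = 0")
  case True
  then show ?thesis using assms by (intro exI[of _ 0]) auto
next
  case False
  have "(of_real (root m (norm w)) * cis (Arg w / m)) ^ m = of_real (root m (norm w) ^ m) * cis (Arg w)"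
    using assms by (simp add: power_mult_distrib DeMoivre del: of_real_power flip: of_real_power)
  also have "\<dots> = w" using assms False by (simp add: rcis_cmod_Arg[unfolded rcis_def])
  finally show ?thesis by blast
qed

text \<open>The first extension decides everything: it starts from the trivial character of
  \<open>S\<close> and takes at \<open>x\<close> a primitive \<open>m\<close>-th root of unity,
  different from 1 because \<open>m \<ge> 2\<close> when \<open>x\<close> is outside
  \<open>S\<close>. Further extensions, one element at a time, keep this value.\<close>

theorem (in comm_group) character_separation:
  assumes fin: "finite (carrier G)" and S: "subgroup S G" and x: "x \<in> carrier G" "x \<notin> S"
  obtains \<theta> where "character_on G (carrier G) \<theta>" "\<And>s. s \<in> S \<Longrightarrow> \<theta> s = 1" "\<theta> x \<noteq> 1"
proof -
  obtain m :: nat where m: "0 < m" "x [^] m \<in> S" "\<And>j::nat. 0 < j \<Longrightarrow> x [^] j \<in> S \<Longrightarrow> m \<le> j"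
    using character_extend_exists[OF fin S x(1)] by blast
  have m2: "m \<ge> 2"
  proof (rule ccontr)
    assume "\<not> m \<ge> 2"
    then have "m = 1" using m(1) by simp
    then show False using m(2) x by simp
  qed
  define z where "z = cis (2 * pi / m)"
  have zm: "z ^ m = 1" using m(1) by (simp add: z_def DeMoivre)
  have z1: "z \<noteq> 1"
  proof
    assume "z = 1"
    then have "cos (2 * pi / m) = 1" by (simp add: z_def cis.ctr complex_eq_iff)
    then obtain n :: int where "2 * pi / m = n * 2 * pi" by (auto simp: cos_one_2pi_int)
    then have "real_of_int n * real m = 1" using m(1) by (simp add: field_simps)
    then have "n * int m = 1" by (metis of_int_1 of_int_eq_iff of_int_mult of_int_of_nat_eq)
    then have "int m = 1 \<or> int m = - 1" by (metis zmult_eq_1_iff)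
    then show False using m2 by simp
  qed
  have "character_on G S (\<lambda>_. 1)" by (simp add: character_on_def)
  from character_extend[OF fin S this x(1) m zm]
  obtain T0 \<theta>0 where T0: "subgroup T0 G" "S \<subseteq> T0" "x \<in> T0" "character_on G T0 \<theta>0" "\<And>a. a \<in> S \<Longrightarrow> \<theta>0 a = 1" "\<theta>0 x = z"
    by metis
  have "\<exists>T \<theta>. subgroup T G \<and> F \<subseteq> T \<and> T0 \<subseteq> T \<and> character_on G T \<theta> \<and> (\<forall>a\<in>T0. \<theta> a = \<theta>0 a)"
    if "F \<subseteq> carrier G" for F
    using finite_subset[OF that fin] that
  proof (induction F rule: finite_induct)
    case empty
    then show ?case using T0 by auto
  next
    case (insert g F)
    then obtain T \<theta> where T: "subgroup T G" "F \<subseteq> T" "T0 \<subseteq> T" "character_on G T \<theta>" "\<forall>a\<in>T0. \<theta> a = \<theta>0 a" by auto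
    have g: "g \<in> carrier G" using insert by auto
    obtain m :: nat where m: "0 < m" "g [^] m \<in> T" "\<And>j::nat. 0 < j \<Longrightarrow> g [^] j \<in> T \<Longrightarrow> m \<le> j"
      using character_extend_exists[OF fin T(1) g] by blast
    obtain w where w: "w ^ m = \<theta> (g [^] m)" using complex_root_exists[OF m(1)] by blast
    obtain T' \<theta>' where T': "subgroup T' G" "T \<subseteq> T'" "g \<in> T'" "character_on G T' \<theta>'" "\<And>a. a \<in> T \<Longrightarrow> \<theta>' a = \<theta> a"
      using character_extend[OF fin T(1,4) g m w] by metis
    have "insert g F \<subseteq> T'" "T0 \<subseteq> T'" using T T' by auto
    moreover have "\<forall>a\<in>T0. \<theta>' a = \<theta>0 a" using T T' by auto
    ultimately show ?case using T' by blast
  qed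
  from this[of "carrier G"] obtain T \<theta> where T: "subgroup T G" "carrier G \<subseteq> T" "T0 \<subseteq> T" "character_on G T \<theta>" "\<forall>a\<in>T0. \<theta> a = \<theta>0 a"
    by auto
  have "T = carrier G" using T(2) subgroup.subset[OF T(1)] by auto
  have "\<theta> s = 1" if "s \<in> S" for s using that T(5) T0(2,5) by auto
  moreover have "\<theta> x \<noteq> 1" using T(5) T0(3,6) z1 by simp
  ultimately show ?thesis using that[of \<theta>] T(4) \<open>T = carrier G\<close> by simp
qed

text \<open>
  The circle group is written additively in order to be of class \<^class>\<open>ab_group_add\<close>. Evaluation at
  homomorphisms into it turns the carrier-based finite abelian groups into subgroups of a type of this class.
\<close>

typedef circle = "{z::complex. norm z = 1}" morphisms circle_val Circle
  by (rule exI[of _ 1]) simp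

instantiation circle :: ab_group_add
begin
definition "0 = Circle 1"
definition "x + y = Circle (circle_val x * circle_val y)"
definition "- x = Circle (inverse (circle_val x))"
definition "x - y = Circle (circle_val x * inverse (circle_val y))" for x y :: circle
instance
proof
  note [simp] = zero_circle_def plus_circle_def uminus_circle_def minus_circle_def Circle_inverse circle_val_inverse
  have n: "norm (circle_val x) = 1" for x using circle_val[of x] by simp
  fix a b c :: circle
  show "a + b + c = a + (b + c)" by (simp add: n norm_mult mult.assoc)
  show "a + b = b + a" by (simp add: mult.commute)
  show "0 + a = a" by (simp add: n)
  show "- a + a = 0"
  proof -
    have "circle_val a \<noteq> 0" using n[of a] by auto
    then show ?thesis by (simp add: n norm_inverse)
  qed
  show "a - b = a + - b" by (simp add: n norm_inverse)
qed
end

lemma Circle_mult: "norm a = 1 \<Longrightarrow> norm b = 1 \<Longrightarrow> Circle (a * b) = Circle a + Circle b"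
  by (simp add: plus_circle_def Circle_inverse)

text \<open>The value at a map that is not a homomorphism is set to 0; thereby evaluation is
  additive at every argument \<theta>, homomorphism or not.\<close>

definition embed_group :: "('a, 'b) monoid_scheme \<Rightarrow> 'a \<Rightarrow> ('a \<Rightarrow> circle) \<Rightarrow> circle" where
  "embed_group G x = (\<lambda>\<theta>. if \<forall>a\<in>carrier G. \<forall>b\<in>carrier G. \<theta> (a \<otimes>\<^bsub>G\<^esub> b) = \<theta> a + \<theta> b then \<theta> x else 0)"

lemma embed_group_mult:
  "a \<in> carrier G \<Longrightarrow> b \<in> carrier G \<Longrightarrow> embed_group G (a \<otimes>\<^bsub>G\<^esub> b) = embed_group G a + embed_group G b"
  by (auto simp: embed_group_def fun_eq_iff)

lemma (in comm_group) embed_group_inj: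
  assumes "finite (carrier G)"
  shows "inj_on (embed_group G) (carrier G)"
proof (rule inj_onI, rule ccontr)
  fix a b assume ab: "a \<in> carrier G" "b \<in> carrier G" "embed_group G a = embed_group G b" "a \<noteq> b"
  have "a \<otimes> inv b \<notin> {\<one>}" using ab by (metis inv_closed inv_equality inv_inv singletonD)
  then obtain \<theta> where \<theta>: "character_on G (carrier G) \<theta>" "\<theta> (a \<otimes> inv b) \<noteq> 1"
    using character_separation[OF assms triv_subgroup, of "a \<otimes> inv b"] ab by auto
  define \<theta>' where "\<theta>' x = Circle (\<theta> x)" for x
  have "\<theta>' (x \<otimes> y) = \<theta>' x + \<theta>' y" if "x \<in> carrier G" "y \<in> carrier G" for x y
    using \<theta>(1) that by (simp add: \<theta>'_def character_on_def Circle_mult)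
  then have "\<theta>' a = \<theta>' b" using fun_cong[OF ab(3), of \<theta>'] by (auto simp: embed_group_def)
  then have "\<theta> a = \<theta> b" using \<theta>(1) ab by (simp add: \<theta>'_def character_on_def Circle_inject)
  moreover have "\<theta> (c \<otimes> inv b) = \<theta> c * \<theta> (inv b)" if "c \<in> carrier G" for c
    using \<theta>(1) ab that unfolding character_on_def by blast
  ultimately have "\<theta> (a \<otimes> inv b) = \<theta> (b \<otimes> inv b)" using ab by metis
  also have "\<dots> = 1" using character_on_pow[OF \<theta>(1) subgroup_self one_closed, of 0] ab by simp
  finally show False using \<theta>(2) by simp
qed

text \<open>The dual group of \<open>Q / N\<close>. Values outside \<open>Q\<close> are fixed to 0
  so that equality of functions is equality of characters and the set is finite.\<close>

definition chars :: "'p::ab_group_add set \<Rightarrow> 'p set \<Rightarrow> ('p \<Rightarrow> complex) set" where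
  "chars Q N = {\<theta>. (\<forall>a\<in>Q. \<forall>b\<in>Q. \<theta> (a + b) = \<theta> a * \<theta> b) \<and> (\<forall>a\<in>Q. norm (\<theta> a) = 1) \<and>
     (\<forall>a\<in>N. \<theta> a = 1) \<and> (\<forall>a. a \<notin> Q \<longrightarrow> \<theta> a = 0)}"

lemma charsD:
  assumes "\<theta> \<in> chars Q N"
  shows "a \<in> Q \<Longrightarrow> b \<in> Q \<Longrightarrow> \<theta> (a + b) = \<theta> a * \<theta> b" "a \<in> Q \<Longrightarrow> norm (\<theta> a) = 1" "a \<in> N \<Longrightarrow> \<theta> a = 1"
  using assms by (auto simp: chars_def)

lemma chars_0: "\<theta> \<in> chars Q N \<Longrightarrow> fsub Q \<Longrightarrow> \<theta> 0 = 1"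
proof -
  assume "\<theta> \<in> chars Q N" "fsub Q"
  then have "\<theta> 0 = \<theta> 0 * \<theta> 0" "norm (\<theta> 0) = 1" using charsD[of \<theta> Q N] fsub_0[of Q] by (metis add_0)+
  then show ?thesis by (metis mult_cancel_right1 norm_zero zero_neq_one)
qed

lemma chars_diff: "\<theta> \<in> chars Q N \<Longrightarrow> fsub Q \<Longrightarrow> a \<in> Q \<Longrightarrow> b \<in> Q \<Longrightarrow> \<theta> (a - b) = \<theta> a * cnj (\<theta> b)"
proof -
  assume \<theta>: "\<theta> \<in> chars Q N" and Q: "fsub Q" "a \<in> Q" "b \<in> Q"
  have "\<theta> (a - b) * \<theta> b = \<theta> a" using charsD(1)[OF \<theta>, of "a - b" b] Q fsub_diff by (metis diff_add_cancel)
  moreover have "\<theta> b * cnj (\<theta> b) = 1" using charsD(2)[OF \<theta> Q(3)] complex_norm_square[of "\<theta> b"] by simp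
  ultimately show ?thesis by (metis mult.assoc mult.right_neutral)
qed

lemma chars_mono: "N \<subseteq> N' \<Longrightarrow> chars Q N' \<subseteq> chars Q N"
  by (auto simp: chars_def)

text \<open>Comparing the product of \<theta> over \<open>Q\<close> with that of its translate by
  \<open>a\<close> gives \<open>\<theta> a ^ card Q = 1\<close>, so only finitely many values are
  possible.\<close>

lemma finite_chars:
  assumes Q: "fsub Q"
  shows "finite (chars Q N)"
proof -
  define n where "n = card Q"
  define W where "W = insert 0 {z::complex. z ^ n = 1}"
  have n: "n > 0" using fsub_card_pos[OF Q] by (simp add: n_def)
  have "finite W" unfolding W_def using finite_roots_unity[of n] n by simp
  have val: "\<theta> a ^ n = 1" if \<theta>: "\<theta> \<in> chars Q N" and a: "a \<in> Q" for \<theta> a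
  proof -
    have "(\<Prod>x\<in>Q. \<theta> x) = (\<Prod>x\<in>Q. \<theta> (x + a))"
    proof -
      have "bij_betw (\<lambda>x. x + a) Q Q"
        by (rule bij_betw_byWitness[where f' = "\<lambda>x. x - a"]) (use Q a fsub_add fsub_diff in auto)
      then show ?thesis by (rule prod.reindex_bij_betw[symmetric])
    qed
    also have "\<dots> = (\<Prod>x\<in>Q. \<theta> x) * \<theta> a ^ n"
      using charsD(1)[OF \<theta> _ a] by (simp add: prod.distrib n_def)
    finally have "(\<Prod>x\<in>Q. \<theta> x) * \<theta> a ^ n = (\<Prod>x\<in>Q. \<theta> x) * 1" by simp
    moreover have "(\<Prod>x\<in>Q. \<theta> x) \<noteq> 0" using charsD(2)[OF \<theta>] fsub_finite[OF Q] by (force simp: prod_zero_iff)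
    ultimately show ?thesis by (metis mult_cancel_left)
  qed
  have "inj_on (\<lambda>\<theta>. restrict \<theta> Q) (chars Q N)"
    by (rule inj_onI) (auto simp: chars_def fun_eq_iff restrict_def, metis)
  moreover have "(\<lambda>\<theta>. restrict \<theta> Q) ` chars Q N \<subseteq> Q \<rightarrow>\<^sub>E W" using val by (auto simp: W_def)
  ultimately show ?thesis
    using finite_PiE[of Q "\<lambda>_. W"] fsub_finite[OF Q] \<open>finite W\<close> by (meson finite_imageD finite_subset)
qed

lemma chars_separation:
  fixes Q :: "'p::ab_group_add set"
  assumes Q: "fsub Q" and N: "fsub N" "N \<subseteq> Q" and x: "x \<in> Q" "x \<notin> N"
  shows "\<exists>\<theta>\<in>chars Q N. \<theta> x \<noteq> 1"
proof -
  define G :: "'p monoid" where "G = \<lparr>carrier = Q, mult = (+), one = 0\<rparr>"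
  have G: "comm_group G"
  proof (rule comm_groupI)
    show "\<exists>y\<in>carrier G. y \<otimes>\<^bsub>G\<^esub> x = \<one>\<^bsub>G\<^esub>" if "x \<in> carrier G" for x
      using that fsub_neg[OF Q] by (auto simp: G_def intro!: bexI[of _ "- x"])
  qed (auto simp: G_def fsub_add[OF Q] fsub_0[OF Q] algebra_simps)
  then interpret G: comm_group G .
  have inv: "inv\<^bsub>G\<^esub> a = - a" if "a \<in> Q" for a
    by (rule G.inv_equality) (use that fsub_neg[OF Q] in \<open>auto simp: G_def\<close>)
  have "subgroup N G"
  proof (rule G.subgroupI)
    show "inv\<^bsub>G\<^esub> a \<in> N" if "a \<in> N" for a
    proof -
      have "inv\<^bsub>G\<^esub> a = - a" using inv that N(2) by blast
      then show ?thesis using fsub_neg[OF N(1) that] by simp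
    qed
  qed (use N fsub_nonempty fsub_add in \<open>auto simp: G_def\<close>)
  then obtain \<theta> where \<theta>: "character_on G (carrier G) \<theta>" "\<And>s. s \<in> N \<Longrightarrow> \<theta> s = 1" "\<theta> x \<noteq> 1"
    using G.character_separation[of N x] x fsub_finite[OF Q] by (auto simp: G_def)
  define \<theta>' where "\<theta>' a = (if a \<in> Q then \<theta> a else 0)" for a
  have "\<theta>' \<in> chars Q N"
    using \<theta>(1,2) N(2) fsub_add[OF Q] by (auto simp: chars_def \<theta>'_def character_on_def G_def)
  moreover have "\<theta>' x \<noteq> 1" using \<theta>(3) x by (simp add: \<theta>'_def)
  ultimately show ?thesis by blast
qed

lemma chars_mult:
  assumes "\<theta> \<in> chars Q N" "\<eta> \<in> chars Q N"
  shows "(\<lambda>x. \<theta> x * \<eta> x) \<in> chars Q N"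
  using assms by (auto simp: chars_def norm_mult)

lemma chars_cnj:
  assumes "\<theta> \<in> chars Q N"
  shows "(\<lambda>x. cnj (\<theta> x)) \<in> chars Q N"
  using assms by (auto simp: chars_def)

text \<open>Multiplication by a character \<eta> with \<open>\<eta> x \<noteq> 1\<close> permutes
  \<open>chars Q N\<close>, so the sum is fixed by a factor different from 1.\<close>

lemma chars_sum:
  assumes Q: "fsub Q" and N: "fsub N" "N \<subseteq> Q" and x: "x \<in> Q"
  shows "(\<Sum>\<theta>\<in>chars Q N. \<theta> x) = (if x \<in> N then of_nat (card (chars Q N)) else 0)"
proof (cases "x \<in> N")
  case True
  then have "(\<Sum>\<theta>\<in>chars Q N. \<theta> x) = (\<Sum>\<theta>\<in>chars Q N. 1)" by (intro sum.cong) (auto simp: charsD(3))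
  then show ?thesis using True by simp
next
  case False
  then obtain \<eta> where \<eta>: "\<eta> \<in> chars Q N" "\<eta> x \<noteq> 1" using chars_separation[OF Q N x] by blast
  have n1: "\<eta> y * cnj (\<eta> y) = 1" if "y \<in> Q" for y
    using charsD(2)[OF \<eta>(1) that] complex_norm_square[of "\<eta> y"] by simp
  have out: "\<theta> y = 0" if "\<theta> \<in> chars Q N" "y \<notin> Q" for \<theta> y using that by (auto simp: chars_def)
  have "bij_betw (\<lambda>\<theta> y. \<eta> y * \<theta> y) (chars Q N) (chars Q N)"
  proof (rule bij_betw_byWitness[where f' = "\<lambda>\<theta> y. cnj (\<eta> y) * \<theta> y"])
    show "\<forall>\<theta>\<in>chars Q N. (\<lambda>y. cnj (\<eta> y) * (\<eta> y * \<theta> y)) = \<theta>"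
    proof (intro ballI ext)
      fix \<theta> y assume "\<theta> \<in> chars Q N"
      then show "cnj (\<eta> y) * (\<eta> y * \<theta> y) = \<theta> y"
        using n1[of y] out[of \<theta> y] by (cases "y \<in> Q") (auto simp: mult.assoc[symmetric] mult.commute[of "cnj (\<eta> y)"])
    qed
    show "\<forall>\<theta>\<in>chars Q N. (\<lambda>y. \<eta> y * (cnj (\<eta> y) * \<theta> y)) = \<theta>"
    proof (intro ballI ext)
      fix \<theta> y assume "\<theta> \<in> chars Q N"
      then show "\<eta> y * (cnj (\<eta> y) * \<theta> y) = \<theta> y"
        using n1[of y] out[of \<theta> y] by (cases "y \<in> Q") (auto simp: mult.assoc[symmetric])
    qed
  qed (use chars_mult[OF \<eta>(1)] chars_mult[OF chars_cnj[OF \<eta>(1)]] in auto)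
  then have "(\<Sum>\<theta>\<in>chars Q N. (\<lambda>y. \<eta> y * \<theta> y) x) = (\<Sum>\<theta>\<in>chars Q N. \<theta> x)"
    by (rule sum.reindex_bij_betw[where g = "\<lambda>\<theta>. \<theta> x"])
  then have "\<eta> x * (\<Sum>\<theta>\<in>chars Q N. \<theta> x) = (\<Sum>\<theta>\<in>chars Q N. \<theta> x)" by (simp only: sum_distrib_left)
  then have "(\<eta> x - 1) * (\<Sum>\<theta>\<in>chars Q N. \<theta> x) = 0" by (simp add: left_diff_distrib)
  then show ?thesis using \<eta>(2) False by simp
qed

lemma chars_nonempty: "fsub Q \<Longrightarrow> N \<subseteq> Q \<Longrightarrow> card (chars Q N) > 0"
proof -
  assume "fsub Q" "N \<subseteq> Q"
  then have "(\<lambda>a. if a \<in> Q then 1 else 0) \<in> chars Q N" by (auto simp: chars_def fsub_add)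
  then show ?thesis using finite_chars[OF \<open>fsub Q\<close>, of N] by (auto simp: card_gt_0_iff)
qed

section \<open>Bias and pigeonhole\<close>

declare return_bound.simps(2) [simp del]

lemma mdeg_cong:
  assumes "fsub A"
  shows "(\<And>x. x \<in> A \<Longrightarrow> f x = g x) \<Longrightarrow> mdeg e A f \<longleftrightarrow> mdeg e A g"
proof (induction e arbitrary: f g)
  case (Suc e)
  have "mdeg e A (dlt h f) \<longleftrightarrow> mdeg e A (dlt h g)" if "h \<in> A" for h
    by (rule Suc.IH) (use that Suc.prems fsub_add[OF assms] in \<open>auto simp: dlt_def\<close>)
  then show ?case by auto
qed auto

lemma pdeg_mdeg:
  assumes A: "fsub A" and Q: "fsub Q" and \<theta>: "\<theta> \<in> chars Q N"
  shows "pdeg e A N \<Phi> \<Longrightarrow> (\<And>x. x \<in> A \<Longrightarrow> \<Phi> x \<in> Q) \<Longrightarrow> mdeg e A (\<lambda>x. \<theta> (\<Phi> x))"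
proof (induction e arbitrary: \<Phi>)
  case 0
  then show ?case using charsD(3)[OF \<theta>] by auto
next
  case (Suc e)
  have "mdeg e A (dlt h (\<lambda>x. \<theta> (\<Phi> x)))" if h: "h \<in> A" for h
  proof -
    have "mdeg e A (\<lambda>x. \<theta> (\<Phi> (x + h) - \<Phi> x))"
      using Suc.prems h fsub_add[OF A] fsub_diff[OF Q] by (intro Suc.IH) auto
    moreover have "\<theta> (\<Phi> (x + h) - \<Phi> x) = dlt h (\<lambda>x. \<theta> (\<Phi> x)) x" if "x \<in> A" for x
      unfolding dlt_def using that h Suc.prems(2) fsub_add[OF A] by (simp add: chars_diff[OF \<theta> Q])
    ultimately show ?thesis using mdeg_cong[OF A, of "\<lambda>x. \<theta> (\<Phi> (x + h) - \<Phi> x)" "dlt h (\<lambda>x. \<theta> (\<Phi> x))" e] by blast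
  qed
  then show ?case by simp
qed

lemma avg_sum: "avg A (\<lambda>x. \<Sum>k\<in>K. f k x) = (\<Sum>k\<in>K. avg A (f k))"
  unfolding avg_def by (subst sum.swap) (simp add: scaleR_sum_right)

text \<open>Summing \<open>a \<theta>\<close> counts hits: over \<open>chars Q N\<close> the sum is
  0 since \<open>g\<close> is missed modulo \<open>N\<close>; over \<open>chars Q M\<close> it is at
  least \<open>1 / c\<close>, since \<Phi> hits \<open>g\<close> modulo \<open>M\<close> and, by
  \<open>fibre_density\<close>, does so often. Some character in the difference must
  compensate.\<close>

lemma biased_character:
  assumes A: "fsub A" and Q: "fsub Q" and N: "fsub N" "N \<subseteq> M" and M: "fsub M" "M \<subseteq> Q"
    and \<Phi>: "\<And>x. x \<in> A \<Longrightarrow> \<Phi> x \<in> Q" "pdeg (Suc e) A M \<Phi>"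
    and g: "g \<in> Q" and x0: "x0 \<in> A" "\<Phi> x0 - g \<in> M" and miss: "\<And>x. x \<in> A \<Longrightarrow> \<Phi> x - g \<notin> N"
  shows "\<exists>\<theta>\<in>chars Q N. (\<exists>r\<in>M. \<theta> r \<noteq> 1) \<and>
    norm (avg A (\<lambda>x. \<theta> (\<Phi> x))) \<ge> 1 / (2 ^ return_bound (Suc e) 1 (card Q) * real (card (chars Q N)))"
proof (rule ccontr)
  define c where "c = (2::real) ^ return_bound (Suc e) 1 (card Q)"
  define n where "n = real (card (chars Q N))"
  define a where "a \<theta> = avg A (\<lambda>x. \<theta> (\<Phi> x - g))" for \<theta> :: "'b \<Rightarrow> complex"
  have c: "c > 0" and n: "n > 0" using chars_nonempty[OF Q, of N] N M by (auto simp: c_def n_def)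
  have NQ: "N \<subseteq> Q" using N M by auto
  have sub: "chars Q M \<subseteq> chars Q N" by (rule chars_mono[OF N(2)])
  have fin: "finite (chars Q N)" by (rule finite_chars[OF Q])
  assume "\<not> ?thesis"
  then have small': "norm (avg A (\<lambda>x. \<theta> (\<Phi> x))) < 1 / (c * n)" if "\<theta> \<in> chars Q N" "\<exists>r\<in>M. \<theta> r \<noteq> 1" for \<theta>
    using that unfolding c_def[symmetric] n_def[symmetric] by (meson not_le)
  have small: "norm (avg A (\<lambda>x. \<theta> (\<Phi> x))) < 1 / (c * n)" if "\<theta> \<in> chars Q N - chars Q M" for \<theta>
  proof (rule small')
    show "\<exists>r\<in>M. \<theta> r \<noteq> 1" using that unfolding chars_def by blast
  qed (use that in blast)
  have na: "norm (a \<theta>) = norm (avg A (\<lambda>x. \<theta> (\<Phi> x)))" if "\<theta> \<in> chars Q N" for \<theta>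
  proof -
    have "a \<theta> = avg A (\<lambda>x. \<theta> (\<Phi> x) * cnj (\<theta> g))"
      unfolding a_def by (rule avg_cong) (simp add: chars_diff[OF that Q] \<Phi> g)
    then show ?thesis using charsD(2)[OF that g] by (simp add: avg_mult_right norm_mult)
  qed
  have xg: "\<Phi> x - g \<in> Q" if "x \<in> A" for x using that \<Phi>(1) g fsub_diff[OF Q] by auto
  have "(\<Sum>\<theta>\<in>chars Q N. a \<theta>) = avg A (\<lambda>x. \<Sum>\<theta>\<in>chars Q N. \<theta> (\<Phi> x - g))" by (simp add: a_def avg_sum)
  also have "\<dots> = avg A (\<lambda>x. 0)" by (rule avg_cong) (simp add: chars_sum[OF Q N(1) NQ] xg miss)
  finally have 0: "(\<Sum>\<theta>\<in>chars Q N. a \<theta>) = 0" by (simp add: avg_def)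
  define G where "G = {x \<in> A. \<Phi> x - g \<in> M}"
  have "(\<Sum>\<theta>\<in>chars Q M. a \<theta>) = avg A (\<lambda>x. \<Sum>\<theta>\<in>chars Q M. \<theta> (\<Phi> x - g))" by (simp add: a_def avg_sum)
  also have "\<dots> = avg A (\<lambda>x. if x \<in> G then of_nat (card (chars Q M)) else 0)"
    by (rule avg_cong) (simp add: chars_sum[OF Q M] xg G_def)
  also have "\<dots> = of_real (real (card (chars Q M)) * real (card G) / real (card A))"
  proof -
    have "A \<inter> G = G" by (auto simp: G_def)
    then show ?thesis using fsub_finite[OF A]
      by (simp add: avg_def sum.If_cases scaleR_conv_of_real divide_inverse mult_ac)
  qed
  finally have 1: "norm (\<Sum>\<theta>\<in>chars Q M. a \<theta>) = real (card (chars Q M)) * real (card G) / real (card A)"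
    by (simp only: norm_of_real) simp
  have dens: "real (card A) \<le> c * real (card G)"
  proof -
    have "pdeg (Suc e) A M (\<lambda>x. \<Phi> x - g)" using \<Phi>(2) by simp
    from fibre_density[OF A Q M(1) this xg x0] have "card A \<le> 2 ^ return_bound (Suc e) 1 (card Q) * card G"
      by (simp add: G_def)
    then have "real (card A) \<le> real (2 ^ return_bound (Suc e) 1 (card Q) * card G)" by (rule of_nat_mono)
    then show ?thesis by (simp add: c_def)
  qed
  have cM: "real (card (chars Q M)) \<ge> 1" using chars_nonempty[OF Q M(2)] by simp
  have cA: "real (card A) > 0" using fsub_card_pos[OF A] by simp
  have "1 / c \<le> real (card G) / real (card A)" using dens c cA by (simp add: field_simps)
  also have "\<dots> \<le> real (card (chars Q M)) * (real (card G) / real (card A))"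
    using mult_right_mono[OF cM, of "real (card G) / real (card A)"] by simp
  also have "\<dots> = norm (\<Sum>\<theta>\<in>chars Q M. a \<theta>)" using 1 by simp
  also have "(\<Sum>\<theta>\<in>chars Q M. a \<theta>) = - (\<Sum>\<theta>\<in>chars Q N - chars Q M. a \<theta>)"
    using 0 sum.subset_diff[OF sub fin, of a] by (simp add: eq_neg_iff_add_eq_0 add.commute)
  also have "norm \<dots> \<le> (\<Sum>\<theta>\<in>chars Q N - chars Q M. norm (a \<theta>))" by (simp add: norm_sum)
  also have "\<dots> \<le> (\<Sum>\<theta>\<in>chars Q N - chars Q M. 1 / (c * n))"
    using small na by (intro sum_mono) (auto intro: less_imp_le)
  \<comment> \<open>\<open>chars Q M\<close> is nonempty, so at most \<open>n - 1\<close> characters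
    remain; this one missing term makes the final inequality strict.\<close>
  also have "\<dots> \<le> (n - 1) * (1 / (c * n))"
  proof -
    have "card (chars Q N - chars Q M) = card (chars Q N) - card (chars Q M)"
      using sub fin by (simp add: card_Diff_subset finite_subset)
    then have "real (card (chars Q N - chars Q M)) \<le> n - 1"
      using chars_nonempty[OF Q M(2)] card_mono[OF fin sub] by (simp add: n_def)
    then show ?thesis using c n by (simp add: divide_right_mono)
  qed
  also have "\<dots> < 1 / c" using c n by (simp add: field_simps)
  finally show False by simp
qed

lemma cluster_real:
  fixes x :: "nat \<Rightarrow> real"
  assumes "infinite J" "\<And>j. j \<in> J \<Longrightarrow> \<bar>x j\<bar> \<le> B" "\<delta> > 0"
  shows "\<exists>J'\<subseteq>J. infinite J' \<and> (\<forall>i\<in>J'. \<forall>j\<in>J'. \<bar>x i - x j\<bar> \<le> \<delta>)"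
proof -
  define c where "c j = \<lfloor>x j / \<delta>\<rfloor>" for j
  have "c ` J \<subseteq> {\<lfloor>- B / \<delta>\<rfloor>..\<lfloor>B / \<delta>\<rfloor>}"
  proof
    fix t assume "t \<in> c ` J"
    then obtain j where j: "j \<in> J" "t = c j" by auto
    have "- B \<le> x j" "x j \<le> B" using assms(2)[OF j(1)] by auto
    then show "t \<in> {\<lfloor>- B / \<delta>\<rfloor>..\<lfloor>B / \<delta>\<rfloor>}"
      using divide_right_mono[of "- B" "x j" \<delta>] divide_right_mono[of "x j" B \<delta>] assms(3)
      unfolding j(2) c_def atLeastAtMost_iff by (intro conjI floor_mono) linarith+
  qed
  then have "finite (c ` J)" using finite_subset by blast
  then obtain j0 where j0: "j0 \<in> J" "infinite {j \<in> J. c j = c j0}"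
    using pigeonhole_infinite[OF assms(1)] by blast
  have "\<bar>x i - x j\<bar> \<le> \<delta>" if "c i = c j0" "c j = c j0" for i j
  proof -
    have "\<bar>x i / \<delta> - x j / \<delta>\<bar> \<le> 1" using that unfolding c_def by linarith
    then have "\<bar>x i - x j\<bar> / \<delta> \<le> 1" using assms(3) by (simp add: diff_divide_distrib[symmetric])
    then show ?thesis using assms(3) by simp
  qed
  then show ?thesis using j0(2) by (intro exI[of _ "{j \<in> J. c j = c j0}"]) auto
qed

lemma cluster_family:
  fixes x :: "'k \<Rightarrow> nat \<Rightarrow> real"
  assumes "finite K" "infinite J" "\<And>k j. k \<in> K \<Longrightarrow> j \<in> J \<Longrightarrow> \<bar>x k j\<bar> \<le> B" "\<delta> > 0"
  shows "\<exists>J'\<subseteq>J. infinite J' \<and> (\<forall>k\<in>K. \<forall>i\<in>J'. \<forall>j\<in>J'. \<bar>x k i - x k j\<bar> \<le> \<delta>)"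
  using assms(1,3)
proof (induction K rule: finite_induct)
  case empty
  then show ?case using assms(2) by auto
next
  case (insert k K)
  have "\<exists>J'\<subseteq>J. infinite J' \<and> (\<forall>k\<in>K. \<forall>i\<in>J'. \<forall>j\<in>J'. \<bar>x k i - x k j\<bar> \<le> \<delta>)"
    by (rule insert.IH) (rule insert.prems, simp_all)
  then obtain J1 where J1: "J1 \<subseteq> J" "infinite J1" "\<And>k i j. k \<in> K \<Longrightarrow> i \<in> J1 \<Longrightarrow> j \<in> J1 \<Longrightarrow> \<bar>x k i - x k j\<bar> \<le> \<delta>" by blast
  have "\<bar>x k j\<bar> \<le> B" if "j \<in> J1" for j using insert.prems[of k j] that J1(1) by auto
  then have "\<exists>J'\<subseteq>J1. infinite J' \<and> (\<forall>i\<in>J'. \<forall>j\<in>J'. \<bar>x k i - x k j\<bar> \<le> \<delta>)"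
    by (rule cluster_real[where x = "x k", OF J1(2) _ assms(4)])
  then obtain J2 where J2: "J2 \<subseteq> J1" "infinite J2" "\<forall>i\<in>J2. \<forall>j\<in>J2. \<bar>x k i - x k j\<bar> \<le> \<delta>" by (elim exE conjE)
  show ?case
  proof (intro exI[of _ J2] conjI ballI)
    show "J2 \<subseteq> J" using J1(1) J2(1) by blast
    fix l i j assume "l \<in> insert k K" "i \<in> J2" "j \<in> J2"
    then show "\<bar>x l i - x l j\<bar> \<le> \<delta>" using J1(3)[of l i j] J2(1,3) by auto
  qed (rule J2(2))
qed

text \<open>Adjoining one index \<open>j\<close> to a subset changes the value by a difference in
  direction \<open>c j\<close>, a map of smaller degree, to which the induction on the degree
  applies; the induction on \<open>F\<close> does the rest.\<close>

lemma pdeg_sum_determined: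
  assumes A: "fsub A" and B: "fsub B" "N \<subseteq> B" and c: "\<And>i. c i \<in> A"
  shows "finite F \<Longrightarrow> pdeg d A N \<Phi> \<Longrightarrow> (\<And>T. T \<subseteq> F \<Longrightarrow> card T < d \<Longrightarrow> \<Phi> (sum c T) \<in> B) \<Longrightarrow> \<Phi> (sum c F) \<in> B"
proof (induction d arbitrary: \<Phi> F)
  case 0
  then show ?case using fsub_sum[OF A, of F c] c B(2) by auto
next
  case (Suc d)
  note outer = Suc.IH
  show ?case using Suc.prems
  proof (induction F rule: finite_induct)
    case empty
    then show ?case by (auto intro: empty.prems(2)[of "{}", simplified])
  next
    case (insert j F)
    have "\<Phi> (sum c F) \<in> B" using insert by (intro insert.IH) auto
    moreover have "\<Phi> (sum c F + c j) - \<Phi> (sum c F) \<in> B"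
    proof (rule outer[of F "\<lambda>x. \<Phi> (x + c j) - \<Phi> x"])
      show "pdeg d A N (\<lambda>x. \<Phi> (x + c j) - \<Phi> x)" using insert.prems(1) c by simp
      fix T assume T: "T \<subseteq> F" "card T < d"
      have fT: "finite T" "j \<notin> T" using T insert.hyps finite_subset by auto
      have "\<Phi> (sum c (insert j T)) \<in> B" using T fT by (intro insert.prems(2)) auto
      moreover have "\<Phi> (sum c T) \<in> B" using T by (intro insert.prems(2)) auto
      ultimately show "\<Phi> (sum c T + c j) - \<Phi> (sum c T) \<in> B" using fT fsub_diff[OF B(1)] by (simp add: add.commute)
    qed (use insert.hyps in auto)
    ultimately have "(\<Phi> (sum c F + c j) - \<Phi> (sum c F)) + \<Phi> (sum c F) \<in> B" using fsub_add[OF B(1)] by blast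
    then show ?case using insert.hyps by (simp add: add.commute)
  qed
qed

section \<open>Functors on a finite additive category\<close>

text \<open>Ramsey's theorem for pairs: on an infinite homogeneous set the colour cannot be bad,
  because the hypothesis provides a good pair inside it. \<open>Min\<close> and \<open>Max\<close>
  recover the order of an unordered pair.\<close>

lemma infinite_good_first:
  assumes "\<And>J. infinite J \<Longrightarrow> \<exists>i\<in>J. \<exists>j\<in>J. i < j \<and> R i j"
  shows "\<exists>i::nat. infinite {j. i < j \<and> R i j}"
proof -
  define f where "f X = (if R (Min X) (Max X) then 0 else 1::nat)" for X :: "nat set"
  have "\<exists>Y t. Y \<subseteq> UNIV \<and> infinite Y \<and> t < 2 \<and> (\<forall>x\<in>Y. \<forall>y\<in>Y. x \<noteq> y \<longrightarrow> f {x, y} = t)"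
    by (rule Ramsey2) (auto simp: f_def)
  then obtain Y t where Y: "infinite Y" and Yt: "\<forall>x\<in>Y. \<forall>y\<in>Y. x \<noteq> y \<longrightarrow> f {x, y} = t" by (elim exE conjE)
  obtain i j where ij: "i \<in> Y" "j \<in> Y" "i < j" "R i j" using assms[OF Y] by blast
  have f: "f {x, y} = (if R x y then 0 else 1)" if "x < y" for x y using that by (simp add: f_def)
  have "f {i, j} = t" using Yt[rule_format, OF ij(1,2)] ij(3) by simp
  then have t: "t = 0" using f[OF ij(3)] ij(4) by simp
  have "R i k" if k: "k \<in> Y" "i < k" for k
  proof -
    have "f {i, k} = t" using Yt[rule_format, OF ij(1) k(1)] k(2) by simp
    then show ?thesis using f[OF k(2)] t by (simp split: if_splits)
  qed
  then have "{j \<in> Y. i < j} \<subseteq> {j. i < j \<and> R i j}" by blast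
  moreover have "infinite {j \<in> Y. i < j}"
  proof
    assume "finite {j \<in> Y. i < j}"
    moreover have "Y \<subseteq> {j \<in> Y. i < j} \<union> {..i}" by auto
    ultimately show False using Y finite_subset by blast
  qed
  ultimately show ?thesis using finite_subset by blast
qed

lemma good_pair_infinite:
  assumes "\<And>\<sigma>::nat \<Rightarrow> nat. strict_mono \<sigma> \<Longrightarrow> range \<sigma> \<subseteq> J \<Longrightarrow> \<exists>i j. i < j \<and> R (\<sigma> i) (\<sigma> j)" "infinite J"
  shows "\<exists>i\<in>J. \<exists>j\<in>J. i < j \<and> R i j"
proof -
  have "strict_mono (enumerate J)" "range (enumerate J) \<subseteq> J"
    using strict_mono_enumerate[OF assms(2)] enumerate_in_set[OF assms(2)] by auto
  then obtain i j where "i < j" "R (enumerate J i) (enumerate J j)" using assms(1) by blast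
  then show ?thesis using enumerate_in_set[OF assms(2)] enumerate_mono[OF _ assms(2)] by blast
qed

text \<open>The interface is equational so that the arguments on functors, shifts and subfunctors
  never touch vector spaces. \<open>scal\<close> supplies the scalars for sampling. The last
  assumption makes every object a retract of a power of \<open>I0\<close>; no zero object is
  assumed.\<close>

locale additive_cat =
  fixes Ob :: "'o set" and hom :: "'o \<Rightarrow> 'o \<Rightarrow> 'h::ab_group_add set"
    and cmp :: "'h \<Rightarrow> 'h \<Rightarrow> 'h" (infixl "\<bullet>" 70) and idn :: "'o \<Rightarrow> 'h"
    and su :: "'o \<Rightarrow> 'o \<Rightarrow> 'o" and i1 i2 q1 q2 :: "'o \<Rightarrow> 'o \<Rightarrow> 'h"
    and scal :: "'o \<Rightarrow> 'h set" and I0 :: 'o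
  assumes hom_Ob: "f \<in> hom U V \<Longrightarrow> U \<in> Ob \<and> V \<in> Ob"
    and hom_fsub: "U \<in> Ob \<Longrightarrow> V \<in> Ob \<Longrightarrow> fsub (hom U V)"
    and cmp_hom: "f \<in> hom U V \<Longrightarrow> g \<in> hom V W \<Longrightarrow> g \<bullet> f \<in> hom U W"
    and cmp_assoc: "f \<in> hom U V \<Longrightarrow> g \<in> hom V W \<Longrightarrow> h \<in> hom W X \<Longrightarrow> (h \<bullet> g) \<bullet> f = h \<bullet> (g \<bullet> f)"
    and cmp_diff_left: "f \<in> hom U V \<Longrightarrow> g \<in> hom V W \<Longrightarrow> g' \<in> hom V W \<Longrightarrow> (g - g') \<bullet> f = g \<bullet> f - g' \<bullet> f"
    and cmp_diff_right: "f \<in> hom U V \<Longrightarrow> f' \<in> hom U V \<Longrightarrow> g \<in> hom V W \<Longrightarrow> g \<bullet> (f - f') = g \<bullet> f - g \<bullet> f'"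
    and idn_hom: "V \<in> Ob \<Longrightarrow> idn V \<in> hom V V"
    and idn_left: "f \<in> hom U V \<Longrightarrow> idn V \<bullet> f = f"
    and idn_right: "f \<in> hom U V \<Longrightarrow> f \<bullet> idn U = f"
    and su_Ob: "U \<in> Ob \<Longrightarrow> V \<in> Ob \<Longrightarrow> su U V \<in> Ob"
    and i1_hom: "U \<in> Ob \<Longrightarrow> V \<in> Ob \<Longrightarrow> i1 U V \<in> hom U (su U V)"
    and i2_hom: "U \<in> Ob \<Longrightarrow> V \<in> Ob \<Longrightarrow> i2 U V \<in> hom V (su U V)"
    and q1_hom: "U \<in> Ob \<Longrightarrow> V \<in> Ob \<Longrightarrow> q1 U V \<in> hom (su U V) U"
    and q2_hom: "U \<in> Ob \<Longrightarrow> V \<in> Ob \<Longrightarrow> q2 U V \<in> hom (su U V) V"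
    and q1_i1: "U \<in> Ob \<Longrightarrow> V \<in> Ob \<Longrightarrow> q1 U V \<bullet> i1 U V = idn U"
    and q2_i2: "U \<in> Ob \<Longrightarrow> V \<in> Ob \<Longrightarrow> q2 U V \<bullet> i2 U V = idn V"
    and q1_i2: "U \<in> Ob \<Longrightarrow> V \<in> Ob \<Longrightarrow> q1 U V \<bullet> i2 U V = 0"
    and q2_i1: "U \<in> Ob \<Longrightarrow> V \<in> Ob \<Longrightarrow> q2 U V \<bullet> i1 U V = 0"
    and i_q: "U \<in> Ob \<Longrightarrow> V \<in> Ob \<Longrightarrow> i1 U V \<bullet> q1 U V + i2 U V \<bullet> q2 U V = idn (su U V)"
    and scal_fsub: "U \<in> Ob \<Longrightarrow> fsub (scal U)"
    and scal_hom: "U \<in> Ob \<Longrightarrow> scal U \<subseteq> hom U U"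
    and scal_card: "U \<in> Ob \<Longrightarrow> card (scal U) \<ge> 2"
    and scal_inv: "U \<in> Ob \<Longrightarrow> s \<in> scal U \<Longrightarrow> s \<noteq> 0 \<Longrightarrow> \<exists>t\<in>hom U U. t \<bullet> s = idn U \<and> s \<bullet> t = idn U"
    and I0_Ob: "I0 \<in> Ob"
    and I0_gen: "V \<in> Ob \<Longrightarrow> \<exists>(n::nat) a b. (\<forall>i. a i \<in> hom V I0 \<and> b i \<in> hom I0 V) \<and> idn V = (\<Sum>i<n. b i \<bullet> a i)"
begin

lemma hom_fsub': "f \<in> hom U V \<Longrightarrow> fsub (hom U V)"
  using hom_Ob hom_fsub by blast

lemma hom_0: "U \<in> Ob \<Longrightarrow> V \<in> Ob \<Longrightarrow> 0 \<in> hom U V"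
  by (rule fsub_0[OF hom_fsub])

lemma hom_add: "f \<in> hom U V \<Longrightarrow> g \<in> hom U V \<Longrightarrow> f + g \<in> hom U V"
  by (rule fsub_add[OF hom_fsub'])

lemma cmp_0_left: "f \<in> hom U V \<Longrightarrow> W \<in> Ob \<Longrightarrow> 0 \<bullet> f = 0"
  using cmp_diff_left[of f U V 0 W 0] hom_0 hom_Ob by fastforce

lemma cmp_0_right: "g \<in> hom V W \<Longrightarrow> U \<in> Ob \<Longrightarrow> g \<bullet> 0 = 0"
  using cmp_diff_right[of 0 U V 0 g W] hom_0 hom_Ob by fastforce

lemma cmp_add_left:
  assumes "f \<in> hom U V" "g \<in> hom V W" "g' \<in> hom V W"
  shows "(g + g') \<bullet> f = g \<bullet> f + g' \<bullet> f"
  using cmp_diff_left[OF assms(1) hom_add[OF assms(2,3)] assms(3)] by simp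

lemma cmp_add_right:
  assumes "f \<in> hom U V" "f' \<in> hom U V" "g \<in> hom V W"
  shows "g \<bullet> (f + f') = g \<bullet> f + g \<bullet> f'"
  using cmp_diff_right[OF hom_add[OF assms(1,2)] assms(2,3)] by simp

text \<open>\<open>pr\<close> is the map into a biproduct with components \<open>f\<close> and
  \<open>g\<close>, \<open>co\<close> is the map out of it, and \<open>ds u V W f\<close> is the
  direct sum of the identity of \<open>u\<close> and \<open>f\<close>.\<close>

definition pr :: "'o \<Rightarrow> 'o \<Rightarrow> 'h \<Rightarrow> 'h \<Rightarrow> 'h" where
  "pr u V f g = i1 u V \<bullet> f + i2 u V \<bullet> g"

definition co :: "'o \<Rightarrow> 'o \<Rightarrow> 'h \<Rightarrow> 'h \<Rightarrow> 'h" where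
  "co u V f g = f \<bullet> q1 u V + g \<bullet> q2 u V"

definition ds :: "'o \<Rightarrow> 'o \<Rightarrow> 'o \<Rightarrow> 'h \<Rightarrow> 'h" where
  "ds u V W f = co u V (i1 u W) (i2 u W \<bullet> f)"

lemma pr_hom: "f \<in> hom X u \<Longrightarrow> g \<in> hom X V \<Longrightarrow> pr u V f g \<in> hom X (su u V)"
  unfolding pr_def using hom_Ob[of f X u] hom_Ob[of g X V] by (intro hom_add[OF cmp_hom[OF _ i1_hom] cmp_hom[OF _ i2_hom]]) auto

lemma co_hom: "f \<in> hom u Y \<Longrightarrow> g \<in> hom V Y \<Longrightarrow> co u V f g \<in> hom (su u V) Y"
  unfolding co_def using hom_Ob[of f u Y] hom_Ob[of g V Y] by (intro hom_add[OF cmp_hom[OF q1_hom] cmp_hom[OF q2_hom]]) auto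

lemma ds_hom: "u \<in> Ob \<Longrightarrow> f \<in> hom V W \<Longrightarrow> ds u V W f \<in> hom (su u V) (su u W)"
  unfolding ds_def using hom_Ob[of f V W] by (intro co_hom[OF i1_hom cmp_hom[OF _ i2_hom]]) auto

lemma cmp_co:
  assumes "f \<in> hom u Y" "g \<in> hom V Y" "h \<in> hom Y Z"
  shows "h \<bullet> co u V f g = co u V (h \<bullet> f) (h \<bullet> g)"
proof -
  have O: "u \<in> Ob" "V \<in> Ob" using hom_Ob assms by blast+
  note q = q1_hom[OF O] q2_hom[OF O]
  have "h \<bullet> co u V f g = h \<bullet> (f \<bullet> q1 u V) + h \<bullet> (g \<bullet> q2 u V)"
    unfolding co_def using assms q by (intro cmp_add_right cmp_hom)
  also have "\<dots> = co u V (h \<bullet> f) (h \<bullet> g)"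
    unfolding co_def using cmp_assoc[OF q(1) assms(1,3)] cmp_assoc[OF q(2) assms(2,3)] by simp
  finally show ?thesis .
qed

lemma co_i1: 
  assumes "f \<in> hom u Y" "g \<in> hom V Y"
  shows "co u V f g \<bullet> i1 u V = f"
proof -
  have O: "u \<in> Ob" "V \<in> Ob" "Y \<in> Ob" using hom_Ob assms by blast+
  note q = q1_hom[OF O(1,2)] q2_hom[OF O(1,2)] i1_hom[OF O(1,2)]
  have "co u V f g \<bullet> i1 u V = (f \<bullet> q1 u V) \<bullet> i1 u V + (g \<bullet> q2 u V) \<bullet> i1 u V"
    unfolding co_def using assms q by (intro cmp_add_left cmp_hom)
  also have "\<dots> = f"
    using cmp_assoc[OF q(3,1) assms(1)] cmp_assoc[OF q(3,2) assms(2)] O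
    by (simp add: q1_i1 q2_i1 idn_right[OF assms(1)] cmp_0_right[OF assms(2)])
  finally show ?thesis .
qed

lemma co_i2: 
  assumes "f \<in> hom u Y" "g \<in> hom V Y"
  shows "co u V f g \<bullet> i2 u V = g"
proof -
  have O: "u \<in> Ob" "V \<in> Ob" "Y \<in> Ob" using hom_Ob assms by blast+
  note q = q1_hom[OF O(1,2)] q2_hom[OF O(1,2)] i2_hom[OF O(1,2)]
  have "co u V f g \<bullet> i2 u V = (f \<bullet> q1 u V) \<bullet> i2 u V + (g \<bullet> q2 u V) \<bullet> i2 u V"
    unfolding co_def using assms q by (intro cmp_add_left cmp_hom)
  also have "\<dots> = g"
    using cmp_assoc[OF q(3,1) assms(1)] cmp_assoc[OF q(3,2) assms(2)] O
    by (simp add: q1_i2 q2_i2 idn_right[OF assms(2)] cmp_0_right[OF assms(1)])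
  finally show ?thesis .
qed

lemma co_pr:
  assumes "f \<in> hom u Y" "g \<in> hom V Y" "a \<in> hom X u" "b \<in> hom X V"
  shows "co u V f g \<bullet> pr u V a b = f \<bullet> a + g \<bullet> b"
proof -
  have O: "u \<in> Ob" "V \<in> Ob" using hom_Ob assms by blast+
  note i = i1_hom[OF O] i2_hom[OF O]
  note c = co_hom[OF assms(1,2)]
  have "co u V f g \<bullet> pr u V a b = co u V f g \<bullet> (i1 u V \<bullet> a) + co u V f g \<bullet> (i2 u V \<bullet> b)"
    unfolding pr_def using assms i c by (intro cmp_add_right cmp_hom)
  also have "\<dots> = f \<bullet> a + g \<bullet> b"
    using cmp_assoc[OF assms(3) i(1) c] cmp_assoc[OF assms(4) i(2) c]
    by (simp add: co_i1[OF assms(1,2)] co_i2[OF assms(1,2)])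
  finally show ?thesis .
qed

lemma co_co_ds:
  assumes "f \<in> hom u Y" "g \<in> hom W Y" "h \<in> hom V W"
  shows "co u W f g \<bullet> ds u V W h = co u V f (g \<bullet> h)"
proof -
  have O: "u \<in> Ob" "V \<in> Ob" "W \<in> Ob" "Y \<in> Ob" using hom_Ob assms by blast+
  note i = i1_hom[OF O(1,3)] i2_hom[OF O(1,3)]
  note c = co_hom[OF assms(1,2)]
  have "co u W f g \<bullet> ds u V W h = co u V (co u W f g \<bullet> i1 u W) (co u W f g \<bullet> (i2 u W \<bullet> h))"
    unfolding ds_def by (rule cmp_co[OF i(1) cmp_hom[OF assms(3) i(2)] c])
  also have "co u W f g \<bullet> (i2 u W \<bullet> h) = g \<bullet> h"
    using cmp_assoc[OF assms(3) i(2) c] co_i2[OF assms(1,2)] by simp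
  finally show ?thesis by (simp add: co_i1[OF assms(1,2)])
qed

lemma ds_id: "u \<in> Ob \<Longrightarrow> V \<in> Ob \<Longrightarrow> ds u V V (idn V) = idn (su u V)"
  unfolding ds_def co_def by (simp add: idn_right[OF i2_hom] i_q)

lemma ds_cmp:
  assumes "u \<in> Ob" "f \<in> hom U V" "g \<in> hom V W"
  shows "ds u U W (g \<bullet> f) = ds u V W g \<bullet> ds u U V f"
proof -
  have O: "V \<in> Ob" "W \<in> Ob" using hom_Ob assms by blast+
  note i = i1_hom[OF assms(1) O(2)] i2_hom[OF assms(1) O(2)]
  have "ds u V W g \<bullet> ds u U V f = co u U (i1 u W) ((i2 u W \<bullet> g) \<bullet> f)"
    unfolding ds_def[of u V W g] by (rule co_co_ds[OF i(1) cmp_hom[OF assms(3) i(2)] assms(2)])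
  then show ?thesis by (simp add: ds_def cmp_assoc[OF assms(2,3) i(2)])
qed

lemma ds_i2:
  assumes "u \<in> Ob" "f \<in> hom V W"
  shows "ds u V W f \<bullet> i2 u V = i2 u W \<bullet> f"
proof -
  have O: "V \<in> Ob" "W \<in> Ob" using hom_Ob assms by blast+
  show ?thesis unfolding ds_def
    by (rule co_i2[OF i1_hom[OF assms(1) O(2)] cmp_hom[OF assms(2) i2_hom[OF assms(1) O(2)]]])
qed

definition is_functor :: "('o \<Rightarrow> 'p::ab_group_add set) \<Rightarrow> ('o \<Rightarrow> 'o \<Rightarrow> 'h \<Rightarrow> 'p \<Rightarrow> 'p) \<Rightarrow> bool" where
  "is_functor G act \<longleftrightarrow>
     (\<forall>V\<in>Ob. fsub (G V)) \<and>
     (\<forall>U V f p. f \<in> hom U V \<longrightarrow> p \<in> G U \<longrightarrow> act U V f p \<in> G V) \<and>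
     (\<forall>U V f p q. f \<in> hom U V \<longrightarrow> p \<in> G U \<longrightarrow> q \<in> G U \<longrightarrow> act U V f (p - q) = act U V f p - act U V f q) \<and>
     (\<forall>V\<in>Ob. \<forall>p\<in>G V. act V V (idn V) p = p) \<and>
     (\<forall>U V W f g p. f \<in> hom U V \<longrightarrow> g \<in> hom V W \<longrightarrow> p \<in> G U \<longrightarrow> act U W (g \<bullet> f) p = act V W g (act U V f p))"

definition is_sub :: "('o \<Rightarrow> 'p::ab_group_add set) \<Rightarrow> ('o \<Rightarrow> 'o \<Rightarrow> 'h \<Rightarrow> 'p \<Rightarrow> 'p) \<Rightarrow> ('o \<Rightarrow> 'p set) \<Rightarrow> bool" where
  "is_sub G act M \<longleftrightarrow> (\<forall>V\<in>Ob. fsub (M V) \<and> M V \<subseteq> G V) \<and>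
     (\<forall>U V f p. f \<in> hom U V \<longrightarrow> p \<in> M U \<longrightarrow> act U V f p \<in> M V)"

definition pol_degree :: "nat \<Rightarrow> ('o \<Rightarrow> 'p::ab_group_add set) \<Rightarrow> ('o \<Rightarrow> 'o \<Rightarrow> 'h \<Rightarrow> 'p \<Rightarrow> 'p) \<Rightarrow> ('o \<Rightarrow> 'p set) \<Rightarrow> bool" where
  "pol_degree e G act N \<longleftrightarrow> (\<forall>U\<in>Ob. \<forall>V\<in>Ob. \<forall>p\<in>G U. pdeg e (hom U V) (N V) (\<lambda>\<psi>. act U V \<psi> p))"

definition wqo_mod :: "('o \<Rightarrow> 'p::ab_group_add set) \<Rightarrow> ('o \<Rightarrow> 'o \<Rightarrow> 'h \<Rightarrow> 'p \<Rightarrow> 'p) \<Rightarrow> ('o \<Rightarrow> 'p set) \<Rightarrow> bool" where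
  "wqo_mod G act N \<longleftrightarrow> (\<forall>V p. (\<forall>i::nat. V i \<in> Ob \<and> p i \<in> G (V i)) \<longrightarrow>
     (\<exists>i j. i < j \<and> (\<exists>\<alpha>\<in>hom (V j) (V i). act (V j) (V i) \<alpha> (p j) - p i \<in> N (V i))))"

text \<open>
  Well-quasi-order modulo \<open>M\<close> after adjoining to every \<open>p i\<close> a map \<open>\<phi> i\<close> to a fixed object \<open>U\<close>:
  the functor \<open>W \<mapsto> G (U \<oplus> W)\<close> is applied to the elements \<open>(\<phi> i, id) (p i)\<close>.
\<close>

definition pointed_wqo :: "('o \<Rightarrow> 'p::ab_group_add set) \<Rightarrow> ('o \<Rightarrow> 'o \<Rightarrow> 'h \<Rightarrow> 'p \<Rightarrow> 'p) \<Rightarrow> ('o \<Rightarrow> 'p set) \<Rightarrow> ('o \<Rightarrow> 'p set) \<Rightarrow> bool" where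
  "pointed_wqo G act N M \<longleftrightarrow> (\<forall>U\<in>Ob. \<forall>V p \<phi>. (\<forall>i::nat. p i \<in> G (V i) \<and> \<phi> i \<in> hom (V i) U) \<longrightarrow>
     (\<exists>i j. i < j \<and> (\<exists>\<alpha>\<in>hom (V j) (V i). \<exists>r\<in>M (V i). \<forall>X. \<forall>\<psi>\<in>hom U X. \<forall>y\<in>hom (V i) X.
        act (V j) X (\<psi> \<bullet> \<phi> j + y \<bullet> \<alpha>) (p j) - act (V i) X (\<psi> \<bullet> \<phi> i + y) (p i) - act (V i) X y r \<in> N X)))"

lemma functorD:
  assumes "is_functor G act"
  shows "V \<in> Ob \<Longrightarrow> fsub (G V)"
    and "f \<in> hom U V \<Longrightarrow> p \<in> G U \<Longrightarrow> act U V f p \<in> G V"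
    and "f \<in> hom U V \<Longrightarrow> p \<in> G U \<Longrightarrow> q \<in> G U \<Longrightarrow> act U V f (p - q) = act U V f p - act U V f q"
    and "V \<in> Ob \<Longrightarrow> p \<in> G V \<Longrightarrow> act V V (idn V) p = p"
    and "f \<in> hom U V \<Longrightarrow> g \<in> hom V W \<Longrightarrow> p \<in> G U \<Longrightarrow> act U W (g \<bullet> f) p = act V W g (act U V f p)"
  using assms unfolding is_functor_def by blast+

lemma subD:
  assumes "is_sub G act M"
  shows "V \<in> Ob \<Longrightarrow> fsub (M V)" "V \<in> Ob \<Longrightarrow> M V \<subseteq> G V"
    and "f \<in> hom U V \<Longrightarrow> p \<in> M U \<Longrightarrow> act U V f p \<in> M V"
  using assms unfolding is_sub_def by blast+

lemma functor_add:
  assumes F: "is_functor G act" and f: "f \<in> hom U V" "p \<in> G U" "q \<in> G U"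
  shows "act U V f (p + q) = act U V f p + act U V f q"
proof -
  have "fsub (G U)" using functorD(1)[OF F] hom_Ob[OF f(1)] by blast
  then show ?thesis using functorD(3)[OF F f(1) fsub_add[OF _ f(2,3)] f(3)] by simp
qed

lemma functor_0: "is_functor G act \<Longrightarrow> f \<in> hom U V \<Longrightarrow> act U V f 0 = 0"
  using functorD(3)[of G act f U V 0 0] functorD(1)[of G act U] fsub_0[of "G U"] hom_Ob[of f U V] by simp

end

section \<open>Rigidity of the phase of the error term\<close>

lemma avg_norm_variance:
  fixes f :: "'a \<Rightarrow> complex"
  assumes ne: "finite A" "A \<noteq> {}"
  shows "avg A (\<lambda>x. (norm (f x - avg A f))\<^sup>2) = avg A (\<lambda>x. (norm (f x))\<^sup>2) - (norm (avg A f))\<^sup>2"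
proof -
  define a where "a = avg A f"
  have "avg A (\<lambda>x. (norm (f x - a))\<^sup>2) = avg A (\<lambda>x. ((norm (f x))\<^sup>2 + (norm a)\<^sup>2) - 2 * Re (f x * cnj a))"
    by (rule avg_cong) (unfold cmod_power2, simp add: power2_eq_square algebra_simps)
  also have "\<dots> = (avg A (\<lambda>x. (norm (f x))\<^sup>2) + (norm a)\<^sup>2) - 2 * Re (avg A f * cnj a)"
    by (simp only: avg_diff avg_add avg_const[OF ne] avg_mult_left avg_mult_right[symmetric] Re_avg)
  also have "Re (avg A f * cnj a) = (norm a)\<^sup>2" unfolding cmod_power2 a_def by (simp add: power2_eq_square)
  finally show ?thesis by (simp add: a_def)
qed

text \<open>Here \<open>Hi\<close>, \<open>Hj\<close>, \<open>A\<close> stand for the Hom groups to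
  \<open>U\<close> from \<open>V i\<close>, from \<open>V j\<close> and from the target of the
  adjoined maps, and \<open>fi\<close>, \<open>fj\<close>, \<open>F\<close> for the phases of
  \<open>p i\<close>, \<open>p j\<close>, \<open>r\<close>. On each coset of the image of
  \<open>A\<close> the factor \<open>F y\<close> is a unimodular constant, invisible to positive
  orders. So sampling for \<open>fi\<close> gives capture for \<open>fj\<close>, and the means of
  \<open>fj\<close> on \<open>Hj\<close> and on \<open>H'\<close> nearly agree; the latter is nearly
  the mean of \<open>fi\<close> times that of \<open>F\<close>.\<close>

lemma rigidity:
  fixes c \<epsilon> :: real
  assumes "c \<ge> 1" "\<epsilon> > 0"
  obtains \<delta> where "\<delta> > 0" and
    "\<And>(Hi::'h::ab_group_add set) (Hj::'h set) (A::'h set) \<Phi>i \<Phi>j \<alpha> fi fj F.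
      fsub Hi \<Longrightarrow> fsub Hj \<Longrightarrow> fsub A \<Longrightarrow>
      (\<And>x. x \<in> A \<Longrightarrow> \<Phi>i x \<in> Hi) \<Longrightarrow> (\<And>x y. x \<in> A \<Longrightarrow> y \<in> A \<Longrightarrow> \<Phi>i (x - y) = \<Phi>i x - \<Phi>i y) \<Longrightarrow>
      (\<And>x. x \<in> A \<Longrightarrow> \<Phi>j x \<in> Hj) \<Longrightarrow> (\<And>x y. x \<in> A \<Longrightarrow> y \<in> A \<Longrightarrow> \<Phi>j (x - y) = \<Phi>j x - \<Phi>j y) \<Longrightarrow>
      (\<And>x. x \<in> Hi \<Longrightarrow> \<alpha> x \<in> Hj) \<Longrightarrow> (\<And>x y. x \<in> Hi \<Longrightarrow> y \<in> Hi \<Longrightarrow> \<alpha> (x - y) = \<alpha> x - \<alpha> y) \<Longrightarrow>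
      (\<And>x. x \<in> Hi \<Longrightarrow> norm (F x) = 1) \<Longrightarrow> mdeg (Suc e) Hi F \<Longrightarrow> mdeg (Suc e) Hj fj \<Longrightarrow> F 0 = 1 \<Longrightarrow>
      (\<And>\<psi> y. \<psi> \<in> A \<Longrightarrow> y \<in> Hi \<Longrightarrow> fj (\<Phi>j \<psi> + \<alpha> y) = fi (\<Phi>i \<psi> + y) * F y) \<Longrightarrow>
      (\<And>k. 1 \<le> k \<Longrightarrow> k \<le> Suc e \<Longrightarrow> avg Hi (\<lambda>y. gow k (\<Phi>i ` A) (sh y fi)) \<le> gow k Hi fi + \<delta>) \<Longrightarrow>
      (\<And>k. 1 \<le> k \<Longrightarrow> k \<le> Suc e \<Longrightarrow> \<bar>gow k Hi fi - gow k Hj fj\<bar> \<le> \<delta>) \<Longrightarrow>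
      \<epsilon> \<le> norm (avg Hi fi) \<Longrightarrow>
      (\<And>y. y \<in> Hj \<Longrightarrow> \<exists>B. fsub B \<and> B \<subseteq> Hj \<and> y \<in> B \<and> real (card B) \<le> c) \<Longrightarrow>
      \<forall>y\<in>Hi. F y = 1"
proof -
  \<comment> \<open>Three errors of size \<tau> occur at the end and together must stay below
    \<open>\<epsilon> / 4 ^ e\<close>, the margin set by \<open>phase_constant\<close>; hence the 4
    in the denominator.\<close>
  define \<tau> where "\<tau> = \<epsilon> / (4 * 4 ^ e)"
  have \<tau>: "\<tau> > 0" using assms by (simp add: \<tau>_def)
  obtain \<delta>c where \<delta>c: "\<delta>c > 0" and capture: "\<And>(H::'h set) H' f. nearly_captured (Suc e) c \<delta>c H H' f \<Longrightarrow> norm (avg H' f - avg H f) \<le> \<tau>"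
    using avg_capture[OF assms(1) _ \<tau>, of "Suc e", where 'a = 'h] by auto
  \<comment> \<open>The bounds serve, in this order, the comparison of the two biases at order 1,
    the variance of the coset means, and near capture, where the sampling error and the clustering
    error add up.\<close>
  define \<delta> where "\<delta> = min (\<tau> * \<epsilon>) (min (\<tau>\<^sup>2) (\<delta>c / 2))"
  have \<delta>: "\<delta> > 0" "\<delta> \<le> \<tau> * \<epsilon>" "\<delta> \<le> \<tau>\<^sup>2" "\<delta> + \<delta> \<le> \<delta>c" using \<tau> \<delta>c assms by (auto simp: \<delta>_def)
  show ?thesis
  proof (rule that[OF \<delta>(1)])
    fix Hi Hj A :: "'h set" and \<Phi>i \<Phi>j \<alpha> fi fj F
    assume Hi: "fsub Hi" and Hj: "fsub Hj" and A: "fsub A"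
      and \<Phi>i: "\<And>x. x \<in> A \<Longrightarrow> \<Phi>i x \<in> Hi" "\<And>x y. x \<in> A \<Longrightarrow> y \<in> A \<Longrightarrow> \<Phi>i (x - y) = \<Phi>i x - \<Phi>i y"
      and \<Phi>j: "\<And>x. x \<in> A \<Longrightarrow> \<Phi>j x \<in> Hj" "\<And>x y. x \<in> A \<Longrightarrow> y \<in> A \<Longrightarrow> \<Phi>j (x - y) = \<Phi>j x - \<Phi>j y"
      and \<alpha>: "\<And>x. x \<in> Hi \<Longrightarrow> \<alpha> x \<in> Hj" "\<And>x y. x \<in> Hi \<Longrightarrow> y \<in> Hi \<Longrightarrow> \<alpha> (x - y) = \<alpha> x - \<alpha> y"
      and F: "\<And>x. x \<in> Hi \<Longrightarrow> norm (F x) = 1" "mdeg (Suc e) Hi F" and fj: "mdeg (Suc e) Hj fj" and F0: "F 0 = 1"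
      and key: "\<And>\<psi> y. \<psi> \<in> A \<Longrightarrow> y \<in> Hi \<Longrightarrow> fj (\<Phi>j \<psi> + \<alpha> y) = fi (\<Phi>i \<psi> + y) * F y"
      and samp: "\<And>k. 1 \<le> k \<Longrightarrow> k \<le> Suc e \<Longrightarrow> avg Hi (\<lambda>y. gow k (\<Phi>i ` A) (sh y fi)) \<le> gow k Hi fi + \<delta>"
      and close: "\<And>k. 1 \<le> k \<Longrightarrow> k \<le> Suc e \<Longrightarrow> \<bar>gow k Hi fi - gow k Hj fj\<bar> \<le> \<delta>"
      and bias: "\<epsilon> \<le> norm (avg Hi fi)"
      and small: "\<And>y. y \<in> Hj \<Longrightarrow> \<exists>B. fsub B \<and> B \<subseteq> Hj \<and> y \<in> B \<and> real (card B) \<le> c"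
    define L where "L = \<Phi>j ` A"
    \<comment> \<open>The part of \<open>Hj\<close> on which the phase of \<open>p j\<close> is
      known from those of \<open>p i\<close> and \<open>r\<close>.\<close>
    define H' where "H' = ssum L (\<alpha> ` Hi)"
    have L: "fsub L" "L \<subseteq> Hj" unfolding L_def using fsub_image[OF A \<Phi>j(2)] \<Phi>j(1) by auto
    have aH: "fsub (\<alpha> ` Hi)" "\<alpha> ` Hi \<subseteq> Hj" using fsub_image[OF Hi \<alpha>(2)] \<alpha>(1) by auto
    have H': "fsub H'" "H' \<subseteq> Hj" "L \<subseteq> H'" unfolding H'_def
      using fsub_ssum[OF L(1) aH(1)] ssum_subset[OF Hj L(2) aH(2)] ssum_left[OF aH(1)] by auto
    have Ai: "fsub (\<Phi>i ` A)" by (rule fsub_image[OF A \<Phi>i(2)])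
    have avgH': "avg H' G = avg Hi (\<lambda>y. avg A (\<lambda>\<psi>. G (\<Phi>j \<psi> + \<alpha> y)))" for G :: "'h \<Rightarrow> 'z::real_vector"
    proof -
      have "avg H' G = avg L (\<lambda>l. avg (\<alpha> ` Hi) (\<lambda>b. G (l + b)))" unfolding H'_def by (rule avg_ssum[OF L(1) aH(1)])
      also have "\<dots> = avg A (\<lambda>\<psi>. avg (\<alpha> ` Hi) (\<lambda>b. G (\<Phi>j \<psi> + b)))" unfolding L_def by (rule avg_image[OF A \<Phi>j(2)])
      also have "\<dots> = avg A (\<lambda>\<psi>. avg Hi (\<lambda>y. G (\<Phi>j \<psi> + \<alpha> y)))"
        by (rule avg_cong) (rule avg_image[OF Hi \<alpha>(2)])
      finally show ?thesis by (simp only: avg_swap[of A Hi])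
    qed
    \<comment> \<open>Pulled back to \<open>A\<close>, \<open>fj\<close> on the coset of
      \<open>L\<close> at \<open>\<alpha> y\<close> is \<open>fi\<close> on the coset of the image
      of \<open>\<Phi>i\<close> at \<open>y\<close>, up to the constant \<open>F y\<close>;
      \<open>gow_scale\<close> removes the constant because \<open>k\<close> is positive.\<close>
    have gH': "gow k H' fj \<le> gow k Hi fi + \<delta>" if k: "1 \<le> k" "k \<le> Suc e" for k
    proof -
      have "gow k H' fj \<le> avg H' (\<lambda>h. gow k L (sh h fj))" by (rule gow_cosets[OF H'(1,3) L(1)])
      also have "\<dots> = avg Hi (\<lambda>y. avg A (\<lambda>\<psi>. gow k L (sh (\<Phi>j \<psi> + \<alpha> y) fj)))" by (rule avgH')
      also have "\<dots> = avg Hi (\<lambda>y. avg A (\<lambda>\<psi>. gow k (\<Phi>i ` A) (sh y fi)))"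
      proof (intro avg_cong)
        fix y \<psi> assume y: "y \<in> Hi" and \<psi>: "\<psi> \<in> A"
        have "gow k L (sh (\<Phi>j \<psi> + \<alpha> y) fj) = gow k L (sh (\<alpha> y) fj)"
          using gow_shift[OF L(1), of "\<Phi>j \<psi>" k "sh (\<alpha> y) fj"] \<psi> by (simp add: sh_sh L_def)
        also have "\<dots> = gow k A (\<lambda>x. sh (\<alpha> y) fj (\<Phi>j x))" unfolding L_def by (rule gow_image[OF A \<Phi>j(2)])
        also have "\<dots> = gow k A (\<lambda>x. F y * sh y fi (\<Phi>i x))"
          by (rule gow_cong[OF A]) (simp add: sh_def key y mult.commute)
        also have "\<dots> = gow k A (\<lambda>x. sh y fi (\<Phi>i x))"
          using gow_scale[OF F(1)[OF y]] k(1) by (cases k) (simp_all del: gow.simps)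
        also have "\<dots> = gow k (\<Phi>i ` A) (sh y fi)" by (rule gow_image[OF A \<Phi>i(2), symmetric])
        finally show "gow k L (sh (\<Phi>j \<psi> + \<alpha> y) fj) = gow k (\<Phi>i ` A) (sh y fi)" .
      qed
      also have "\<dots> = avg Hi (\<lambda>y. gow k (\<Phi>i ` A) (sh y fi))"
        using A by (simp add: avg_const fsub_finite fsub_nonempty)
      also have "\<dots> \<le> gow k Hi fi + \<delta>" by (rule samp[OF k])
      finally show ?thesis .
    qed
    have "nearly_captured (Suc e) c \<delta>c Hj H' fj"
      unfolding nearly_captured_def
    proof (intro conjI allI impI ballI Hj H'(1,2))
      show "\<exists>B. fsub B \<and> B \<subseteq> Hj \<and> y \<in> B \<and> real (card B) \<le> c" if "y \<in> Hj" for y using small[OF that] .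
      show "gow (Suc e) La (sh y fj) = 1" if "fsub La" "La \<subseteq> Hj" "y \<in> Hj" for La y
        by (rule mdeg_gow[OF Hj that fj])
      show "gow k H' fj \<le> gow k Hj fj + \<delta>c" if k: "1 \<le> k" "k \<le> Suc e" for k
        using gH'[OF k] close[OF k] \<delta>(4) by linarith
    qed
    from capture[OF this] have cap: "norm (avg Hj fj) \<le> norm (avg H' fj) + \<tau>"
      using norm_triangle_ineq2[of "avg Hj fj" "avg H' fj"] by (simp add: norm_minus_commute)
    define \<beta> where "\<beta> = avg Hi fi"
    have \<beta>: "\<epsilon> \<le> norm \<beta>" using bias by (simp add: \<beta>_def)
    have bj: "norm \<beta> - \<tau> \<le> norm (avg Hj fj)"
    proof (rule ccontr)
      define b where "b = norm (avg Hj fj)"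
      assume "\<not> norm \<beta> - \<tau> \<le> norm (avg Hj fj)"
      then have lt: "b < norm \<beta> - \<tau>" by (simp add: b_def)
      have b0: "0 \<le> b" by (simp add: b_def)
      have "\<bar>(norm \<beta>)\<^sup>2 - b\<^sup>2\<bar> \<le> \<delta>"
        using close[of 1] unfolding One_nat_def gow_1[OF Hi] gow_1[OF Hj] by (simp add: \<beta>_def b_def)
      then have "(norm \<beta>)\<^sup>2 - b\<^sup>2 \<le> \<tau> * \<epsilon>" using \<delta>(2) by linarith
      moreover have "(norm \<beta>)\<^sup>2 - b\<^sup>2 = (norm \<beta> - b) * (norm \<beta> + b)" by (simp add: power2_eq_square algebra_simps)
      moreover have "\<tau> * \<epsilon> < (norm \<beta> - b) * (norm \<beta> + b)"
      proof -
        have "\<tau> * \<epsilon> < (norm \<beta> - b) * \<epsilon>" using lt assms(2) by (intro mult_strict_right_mono) auto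
        also have "\<dots> \<le> (norm \<beta> - b) * (norm \<beta> + b)" using lt \<tau> \<beta> b0 by (intro mult_left_mono) auto
        finally show ?thesis .
      qed
      ultimately show False by linarith
    qed
    define d where "d y = avg (\<Phi>i ` A) (sh y fi)" for y
    have d: "d y = avg A (\<lambda>\<psi>. fi (\<Phi>i \<psi> + y))" for y
      unfolding d_def by (simp add: avg_image[OF A \<Phi>i(2)] sh_def)
    have ne: "finite Hi" "Hi \<noteq> {}" using Hi by (auto simp: fsub_finite fsub_nonempty)
    have avd: "avg Hi d = \<beta>"
    proof -
      have "\<Phi>i ` A \<subseteq> Hi" using \<Phi>i(1) by auto
      from avg_avg_shift[OF Hi this Ai, of fi] show ?thesis by (simp add: d_def[abs_def] sh_def \<beta>_def add.commute)
    qed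
    \<comment> \<open>Order 1 is the squared modulus of a mean, so the sampling bound at
      \<open>k = 1\<close> says that the coset means \<open>d y\<close> have small variance around
      \<beta>.\<close>
    have "avg Hi (\<lambda>y. (norm (d y))\<^sup>2) \<le> (norm \<beta>)\<^sup>2 + \<delta>"
      using samp[of 1] unfolding One_nat_def gow_1[OF Ai] gow_1[OF Hi] by (simp add: d_def \<beta>_def)
    then have var: "avg Hi (\<lambda>y. (norm (d y - \<beta>))\<^sup>2) \<le> \<tau>\<^sup>2"
      using avg_norm_variance[OF ne, of d] \<delta>(3) by (simp add: avd)
    have "(avg Hi (\<lambda>y. norm (d y - \<beta>)))\<^sup>2 \<le> \<tau>\<^sup>2" by (rule order_trans[OF avg_square_le[OF ne] var])
    then have dev: "avg Hi (\<lambda>y. norm (d y - \<beta>)) \<le> \<tau>" by (rule power2_le_imp_le) (use \<tau> in simp)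
    have "avg H' fj = avg Hi (\<lambda>y. d y * F y)"
      unfolding avgH' d
    proof (rule avg_cong)
      fix y assume y: "y \<in> Hi"
      have "avg A (\<lambda>\<psi>. fj (\<Phi>j \<psi> + \<alpha> y)) = avg A (\<lambda>\<psi>. fi (\<Phi>i \<psi> + y) * F y)" by (rule avg_cong) (rule key[OF _ y])
      also have "\<dots> = avg A (\<lambda>\<psi>. fi (\<Phi>i \<psi> + y)) * F y" by (rule avg_mult_right)
      finally show "avg A (\<lambda>\<psi>. fj (\<Phi>j \<psi> + \<alpha> y)) = avg A (\<lambda>\<psi>. fi (\<Phi>i \<psi> + y)) * F y" .
    qed
    also have "\<dots> = avg Hi (\<lambda>y. (d y - \<beta>) * F y + \<beta> * F y)" by (simp add: algebra_simps)
    also have "\<dots> = avg Hi (\<lambda>y. (d y - \<beta>) * F y) + \<beta> * avg Hi F" by (simp only: avg_add avg_mult_left)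
    finally have "norm (avg H' fj) \<le> norm (avg Hi (\<lambda>y. (d y - \<beta>) * F y)) + norm \<beta> * norm (avg Hi F)"
      using norm_triangle_ineq[of "avg Hi (\<lambda>y. (d y - \<beta>) * F y)" "\<beta> * avg Hi F"] by (simp only: norm_mult)
    moreover have "norm (avg Hi (\<lambda>y. (d y - \<beta>) * F y)) \<le> avg Hi (\<lambda>y. norm (d y - \<beta>))"
      by (rule order_trans[OF norm_avg_le]) (rule avg_mono, simp add: norm_mult F(1))
    ultimately have "norm \<beta> - 3 * \<tau> \<le> norm \<beta> * norm (avg Hi F)" using dev cap bj by linarith
    moreover have "norm \<beta> * (1 - 1 / 4 ^ e) < norm \<beta> - 3 * \<tau>"
    proof -
      have "3 * \<tau> < \<epsilon> / 4 ^ e" using assms(2) by (simp add: \<tau>_def field_simps)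
      also have "\<dots> \<le> norm \<beta> / 4 ^ e" using \<beta> by (intro divide_right_mono) auto
      finally show ?thesis by (simp add: algebra_simps)
    qed
    ultimately have "norm \<beta> * (1 - 1 / 4 ^ e) < norm \<beta> * norm (avg Hi F)" by (metis less_le_trans)
    then have "1 - 1 / 4 ^ e < norm (avg Hi F)" by (rule mult_less_cancel_left_pos[THEN iffD1, rotated]) (use assms(2) \<beta> in linarith)
    then show "\<forall>y\<in>Hi. F y = 1" using phase_constant[OF Hi F(2,1)] F0 by auto
  qed
qed

section \<open>Refining a well-quasi-order by a simple subquotient\<close>

context additive_cat
begin

lemma wqo_mod_infinite:
  fixes V :: "nat \<Rightarrow> 'o" and p :: "nat \<Rightarrow> 'p::ab_group_add"
  assumes "wqo_mod G act N" "infinite J" "\<And>i. i \<in> J \<Longrightarrow> V i \<in> Ob \<and> p i \<in> G (V i)"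
  shows "\<exists>i\<in>J. \<exists>j\<in>J. i < j \<and> (\<exists>\<alpha>\<in>hom (V j) (V i). act (V j) (V i) \<alpha> (p j) - p i \<in> N (V i))"
proof (rule good_pair_infinite[where R = "\<lambda>i j. \<exists>\<alpha>\<in>hom (V j) (V i). act (V j) (V i) \<alpha> (p j) - p i \<in> N (V i)"])
  fix \<sigma> :: "nat \<Rightarrow> nat" assume "strict_mono \<sigma>" "range \<sigma> \<subseteq> J"
  then have "\<forall>i. V (\<sigma> i) \<in> Ob \<and> p (\<sigma> i) \<in> G (V (\<sigma> i))" using assms(3) by blast
  then show "\<exists>i j. i < j \<and> (\<exists>\<alpha>\<in>hom (V (\<sigma> j)) (V (\<sigma> i)). act (V (\<sigma> j)) (V (\<sigma> i)) \<alpha> (p (\<sigma> j)) - p (\<sigma> i) \<in> N (V (\<sigma> i)))"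
    using assms(1)[unfolded wqo_mod_def, THEN spec, of "\<lambda>i. V (\<sigma> i)", THEN spec, of "\<lambda>i. p (\<sigma> i)"] by simp
qed (rule assms(2))

lemma pointed_wqo_infinite:
  fixes V :: "nat \<Rightarrow> 'o" and p :: "nat \<Rightarrow> 'p::ab_group_add"
  assumes "pointed_wqo G act N M" "infinite J" "U \<in> Ob" "\<And>i. i \<in> J \<Longrightarrow> p i \<in> G (V i) \<and> \<phi> i \<in> hom (V i) U"
  shows "\<exists>i\<in>J. \<exists>j\<in>J. i < j \<and> (\<exists>\<alpha>\<in>hom (V j) (V i). \<exists>r\<in>M (V i). \<forall>X. \<forall>\<psi>\<in>hom U X. \<forall>y\<in>hom (V i) X.
        act (V j) X (\<psi> \<bullet> \<phi> j + y \<bullet> \<alpha>) (p j) - act (V i) X (\<psi> \<bullet> \<phi> i + y) (p i) - act (V i) X y r \<in> N X)"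
proof (rule good_pair_infinite[where R = "\<lambda>i j. \<exists>\<alpha>\<in>hom (V j) (V i). \<exists>r\<in>M (V i). \<forall>X. \<forall>\<psi>\<in>hom U X. \<forall>y\<in>hom (V i) X.
        act (V j) X (\<psi> \<bullet> \<phi> j + y \<bullet> \<alpha>) (p j) - act (V i) X (\<psi> \<bullet> \<phi> i + y) (p i) - act (V i) X y r \<in> N X"])
  fix \<sigma> :: "nat \<Rightarrow> nat" assume "strict_mono \<sigma>" "range \<sigma> \<subseteq> J"
  then have "\<forall>i. p (\<sigma> i) \<in> G (V (\<sigma> i)) \<and> \<phi> (\<sigma> i) \<in> hom (V (\<sigma> i)) U" using assms(4) by blast
  then show "\<exists>i j. i < j \<and> (\<exists>\<alpha>\<in>hom (V (\<sigma> j)) (V (\<sigma> i)). \<exists>r\<in>M (V (\<sigma> i)). \<forall>X. \<forall>\<psi>\<in>hom U X. \<forall>y\<in>hom (V (\<sigma> i)) X.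
        act (V (\<sigma> j)) X (\<psi> \<bullet> \<phi> (\<sigma> j) + y \<bullet> \<alpha>) (p (\<sigma> j)) - act (V (\<sigma> i)) X (\<psi> \<bullet> \<phi> (\<sigma> i) + y) (p (\<sigma> i)) - act (V (\<sigma> i)) X y r \<in> N X)"
    using assms(1)[unfolded pointed_wqo_def, rule_format, OF assms(3), of "\<lambda>i. p (\<sigma> i)" "\<lambda>i. V (\<sigma> i)" "\<lambda>i. \<phi> (\<sigma> i)"] by blast
qed (rule assms(2))

text \<open>\<open>pw U n\<close> is the power with \<open>n + 1\<close> factors. Starting with
  \<open>U\<close> itself avoids an empty power, that is, a zero object; correspondingly
  \<open>tup\<close> starts with the zero map as a dummy component.\<close>

primrec pw :: "'o \<Rightarrow> nat \<Rightarrow> 'o" where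
  "pw U 0 = U"
| "pw U (Suc n) = su (pw U n) U"

primrec tup :: "'o \<Rightarrow> 'o \<Rightarrow> 'h list \<Rightarrow> 'h" where
  "tup V U [] = 0"
| "tup V U (g # gs) = pr (pw U (length gs)) U (tup V U gs) g"

lemma pw_Ob: "U \<in> Ob \<Longrightarrow> pw U n \<in> Ob"
  by (induction n) (auto intro: su_Ob)

lemma tup_hom: "U \<in> Ob \<Longrightarrow> V \<in> Ob \<Longrightarrow> set gs \<subseteq> hom V U \<Longrightarrow> tup V U gs \<in> hom V (pw U (length gs))"
  by (induction gs) (auto intro: hom_0 pr_hom)

lemma tup_proj:
  assumes O: "U \<in> Ob" "V \<in> Ob"
  shows "set gs \<subseteq> hom V U \<Longrightarrow> g \<in> set gs \<Longrightarrow> \<exists>\<pi>\<in>hom (pw U (length gs)) U. \<pi> \<bullet> tup V U gs = g"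
proof (induction gs)
  case (Cons h gs)
  let ?P = "pw U (length gs)"
  have P: "?P \<in> Ob" by (rule pw_Ob[OF O(1)])
  have t: "tup V U gs \<in> hom V ?P" using tup_hom[OF O] Cons.prems by auto
  have h: "h \<in> hom V U" using Cons.prems by auto
  show ?case
  proof (cases "g = h")
    case True
    have "co ?P U 0 (idn U) \<bullet> pr ?P U (tup V U gs) h = 0 \<bullet> tup V U gs + idn U \<bullet> h"
      by (rule co_pr[OF hom_0[OF P O(1)] idn_hom[OF O(1)] t h])
    then have "co ?P U 0 (idn U) \<bullet> tup V U (h # gs) = g"
      by (simp add: True cmp_0_left[OF t O(1)] idn_left[OF h])
    then show ?thesis using co_hom[OF hom_0[OF P O(1)] idn_hom[OF O(1)]] by auto
  next
    case False
    then obtain \<pi> where \<pi>: "\<pi> \<in> hom ?P U" "\<pi> \<bullet> tup V U gs = g" using Cons by auto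
    have "co ?P U \<pi> 0 \<bullet> pr ?P U (tup V U gs) h = \<pi> \<bullet> tup V U gs + 0 \<bullet> h"
      by (rule co_pr[OF \<pi>(1) hom_0[OF O(1) O(1)] t h])
    then have "co ?P U \<pi> 0 \<bullet> tup V U (h # gs) = g" by (simp add: \<pi>(2) cmp_0_left[OF h O(1)])
    then show ?thesis using co_hom[OF \<pi>(1) hom_0[OF O(1) O(1)]] by auto
  qed
qed simp

lemma scaled_group_hom:
  assumes O: "U \<in> Ob" "V \<in> Ob"
  shows "scaled_group (hom V U) (scal U) (\<bullet>)"
proof
  show "fsub (hom V U)" "fsub (scal U)" "2 \<le> card (scal U)"
    using hom_fsub[OF O(2,1)] scal_fsub[OF O(1)] scal_card[OF O(1)] by auto
  have s: "s \<in> hom U U" if "s \<in> scal U" for s using that scal_hom[OF O(1)] by auto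
  show "s \<bullet> g \<in> hom V U" if "s \<in> scal U" "g \<in> hom V U" for s g by (rule cmp_hom[OF that(2) s[OF that(1)]])
  show "(s - t) \<bullet> g = s \<bullet> g - t \<bullet> g" if "s \<in> scal U" "t \<in> scal U" "g \<in> hom V U" for s t g
    by (rule cmp_diff_left[OF that(3) s[OF that(1)] s[OF that(2)]])
  show "bij_betw ((\<bullet>) s) (hom V U) (hom V U)" if s0: "s \<in> scal U" "s \<noteq> 0" for s
  proof -
    obtain t where t: "t \<in> hom U U" "t \<bullet> s = idn U" "s \<bullet> t = idn U" using scal_inv[OF O(1) s0] by blast
    show ?thesis
    proof (rule bij_betw_byWitness[where f' = "(\<bullet>) t"])
      show "\<forall>a\<in>hom V U. t \<bullet> (s \<bullet> a) = a"
        using cmp_assoc[OF _ s[OF s0(1)] t(1)] idn_left t(2) by metis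
      show "\<forall>a\<in>hom V U. s \<bullet> (t \<bullet> a) = a"
        using cmp_assoc[OF _ t(1) s[OF s0(1)]] idn_left t(3) by metis
    qed (use cmp_hom s[OF s0(1)] t(1) in blast)+
  qed
qed

text \<open>Adjoining zero maps and evaluating at \<open>\<psi> = 0\<close>,
  \<open>y = idn (V i)\<close> leaves the plain relation.\<close>

lemma pointed_imp_wqo_mod:
  assumes F: "is_functor G act" and M: "is_sub G act M" and sub: "\<And>V. V \<in> Ob \<Longrightarrow> N V \<subseteq> M V"
    and pw: "pointed_wqo G act N M"
  shows "wqo_mod G act M"
  unfolding wqo_mod_def
proof (intro allI impI)
  fix V p assume Vp: "\<forall>i::nat. V i \<in> Ob \<and> p i \<in> G (V i)"
  then have U: "V 0 \<in> Ob" and "\<forall>i. p i \<in> G (V i) \<and> 0 \<in> hom (V i) (V 0)" using hom_0 by auto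
  from pw[unfolded pointed_wqo_def, rule_format, OF U, of p V "\<lambda>_. 0"] this(2)
  obtain i j \<alpha> r where ij: "i < j" and \<alpha>: "\<alpha> \<in> hom (V j) (V i)" and r: "r \<in> M (V i)"
    and key: "\<And>X \<psi> y. \<psi> \<in> hom (V 0) X \<Longrightarrow> y \<in> hom (V i) X \<Longrightarrow>
      act (V j) X (\<psi> \<bullet> 0 + y \<bullet> \<alpha>) (p j) - act (V i) X (\<psi> \<bullet> 0 + y) (p i) - act (V i) X y r \<in> N X"
    by blast
  have O: "V i \<in> Ob" "V j \<in> Ob" using Vp by auto
  have z: "0 \<in> hom (V 0) (V i)" by (rule hom_0[OF U O(1)])
  have "act (V j) (V i) \<alpha> (p j) - p i - r \<in> N (V i)"
    using key[OF z idn_hom[OF O(1)]] Vp subD(2)[OF M O(1)] r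
    by (auto simp: cmp_0_right[OF z U] O idn_left[OF \<alpha>] functorD(4)[OF F])
  then have "(act (V j) (V i) \<alpha> (p j) - p i - r) + r \<in> M (V i)"
    using sub[OF O(1)] r by (intro fsub_add[OF subD(1)[OF M O(1)]]) auto
  then show "\<exists>i j. i < j \<and> (\<exists>\<alpha>\<in>hom (V j) (V i). act (V j) (V i) \<alpha> (p j) - p i \<in> M (V i))"
    using ij \<alpha> by auto
qed

theorem wqo_mod_refine:
  assumes F: "is_functor G act" and M: "is_sub G act M" and M': "is_sub G act M'"
    and sub: "\<And>V. V \<in> Ob \<Longrightarrow> M' V \<subseteq> M V" and deg: "pol_degree (Suc e) G act M'"
    and simple: "\<And>U V \<theta> r. U \<in> Ob \<Longrightarrow> V \<in> Ob \<Longrightarrow> \<theta> \<in> chars (G U) (M' U) \<Longrightarrow> \<exists>s\<in>M U. \<theta> s \<noteq> 1 \<Longrightarrow> r \<in> M V \<Longrightarrow>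
      (\<And>\<psi>. \<psi> \<in> hom V U \<Longrightarrow> \<theta> (act V U \<psi> r) = 1) \<Longrightarrow> r \<in> M' V"
    and pw: "pointed_wqo G act M' M"
  shows "wqo_mod G act M'"
proof (rule ccontr)
  assume "\<not> wqo_mod G act M'"
  then obtain V p where "\<forall>i::nat. V i \<in> Ob \<and> p i \<in> G (V i)"
    and nbad: "\<not> (\<exists>i j. i < j \<and> (\<exists>\<alpha>\<in>hom (V j) (V i). act (V j) (V i) \<alpha> (p j) - p i \<in> M' (V i)))"
    unfolding wqo_mod_def by blast
  then have V: "\<And>i. V i \<in> Ob" and p: "\<And>i. p i \<in> G (V i)" by auto
  have bad: "act (V j) (V i) \<alpha> (p j) - p i \<notin> M' (V i)" if "i < j" "\<alpha> \<in> hom (V j) (V i)" for i j \<alpha>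
    using nbad that by blast
  \<comment> \<open>One \<open>i0\<close> lies below infinitely many \<open>j\<close> modulo
    \<open>M\<close>, so all later phases come from one finite group \<open>G U\<close>, with
    \<open>U = V i0\<close>. Modulo \<open>M'\<close> the target \<open>p i0\<close> is missed,
    which is where the bias comes from.\<close>
  have "\<exists>i. infinite {j. i < j \<and> (\<exists>\<alpha>\<in>hom (V j) (V i). act (V j) (V i) \<alpha> (p j) - p i \<in> M (V i))}"
    by (rule infinite_good_first) (rule wqo_mod_infinite[OF pointed_imp_wqo_mod[OF F M sub pw]], use V p in auto)
  then obtain i0 where i0: "infinite {j. i0 < j \<and> (\<exists>\<alpha>\<in>hom (V j) (V i0). act (V j) (V i0) \<alpha> (p j) - p i0 \<in> M (V i0))}" by blast
  define J0 where "J0 = {j. i0 < j \<and> (\<exists>\<alpha>\<in>hom (V j) (V i0). act (V j) (V i0) \<alpha> (p j) - p i0 \<in> M (V i0))}"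
  define U where "U = V i0"
  have U: "U \<in> Ob" by (simp add: U_def V)
  define H where "H j = hom (V j) U" for j
  have H: "fsub (H j)" for j unfolding H_def by (rule hom_fsub[OF V U])
  have GU: "fsub (G U)" by (rule functorD(1)[OF F U])
  have MU: "fsub (M U)" "M U \<subseteq> G U" "fsub (M' U)" "M' U \<subseteq> M U" "M' U \<subseteq> G U"
    using subD(1,2)[OF M U] subD(1,2)[OF M' U] sub[OF U] by auto
  \<comment> \<open>The bound of \<open>biased_character\<close>; it depends on the group
    \<open>G U\<close> and the degree, not on \<open>j\<close>.\<close>
  define \<epsilon> where "\<epsilon> = 1 / ((2::real) ^ return_bound (Suc e) 1 (card (G U)) * real (card (chars (G U) (M' U))))"
  have \<epsilon>: "\<epsilon> > 0" using chars_nonempty[OF GU MU(5)] by (simp add: \<epsilon>_def)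
  have act_U: "act (V j) U \<psi> (p j) \<in> G U" if "\<psi> \<in> H j" for j \<psi>
    using functorD(2)[OF F _ p] that by (simp add: H_def)
  have pd: "pdeg (Suc e) (hom X Y) (M' Y) (\<lambda>\<psi>. act X Y \<psi> q)" if "X \<in> Ob" "Y \<in> Ob" "q \<in> G X" for X Y q
    using deg that unfolding pol_degree_def by blast
  have "\<forall>j\<in>J0. \<exists>\<theta>. \<theta> \<in> chars (G U) (M' U) \<and> (\<exists>r\<in>M U. \<theta> r \<noteq> 1) \<and> norm (avg (H j) (\<lambda>\<psi>. \<theta> (act (V j) U \<psi> (p j)))) \<ge> \<epsilon>"
  proof
    fix j assume "j \<in> J0"
    then obtain \<alpha> where \<alpha>: "i0 < j" "\<alpha> \<in> H j" "act (V j) U \<alpha> (p j) - p i0 \<in> M U" by (auto simp: J0_def H_def U_def)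
    have "\<exists>\<theta>\<in>chars (G U) (M' U). (\<exists>r\<in>M U. \<theta> r \<noteq> 1) \<and> norm (avg (H j) (\<lambda>\<psi>. \<theta> (act (V j) U \<psi> (p j)))) \<ge> \<epsilon>"
      unfolding \<epsilon>_def
    proof (rule biased_character[where M = "M U" and g = "p i0" and ?x0.0 = \<alpha>])
      show "pdeg (Suc e) (H j) (M U) (\<lambda>\<psi>. act (V j) U \<psi> (p j))"
        unfolding H_def by (rule pdeg_mono[OF MU(4) pd[OF V U p]])
      show "p i0 \<in> G U" using p by (simp add: U_def)
      show "act (V j) U x (p j) - p i0 \<notin> M' U" if "x \<in> H j" for x
        using bad[OF \<alpha>(1), of x] that by (simp add: H_def U_def)
    qed (use H GU MU act_U \<alpha> in auto)
    then show "\<exists>\<theta>. \<theta> \<in> chars (G U) (M' U) \<and> (\<exists>r\<in>M U. \<theta> r \<noteq> 1) \<and> norm (avg (H j) (\<lambda>\<psi>. \<theta> (act (V j) U \<psi> (p j)))) \<ge> \<epsilon>"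
      by blast
  qed
  then obtain \<theta>f where \<theta>f: "\<forall>j\<in>J0. \<theta>f j \<in> chars (G U) (M' U) \<and> (\<exists>r\<in>M U. \<theta>f j r \<noteq> 1) \<and>
      norm (avg (H j) (\<lambda>\<psi>. \<theta>f j (act (V j) U \<psi> (p j)))) \<ge> \<epsilon>"
    by (rule bchoice[THEN exE])
  have "finite (\<theta>f ` J0)" by (rule finite_subset[OF _ finite_chars[OF GU, of "M' U"]]) (use \<theta>f in blast)
  then obtain j0 where j0: "j0 \<in> J0" "infinite {j \<in> J0. \<theta>f j = \<theta>f j0}"
    using pigeonhole_infinite[of J0 \<theta>f] i0 unfolding J0_def[symmetric] by blast
  define \<theta> where "\<theta> = \<theta>f j0"
  define J1 where "J1 = {j \<in> J0. \<theta>f j = \<theta>}"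
  have J1: "infinite J1" using j0 by (simp add: J1_def \<theta>_def)
  have \<theta>: "\<theta> \<in> chars (G U) (M' U)" "\<exists>r\<in>M U. \<theta> r \<noteq> 1" using \<theta>f j0(1) unfolding \<theta>_def by blast+
  define f where "f j \<psi> = \<theta> (act (V j) U \<psi> (p j))" for j \<psi>
  have bias: "\<epsilon> \<le> norm (avg (H j) (f j))" if "j \<in> J1" for j
    using that \<theta>f unfolding J1_def f_def by auto
  have fn: "norm (f j \<psi>) = 1" if "\<psi> \<in> H j" for j \<psi>
    unfolding f_def by (rule charsD(2)[OF \<theta>(1) act_U[OF that]])
  have fd: "mdeg (Suc e) (H j) (f j)" for j
    unfolding f_def by (rule pdeg_mdeg[OF H GU \<theta>(1)]) (use pd[OF V U p] act_U in \<open>auto simp: H_def\<close>)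
  \<comment> \<open>A functor need not vanish at the zero map, so the phases may differ at 0. Making
    them equal there gives \<open>F' 0 = 1\<close> below.\<close>
  have "finite ((\<lambda>j. f j 0) ` J1)"
    by (rule finite_subset[of _ "\<theta> ` G U"]) (use act_U fsub_0[OF H] fsub_finite[OF GU] in \<open>auto simp: f_def\<close>)
  then obtain j1 where j1: "infinite {j \<in> J1. f j 0 = f j1 0}" using pigeonhole_infinite[OF J1] by blast
  define J2 where "J2 = {j \<in> J1. f j 0 = f j1 0}"
  \<comment> \<open>Each \<open>y\<close> in \<open>hom (V j) U\<close> lies in the subgroup of all
    \<open>\<psi> \<bullet> y\<close> with \<psi> in \<open>hom U U\<close>, whose size is bounded
    independently of \<open>j\<close>.\<close>
  define c where "c = real (card (hom U U))"
  have c: "c \<ge> 1" using fsub_card_pos[OF hom_fsub[OF U U]] by (simp add: c_def)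
  obtain \<delta> where \<delta>: "\<delta> > 0" and rigid: "\<And>(Hi::'h set) (Hj::'h set) (A::'h set) \<Phi>i \<Phi>j \<alpha> fi fj F.
      fsub Hi \<Longrightarrow> fsub Hj \<Longrightarrow> fsub A \<Longrightarrow>
      (\<And>x. x \<in> A \<Longrightarrow> \<Phi>i x \<in> Hi) \<Longrightarrow> (\<And>x y. x \<in> A \<Longrightarrow> y \<in> A \<Longrightarrow> \<Phi>i (x - y) = \<Phi>i x - \<Phi>i y) \<Longrightarrow>
      (\<And>x. x \<in> A \<Longrightarrow> \<Phi>j x \<in> Hj) \<Longrightarrow> (\<And>x y. x \<in> A \<Longrightarrow> y \<in> A \<Longrightarrow> \<Phi>j (x - y) = \<Phi>j x - \<Phi>j y) \<Longrightarrow>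
      (\<And>x. x \<in> Hi \<Longrightarrow> \<alpha> x \<in> Hj) \<Longrightarrow> (\<And>x y. x \<in> Hi \<Longrightarrow> y \<in> Hi \<Longrightarrow> \<alpha> (x - y) = \<alpha> x - \<alpha> y) \<Longrightarrow>
      (\<And>x. x \<in> Hi \<Longrightarrow> norm (F x) = 1) \<Longrightarrow> mdeg (Suc e) Hi F \<Longrightarrow> mdeg (Suc e) Hj fj \<Longrightarrow> F 0 = 1 \<Longrightarrow>
      (\<And>\<psi> y. \<psi> \<in> A \<Longrightarrow> y \<in> Hi \<Longrightarrow> fj (\<Phi>j \<psi> + \<alpha> y) = fi (\<Phi>i \<psi> + y) * F y) \<Longrightarrow>
      (\<And>k. 1 \<le> k \<Longrightarrow> k \<le> Suc e \<Longrightarrow> avg Hi (\<lambda>y. gow k (\<Phi>i ` A) (sh y fi)) \<le> gow k Hi fi + \<delta>) \<Longrightarrow>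
      (\<And>k. 1 \<le> k \<Longrightarrow> k \<le> Suc e \<Longrightarrow> \<bar>gow k Hi fi - gow k Hj fj\<bar> \<le> \<delta>) \<Longrightarrow>
      \<epsilon> \<le> norm (avg Hi fi) \<Longrightarrow>
      (\<And>y. y \<in> Hj \<Longrightarrow> \<exists>B. fsub B \<and> B \<subseteq> Hj \<and> y \<in> B \<and> real (card B) \<le> c) \<Longrightarrow>
      \<forall>y\<in>Hi. F y = 1"
    apply (rule rigidity[OF c \<epsilon>, where e = e and 'h = 'h])
    subgoal premises prems for \<delta>
      by (rule that[of \<delta>]) (fact prems)+
    done
  have "\<exists>J'\<subseteq>J2. infinite J' \<and> (\<forall>k\<in>{1..Suc e}. \<forall>i\<in>J'. \<forall>j\<in>J'. \<bar>gow k (H i) (f i) - gow k (H j) (f j)\<bar> \<le> \<delta>)"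
    by (rule cluster_family[where B = 1]) (use j1 \<delta> gow_bound[OF H] fn in \<open>auto simp: J2_def simp del: gow.simps\<close>)
  then obtain J3 where J3: "J3 \<subseteq> J2" "infinite J3"
    and close: "\<forall>k\<in>{1..Suc e}. \<forall>i\<in>J3. \<forall>j\<in>J3. \<bar>gow k (H i) (f i) - gow k (H j) (f j)\<bar> \<le> \<delta>"
    by (elim exE conjE)
  obtain T where T: "\<And>(H::'h set) (S::'h set) sc (f::'h \<Rightarrow> complex). scaled_group H S sc \<Longrightarrow>
    (\<And>x. x \<in> H \<Longrightarrow> norm (f x) \<le> 1) \<Longrightarrow>
    \<exists>gs. length gs = T \<and> set gs \<subseteq> H \<and> (\<forall>L k. fsub L \<longrightarrow> L \<subseteq> H \<longrightarrow> (\<forall>g\<in>set gs. \<forall>s\<in>S. sc s g \<in> L) \<longrightarrow>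
      1 \<le> k \<longrightarrow> k \<le> Suc e \<longrightarrow> avg H (\<lambda>y. gow k L (sh y f)) \<le> gow k H f + \<delta>)"
    apply (rule sampling[OF \<delta>, where e = "Suc e" and 'a = 'h and 's = 'h])
    subgoal premises prems for T
      by (rule that[of T]) (fact prems)+
    done
  have "\<forall>j. \<exists>gs. length gs = T \<and> set gs \<subseteq> H j \<and> (\<forall>L k. fsub L \<longrightarrow> L \<subseteq> H j \<longrightarrow> (\<forall>g\<in>set gs. \<forall>s\<in>scal U. s \<bullet> g \<in> L) \<longrightarrow>
      1 \<le> k \<longrightarrow> k \<le> Suc e \<longrightarrow> avg (H j) (\<lambda>y. gow k L (sh y (f j))) \<le> gow k (H j) (f j) + \<delta>)"
    using T[of "H _" "scal U" "(\<bullet>)" "f _"] scaled_group_hom[OF U V] fn unfolding H_def by simp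
  then obtain gs where gs': "\<forall>j. length (gs j) = T \<and> set (gs j) \<subseteq> H j \<and> (\<forall>L k. fsub L \<longrightarrow> L \<subseteq> H j \<longrightarrow> (\<forall>g\<in>set (gs j). \<forall>s\<in>scal U. s \<bullet> g \<in> L) \<longrightarrow>
      1 \<le> k \<longrightarrow> k \<le> Suc e \<longrightarrow> avg (H j) (\<lambda>y. gow k L (sh y (f j))) \<le> gow k (H j) (f j) + \<delta>)"
    by (rule choice[THEN exE])
  then have gs: "\<And>j. length (gs j) = T" "\<And>j. set (gs j) \<subseteq> H j"
    and samp: "\<And>j L k. fsub L \<Longrightarrow> L \<subseteq> H j \<Longrightarrow> (\<forall>g\<in>set (gs j). \<forall>s\<in>scal U. s \<bullet> g \<in> L) \<Longrightarrow>
      1 \<le> k \<Longrightarrow> k \<le> Suc e \<Longrightarrow> avg (H j) (\<lambda>y. gow k L (sh y (f j))) \<le> gow k (H j) (f j) + \<delta>"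
    by auto
  define P where "P = pw U T"
  have P: "P \<in> Ob" by (simp add: P_def pw_Ob U)
  \<comment> \<open>The sampled maps are packed into one map to a power of \<open>U\<close>; then
    the subgroup of all \<open>\<psi> \<bullet> \<phi> j\<close> contains the scalar multiples of
    every sampled map.\<close>
  define \<phi> where "\<phi> j = tup (V j) U (gs j)" for j
  have \<phi>: "\<phi> j \<in> hom (V j) P" for j
    using tup_hom[OF U V, of "gs j" j] gs[of j] by (simp add: \<phi>_def P_def H_def)
  define A where "A = hom P U"
  have A: "fsub A" unfolding A_def by (rule hom_fsub[OF P U])
  from pointed_wqo_infinite[OF pw J3(2) P, of p V \<phi>] p \<phi>
  obtain i j \<alpha> r where ij: "i \<in> J3" "j \<in> J3" "i < j" and \<alpha>: "\<alpha> \<in> hom (V j) (V i)" and r: "r \<in> M (V i)"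
    and key: "\<forall>X. \<forall>\<psi>\<in>hom P X. \<forall>y\<in>hom (V i) X.
      act (V j) X (\<psi> \<bullet> \<phi> j + y \<bullet> \<alpha>) (p j) - act (V i) X (\<psi> \<bullet> \<phi> i + y) (p i) - act (V i) X y r \<in> M' X"
    by blast
  have rG: "r \<in> G (V i)" using r subD(2)[OF M V] by blast
  define F' where "F' y = \<theta> (act (V i) U y r)" for y
  have actr: "act (V i) U y r \<in> G U" if "y \<in> H i" for y using functorD(2)[OF F _ rG] that by (simp add: H_def)
  have sub_P: "\<psi> \<bullet> \<phi> k \<in> H k" if "\<psi> \<in> A" for \<psi> k using cmp_hom[OF \<phi>] that by (simp add: A_def H_def)
  have sub_\<alpha>: "y \<bullet> \<alpha> \<in> H j" if "y \<in> H i" for y using cmp_hom[OF \<alpha>] that by (simp add: H_def)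
  have keyf: "f j (\<psi> \<bullet> \<phi> j + y \<bullet> \<alpha>) = f i (\<psi> \<bullet> \<phi> i + y) * F' y" if "\<psi> \<in> A" "y \<in> H i" for \<psi> y
  proof -
    define a b s where "a = act (V j) U (\<psi> \<bullet> \<phi> j + y \<bullet> \<alpha>) (p j)" and "b = act (V i) U (\<psi> \<bullet> \<phi> i + y) (p i)"
      and "s = act (V i) U y r"
    have G: "b \<in> G U" "s \<in> G U" unfolding b_def s_def
      using act_U[OF fsub_add[OF H sub_P[OF that(1)] that(2)]] actr[OF that(2)] by auto
    have m: "a - b - s \<in> M' U" using key that unfolding a_def b_def s_def A_def H_def by blast
    have "\<theta> ((a - b - s) + (b + s)) = \<theta> (a - b - s) * (\<theta> b * \<theta> s)"
      using charsD(1)[OF \<theta>(1)] m MU(5) G fsub_add[OF GU] by (metis subsetD)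
    then have "\<theta> a = \<theta> b * \<theta> s" using charsD(3)[OF \<theta>(1) m] by simp
    then show ?thesis by (simp add: f_def F'_def a_def b_def s_def)
  qed
  have H0: "0 \<in> H k" for k by (rule fsub_0[OF H])
  have "\<forall>y\<in>H i. F' y = 1"
  proof (rule rigid[of "H i" "H j" A "\<lambda>\<psi>. \<psi> \<bullet> \<phi> i" "\<lambda>\<psi>. \<psi> \<bullet> \<phi> j" "\<lambda>y. y \<bullet> \<alpha>" F' "f j" "f i"])
    show "fsub (H i)" "fsub (H j)" "fsub A" by (rule H H A)+
    show "x \<bullet> \<phi> i \<in> H i" "x \<bullet> \<phi> j \<in> H j" if "x \<in> A" for x using sub_P that by auto
    show "(x - y) \<bullet> \<phi> i = x \<bullet> \<phi> i - y \<bullet> \<phi> i" if "x \<in> A" "y \<in> A" for x y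
      using cmp_diff_left[OF \<phi>] that by (simp add: A_def)
    show "(x - y) \<bullet> \<phi> j = x \<bullet> \<phi> j - y \<bullet> \<phi> j" if "x \<in> A" "y \<in> A" for x y
      using cmp_diff_left[OF \<phi>] that by (simp add: A_def)
    show "x \<bullet> \<alpha> \<in> H j" if "x \<in> H i" for x by (rule sub_\<alpha>[OF that])
    show "(x - y) \<bullet> \<alpha> = x \<bullet> \<alpha> - y \<bullet> \<alpha>" if "x \<in> H i" "y \<in> H i" for x y
      using cmp_diff_left[OF \<alpha>] that by (simp add: H_def)
    show "norm (F' x) = 1" if "x \<in> H i" for x unfolding F'_def by (rule charsD(2)[OF \<theta>(1) actr[OF that]])
    show "mdeg (Suc e) (H i) F'"
      unfolding F'_def by (rule pdeg_mdeg[OF H GU \<theta>(1)]) (use pd[OF V U rG] actr in \<open>auto simp: H_def\<close>)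
    show "mdeg (Suc e) (H j) (f j)" by (rule fd)
    show "F' 0 = 1"
    proof -
      have "f j (0 \<bullet> \<phi> j + 0 \<bullet> \<alpha>) = f i (0 \<bullet> \<phi> i + 0) * F' 0" by (rule keyf[OF fsub_0[OF A] H0])
      moreover have "0 \<bullet> \<phi> j = 0" "0 \<bullet> \<phi> i = 0" "0 \<bullet> \<alpha> = 0"
        using cmp_0_left[OF \<phi> U] cmp_0_left[OF \<alpha> U] by auto
      moreover have "f j 0 = f i 0"
      proof -
        have "i \<in> J2" "j \<in> J2" using ij J3(1) by auto
        then show ?thesis unfolding J2_def by (metis (mono_tags, lifting) mem_Collect_eq)
      qed
      moreover have "f i 0 \<noteq> 0" using fn[OF H0, of i] by auto
      ultimately show ?thesis by simp
    qed
    show "f j (\<psi> \<bullet> \<phi> j + y \<bullet> \<alpha>) = f i (\<psi> \<bullet> \<phi> i + y) * F' y" if "\<psi> \<in> A" "y \<in> H i" for \<psi> y by (rule keyf[OF that])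
    show "avg (H i) (\<lambda>y. gow k ((\<lambda>\<psi>. \<psi> \<bullet> \<phi> i) ` A) (sh y (f i))) \<le> gow k (H i) (f i) + \<delta>" if k: "1 \<le> k" "k \<le> Suc e" for k
    proof (rule samp[OF _ _ _ k])
      show "fsub ((\<lambda>\<psi>. \<psi> \<bullet> \<phi> i) ` A)"
        by (rule fsub_image[OF A]) (use cmp_diff_left[OF \<phi>] in \<open>simp add: A_def\<close>)
      show "(\<lambda>\<psi>. \<psi> \<bullet> \<phi> i) ` A \<subseteq> H i" using sub_P by auto
      show "\<forall>g\<in>set (gs i). \<forall>s\<in>scal U. s \<bullet> g \<in> (\<lambda>\<psi>. \<psi> \<bullet> \<phi> i) ` A"
      proof (intro ballI)
        fix g s assume g: "g \<in> set (gs i)" and s: "s \<in> scal U"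
        obtain \<pi> where \<pi>: "\<pi> \<in> hom P U" "\<pi> \<bullet> \<phi> i = g"
          using tup_proj[OF U V _ g] gs[of i] by (auto simp: H_def P_def \<phi>_def)
        have s': "s \<in> hom U U" using scal_hom[OF U] s by auto
        have "s \<bullet> g = (s \<bullet> \<pi>) \<bullet> \<phi> i" using cmp_assoc[OF \<phi> \<pi>(1) s'] \<pi>(2) by simp
        then show "s \<bullet> g \<in> (\<lambda>\<psi>. \<psi> \<bullet> \<phi> i) ` A" using cmp_hom[OF \<pi>(1) s'] by (auto simp: A_def)
      qed
    qed
    show "\<bar>gow k (H i) (f i) - gow k (H j) (f j)\<bar> \<le> \<delta>" if "1 \<le> k" "k \<le> Suc e" for k
      using close that ij by auto
    show "\<epsilon> \<le> norm (avg (H i) (f i))" by (rule bias) (use ij J3(1) in \<open>auto simp: J2_def\<close>)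
    show "\<exists>B. fsub B \<and> B \<subseteq> H j \<and> y \<in> B \<and> real (card B) \<le> c" if y: "y \<in> H j" for y
    proof (intro exI[of _ "(\<lambda>\<psi>. \<psi> \<bullet> y) ` hom U U"] conjI)
      have y': "y \<in> hom (V j) U" using y by (simp add: H_def)
      show "fsub ((\<lambda>\<psi>. \<psi> \<bullet> y) ` hom U U)" by (rule fsub_image[OF hom_fsub[OF U U]]) (rule cmp_diff_left[OF y'])
      show "(\<lambda>\<psi>. \<psi> \<bullet> y) ` hom U U \<subseteq> H j" using cmp_hom[OF y'] by (auto simp: H_def)
      show "y \<in> (\<lambda>\<psi>. \<psi> \<bullet> y) ` hom U U" using idn_left[OF y'] idn_hom[OF U] by (metis image_eqI)
      show "real (card ((\<lambda>\<psi>. \<psi> \<bullet> y) ` hom U U)) \<le> c"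
        unfolding c_def using card_image_le[OF fsub_finite[OF hom_fsub[OF U U]]] by simp
    qed
  qed
  \<comment> \<open>A phase of \<open>r\<close> that is identically 1 means that \<theta> kills all
    images of \<open>r\<close> in \<open>G U\<close>; such an \<open>r\<close> in \<open>M\<close>
    lies in \<open>M'\<close> by simplicity.\<close>
  then have "r \<in> M' (V i)" by (intro simple[OF U V \<theta> r]) (simp add: F'_def H_def)
  moreover have "act (V j) (V i) \<alpha> (p j) - p i - r \<in> M' (V i)"
  proof -
    have z: "0 \<in> hom P (V i)" by (rule hom_0[OF P V])
    have "act (V j) (V i) (0 \<bullet> \<phi> j + idn (V i) \<bullet> \<alpha>) (p j) - act (V i) (V i) (0 \<bullet> \<phi> i + idn (V i)) (p i) - act (V i) (V i) (idn (V i)) r \<in> M' (V i)"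
      using key z idn_hom[OF V] by blast
    then show ?thesis
      using functorD(4)[OF F V p] functorD(4)[OF F V rG] by (simp add: cmp_0_left[OF \<phi> V] idn_left[OF \<alpha>])
  qed
  ultimately have "(act (V j) (V i) \<alpha> (p j) - p i - r) + r \<in> M' (V i)"
    by (intro fsub_add[OF subD(1)[OF M' V]])
  then show False using bad[OF ij(3) \<alpha>] by simp
qed

end

section \<open>Shifts and induction on the degree\<close>

lemma pdeg_add_in:
  assumes A: "fsub A" and N: "fsub N"
  shows "pdeg e A N \<Phi> \<Longrightarrow> (\<And>x. x \<in> A \<Longrightarrow> \<Psi> x \<in> N) \<Longrightarrow> pdeg e A N (\<lambda>x. \<Phi> x + \<Psi> x)"
proof (induction e arbitrary: \<Phi> \<Psi>)
  case 0
  then show ?case by (auto intro: fsub_add[OF N])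
next
  case (Suc e)
  have "pdeg e A N (\<lambda>x. (\<Phi> (x + h) + \<Psi> (x + h)) - (\<Phi> x + \<Psi> x))" if h: "h \<in> A" for h
  proof -
    have "pdeg e A N (\<lambda>x. (\<Phi> (x + h) - \<Phi> x) + (\<Psi> (x + h) - \<Psi> x))"
      using Suc.prems h by (intro Suc.IH) (auto intro: fsub_diff[OF N] fsub_add[OF A])
    then show ?thesis by (simp add: algebra_simps)
  qed
  then show ?case by simp
qed

context additive_cat
begin

definition shG :: "'o \<Rightarrow> ('o \<Rightarrow> 'p set) \<Rightarrow> 'o \<Rightarrow> 'p set" where
  "shG u G = (\<lambda>W. G (su u W))"

definition shA :: "'o \<Rightarrow> ('o \<Rightarrow> 'o \<Rightarrow> 'h \<Rightarrow> 'p \<Rightarrow> 'p) \<Rightarrow> 'o \<Rightarrow> 'o \<Rightarrow> 'h \<Rightarrow> 'p \<Rightarrow> 'p" where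
  "shA u act = (\<lambda>V W f. act (su u V) (su u W) (ds u V W f))"

text \<open>Besides the shift of \<open>N\<close> it contains the image of \<open>M\<close> under
  the inclusion of the second summand. For \<open>M = G\<close> the degree modulo it is smaller; for
  \<open>M\<close> inside \<open>N\<close> it is just the shift of \<open>N\<close>. The descent in
  the main induction moves \<open>M\<close> from the first extreme to the second.\<close>

definition shN :: "'o \<Rightarrow> ('o \<Rightarrow> 'p::ab_group_add set) \<Rightarrow> ('o \<Rightarrow> 'o \<Rightarrow> 'h \<Rightarrow> 'p \<Rightarrow> 'p) \<Rightarrow> ('o \<Rightarrow> 'p set) \<Rightarrow> 'o \<Rightarrow> 'p set" where
  "shN u N act M = (\<lambda>W. ssum (N (su u W)) (act W (su u W) (i2 u W) ` M W))"

lemma shift_functor: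
  assumes F: "is_functor G act" and u: "u \<in> Ob"
  shows "is_functor (shG u G) (shA u act)"
  unfolding is_functor_def shG_def shA_def
proof (intro conjI allI impI ballI)
  show "fsub (G (su u V))" if "V \<in> Ob" for V by (rule functorD(1)[OF F su_Ob[OF u that]])
  show "act (su u U) (su u V) (ds u U V f) p \<in> G (su u V)" if "f \<in> hom U V" "p \<in> G (su u U)" for U V f p
    by (rule functorD(2)[OF F ds_hom[OF u that(1)] that(2)])
  show "act (su u U) (su u V) (ds u U V f) (p - q) = act (su u U) (su u V) (ds u U V f) p - act (su u U) (su u V) (ds u U V f) q"
    if "f \<in> hom U V" "p \<in> G (su u U)" "q \<in> G (su u U)" for U V f p q
    by (rule functorD(3)[OF F ds_hom[OF u that(1)] that(2,3)])
  show "act (su u V) (su u V) (ds u V V (idn V)) p = p" if "V \<in> Ob" "p \<in> G (su u V)" for V p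
    using functorD(4)[OF F su_Ob[OF u that(1)] that(2)] by (simp add: ds_id[OF u that(1)])
  show "act (su u U) (su u W) (ds u U W (g \<bullet> f)) p = act (su u V) (su u W) (ds u V W g) (act (su u U) (su u V) (ds u U V f) p)"
    if "f \<in> hom U V" "g \<in> hom V W" "p \<in> G (su u U)" for U V W f g p
    using functorD(5)[OF F ds_hom[OF u that(1)] ds_hom[OF u that(2)] that(3)] by (simp add: ds_cmp[OF u that(1,2)])
qed

lemma act_image_fsub:
  assumes F: "is_functor G act" and M: "is_sub G act M" and f: "f \<in> hom V W"
  shows "fsub (act V W f ` M V)"
proof -
  have V: "V \<in> Ob" using hom_Ob[OF f] by simp
  show ?thesis
    using functorD(3)[OF F f] subD(2)[OF M V] by (intro fsub_image[OF subD(1)[OF M V]]) blast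
qed

lemma shN_fsub:
  assumes F: "is_functor G act" and N: "is_sub G act N" and M: "is_sub G act M" and O: "u \<in> Ob" "V \<in> Ob"
  shows "fsub (shN u N act M V)" "shN u N act M V \<subseteq> G (su u V)"
    "N (su u V) \<subseteq> shN u N act M V" "act V (su u V) (i2 u V) ` M V \<subseteq> shN u N act M V"
proof -
  note i = i2_hom[OF O] and s = su_Ob[OF O]
  have Im: "fsub (act V (su u V) (i2 u V) ` M V)" by (rule act_image_fsub[OF F M i])
  have Nf: "fsub (N (su u V))" "N (su u V) \<subseteq> G (su u V)" by (rule subD(1,2)[OF N s])+
  show "fsub (shN u N act M V)" unfolding shN_def by (rule fsub_ssum[OF Nf(1) Im])
  show "shN u N act M V \<subseteq> G (su u V)" unfolding shN_def
    by (rule ssum_subset[OF functorD(1)[OF F s] Nf(2)]) (use functorD(2)[OF F i] subD(2)[OF M O(2)] in blast)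
  show "N (su u V) \<subseteq> shN u N act M V" unfolding shN_def by (rule ssum_left[OF Im])
  show "act V (su u V) (i2 u V) ` M V \<subseteq> shN u N act M V" unfolding shN_def by (rule ssum_right[OF Nf(1)])
qed

lemma act_ds_i2:
  assumes F: "is_functor G act" and u: "u \<in> Ob" and f: "f \<in> hom V W" and m: "m \<in> G V"
  shows "act (su u V) (su u W) (ds u V W f) (act V (su u V) (i2 u V) m) = act W (su u W) (i2 u W) (act V W f m)"
proof -
  have O: "V \<in> Ob" "W \<in> Ob" using hom_Ob[OF f] by auto
  show ?thesis
    using functorD(5)[OF F i2_hom[OF u O(1)] ds_hom[OF u f] m] functorD(5)[OF F f i2_hom[OF u O(2)] m]
    by (simp add: ds_i2[OF u f])
qed

lemma shift_sub:
  assumes F: "is_functor G act" and N: "is_sub G act N" and M: "is_sub G act M" and u: "u \<in> Ob"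
  shows "is_sub (shG u G) (shA u act) (shN u N act M)"
  unfolding is_sub_def
proof (intro conjI ballI allI impI)
  show "fsub (shN u N act M V)" "shN u N act M V \<subseteq> shG u G V" if "V \<in> Ob" for V
    using shN_fsub[OF F N M u that] by (auto simp: shG_def)
next
  fix V W f p assume f: "f \<in> hom V W" and p: "p \<in> shN u N act M V"
  have O: "V \<in> Ob" "W \<in> Ob" using hom_Ob[OF f] by auto
  from p obtain n m where n: "n \<in> N (su u V)" and m: "m \<in> M V" and pe: "p = n + act V (su u V) (i2 u V) m"
    unfolding shN_def by (auto elim!: ssumE)
  note s = subD(2)[OF N su_Ob[OF u O(1)]] subD(2)[OF M O(1)]
  have "shA u act V W f p = act (su u V) (su u W) (ds u V W f) n + act W (su u W) (i2 u W) (act V W f m)"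
    unfolding shA_def pe using n m s functorD(2)[OF F i2_hom[OF u O(1)]]
    by (subst functor_add[OF F ds_hom[OF u f]]) (auto simp: act_ds_i2[OF F u f])
  also have "\<dots> \<in> shN u N act M W"
    unfolding shN_def using subD(3)[OF N ds_hom[OF u f] n] subD(3)[OF M f m] by (intro ssumI imageI)
  finally show "shA u act V W f p \<in> shN u N act M W" .
qed

lemma ds_split:
  assumes u: "u \<in> Ob" and f: "f \<in> hom V W"
  shows "ds u V W f = i1 u W \<bullet> q1 u V + (i2 u W \<bullet> f) \<bullet> q2 u V"
  by (simp add: ds_def co_def)

lemma i2_q2_hom:
  assumes u: "u \<in> Ob" and f: "f \<in> hom V W"
  shows "(i2 u W \<bullet> f) \<bullet> q2 u V \<in> hom (su u V) (su u W)"
  using hom_Ob[OF f] by (intro cmp_hom[OF q2_hom cmp_hom[OF f i2_hom]] u) auto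

lemma i2_q2_add:
  assumes u: "u \<in> Ob" and f: "f \<in> hom V W" "g \<in> hom V W"
  shows "(i2 u W \<bullet> (f + g)) \<bullet> q2 u V = (i2 u W \<bullet> f) \<bullet> q2 u V + (i2 u W \<bullet> g) \<bullet> q2 u V"
proof -
  have O: "V \<in> Ob" "W \<in> Ob" using hom_Ob[OF f(1)] by auto
  note i = i2_hom[OF u O(2)]
  have "(i2 u W \<bullet> f + i2 u W \<bullet> g) \<bullet> q2 u V = (i2 u W \<bullet> f) \<bullet> q2 u V + (i2 u W \<bullet> g) \<bullet> q2 u V"
    by (rule cmp_add_left[OF q2_hom[OF u O(1)] cmp_hom[OF f(1) i] cmp_hom[OF f(2) i]])
  then show ?thesis by (simp add: cmp_add_right[OF f i])
qed

text \<open>The map sending \<alpha> to \<open>ds u V W \<alpha>\<close> is a constant plus an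
  additive map, and affine substitution does not raise the degree.\<close>

lemma pol_degree_shift:
  assumes F: "is_functor G act" and N: "is_sub G act N" and M: "is_sub G act M" and u: "u \<in> Ob"
    and deg: "pol_degree e G act N"
  shows "pol_degree e (shG u G) (shA u act) (shN u N act M)"
  unfolding pol_degree_def shG_def shA_def
proof (intro ballI)
  fix V W p assume O: "V \<in> Ob" "W \<in> Ob" and p: "p \<in> G (su u V)"
  note s = su_Ob[OF u O(1)] su_Ob[OF u O(2)]
  have "pdeg e (hom (su u V) (su u W)) (N (su u W)) (\<lambda>\<psi>. act (su u V) (su u W) \<psi> p)"
    using deg s p unfolding pol_degree_def by blast
  then have "pdeg e (hom V W) (N (su u W)) (\<lambda>\<alpha>. act (su u V) (su u W) (i1 u W \<bullet> q1 u V + (i2 u W \<bullet> \<alpha>) \<bullet> q2 u V) p)"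
    by (intro pdeg_affine[where \<Phi> = "\<lambda>\<psi>. act (su u V) (su u W) \<psi> p" and T = "\<lambda>\<alpha>. (i2 u W \<bullet> \<alpha>) \<bullet> q2 u V"
          and B = "hom (su u V) (su u W)"]
        hom_fsub O s cmp_hom[OF q1_hom i1_hom] u i2_q2_hom i2_q2_add)
  then have "pdeg e (hom V W) (N (su u W)) (\<lambda>\<alpha>. act (su u V) (su u W) (ds u V W \<alpha>) p)"
    by (subst pdeg_cong[OF hom_fsub[OF O]]) (auto simp: ds_split[OF u])
  then show "pdeg e (hom V W) (shN u N act M W) (\<lambda>\<psi>. act (su u V) (su u W) (ds u V W \<psi>) p)"
    by (rule pdeg_mono[OF shN_fsub(3)[OF F N M u O(2)]])
qed

text \<open>
  Modulo the image of \<open>G W\<close> the value at \<open>id \<oplus> \<alpha>\<close> is the difference of the values at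
  \<open>id \<oplus> \<alpha>\<close> and \<open>0 \<oplus> \<alpha>\<close>, a derivative in the direction \<open>id \<oplus> 0\<close>.
\<close>

lemma pol_degree_shift_less:
  assumes F: "is_functor G act" and N: "is_sub G act N" and u: "u \<in> Ob"
    and deg: "pol_degree (Suc e) G act N"
  shows "pol_degree e (shG u G) (shA u act) (shN u N act G)"
  unfolding pol_degree_def shG_def shA_def
proof (intro ballI)
  fix V W p assume O: "V \<in> Ob" "W \<in> Ob" and p: "p \<in> G (su u V)"
  note s = su_Ob[OF u O(1)] su_Ob[OF u O(2)]
  have G: "is_sub G act G" using functorD[OF F] by (auto simp: is_sub_def)
  let ?A = "\<lambda>\<psi>. act (su u V) (su u W) \<psi> p" and ?h = "i1 u W \<bullet> q1 u V" and ?T = "\<lambda>\<alpha>. (i2 u W \<bullet> \<alpha>) \<bullet> q2 u V"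
  have h: "?h \<in> hom (su u V) (su u W)" by (rule cmp_hom[OF q1_hom i1_hom]) (use u O in auto)
  have "pdeg (Suc e) (hom (su u V) (su u W)) (N (su u W)) ?A"
    using deg s p unfolding pol_degree_def by blast
  then have "pdeg e (hom (su u V) (su u W)) (N (su u W)) (\<lambda>\<psi>. ?A (\<psi> + ?h) - ?A \<psi>)" using h by simp
  then have "pdeg e (hom V W) (N (su u W)) (\<lambda>\<alpha>. ?A (0 + ?T \<alpha> + ?h) - ?A (0 + ?T \<alpha>))"
    by (intro pdeg_affine[where \<Phi> = "\<lambda>\<psi>. ?A (\<psi> + ?h) - ?A \<psi>" and T = ?T and B = "hom (su u V) (su u W)"]
        hom_fsub hom_0 O s u i2_q2_hom i2_q2_add)
  then have "pdeg e (hom V W) (N (su u W)) (\<lambda>\<alpha>. ?A (ds u V W \<alpha>) - ?A (?T \<alpha>))"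
    by (subst pdeg_cong[OF hom_fsub[OF O]]) (auto simp: ds_split[OF u] add.commute)
  then have "pdeg e (hom V W) (shN u N act G W) (\<lambda>\<alpha>. ?A (ds u V W \<alpha>) - ?A (?T \<alpha>))"
    by (rule pdeg_mono[OF shN_fsub(3)[OF F N G u O(2)]])
  then have "pdeg e (hom V W) (shN u N act G W) (\<lambda>\<alpha>. (?A (ds u V W \<alpha>) - ?A (?T \<alpha>)) + ?A (?T \<alpha>))"
  proof (rule pdeg_add_in[OF hom_fsub[OF O] shN_fsub(1)[OF F N G u O(2)]])
    fix \<alpha> assume \<alpha>: "\<alpha> \<in> hom V W"
    have "?A (?T \<alpha>) = act W (su u W) (i2 u W) (act (su u V) W (\<alpha> \<bullet> q2 u V) p)"
      using functorD(5)[OF F cmp_hom[OF q2_hom[OF u O(1)] \<alpha>] i2_hom[OF u O(2)] p]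
        cmp_assoc[OF q2_hom[OF u O(1)] \<alpha> i2_hom[OF u O(2)]] by simp
    also have "\<dots> \<in> act W (su u W) (i2 u W) ` G W"
      by (rule imageI) (rule functorD(2)[OF F cmp_hom[OF q2_hom[OF u O(1)] \<alpha>] p])
    finally show "?A (?T \<alpha>) \<in> shN u N act G W" using shN_fsub(4)[OF F N G u O(2)] by blast
  qed
  then show "pdeg e (hom V W) (shN u N act G W) (\<lambda>\<psi>. ?A (ds u V W \<psi>))" by simp
qed

definition wqo_shifts :: "('o \<Rightarrow> 'p::ab_group_add set) \<Rightarrow> ('o \<Rightarrow> 'o \<Rightarrow> 'h \<Rightarrow> 'p \<Rightarrow> 'p) \<Rightarrow> ('o \<Rightarrow> 'p set) \<Rightarrow> ('o \<Rightarrow> 'p set) \<Rightarrow> bool" where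
  "wqo_shifts G act N M \<longleftrightarrow> (\<forall>u\<in>Ob. wqo_mod (shG u G) (shA u act) (shN u N act M))"

text \<open>The map \<open>\<phi> i\<close> is absorbed by shifting with \<open>su u U\<close> in
  place of \<open>u\<close>: the well-quasi-order there is applied to the image of
  \<open>p i\<close> under \<open>k i\<close>. Relations for all \<psi> and \<open>y\<close> follow
  from this single one by applying the map \<open>ev\<close>.\<close>

lemma wqo_shifts_pointed:
  assumes F: "is_functor G act" and N: "is_sub G act N" and M: "is_sub G act M" and M': "is_sub G act M'"
    and W: "wqo_shifts G act N M" and u: "u \<in> Ob"
  shows "pointed_wqo (shG u G) (shA u act) (shN u N act M') (shN u N act M)"
  unfolding pointed_wqo_def
proof (intro ballI allI impI)
  fix U and V :: "nat \<Rightarrow> 'o" and p \<phi> assume U: "U \<in> Ob" and "\<forall>i. p i \<in> shG u G (V i) \<and> \<phi> i \<in> hom (V i) U"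
  then have p: "\<And>i. p i \<in> G (su u (V i))" and \<phi>: "\<And>i. \<phi> i \<in> hom (V i) U" by (auto simp: shG_def)
  have V: "V i \<in> Ob" for i using hom_Ob[OF \<phi>] by simp
  define w where "w = su u U"
  have w: "w \<in> Ob" using su_Ob[OF u U] by (simp add: w_def)
  define k1 where "k1 i = i1 w (V i) \<bullet> i1 u U" for i
  \<comment> \<open>The map \<open>k i\<close> keeps \<open>u\<close> and sends \<open>V i\<close>
    both to \<open>U\<close>, by \<open>\<phi> i\<close>, and identically to itself.\<close>
  define k2 where "k2 i = i1 w (V i) \<bullet> (i2 u U \<bullet> \<phi> i) + i2 w (V i)" for i
  define k where "k i = co u (V i) (k1 i) (k2 i)" for i
  have iU: "i1 u U \<in> hom u w" "i2 u U \<bullet> \<phi> i \<in> hom (V i) w" for i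
    unfolding w_def by (rule i1_hom[OF u U]) (rule cmp_hom[OF \<phi> i2_hom[OF u U]])
  have k1: "k1 i \<in> hom u (su w (V i))" for i
    unfolding k1_def by (rule cmp_hom[OF iU(1) i1_hom[OF w V]])
  have k2: "k2 i \<in> hom (V i) (su w (V i))" for i
    unfolding k2_def by (rule hom_add[OF cmp_hom[OF iU(2) i1_hom[OF w V]] i2_hom[OF w V]])
  have k: "k i \<in> hom (su u (V i)) (su w (V i))" for i unfolding k_def by (rule co_hom[OF k1 k2])
  define pp where "pp i = act (su u (V i)) (su w (V i)) (k i) (p i)" for i
  have pp: "pp i \<in> G (su w (V i))" for i unfolding pp_def by (rule functorD(2)[OF F k p])
  have "\<exists>i j. i < j \<and> (\<exists>\<alpha>\<in>hom (V j) (V i). shA w act (V j) (V i) \<alpha> (pp j) - pp i \<in> shN w N act M (V i))"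
    using W w pp V unfolding wqo_shifts_def wqo_mod_def shG_def by blast
  then obtain i j \<alpha> where ij: "i < j" and \<alpha>: "\<alpha> \<in> hom (V j) (V i)"
    and d: "shA w act (V j) (V i) \<alpha> (pp j) - pp i \<in> shN w N act M (V i)" by blast
  from d obtain n m where n: "n \<in> N (su w (V i))" and m: "m \<in> M (V i)"
    and nm: "shA w act (V j) (V i) \<alpha> (pp j) - pp i = n + act (V i) (su w (V i)) (i2 w (V i)) m"
    unfolding shN_def by (auto elim!: ssumE)
  have mG: "m \<in> G (V i)" using m subD(2)[OF M V] by blast
  have nG: "n \<in> G (su w (V i))" using n subD(2)[OF N su_Ob[OF w V]] by blast
  define r where "r = act (V i) (su u (V i)) (i2 u (V i)) m"
  have r: "r \<in> shN u N act M (V i)" using m shN_fsub(4)[OF F N M u V] by (auto simp: r_def)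
  have "shA u act (V j) X (\<psi> \<bullet> \<phi> j + y \<bullet> \<alpha>) (p j) - shA u act (V i) X (\<psi> \<bullet> \<phi> i + y) (p i) - shA u act (V i) X y r
      \<in> shN u N act M' X" if \<psi>: "\<psi> \<in> hom U X" and y: "y \<in> hom (V i) X" for X \<psi> y
  proof -
    have X: "X \<in> Ob" using hom_Ob[OF y] by simp
    note iX = i1_hom[OF u X] i2_hom[OF u X]
    \<comment> \<open>Together with \<open>c\<close> the map \<open>ev\<close> evaluates: it is the
      identity on \<open>u\<close>, \<psi> on \<open>U\<close> and \<open>y\<close> on
      \<open>V i\<close>, each followed by the inclusion into \<open>su u X\<close>.\<close>
    define c where "c = co u U (i1 u X) (i2 u X \<bullet> \<psi>)"
    have \<psi>X: "i2 u X \<bullet> \<psi> \<in> hom U (su u X)" and yX: "i2 u X \<bullet> y \<in> hom (V i) (su u X)"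
      using cmp_hom[OF \<psi> iX(2)] cmp_hom[OF y iX(2)] by auto
    have c: "c \<in> hom w (su u X)" unfolding c_def w_def by (rule co_hom[OF iX(1) \<psi>X])
    have cU: "c \<bullet> i1 u U = i1 u X" "c \<bullet> i2 u U = i2 u X \<bullet> \<psi>"
      unfolding c_def using co_i1[OF iX(1) \<psi>X] co_i2[OF iX(1) \<psi>X] by auto
    have cp: "c \<bullet> (i2 u U \<bullet> \<phi> l) = i2 u X \<bullet> (\<psi> \<bullet> \<phi> l)" for l
      using cmp_assoc[OF \<phi> i2_hom[OF u U] c[unfolded w_def]] cmp_assoc[OF \<phi> \<psi> iX(2)] by (simp add: cU)
    define ev where "ev = co w (V i) c (i2 u X \<bullet> y)"
    have ev: "ev \<in> hom (su w (V i)) (su u X)" unfolding ev_def by (rule co_hom[OF c yX])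
    have gen: "co w (V l) c b \<bullet> k l = ds u (V l) X (\<psi> \<bullet> \<phi> l + z)"
      if b: "b = i2 u X \<bullet> z" and z: "z \<in> hom (V l) X" for l b z
    proof -
      have bh: "b \<in> hom (V l) (su u X)" unfolding b by (rule cmp_hom[OF z iX(2)])
      note cb = co_hom[OF c bh]
      have "co w (V l) c b \<bullet> k1 l = i1 u X"
        unfolding k1_def using cmp_assoc[OF iU(1) i1_hom[OF w V] cb] co_i1[OF c bh] cU by simp
      moreover have "co w (V l) c b \<bullet> k2 l = i2 u X \<bullet> (\<psi> \<bullet> \<phi> l + z)"
      proof -
        have "co w (V l) c b \<bullet> k2 l = co w (V l) c b \<bullet> (i1 w (V l) \<bullet> (i2 u U \<bullet> \<phi> l)) + co w (V l) c b \<bullet> i2 w (V l)"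
          unfolding k2_def by (rule cmp_add_right[OF cmp_hom[OF iU(2) i1_hom[OF w V]] i2_hom[OF w V] cb])
        also have "\<dots> = i2 u X \<bullet> (\<psi> \<bullet> \<phi> l) + i2 u X \<bullet> z"
          using cmp_assoc[OF iU(2) i1_hom[OF w V] cb] co_i1[OF c bh] co_i2[OF c bh] cp b by simp
        also have "\<dots> = i2 u X \<bullet> (\<psi> \<bullet> \<phi> l + z)" by (rule cmp_add_right[OF cmp_hom[OF \<phi> \<psi>] z iX(2), symmetric])
        finally show ?thesis .
      qed
      ultimately show ?thesis unfolding k_def ds_def by (simp add: cmp_co[OF k1 k2 cb])
    qed
    have evi: "ev \<bullet> k i = ds u (V i) X (\<psi> \<bullet> \<phi> i + y)" unfolding ev_def by (rule gen[OF refl y])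
    have evj: "(ev \<bullet> ds w (V j) (V i) \<alpha>) \<bullet> k j = ds u (V j) X (\<psi> \<bullet> \<phi> j + y \<bullet> \<alpha>)"
    proof -
      have "ev \<bullet> ds w (V j) (V i) \<alpha> = co w (V j) c ((i2 u X \<bullet> y) \<bullet> \<alpha>)"
        unfolding ev_def by (rule co_co_ds[OF c yX \<alpha>])
      then show ?thesis using gen[OF _ cmp_hom[OF \<alpha> y]] cmp_assoc[OF \<alpha> y iX(2)] by simp
    qed
    have ev2: "ev \<bullet> i2 w (V i) = i2 u X \<bullet> y" unfolding ev_def by (rule co_i2[OF c yX])
    note dsh = ds_hom[OF w \<alpha>]
    let ?E = "act (su w (V i)) (su u X) ev"
    have a1: "?E (shA w act (V j) (V i) \<alpha> (pp j)) = shA u act (V j) X (\<psi> \<bullet> \<phi> j + y \<bullet> \<alpha>) (p j)"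
      unfolding shA_def pp_def evj[symmetric]
      using functorD(5)[OF F k cmp_hom[OF dsh ev] p] functorD(5)[OF F dsh ev functorD(2)[OF F k p]] by simp
    have a2: "?E (pp i) = shA u act (V i) X (\<psi> \<bullet> \<phi> i + y) (p i)"
      unfolding shA_def pp_def evi[symmetric] using functorD(5)[OF F k ev p] by simp
    have a3: "?E (act (V i) (su w (V i)) (i2 w (V i)) m) = shA u act (V i) X y r"
      unfolding shA_def r_def act_ds_i2[OF F u y mG]
      using functorD(5)[OF F i2_hom[OF w V] ev mG] functorD(5)[OF F y iX(2) mG] ev2 by simp
    have g: "shA w act (V j) (V i) \<alpha> (pp j) \<in> G (su w (V i))" "act (V i) (su w (V i)) (i2 w (V i)) m \<in> G (su w (V i))"
      unfolding shA_def using functorD(2)[OF F dsh pp] functorD(2)[OF F i2_hom[OF w V] mG] by auto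
    have "?E (shA w act (V j) (V i) \<alpha> (pp j) - pp i) = ?E n + ?E (act (V i) (su w (V i)) (i2 w (V i)) m)"
      unfolding nm by (rule functor_add[OF F ev nG g(2)])
    then have "shA u act (V j) X (\<psi> \<bullet> \<phi> j + y \<bullet> \<alpha>) (p j) - shA u act (V i) X (\<psi> \<bullet> \<phi> i + y) (p i) - shA u act (V i) X y r = ?E n"
      using functorD(3)[OF F ev g(1) pp] by (simp add: a1 a2 a3)
    also have "\<dots> \<in> N (su u X)" by (rule subD(3)[OF N ev n])
    also have "N (su u X) \<subseteq> shN u N act M' X" by (rule shN_fsub(3)[OF F N M' u X])
    finally show ?thesis .
  qed
  then show "\<exists>i j. i < j \<and> (\<exists>\<alpha>\<in>hom (V j) (V i). \<exists>r\<in>shN u N act M (V i). \<forall>X. \<forall>\<psi>\<in>hom U X. \<forall>y\<in>hom (V i) X.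
      shA u act (V j) X (\<psi> \<bullet> \<phi> j + y \<bullet> \<alpha>) (p j) - shA u act (V i) X (\<psi> \<bullet> \<phi> i + y) (p i) - shA u act (V i) X y r
      \<in> shN u N act M' X)"
    using ij \<alpha> r by blast
qed

section \<open>Subfunctors are determined by one value\<close>

lemma factor_through_power:
  assumes O: "U \<in> Ob" "V \<in> Ob" and ab: "\<And>i. a i \<in> hom V U \<and> b i \<in> hom U V"
  shows "finite T \<Longrightarrow> card T \<le> m \<Longrightarrow> \<exists>f\<in>hom V (pw U m). \<exists>g\<in>hom (pw U m) V. (\<Sum>i\<in>T. b i \<bullet> a i) = g \<bullet> f"
proof (induction m arbitrary: T)
  case 0
  have "0 \<in> hom V U" "0 \<in> hom U V" using O hom_0 by auto
  then show ?case using 0 cmp_0_left[of 0 V U V] O by force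
next
  case (Suc m)
  note P = pw_Ob[OF O(1)]
  show ?case
  proof (cases "T = {}")
    case True
    have "0 \<in> hom V (pw U (Suc m))" "0 \<in> hom (pw U (Suc m)) V" by (rule hom_0; rule P O)+
    then show ?thesis using True cmp_0_left[of 0 V "pw U (Suc m)" V] O by force
  next
    case False
    then obtain i T' where T: "T = insert i T'" "i \<notin> T'" by (meson all_not_in_conv mk_disjoint_insert)
    then have "\<exists>f\<in>hom V (pw U m). \<exists>g\<in>hom (pw U m) V. (\<Sum>i\<in>T'. b i \<bullet> a i) = g \<bullet> f"
      using Suc.prems by (intro Suc.IH) auto
    then obtain f g where f: "f \<in> hom V (pw U m)" and g: "g \<in> hom (pw U m) V" and e: "(\<Sum>i\<in>T'. b i \<bullet> a i) = g \<bullet> f" by blast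
    have abi: "a i \<in> hom V U" "b i \<in> hom U V" using ab by auto
    have "(\<Sum>i\<in>T. b i \<bullet> a i) = co (pw U m) U g (b i) \<bullet> pr (pw U m) U f (a i)"
      unfolding co_pr[OF g abi(2) f abi(1)] using T Suc.prems e by simp
    moreover have "pr (pw U m) U f (a i) \<in> hom V (pw U (Suc m))" "co (pw U m) U g (b i) \<in> hom (pw U (Suc m)) V"
      using pr_hom[OF f abi(1)] co_hom[OF g abi(2)] by auto
    ultimately show ?thesis by blast
  qed
qed

text \<open>The identity of \<open>V\<close> is a sum of maps through \<open>I0\<close>, and modulo
  \<open>N\<close> the action has degree below \<open>e\<close>, so by
  \<open>pdeg_sum_determined\<close> only partial sums with fewer than \<open>e\<close> terms
  matter; each of them factors through \<open>pw I0 e\<close>.\<close>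

lemma determined_by_power:
  assumes F: "is_functor G act" and M: "is_sub G act M" and NM: "N V \<subseteq> M V"
    and deg: "pol_degree e G act N" and V: "V \<in> Ob" and x: "x \<in> G V"
    and res: "\<And>f. f \<in> hom V (pw I0 e) \<Longrightarrow> act V (pw I0 e) f x \<in> M (pw I0 e)"
  shows "x \<in> M V"
proof -
  obtain n :: nat and a b where ab: "\<forall>i. a i \<in> hom V I0 \<and> b i \<in> hom I0 V" and id: "idn V = (\<Sum>i<n. b i \<bullet> a i)"
    using I0_gen[OF V] by blast
  have "act V V (\<Sum>i<n. b i \<bullet> a i) x \<in> M V"
  proof (rule pdeg_sum_determined[where \<Phi> = "\<lambda>\<psi>. act V V \<psi> x" and c = "\<lambda>i. b i \<bullet> a i", OF hom_fsub[OF V V] subD(1)[OF M V] NM])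
    show "b i \<bullet> a i \<in> hom V V" for i using ab cmp_hom by blast
    show "pdeg e (hom V V) (N V) (\<lambda>\<psi>. act V V \<psi> x)" using deg V x unfolding pol_degree_def by blast
    fix T assume T: "T \<subseteq> {..<n}" "card T < e"
    obtain f g where f: "f \<in> hom V (pw I0 e)" and g: "g \<in> hom (pw I0 e) V" and fg: "(\<Sum>i\<in>T. b i \<bullet> a i) = g \<bullet> f"
      using factor_through_power[OF I0_Ob V, of a b T e] ab T finite_subset[OF T(1)] by auto
    show "act V V (\<Sum>i\<in>T. b i \<bullet> a i) x \<in> M V"
      unfolding fg functorD(5)[OF F f g x] by (rule subD(3)[OF M g res[OF f]])
  qed simp
  then show ?thesis using functorD(4)[OF F V x] by (simp add: id[symmetric])
qed

text \<open>Inclusions can thus be tested at the single finite group over \<open>pw I0 e\<close>,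
  and cardinality there measures progress in the descent.\<close>

lemma sub_determined_by_power:
  assumes F: "is_functor G act" and M: "is_sub G act M" and M': "is_sub G act M'"
    and NM: "\<And>V. V \<in> Ob \<Longrightarrow> N V \<subseteq> M V" and deg: "pol_degree e G act N"
    and D: "M' (pw I0 e) \<subseteq> M (pw I0 e)" and V: "V \<in> Ob"
  shows "M' V \<subseteq> M V"
proof
  fix x assume x: "x \<in> M' V"
  show "x \<in> M V"
    by (rule determined_by_power[OF F M NM[OF V] deg V]) (use x subD[OF M'] V D in blast)+
qed

text \<open>The largest subfunctor of \<open>M\<close> whose value at \<open>U\<close>, embedded by
  \<open>i2\<close>, is annihilated by \<theta>; quantifying over all \<psi> makes it stable under
  maps.\<close>

definition ortho :: "'o \<Rightarrow> 'o \<Rightarrow> ('o \<Rightarrow> 'o \<Rightarrow> 'h \<Rightarrow> 'p \<Rightarrow> 'p) \<Rightarrow> ('p \<Rightarrow> complex) \<Rightarrow> ('o \<Rightarrow> 'p::ab_group_add set) \<Rightarrow> 'o \<Rightarrow> 'p set" where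
  "ortho u U act \<theta> M = (\<lambda>W. {m \<in> M W. \<forall>\<psi>\<in>hom W U. \<theta> (act U (su u U) (i2 u U) (act W U \<psi> m)) = 1})"

lemma ortho_sub:
  assumes F: "is_functor G act" and M: "is_sub G act M" and u: "u \<in> Ob" and U: "U \<in> Ob"
    and \<theta>: "\<theta> \<in> chars (G (su u U)) Z"
  shows "is_sub G act (ortho u U act \<theta> M)"
  unfolding is_sub_def
proof (intro conjI ballI allI impI)
  note i = i2_hom[OF u U]
  have Gs: "fsub (G (su u U))" by (rule functorD(1)[OF F su_Ob[OF u U]])
  fix V assume V: "V \<in> Ob"
  note MG = subD(2)[OF M V]
  show "ortho u U act \<theta> M V \<subseteq> G V" using MG by (auto simp: ortho_def)
  have "0 \<in> ortho u U act \<theta> M V"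
    using fsub_0[OF subD(1)[OF M V]] functor_0[OF F] i chars_0[OF \<theta> Gs] by (simp add: ortho_def)
  moreover have "x - y \<in> ortho u U act \<theta> M V" if x: "x \<in> ortho u U act \<theta> M V" and y: "y \<in> ortho u U act \<theta> M V" for x y
  proof -
    have xy: "x \<in> G V" "y \<in> G V" using x y MG by (auto simp: ortho_def)
    have "\<theta> (act U (su u U) (i2 u U) (act V U \<psi> (x - y))) = 1" if \<psi>: "\<psi> \<in> hom V U" for \<psi>
    proof -
      note xy' = functorD(2)[OF F \<psi> xy(1)] functorD(2)[OF F \<psi> xy(2)]
      have "act U (su u U) (i2 u U) (act V U \<psi> (x - y)) = act U (su u U) (i2 u U) (act V U \<psi> x) - act U (su u U) (i2 u U) (act V U \<psi> y)"
        by (simp add: functorD(3)[OF F \<psi> xy] functorD(3)[OF F i xy'])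
      then show ?thesis
        using chars_diff[OF \<theta> Gs functorD(2)[OF F i xy'(1)] functorD(2)[OF F i xy'(2)]] x y \<psi> by (simp add: ortho_def)
    qed
    then show ?thesis using x y fsub_diff[OF subD(1)[OF M V]] by (auto simp: ortho_def)
  qed
  moreover have "finite (ortho u U act \<theta> M V)" using fsub_finite[OF subD(1)[OF M V]] by (simp add: ortho_def)
  ultimately show "fsub (ortho u U act \<theta> M V)" by (auto simp: fsub_def)
next
  fix V W f p assume f: "f \<in> hom V W" and p: "p \<in> ortho u U act \<theta> M V"
  have V: "V \<in> Ob" using hom_Ob[OF f] by simp
  have pM: "p \<in> M V" and pG: "p \<in> G V" using p subD(2)[OF M V] by (auto simp: ortho_def)
  have "\<theta> (act U (su u U) (i2 u U) (act W U \<psi> (act V W f p))) = 1" if \<psi>: "\<psi> \<in> hom W U" for \<psi>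
    using p cmp_hom[OF f \<psi>] unfolding functorD(5)[OF F f \<psi> pG, symmetric] by (simp add: ortho_def)
  then show "act V W f p \<in> ortho u U act \<theta> M W" using subD(3)[OF M f pM] by (simp add: ortho_def)
qed

text \<open>
  A maximal proper subfunctor \<open>M'\<close> of \<open>M\<close> makes \<open>M / M'\<close> simple, so a character that is trivial on
  \<open>M'\<close> but not on \<open>M\<close> detects all of \<open>M / M'\<close>.
\<close>

lemma maximal_sub_detected:
  assumes F: "is_functor G act" and N: "is_sub G act N" and M: "is_sub G act M" and M': "is_sub G act M'"
    and NM: "\<And>V. V \<in> Ob \<Longrightarrow> N V \<subseteq> M' V" and MM: "\<And>V. V \<in> Ob \<Longrightarrow> M' V \<subseteq> M V"
    and deg: "pol_degree e G act N" and D: "D = pw I0 e"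
    and max: "\<And>L. is_sub G act L \<Longrightarrow> (\<And>V. V \<in> Ob \<Longrightarrow> N V \<subseteq> L V) \<Longrightarrow> (\<And>V. V \<in> Ob \<Longrightarrow> L V \<subseteq> M V) \<Longrightarrow> L D \<noteq> M D \<Longrightarrow>
      card (L D) \<le> card (M' D)"
    and O: "u \<in> Ob" "U \<in> Ob" "V \<in> Ob" and \<theta>: "\<theta> \<in> chars (shG u G U) (shN u N act M' U)"
    and s: "s \<in> shN u N act M U" "\<theta> s \<noteq> 1" and r: "r \<in> shN u N act M V"
    and triv: "\<And>\<psi>. \<psi> \<in> hom V U \<Longrightarrow> \<theta> (shA u act V U \<psi> r) = 1"
  shows "r \<in> shN u N act M' V"
proof -
  have Do: "D \<in> Ob" unfolding D by (rule pw_Ob[OF I0_Ob])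
  have \<theta>': "\<theta> \<in> chars (G (su u U)) (shN u N act M' U)" using \<theta> by (simp add: shG_def)
  define L where "L = ortho u U act \<theta> M"
  have L: "is_sub G act L" unfolding L_def by (rule ortho_sub[OF F M O(1,2) \<theta>'])
  have LM: "L W \<subseteq> M W" for W by (auto simp: L_def ortho_def)
  have MsL: "M' W \<subseteq> L W" if W: "W \<in> Ob" for W
  proof
    fix x assume x: "x \<in> M' W"
    have "\<theta> (act U (su u U) (i2 u U) (act W U \<psi> x)) = 1" if "\<psi> \<in> hom W U" for \<psi>
      using charsD(3)[OF \<theta>'] shN_fsub(4)[OF F N M' O(1,2)] subD(3)[OF M' that x] by blast
    then show "x \<in> L W" using x MM[OF W] by (auto simp: L_def ortho_def)
  qed
  note i = i2_hom[OF O(1,2)]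
  have split1: "\<theta> (n + act U (su u U) (i2 u U) m) = \<theta> (act U (su u U) (i2 u U) m)" if n: "n \<in> N (su u U)" and m: "m \<in> M U" for n m
  proof -
    have "n \<in> G (su u U)" using n subD(2)[OF N su_Ob[OF O(1,2)]] by blast
    moreover have "act U (su u U) (i2 u U) m \<in> G (su u U)" using m subD(2)[OF M O(2)] functorD(2)[OF F i] by blast
    moreover have "\<theta> n = 1" using charsD(3)[OF \<theta>'] shN_fsub(3)[OF F N M' O(1,2)] n by blast
    ultimately show ?thesis using charsD(1)[OF \<theta>'] by simp
  qed
  \<comment> \<open>Otherwise \<open>M\<close> would be contained in \<open>L\<close>, and testing
    the component of \<open>s\<close> in \<open>M U\<close> with the identity would give
    \<open>\<theta> s = 1\<close>.\<close>
  have "L D \<noteq> M D"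
  proof
    assume "L D = M D"
    then have "M U \<subseteq> L U"
      using sub_determined_by_power[OF F L M _ deg _ O(2)] NM MsL D by blast
    moreover obtain n m where n: "n \<in> N (su u U)" and m: "m \<in> M U" and "s = n + act U (su u U) (i2 u U) m"
      using s(1) unfolding shN_def by (auto elim!: ssumE)
    ultimately have "\<theta> (act U (su u U) (i2 u U) m) = 1"
      using idn_hom[OF O(2)] functorD(4)[OF F O(2), of m] subD(2)[OF M O(2)]
      by (auto simp: L_def ortho_def dest!: subsetD[of _ _ m] bspec[of _ _ "idn U"])
    then show False using s(2) split1[OF n m] \<open>s = _\<close> by simp
  qed
  \<comment> \<open>Maximality squeezes \<open>L\<close> down to \<open>M'\<close> at
    \<open>D\<close>, hence everywhere; so the part of \<open>M\<close> that \<theta> does not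
    detect lies in \<open>M'\<close>.\<close>
  then have "card (L D) \<le> card (M' D)" using NM MsL LM by (intro max[OF L]) blast+
  then have "M' D = L D" using MsL[OF Do] fsub_finite[OF subD(1)[OF L Do]] by (intro card_subset_eq) (auto intro: le_antisym card_mono)
  then have LV: "L V \<subseteq> M' V" by (intro sub_determined_by_power[OF F M' L NM deg _ O(3)]) (simp_all add: D)
  from r obtain n m where n: "n \<in> N (su u V)" and m: "m \<in> M V" and re: "r = n + act V (su u V) (i2 u V) m"
    unfolding shN_def by (auto elim!: ssumE)
  have mG: "m \<in> G V" and nG: "n \<in> G (su u V)" using m n subD(2)[OF M O(3)] subD(2)[OF N su_Ob[OF O(1,3)]] by auto
  have "\<theta> (act U (su u U) (i2 u U) (act V U \<psi> m)) = 1" if \<psi>: "\<psi> \<in> hom V U" for \<psi>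
  proof -
    note dsh = ds_hom[OF O(1) \<psi>]
    have "shA u act V U \<psi> r = act (su u V) (su u U) (ds u V U \<psi>) n + act U (su u U) (i2 u U) (act V U \<psi> m)"
      unfolding shA_def re using functor_add[OF F dsh nG functorD(2)[OF F i2_hom[OF O(1,3)] mG]] act_ds_i2[OF F O(1) \<psi> mG] by simp
    then show ?thesis using triv[OF \<psi>] split1[OF subD(3)[OF N dsh n] subD(3)[OF M \<psi> m]] by simp
  qed
  then have "m \<in> M' V" using m LV by (auto simp: L_def ortho_def)
  then show ?thesis unfolding re shN_def using n by (intro ssumI imageI)
qed

section \<open>The induction on the degree\<close>

lemma wqo_shifts_imp:
  assumes F: "is_functor G act" and N: "is_sub G act N" and M: "is_sub G act M"
    and MN: "\<And>V. V \<in> Ob \<Longrightarrow> M V \<subseteq> N V" and W: "wqo_shifts G act N M"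
  shows "wqo_mod G act N"
  unfolding wqo_mod_def
proof (intro allI impI)
  fix V :: "nat \<Rightarrow> 'o" and p assume "\<forall>i. V i \<in> Ob \<and> p i \<in> G (V i)"
  then have V: "\<And>i. V i \<in> Ob" and p: "\<And>i. p i \<in> G (V i)" by auto
  note u = I0_Ob
  define P where "P i = act (V i) (su I0 (V i)) (i2 I0 (V i)) (p i)" for i
  have P: "P i \<in> G (su I0 (V i))" for i unfolding P_def by (rule functorD(2)[OF F i2_hom[OF u V] p])
  have "\<exists>i j. i < j \<and> (\<exists>\<alpha>\<in>hom (V j) (V i). shA I0 act (V j) (V i) \<alpha> (P j) - P i \<in> shN I0 N act M (V i))"
    using W u P V unfolding wqo_shifts_def wqo_mod_def shG_def by blast
  then obtain i j \<alpha> where ij: "i < j" and \<alpha>: "\<alpha> \<in> hom (V j) (V i)"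
    and d: "shA I0 act (V j) (V i) \<alpha> (P j) - P i \<in> shN I0 N act M (V i)" by blast
  from d obtain n m where n: "n \<in> N (su I0 (V i))" and m: "m \<in> M (V i)"
    and nm: "shA I0 act (V j) (V i) \<alpha> (P j) - P i = n + act (V i) (su I0 (V i)) (i2 I0 (V i)) m"
    unfolding shN_def by (auto elim!: ssumE)
  have mG: "m \<in> G (V i)" and nG: "n \<in> G (su I0 (V i))"
    using m n subD(2)[OF M V] subD(2)[OF N su_Ob[OF u V]] by auto
  note q = q2_hom[OF u V] and i2 = i2_hom[OF u V]
  have retr: "act (su I0 (V i)) (V i) (q2 I0 (V i)) (act (V i) (su I0 (V i)) (i2 I0 (V i)) x) = x" if "x \<in> G (V i)" for x
    using functorD(5)[OF F i2 q that] functorD(4)[OF F V that] q2_i2[OF u V] by simp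
  have e1: "shA I0 act (V j) (V i) \<alpha> (P j) = act (V i) (su I0 (V i)) (i2 I0 (V i)) (act (V j) (V i) \<alpha> (p j))"
    unfolding shA_def P_def by (rule act_ds_i2[OF F u \<alpha> p])
  note ap = functorD(2)[OF F \<alpha> p]
  note g = functorD(2)[OF F i2 ap] functorD(2)[OF F i2 mG]
  have "act (V j) (V i) \<alpha> (p j) - p i = act (su I0 (V i)) (V i) (q2 I0 (V i)) (shA I0 act (V j) (V i) \<alpha> (P j) - P i)"
    unfolding e1 functorD(3)[OF F q g(1) P] retr[OF ap] unfolding P_def retr[OF p] ..
  also have "\<dots> = act (su I0 (V i)) (V i) (q2 I0 (V i)) n + m"
    unfolding nm functor_add[OF F q nG g(2)] retr[OF mG] ..
  also have "\<dots> \<in> N (V i)"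
    using MN[OF V] m by (intro fsub_add[OF subD(1)[OF N V] subD(3)[OF N q n]]) auto
  finally show "\<exists>i j. i < j \<and> (\<exists>\<alpha>\<in>hom (V j) (V i). act (V j) (V i) \<alpha> (p j) - p i \<in> N (V i))"
    using ij \<alpha> by blast
qed

text \<open>Shifting modulo the image of \<open>G\<close> lowers the degree, which starts the
  descent at \<open>M = G\<close>. The induction quantifies over \<open>G\<close>,
  \<open>act\<close> and \<open>N\<close>, since its hypothesis is applied to the shifted functors
  and subfunctors.\<close>

theorem wqo_mod_pol_degree:
  "is_functor G act \<Longrightarrow> is_sub G act N \<Longrightarrow> pol_degree e G act N \<Longrightarrow> wqo_mod G act N"
proof (induction e arbitrary: G act N)
  case 0
  show ?case unfolding wqo_mod_def
  proof (intro allI impI)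
    fix V :: "nat \<Rightarrow> 'o" and p assume Vp: "\<forall>i. V i \<in> Ob \<and> p i \<in> G (V i)"
    have in_N: "act (V i) (V j) f (p i) \<in> N (V j)" if "f \<in> hom (V i) (V j)" for i j f
      using 0(3) Vp that unfolding pol_degree_def by auto
    have V: "V 0 \<in> Ob" "V 1 \<in> Ob" using Vp by auto
    have "p 0 \<in> N (V 0)" using in_N[OF idn_hom[OF V(1)]] functorD(4)[OF 0(1) V(1)] Vp by simp
    then have "act (V 1) (V 0) 0 (p 1) - p 0 \<in> N (V 0)"
      by (intro fsub_diff[OF subD(1)[OF 0(2) V(1)]] in_N hom_0 V)
    then show "\<exists>i j. i < j \<and> (\<exists>\<alpha>\<in>hom (V j) (V i). act (V j) (V i) \<alpha> (p j) - p i \<in> N (V i))"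
      using hom_0[OF V(2,1)] by (intro exI[of _ "0::nat"] exI[of _ "1::nat"] conjI bexI[of _ 0]) simp_all
  qed
next
  case (Suc e)
  note F = Suc.prems(1) and N = Suc.prems(2) and deg = Suc.prems(3)
  define D where "D = pw I0 (Suc e)"
  have Do: "D \<in> Ob" unfolding D_def by (rule pw_Ob[OF I0_Ob])
  \<comment> \<open>This records the progress of the descent: all shifts are well-quasi-ordered
    modulo \<open>N\<close> and the image of \<open>M\<close>. A good \<open>M\<close> of least
    cardinality at \<open>D\<close> will turn out to agree with \<open>N\<close> there.\<close>
  define good where "good M \<longleftrightarrow> is_sub G act M \<and> (\<forall>V\<in>Ob. N V \<subseteq> M V) \<and> wqo_shifts G act N M" for M
  have G: "is_sub G act G" using functorD[OF F] by (auto simp: is_sub_def)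
  have "wqo_shifts G act N G"
    unfolding wqo_shifts_def
    by (intro ballI Suc.IH shift_functor[OF F] shift_sub[OF F N G] pol_degree_shift_less[OF F N _ deg])
  then have "good G" using G subD(2)[OF N] by (auto simp: good_def)
  then obtain M where M: "good M" and M_min: "\<And>L. good L \<Longrightarrow> card (M D) \<le> card (L D)"
    using ex_has_least_nat[of good G "\<lambda>M. card (M D)"] by blast
  then have Ms: "is_sub G act M" and NM: "\<And>V. V \<in> Ob \<Longrightarrow> N V \<subseteq> M V" and MW: "wqo_shifts G act N M" by (auto simp: good_def)
  show ?case
  proof (cases "M D = N D")
    case True
    have "M V \<subseteq> N V" if "V \<in> Ob" for V
      by (rule sub_determined_by_power[OF F N Ms _ deg _ that]) (use True D_def in auto)
    then show ?thesis by (rule wqo_shifts_imp[OF F N Ms _ MW])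
  next
    case False
    \<comment> \<open>Properness is expressed at \<open>D\<close>, where cardinality decides
      equality of nested groups; a candidate that is largest at \<open>D\<close> is maximal in the
      sense of \<open>maximal_sub_detected\<close>.\<close>
    define cand where "cand L \<longleftrightarrow> is_sub G act L \<and> (\<forall>V\<in>Ob. N V \<subseteq> L V) \<and> (\<forall>V\<in>Ob. L V \<subseteq> M V) \<and> L D \<noteq> M D" for L
    have fin: "finite (M D)" by (rule fsub_finite[OF subD(1)[OF Ms Do]])
    have candN: "cand N" using N NM False by (auto simp: cand_def)
    have bound: "card (L D) \<le> card (M D)" if "cand L" for L using that Do by (intro card_mono[OF fin]) (auto simp: cand_def)
    obtain M' where M': "cand M'" and M'_max: "\<And>L. cand L \<Longrightarrow> card (L D) \<le> card (M' D)"
      using ex_has_greatest_nat[of cand N "\<lambda>L. card (L D)" "Suc (card (M D))"] candN bound le_imp_less_Suc by blast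
    have M's: "is_sub G act M'" "\<And>V. V \<in> Ob \<Longrightarrow> N V \<subseteq> M' V" "\<And>V. V \<in> Ob \<Longrightarrow> M' V \<subseteq> M V" "M' D \<noteq> M D"
      using M' by (auto simp: cand_def)
    have "wqo_mod (shG u G) (shA u act) (shN u N act M')" if u: "u \<in> Ob" for u
    proof (rule wqo_mod_refine[OF shift_functor[OF F u] shift_sub[OF F N Ms u] shift_sub[OF F N M's(1) u] _
          pol_degree_shift[OF F N M's(1) u deg] _ wqo_shifts_pointed[OF F N Ms M's(1) MW u]])
      show "shN u N act M' V \<subseteq> shN u N act M V" if "V \<in> Ob" for V
        using M's(3)[OF that] unfolding shN_def by (auto elim!: ssumE intro!: ssumI)
      show "r \<in> shN u N act M' V"
        if h: "U \<in> Ob" "V \<in> Ob" "\<theta> \<in> chars (shG u G U) (shN u N act M' U)" "\<exists>s\<in>shN u N act M U. \<theta> s \<noteq> 1" "r \<in> shN u N act M V"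
          "\<And>\<psi>. \<psi> \<in> hom V U \<Longrightarrow> \<theta> (shA u act V U \<psi> r) = 1" for U V \<theta> r
      proof -
        obtain s where s: "s \<in> shN u N act M U" "\<theta> s \<noteq> 1" using h(4) by blast
        show ?thesis
          by (rule maximal_sub_detected[OF F N Ms M's(1,2,3) deg D_def _ u h(1,2,3) s h(5,6)])
            (assumption | rule M'_max, simp add: cand_def)+
      qed
    qed
    then have "good M'" using M's by (simp add: good_def wqo_shifts_def)
    then have "card (M D) \<le> card (M' D)" by (rule M_min)
    moreover have "card (M' D) < card (M D)" using M's(3)[OF Do] M's(4) by (intro psubset_card_mono[OF fin]) auto
    ultimately show ?thesis by simp
  qed
qed

end

section \<open>Finite vector spaces as additive category\<close>

definition enc :: "('k, 'a, 'm) module_scheme \<Rightarrow> 'a \<Rightarrow> ('a \<Rightarrow> circle) \<Rightarrow> circle" where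
  "enc M = embed_group (add_monoid M)"

definition dec :: "('k, 'a, 'm) module_scheme \<Rightarrow> (('a \<Rightarrow> circle) \<Rightarrow> circle) \<Rightarrow> 'a" where
  "dec M = inv_into (carrier M) (enc M)"

definition fvs :: "('k, 'n) ring_scheme \<Rightarrow> ('k, 'a, 'm) module_scheme \<Rightarrow> bool" where
  "fvs K M \<longleftrightarrow> vectorspace K M \<and> finite (carrier M)"

lemma fvsD:
  assumes "fvs K M"
  shows "vectorspace K M" "module K M" "abelian_group M" "finite (carrier M)" "cring K"
proof -
  show v: "vectorspace K M" and "finite (carrier M)" using assms by (simp_all add: fvs_def)
  show m: "module K M" by (rule vectorspace.axioms(1)[OF v])
  show "cring K" "abelian_group M" by (rule module.axioms[OF m])+
qed

lemma enc_add:
  "x \<in> carrier M \<Longrightarrow> y \<in> carrier M \<Longrightarrow> enc M (x \<oplus>\<^bsub>M\<^esub> y) = enc M x + enc M y"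
  using embed_group_mult[of x "add_monoid M" y] by (simp add: enc_def)

lemma enc_inj: "abelian_group M \<Longrightarrow> finite (carrier M) \<Longrightarrow> inj_on (enc M) (carrier M)"
  using comm_group.embed_group_inj[OF abelian_group.a_comm_group, of M] by (simp add: enc_def)

lemma enc_zero: "abelian_group M \<Longrightarrow> enc M \<zero>\<^bsub>M\<^esub> = 0"
proof -
  assume "abelian_group M"
  then interpret abelian_group M .
  show ?thesis using enc_add[of "\<zero>\<^bsub>M\<^esub>" M "\<zero>\<^bsub>M\<^esub>"] by simp
qed

lemma dec_enc: "abelian_group M \<Longrightarrow> finite (carrier M) \<Longrightarrow> x \<in> carrier M \<Longrightarrow> dec M (enc M x) = x"
  unfolding dec_def by (rule inv_into_f_f[OF enc_inj])

lemma enc_minus: "abelian_group M \<Longrightarrow> x \<in> carrier M \<Longrightarrow> y \<in> carrier M \<Longrightarrow> enc M (x \<ominus>\<^bsub>M\<^esub> y) = enc M x - enc M y"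
proof -
  assume "abelian_group M" and xy: "x \<in> carrier M" "y \<in> carrier M"
  then interpret abelian_group M by simp
  have "(x \<ominus>\<^bsub>M\<^esub> y) \<oplus>\<^bsub>M\<^esub> y = x" using xy by (simp add: a_minus_def a_assoc l_neg)
  then have "enc M (x \<ominus>\<^bsub>M\<^esub> y) + enc M y = enc M x" using enc_add[of "x \<ominus>\<^bsub>M\<^esub> y" M y] xy by simp
  then show ?thesis by (simp add: algebra_simps)
qed

lemma enc_fsub: "abelian_group M \<Longrightarrow> finite (carrier M) \<Longrightarrow> fsub (enc M ` carrier M)"
proof -
  assume M: "abelian_group M" "finite (carrier M)"
  then interpret abelian_group M by simp
  have "a - b \<in> enc M ` carrier M" if ab: "a \<in> enc M ` carrier M" "b \<in> enc M ` carrier M" for a b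
  proof -
    obtain x y where "x \<in> carrier M" "y \<in> carrier M" "a = enc M x" "b = enc M y" using ab by blast
    then show ?thesis using enc_minus[OF M(1), of x y] by (intro image_eqI[of _ _ "x \<ominus>\<^bsub>M\<^esub> y"]) simp_all
  qed
  moreover have "0 \<in> enc M ` carrier M" using imageI[OF zero_closed, of "enc M"] by (simp add: enc_zero[OF M(1)])
  ultimately show ?thesis using M by (simp add: fsub_def)
qed

lemma enc_finsum:
  assumes "abelian_group M"
  shows "finite F \<Longrightarrow> (\<And>i. i \<in> F \<Longrightarrow> x i \<in> carrier M) \<Longrightarrow> enc M (\<Oplus>\<^bsub>M\<^esub>i\<in>F. x i) = (\<Sum>i\<in>F. enc M (x i))"
proof (induction F rule: finite_induct)
  interpret abelian_group M by fact
  case empty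
  then show ?case by (simp add: enc_zero[OF assms])
next
  interpret abelian_group M by fact
  case (insert i F)
  then have "(\<Oplus>\<^bsub>M\<^esub>i\<in>insert i F. x i) = x i \<oplus>\<^bsub>M\<^esub> (\<Oplus>\<^bsub>M\<^esub>i\<in>F. x i)" by (intro finsum_insert) auto
  moreover have "(\<Oplus>\<^bsub>M\<^esub>i\<in>F. x i) \<in> carrier M" using insert by (intro finsum_closed) auto
  ultimately show ?case using insert by (simp add: enc_add)
qed

lemma module_hom_comp: "f \<in> module_hom K U V \<Longrightarrow> g \<in> module_hom K V W \<Longrightarrow> (\<lambda>x. g (f x)) \<in> module_hom K U W"
  by (auto simp: module_hom_def Pi_iff)

lemma restrict_in_Hom:
  assumes f: "f \<in> module_hom K U V" and U: "module K U"
  shows "restrict f (carrier U) \<in> Hom K U V"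
proof -
  interpret module K U by fact
  show ?thesis using f by (auto simp: Hom_def module_hom_def Pi_iff)
qed

locale fin_field = field K for K (structure) +
  assumes finite_K: "finite (carrier K)"
begin

lemma fvs_fin_dim:
  assumes V: "fvs K V"
  shows "vectorspace.fin_dim K V"
proof -
  interpret vectorspace K V by (rule fvsD(1)[OF V])
  have "span (carrier V) = carrier V"
    by (rule subset_antisym[OF span_is_subset2 in_own_span]) simp_all
  then show ?thesis unfolding fin_dim_def using fvsD(4)[OF V] by blast
qed

text \<open>A finite spanning set has only finitely many coefficient families. The equivalence turns
  Hom spaces and the values of \<open>P\<close> into finite groups.\<close>

lemma fvs_Vec: "V \<in> Vec K \<longleftrightarrow> fvs K V"
proof
  assume "V \<in> Vec K"
  then have vs: "vectorspace K V" and fd: "vectorspace.fin_dim K V" by (simp_all add: Vec_def)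
  interpret vectorspace K V by fact
  obtain A where A: "finite A" "A \<subseteq> carrier V" "gen_set A" using fd by (auto simp: fin_dim_def)
  have "carrier V = (\<lambda>a. lincomb a A) ` (A \<rightarrow>\<^sub>E carrier K)"
  proof
    show "carrier V \<subseteq> (\<lambda>a. lincomb a A) ` (A \<rightarrow>\<^sub>E carrier K)"
    proof
      fix v assume "v \<in> carrier V"
      then obtain a where a: "a \<in> A \<rightarrow> carrier K" "v = lincomb a A" using A(3) unfolding finite_span[OF A(1,2)] by blast
      have "lincomb (restrict a A) A = lincomb a A" using a A by (intro lincomb_cong) auto
      then show "v \<in> (\<lambda>a. lincomb a A) ` (A \<rightarrow>\<^sub>E carrier K)" using a by (intro image_eqI[of _ _ "restrict a A"]) auto
    qed
    show "(\<lambda>a. lincomb a A) ` (A \<rightarrow>\<^sub>E carrier K) \<subseteq> carrier V"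
      using A(1,2) by (auto intro!: lincomb_closed simp: PiE_def)
  qed
  moreover have "finite (A \<rightarrow>\<^sub>E carrier K)" by (intro finite_PiE A finite_K)
  ultimately show "fvs K V" using vs by (simp add: fvs_def)
next
  assume V: "fvs K V"
  then show "V \<in> Vec K" using fvsD(1)[OF V] fvs_fin_dim[OF V] by (simp add: Vec_def)
qed

text \<open>The structure is carried over along a bijection onto some subset of the universe with
  the right number of elements, which exists because the universe is infinite. This is how direct
  sums, the line and the zero space get copies in \<open>Vec K\<close>.\<close>

lemma transport:
  assumes M: "fvs K (M :: ('a, 'c) module)" and inf: "infinite (UNIV :: 'v set)"
  shows "\<exists>V j j'. V \<in> (Vec K :: ('a, 'v) module set) \<and> j \<in> module_hom K M V \<and> j' \<in> module_hom K V M \<and>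
    (\<forall>x\<in>carrier M. j' (j x) = x) \<and> (\<forall>y\<in>carrier V. j (j' y) = y)"
proof -
  interpret M: vectorspace K M by (rule fvsD(1)[OF M])
  obtain B :: "'v set" where "finite B" "card B = card (carrier M)"
    using infinite_arbitrarily_large[OF inf] by blast
  then obtain j where j: "bij_betw j (carrier M) B" using fvsD(4)[OF M] finite_same_card_bij by metis
  define j' where "j' = inv_into (carrier M) j"
  have j'j: "j' (j x) = x" if "x \<in> carrier M" for x using j that by (simp add: j'_def bij_betw_inv_into_left)
  have jj': "j (j' y) = y" if "y \<in> B" for y using j that by (simp add: j'_def bij_betw_inv_into_right)
  have j'B: "j' y \<in> carrier M" if "y \<in> B" for y using j that by (metis bij_betw_inv_into bij_betwE j'_def)
  have jB: "j x \<in> B" if "x \<in> carrier M" for x using j that by (metis bij_betwE)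
  define V :: "('a, 'v) module" where "V = \<lparr>carrier = B, mult = undefined, one = undefined, zero = j \<zero>\<^bsub>M\<^esub>,
    add = (\<lambda>x y. j (j' x \<oplus>\<^bsub>M\<^esub> j' y)), smult = (\<lambda>c x. j (c \<odot>\<^bsub>M\<^esub> j' x))\<rparr>"
  have "vectorspace K V"
  proof (rule vs_criteria)
    show "\<forall>v\<in>carrier V. \<exists>neg_v\<in>carrier V. v \<oplus>\<^bsub>V\<^esub> neg_v = \<zero>\<^bsub>V\<^esub>"
    proof
      fix v assume "v \<in> carrier V"
      then have "v \<in> B" by (simp add: V_def)
      then show "\<exists>neg_v\<in>carrier V. v \<oplus>\<^bsub>V\<^esub> neg_v = \<zero>\<^bsub>V\<^esub>"
        by (intro bexI[of _ "j (\<ominus>\<^bsub>M\<^esub> j' v)"]) (auto simp: V_def j'j j'B jB M.M.r_neg)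
    qed
  qed (auto simp: V_def j'j jj' j'B jB M.M.a_assoc M.M.a_lcomm M.smult_assoc1 M.smult_l_distr M.smult_r_distr M.M.a_comm
      field_axioms)
  then have "V \<in> Vec K" unfolding fvs_Vec using \<open>finite B\<close> by (simp add: fvs_def V_def)
  moreover have "j \<in> module_hom K M V" "j' \<in> module_hom K V M"
    by (auto simp: module_hom_def V_def j'j jB j'B)
  ultimately show ?thesis using j'j jj' by (intro exI[of _ V] exI[of _ j] exI[of _ j']) (auto simp: V_def)
qed

lemma fvs_direct_sum:
  assumes "fvs K U" "fvs K V"
  shows "fvs K (direct_sum U V)"
proof -
  have "carrier (direct_sum U V) = carrier U \<times> carrier V" by (simp add: direct_sum_def)
  then show ?thesis
    using direct_sum_is_vs[OF fvsD(1)[OF assms(1)] fvsD(1)[OF assms(2)]] fvsD(4)[OF assms(1)] fvsD(4)[OF assms(2)]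
    unfolding fvs_def by (metis finite_cartesian_product)
qed

lemma biproduct_exists:
  assumes U: "U \<in> Vec K" and V: "V \<in> (Vec K :: ('a, 'v) module set)" and inf: "infinite (UNIV :: 'v set)"
  shows "\<exists>W i1 i2 q1 q2. W \<in> (Vec K :: ('a, 'v) module set) \<and> i1 \<in> module_hom K U W \<and> i2 \<in> module_hom K V W \<and>
    q1 \<in> module_hom K W U \<and> q2 \<in> module_hom K W V \<and>
    (\<forall>x\<in>carrier U. q1 (i1 x) = x \<and> q2 (i1 x) = \<zero>\<^bsub>V\<^esub>) \<and> (\<forall>x\<in>carrier V. q2 (i2 x) = x \<and> q1 (i2 x) = \<zero>\<^bsub>U\<^esub>) \<and>
    (\<forall>w\<in>carrier W. i1 (q1 w) \<oplus>\<^bsub>W\<^esub> i2 (q2 w) = w)"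
proof -
  have f: "fvs K U" "fvs K V" using U V fvs_Vec by auto
  interpret U: vectorspace K U by (rule fvsD(1)[OF f(1)])
  interpret V: vectorspace K V by (rule fvsD(1)[OF f(2)])
  let ?S = "direct_sum U V"
  obtain W j j' where W: "W \<in> (Vec K :: ('a, 'v) module set)" and j: "j \<in> module_hom K ?S W" and j': "j' \<in> module_hom K W ?S"
    and e: "\<forall>x\<in>carrier ?S. j' (j x) = x" "\<forall>y\<in>carrier W. j (j' y) = y"
    using transport[OF fvs_direct_sum[OF f] inf] by blast
  define i1 where "i1 x = j (x, \<zero>\<^bsub>V\<^esub>)" for x
  define i2 where "i2 x = j (\<zero>\<^bsub>U\<^esub>, x)" for x
  have "i1 \<in> module_hom K U W" "i2 \<in> module_hom K V W"
    unfolding i1_def i2_def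
    by (rule module_hom_comp[OF _ j]; simp add: module_hom_def direct_sum_def)+
  moreover have "(\<lambda>w. fst (j' w)) \<in> module_hom K W U" "(\<lambda>w. snd (j' w)) \<in> module_hom K W V"
    by (rule module_hom_comp[OF j']; auto simp: module_hom_def direct_sum_def)+
  moreover have "i1 (fst (j' w)) \<oplus>\<^bsub>W\<^esub> i2 (snd (j' w)) = w" if w: "w \<in> carrier W" for w
  proof -
    have m: "j' w \<in> carrier ?S" using j' w by (auto simp: module_hom_def)
    then have "j ((fst (j' w), \<zero>\<^bsub>V\<^esub>) \<oplus>\<^bsub>?S\<^esub> (\<zero>\<^bsub>U\<^esub>, snd (j' w))) = i1 (fst (j' w)) \<oplus>\<^bsub>W\<^esub> i2 (snd (j' w))"
      unfolding i1_def i2_def by (intro module_hom_add[OF j]) (auto simp: direct_sum_def)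
    moreover have "(fst (j' w), \<zero>\<^bsub>V\<^esub>) \<oplus>\<^bsub>?S\<^esub> (\<zero>\<^bsub>U\<^esub>, snd (j' w)) = j' w"
      using m by (auto simp: direct_sum_def)
    ultimately show ?thesis using e(2) w by simp
  qed
  moreover have "\<forall>x\<in>carrier U. fst (j' (i1 x)) = x \<and> snd (j' (i1 x)) = \<zero>\<^bsub>V\<^esub>" "\<forall>x\<in>carrier V. snd (j' (i2 x)) = x \<and> fst (j' (i2 x)) = \<zero>\<^bsub>U\<^esub>"
    using e(1) by (auto simp: i1_def i2_def direct_sum_def)
  ultimately show ?thesis using W
    by (intro exI[of _ W] exI[of _ i1] exI[of _ i2] exI[of _ "\<lambda>w. fst (j' w)"] exI[of _ "\<lambda>w. snd (j' w)"]) auto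
qed

definition self_module :: "('a, 'a) module" where
  "self_module = \<lparr>carrier = carrier K, mult = undefined, one = undefined, zero = \<zero>, add = (\<oplus>), smult = (\<otimes>)\<rparr>"

lemma fvs_self_module: "fvs K self_module"
proof -
  have "vectorspace K self_module"
  proof (rule vs_criteria)
    show "\<forall>v\<in>carrier self_module. \<exists>neg_v\<in>carrier self_module. v \<oplus>\<^bsub>self_module\<^esub> neg_v = \<zero>\<^bsub>self_module\<^esub>"
      using r_neg by (auto simp: self_module_def)
  qed (auto simp: self_module_def a_assoc a_lcomm a_comm m_assoc l_distr r_distr field_axioms)
  then show ?thesis using finite_K by (simp add: fvs_def self_module_def)
qed

text \<open>The expansion in a basis is written with linear coordinate maps into the line; this form
  exhibits the identity as a sum of maps through \<open>I0\<close>.\<close>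

lemma coordinates_exist:
  assumes V: "fvs K V"
  shows "\<exists>(n::nat) x b. (\<forall>i<n. b i \<in> carrier V \<and> x i \<in> module_hom K V self_module) \<and>
    (\<forall>v\<in>carrier V. v = (\<Oplus>\<^bsub>V\<^esub>i\<in>{..<n}. x i v \<odot>\<^bsub>V\<^esub> b i))"
proof -
  interpret V: vectorspace K V by (rule fvsD(1)[OF V])
  have "V.fin_dim" by (rule fvs_fin_dim[OF V])
  then obtain B where B: "finite B" "V.basis B" using V.finite_basis_exists by blast
  have BC: "B \<subseteq> carrier V" using B(2) by (simp add: V.basis_def)
  have uniq: "\<forall>v. v \<in> carrier V \<longrightarrow> (\<exists>!a. a \<in> B \<rightarrow>\<^sub>E carrier K \<and> V.lincomb a B = v)"
    using V.basis_criterion[OF B(1) BC] B(2) by simp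
  define crd where "crd v = (THE a. a \<in> B \<rightarrow>\<^sub>E carrier K \<and> V.lincomb a B = v)" for v
  have crd: "crd v \<in> B \<rightarrow>\<^sub>E carrier K" "V.lincomb (crd v) B = v" if "v \<in> carrier V" for v
    using theI'[of "\<lambda>a. a \<in> B \<rightarrow>\<^sub>E carrier K \<and> V.lincomb a B = v"] uniq that unfolding crd_def by blast+
  have crdI: "crd v = a" if "a \<in> B \<rightarrow>\<^sub>E carrier K" "V.lincomb a B = v" "v \<in> carrier V" for a v
    unfolding crd_def by (rule the1_equality[OF uniq[rule_format, OF that(3)]]) (use that in simp)
  interpret L: mod_hom K "func_space B" V "\<lambda>a. V.lincomb a B" by (rule V.lincomb_is_mod_hom[OF B(1) BC])
  have ccar: "crd v \<in> carrier (func_space B)" if "v \<in> carrier V" for v using crd(1)[OF that] by (simp add: func_space_def)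
  have crd_add: "crd (v \<oplus>\<^bsub>V\<^esub> w) = crd v \<oplus>\<^bsub>func_space B\<^esub> crd w" if "v \<in> carrier V" "w \<in> carrier V" for v w
  proof (rule crdI)
    show "crd v \<oplus>\<^bsub>func_space B\<^esub> crd w \<in> B \<rightarrow>\<^sub>E carrier K"
      using crd(1)[OF that(1)] crd(1)[OF that(2)] by (auto simp: func_space_def)
    show "V.lincomb (crd v \<oplus>\<^bsub>func_space B\<^esub> crd w) B = v \<oplus>\<^bsub>V\<^esub> w"
      using L.f_add[OF ccar[OF that(1)] ccar[OF that(2)]] that by (simp add: crd)
  qed (use that in simp)
  have crd_smult: "crd (c \<odot>\<^bsub>V\<^esub> v) = c \<odot>\<^bsub>func_space B\<^esub> crd v" if "c \<in> carrier K" "v \<in> carrier V" for v c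
  proof (rule crdI)
    show "c \<odot>\<^bsub>func_space B\<^esub> crd v \<in> B \<rightarrow>\<^sub>E carrier K"
      using crd(1)[OF that(2)] that by (auto simp: func_space_def)
    show "V.lincomb (c \<odot>\<^bsub>func_space B\<^esub> crd v) B = c \<odot>\<^bsub>V\<^esub> v"
      using L.f_smult[OF that(1) ccar[OF that(2)]] that by (simp add: crd)
  qed (use that in simp)
  obtain b where b: "bij_betw b {..<card B} B" using B(1) by (metis bij_betw_from_nat_into_finite)
  have bB: "b i \<in> B" if "i < card B" for i using b that by (metis bij_betwE lessThan_iff)
  show ?thesis
  proof (intro exI[of _ "card B"] exI[of _ "\<lambda>i v. crd v (b i)"] exI[of _ b] conjI allI impI ballI)
    fix i assume i: "i < card B"
    show "b i \<in> carrier V" using bB[OF i] BC by blast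
    show "(\<lambda>v. crd v (b i)) \<in> module_hom K V self_module"
      using crd_add crd_smult PiE_mem[OF crd(1) bB[OF i]] bB[OF i] by (auto simp: module_hom_def self_module_def func_space_def)
  next
    fix v assume v: "v \<in> carrier V"
    have "v = (\<Oplus>\<^bsub>V\<^esub>w\<in>b ` {..<card B}. crd v w \<odot>\<^bsub>V\<^esub> w)"
      using crd(2)[OF v] b by (simp add: V.lincomb_def bij_betw_def)
    also have "\<dots> = (\<Oplus>\<^bsub>V\<^esub>i\<in>{..<card B}. crd v (b i) \<odot>\<^bsub>V\<^esub> b i)"
      using b crd(1)[OF v] BC bB by (intro V.M.add.finprod_reindex) (auto simp: bij_betw_def)
    finally show "v = (\<Oplus>\<^bsub>V\<^esub>i\<in>{..<card B}. crd v (b i) \<odot>\<^bsub>V\<^esub> b i)" .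
  qed
qed

end

lemma sum_fun_apply: "(\<Sum>i\<in>F. f i) x = (\<Sum>i\<in>F. f i x :: 'b::comm_monoid_add)"
  by (induction F rule: infinite_finite_induct) auto

section \<open>Linear maps between encoded spaces\<close>

definition EM :: "('k, 'a, 'm) module_scheme \<Rightarrow> (('a \<Rightarrow> circle) \<Rightarrow> circle) set" where
  "EM V = enc V ` carrier V"

definition sm :: "('k, 'a, 'm) module_scheme \<Rightarrow> 'k \<Rightarrow> (('a \<Rightarrow> circle) \<Rightarrow> circle) \<Rightarrow> ('a \<Rightarrow> circle) \<Rightarrow> circle" where
  "sm V c x = enc V (c \<odot>\<^bsub>V\<^esub> dec V x)"

text \<open>Maps vanish outside the encoded space instead of being undefined there, so that
  pointwise differences stay in the same set and the function type provides the group structure on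
  Hom.\<close>

definition hat :: "('k, 'a, 'm) module_scheme \<Rightarrow> ('k, 'b, 'n) module_scheme \<Rightarrow> ('a \<Rightarrow> 'b) \<Rightarrow>
    (('a \<Rightarrow> circle) \<Rightarrow> circle) \<Rightarrow> ('b \<Rightarrow> circle) \<Rightarrow> circle" where
  "hat U V f = (\<lambda>x. if x \<in> EM U then enc V (f (dec U x)) else 0)"

definition unh :: "('k, 'a, 'm) module_scheme \<Rightarrow> ('k, 'b, 'n) module_scheme \<Rightarrow>
    ((('a \<Rightarrow> circle) \<Rightarrow> circle) \<Rightarrow> ('b \<Rightarrow> circle) \<Rightarrow> circle) \<Rightarrow> 'a \<Rightarrow> 'b" where
  "unh U V F = (\<lambda>v\<in>carrier U. dec V (F (enc U v)))"

definition vhom :: "('k, 'r) ring_scheme \<Rightarrow> ('k, 'a, 'm) module_scheme \<Rightarrow> ('k, 'b, 'n) module_scheme \<Rightarrow>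
    ((('a \<Rightarrow> circle) \<Rightarrow> circle) \<Rightarrow> ('b \<Rightarrow> circle) \<Rightarrow> circle) set" where
  "vhom K U V = {F. (\<forall>x. x \<notin> EM U \<longrightarrow> F x = 0) \<and> (\<forall>x\<in>EM U. F x \<in> EM V) \<and>
     (\<forall>x\<in>EM U. \<forall>y\<in>EM U. F (x - y) = F x - F y) \<and>
     (\<forall>c\<in>carrier K. \<forall>x\<in>EM U. F (sm U c x) = sm V c (F x))}"

text \<open>
  The zero spaces are left out because sampling needs at least two scalars acting differently. They are
  summands of nonzero spaces, so nothing is lost.
\<close>

definition NVec :: "('k, 'r) ring_scheme \<Rightarrow> ('k, 'v) module set" where
  "NVec K = {V \<in> Vec K. carrier V \<noteq> {\<zero>\<^bsub>V\<^esub>}}"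

definition nhom :: "('k, 'r) ring_scheme \<Rightarrow> ('k, 'v) module \<Rightarrow> ('k, 'v) module \<Rightarrow>
    ((('v \<Rightarrow> circle) \<Rightarrow> circle) \<Rightarrow> ('v \<Rightarrow> circle) \<Rightarrow> circle) set" where
  "nhom K U V = (if U \<in> NVec K \<and> V \<in> NVec K then vhom K U V else {})"

context
  fixes K :: "('k, 'r) ring_scheme" and V :: "('k, 'a, 'm) module_scheme"
  assumes V: "fvs K V"
begin

interpretation vectorspace K V by (rule fvsD(1)[OF V])

lemma EM_fsub: "fsub (EM V)"
  unfolding EM_def by (rule enc_fsub[OF fvsD(3,4)[OF V]])

lemma enc_EM: "v \<in> carrier V \<Longrightarrow> enc V v \<in> EM V"
  by (simp add: EM_def)

lemma EM_dec:
  assumes "x \<in> EM V"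
  shows "dec V x \<in> carrier V" "enc V (dec V x) = x"
  using assms unfolding EM_def by (auto simp: dec_enc[OF fvsD(3,4)[OF V]])

lemma dec_enc': "v \<in> carrier V \<Longrightarrow> dec V (enc V v) = v"
  by (rule dec_enc[OF fvsD(3,4)[OF V]])

lemma dec_diff:
  assumes "x \<in> EM V" "y \<in> EM V"
  shows "dec V (x - y) = dec V x \<ominus>\<^bsub>V\<^esub> dec V y"
proof -
  have "x - y = enc V (dec V x \<ominus>\<^bsub>V\<^esub> dec V y)"
    using enc_minus[OF fvsD(3)[OF V] EM_dec(1)[OF assms(1)] EM_dec(1)[OF assms(2)]] EM_dec(2) assms by simp
  then show ?thesis using dec_enc' EM_dec(1) assms by simp
qed

lemma dec_add:
  assumes "x \<in> EM V" "y \<in> EM V"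
  shows "dec V (x + y) = dec V x \<oplus>\<^bsub>V\<^esub> dec V y"
proof -
  have "x + y = enc V (dec V x \<oplus>\<^bsub>V\<^esub> dec V y)"
    using enc_add[OF EM_dec(1)[OF assms(1)] EM_dec(1)[OF assms(2)]] EM_dec(2) assms by simp
  then show ?thesis using dec_enc' EM_dec(1) assms by simp
qed

lemma sm_EM: "c \<in> carrier K \<Longrightarrow> x \<in> EM V \<Longrightarrow> sm V c x \<in> EM V"
  unfolding sm_def by (intro enc_EM smult_closed EM_dec)

lemma sm_enc: "v \<in> carrier V \<Longrightarrow> sm V c (enc V v) = enc V (c \<odot>\<^bsub>V\<^esub> v)"
  by (simp add: sm_def dec_enc')

lemma sm_diff:
  assumes "c \<in> carrier K" "x \<in> EM V" "y \<in> EM V"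
  shows "sm V c (x - y) = sm V c x - sm V c y"
proof -
  note d = EM_dec(1)[OF assms(2)] EM_dec(1)[OF assms(3)]
  have "c \<odot>\<^bsub>V\<^esub> (dec V x \<ominus>\<^bsub>V\<^esub> dec V y) = c \<odot>\<^bsub>V\<^esub> dec V x \<ominus>\<^bsub>V\<^esub> c \<odot>\<^bsub>V\<^esub> dec V y"
    using assms(1) d by (simp add: a_minus_def smult_r_distr smult_r_minus)
  then show ?thesis
    unfolding sm_def dec_diff[OF assms(2,3)] using d assms(1) by (simp add: enc_minus[OF fvsD(3)[OF V]])
qed

lemma sm_scalar_diff:
  assumes "c \<in> carrier K" "d \<in> carrier K" "x \<in> EM V"
  shows "sm V (c \<ominus>\<^bsub>K\<^esub> d) x = sm V c x - sm V d x"
proof -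
  note v = EM_dec(1)[OF assms(3)]
  have "(c \<ominus>\<^bsub>K\<^esub> d) \<odot>\<^bsub>V\<^esub> dec V x = c \<odot>\<^bsub>V\<^esub> dec V x \<ominus>\<^bsub>V\<^esub> d \<odot>\<^bsub>V\<^esub> dec V x"
    using assms(1,2) v by (simp add: a_minus_def smult_l_distr smult_l_minus)
  then show ?thesis unfolding sm_def using v assms(1,2) by (simp add: enc_minus[OF fvsD(3)[OF V]])
qed

lemma sm_mult: "c \<in> carrier K \<Longrightarrow> d \<in> carrier K \<Longrightarrow> x \<in> EM V \<Longrightarrow> sm V c (sm V d x) = sm V (c \<otimes>\<^bsub>K\<^esub> d) x"
  unfolding sm_def using EM_dec(1)[of x] by (simp add: dec_enc' smult_assoc1)

end

lemma vhomD:
  assumes "F \<in> vhom K U V"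
  shows "x \<notin> EM U \<Longrightarrow> F x = 0" "x \<in> EM U \<Longrightarrow> F x \<in> EM V" "x \<in> EM U \<Longrightarrow> y \<in> EM U \<Longrightarrow> F (x - y) = F x - F y"
    "c \<in> carrier K \<Longrightarrow> x \<in> EM U \<Longrightarrow> F (sm U c x) = sm V c (F x)"
  using assms unfolding vhom_def by blast+

lemma vhom_zero_at: "F \<in> vhom K U V \<Longrightarrow> F 0 = 0"
  using vhomD(1)[of F K U V 0] vhomD(3)[of F K U V 0 0] by (cases "0 \<in> EM U") simp_all

lemma vhom_in:
  assumes V: "fvs K V" and F: "F \<in> vhom K U V"
  shows "F x \<in> EM V"
proof (cases "x \<in> EM U")
  case True
  then show ?thesis by (rule vhomD(2)[OF F])
next
  case False
  show ?thesis unfolding vhomD(1)[OF F False] by (rule fsub_0[OF EM_fsub[OF V]])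
qed

lemma vhom_comp:
  assumes F: "F \<in> vhom K U V" and G: "G \<in> vhom K V W"
  shows "G \<circ> F \<in> vhom K U W"
  unfolding vhom_def by (simp add: vhomD[OF F] vhomD[OF G] vhom_zero_at[OF G])

lemma vhom_fsub:
  assumes U: "fvs K U" and V: "fvs K V"
  shows "fsub (vhom K U V)"
proof -
  note E = EM_fsub[OF V] and EU = EM_fsub[OF U]
  have "finite {F. \<forall>x. (x \<in> EM U \<longrightarrow> F x \<in> EM V) \<and> (x \<notin> EM U \<longrightarrow> F x = 0)}"
    by (rule finite_set_of_finite_funs[OF fsub_finite[OF EU] fsub_finite[OF E]])
  then have "finite (vhom K U V)" by (rule rev_finite_subset) (auto simp: vhom_def)
  moreover have "0 \<in> vhom K U V"
    using fsub_0[OF E] sm_diff[OF V _ fsub_0[OF E] fsub_0[OF E]] by (auto simp: vhom_def)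
  moreover have "F - G \<in> vhom K U V" if F: "F \<in> vhom K U V" and G: "G \<in> vhom K U V" for F G
    unfolding vhom_def
  proof (intro CollectI conjI allI impI ballI)
    note FD = vhomD[OF F] and GD = vhomD[OF G]
    show "(F - G) x = 0" if "x \<notin> EM U" for x using that FD(1) GD(1) by simp
    show "(F - G) x \<in> EM V" if "x \<in> EM U" for x using FD(2)[OF that] GD(2)[OF that] fsub_diff[OF E] by simp
    show "(F - G) (x - y) = (F - G) x - (F - G) y" if "x \<in> EM U" "y \<in> EM U" for x y
      using FD(3)[OF that] GD(3)[OF that] by simp
    show "(F - G) (sm U c x) = sm V c ((F - G) x)" if c: "c \<in> carrier K" and x: "x \<in> EM U" for c x
      using FD(4)[OF c x] GD(4)[OF c x] sm_diff[OF V c FD(2)[OF x] GD(2)[OF x]] by simp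
  qed
  ultimately show ?thesis by (simp add: fsub_def)
qed

lemma hat_enc: "fvs K U \<Longrightarrow> v \<in> carrier U \<Longrightarrow> hat U V f (enc U v) = enc V (f v)"
  by (simp add: hat_def enc_EM dec_enc')

lemma hat_vhom:
  assumes U: "fvs K U" and V: "fvs K V" and f: "f \<in> module_hom K U V"
  shows "hat U V f \<in> vhom K U V"
  unfolding vhom_def
proof (intro CollectI conjI allI impI ballI)
  interpret U: vectorspace K U by (rule fvsD(1)[OF U])
  interpret mod_hom K U V f
    using f fvsD(2)[OF U] fvsD(2)[OF V] by (simp add: mod_hom_def mod_hom_axioms_def)
  have fc: "f u \<in> carrier V" if "u \<in> carrier U" for u using f that by (auto simp: module_hom_def)
  show "hat U V f x = 0" if "x \<notin> EM U" for x using that by (simp add: hat_def)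
  show "hat U V f x \<in> EM V" if "x \<in> EM U" for x
    using that fc EM_dec(1)[OF U that] by (simp add: hat_def enc_EM[OF V])
  show "hat U V f (x - y) = hat U V f x - hat U V f y" if x: "x \<in> EM U" and y: "y \<in> EM U" for x y
  proof -
    note d = EM_dec(1)[OF U x] EM_dec(1)[OF U y]
    have "hat U V f (x - y) = enc V (f (dec U x \<ominus>\<^bsub>U\<^esub> dec U y))"
      using fsub_diff[OF EM_fsub[OF U] x y] by (simp add: hat_def dec_diff[OF U x y])
    also have "\<dots> = enc V (f (dec U x)) - enc V (f (dec U y))"
      using f_minus[OF d] enc_minus[OF fvsD(3)[OF V] fc[OF d(1)] fc[OF d(2)]] by simp
    finally show ?thesis using x y by (simp add: hat_def)
  qed
  show "hat U V f (sm U c x) = sm V c (hat U V f x)" if c: "c \<in> carrier K" and x: "x \<in> EM U" for c x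
  proof -
    note d = EM_dec(1)[OF U x]
    have "hat U V f (sm U c x) = enc V (f (c \<odot>\<^bsub>U\<^esub> dec U x))"
      unfolding sm_def by (rule hat_enc[OF U U.smult_closed[OF c d]])
    also have "\<dots> = sm V c (enc V (f (dec U x)))"
      using module_hom_smult[OF f c d] sm_enc[OF V fc[OF d]] by simp
    finally show ?thesis using x by (simp add: hat_def)
  qed
qed

lemma vhom_eqI:
  assumes "F \<in> vhom K U V" "G \<in> vhom K U V" "\<And>u. u \<in> carrier U \<Longrightarrow> F (enc U u) = G (enc U u)"
  shows "F = G"
proof
  fix x
  show "F x = G x"
  proof (cases "x \<in> EM U")
    case True
    then show ?thesis using assms(3) by (auto simp: EM_def)
  next
    case False
    then show ?thesis using vhomD(1)[OF assms(1)] vhomD(1)[OF assms(2)] by simp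
  qed
qed

lemma enc_unh:
  assumes V: "fvs K V" and F: "F \<in> vhom K U V" and u: "u \<in> carrier U"
  shows "enc V (unh U V F u) = F (enc U u)" "unh U V F u \<in> carrier V"
  using EM_dec[OF V vhom_in[OF V F, of "enc U u"]] u by (simp_all add: unh_def)

lemma enc_eqD:
  assumes V: "fvs K V" and e: "enc V x = enc V y" and xy: "x \<in> carrier V" "y \<in> carrier V"
  shows "x = y"
proof -
  have "x = dec V (enc V x)" by (rule dec_enc'[OF V xy(1), symmetric])
  also have "\<dots> = y" unfolding e by (rule dec_enc'[OF V xy(2)])
  finally show ?thesis .
qed

lemma vhom_add:
  assumes U: "fvs K U" and V: "fvs K V" and F: "F \<in> vhom K U V" and x: "x \<in> EM U" "y \<in> EM U"
  shows "F (x + y) = F x + F y"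
  using vhomD(3)[OF F fsub_add[OF EM_fsub[OF U] x] x(2)] by (simp add: algebra_simps)

lemma unh_Hom:
  assumes U: "fvs K U" and V: "fvs K V" and F: "F \<in> vhom K U V"
  shows "unh U V F \<in> Hom K U V"
proof -
  interpret U: vectorspace K U by (rule fvsD(1)[OF U])
  interpret V: vectorspace K V by (rule fvsD(1)[OF V])
  note e = enc_unh[OF V F]
  have "unh U V F (a \<oplus>\<^bsub>U\<^esub> b) = unh U V F a \<oplus>\<^bsub>V\<^esub> unh U V F b" if a: "a \<in> carrier U" and b: "b \<in> carrier U" for a b
  proof (rule enc_eqD[OF V])
    show "enc V (unh U V F (a \<oplus>\<^bsub>U\<^esub> b)) = enc V (unh U V F a \<oplus>\<^bsub>V\<^esub> unh U V F b)"
      using a b e by (simp add: enc_add vhom_add[OF U V F] enc_EM[OF U])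
  qed (use a b e in simp_all)
  moreover have "unh U V F (c \<odot>\<^bsub>U\<^esub> a) = c \<odot>\<^bsub>V\<^esub> unh U V F a" if c: "c \<in> carrier K" and a: "a \<in> carrier U" for a c
  proof (rule enc_eqD[OF V])
    show "enc V (unh U V F (c \<odot>\<^bsub>U\<^esub> a)) = enc V (c \<odot>\<^bsub>V\<^esub> unh U V F a)"
      using sm_enc[OF U a, of c] sm_enc[OF V e(2)[OF a], of c] vhomD(4)[OF F c enc_EM[OF U a]] e a c by simp
  qed (use a c e in simp_all)
  ultimately have "unh U V F \<in> module_hom K U V" using e(2) by (auto simp: module_hom_def)
  then show ?thesis by (simp add: Hom_def unh_def)
qed

lemma unh_comp:
  assumes U: "fvs K U" and V: "fvs K V" and W: "fvs K W" and F: "F \<in> vhom K U V" and G: "G \<in> vhom K V W"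
  shows "unh U W (G \<circ> F) = compose (carrier U) (unh V W G) (unh U V F)"
proof -
  have "unh U W (G \<circ> F) u = unh V W G (unh U V F u)" if u: "u \<in> carrier U" for u
    using enc_unh[OF V F u] enc_unh[OF W G] enc_unh[OF W vhom_comp[OF F G] u]
    by (intro enc_eqD[OF W]) simp_all
  then show ?thesis by (auto simp: compose_def fun_eq_iff unh_def)
qed

definition vid :: "('k, 'v, 'm) module_scheme \<Rightarrow> (('v \<Rightarrow> circle) \<Rightarrow> circle) \<Rightarrow> ('v \<Rightarrow> circle) \<Rightarrow> circle" where
  "vid V = hat V V (\<lambda>v. v)"

definition vscal :: "('k, 'r) ring_scheme \<Rightarrow> ('k, 'v, 'm) module_scheme \<Rightarrow> ((('v \<Rightarrow> circle) \<Rightarrow> circle) \<Rightarrow> ('v \<Rightarrow> circle) \<Rightarrow> circle) set" where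
  "vscal K V = (\<lambda>c. hat V V (\<lambda>v. c \<odot>\<^bsub>V\<^esub> v)) ` carrier K"

lemma id_module_hom: "(\<lambda>v. v) \<in> module_hom K V V"
  by (simp add: module_hom_def)

lemma vid_apply: "fvs K V \<Longrightarrow> vid V x = (if x \<in> EM V then x else 0)"
  using EM_dec(2)[of K V x] by (simp add: vid_def hat_def)

lemma vid_left: "fvs K V \<Longrightarrow> F \<in> vhom K U V \<Longrightarrow> vid V \<circ> F = F"
  by (rule ext) (simp add: vid_apply vhom_in)

lemma vid_right: "fvs K U \<Longrightarrow> F \<in> vhom K U V \<Longrightarrow> F \<circ> vid U = F"
  by (rule ext) (simp add: vid_apply vhom_zero_at vhomD(1))

lemma scalar_module_hom: "fvs K V \<Longrightarrow> c \<in> carrier K \<Longrightarrow> (\<lambda>v. c \<odot>\<^bsub>V\<^esub> v) \<in> module_hom K V V"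
proof -
  assume V: "fvs K V" and c: "c \<in> carrier K"
  interpret vectorspace K V by (rule fvsD(1)[OF V])
  have "c \<odot>\<^bsub>V\<^esub> (r \<odot>\<^bsub>V\<^esub> m) = r \<odot>\<^bsub>V\<^esub> (c \<odot>\<^bsub>V\<^esub> m)" if r: "r \<in> carrier K" "m \<in> carrier V" for r m
    using smult_assoc1[OF c r] smult_assoc1[OF r(1) c r(2)] m_comm[OF c r(1)] by simp
  then show ?thesis using c by (auto simp: module_hom_def smult_r_distr)
qed

lemma vscal_apply: "x \<in> EM V \<Longrightarrow> hat V V (\<lambda>v. c \<odot>\<^bsub>V\<^esub> v) x = sm V c x"
  by (simp add: hat_def sm_def)

lemma vscal_diff:
  assumes V: "fvs K V" and c: "c \<in> carrier K" "d \<in> carrier K"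
  shows "hat V V (\<lambda>v. (c \<ominus>\<^bsub>K\<^esub> d) \<odot>\<^bsub>V\<^esub> v) = hat V V (\<lambda>v. c \<odot>\<^bsub>V\<^esub> v) - hat V V (\<lambda>v. d \<odot>\<^bsub>V\<^esub> v)"
  by (rule ext) (simp add: hat_def sm_scalar_diff[OF V c, unfolded sm_def])

lemma vscal_mult:
  assumes V: "fvs K V" and c: "c \<in> carrier K" "d \<in> carrier K"
  shows "hat V V (\<lambda>v. c \<odot>\<^bsub>V\<^esub> v) \<circ> hat V V (\<lambda>v. d \<odot>\<^bsub>V\<^esub> v) = hat V V (\<lambda>v. (c \<otimes>\<^bsub>K\<^esub> d) \<odot>\<^bsub>V\<^esub> v)"
proof -
  have z: "hat V V (\<lambda>v. c \<odot>\<^bsub>V\<^esub> v) 0 = 0"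
    by (rule vhom_zero_at[OF hat_vhom[OF V V scalar_module_hom[OF V c(1)]]])
  have "hat V V (\<lambda>v. c \<odot>\<^bsub>V\<^esub> v) (hat V V (\<lambda>v. d \<odot>\<^bsub>V\<^esub> v) x) = hat V V (\<lambda>v. (c \<otimes>\<^bsub>K\<^esub> d) \<odot>\<^bsub>V\<^esub> v) x" for x
  proof (cases "x \<in> EM V")
    case True
    then show ?thesis using sm_EM[OF V c(2) True] sm_mult[OF V c True] by (simp add: vscal_apply)
  next
    case False
    then show ?thesis using z by (simp add: hat_def)
  qed
  then show ?thesis by (simp add: fun_eq_iff)
qed

lemma (in fin_field) vscal_fsub:
  assumes V: "fvs K V"
  shows "fsub (vscal K V)"
proof -
  have "a - b \<in> vscal K V" if ab: "a \<in> vscal K V" "b \<in> vscal K V" for a b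
  proof -
    obtain c d where c: "c \<in> carrier K" "d \<in> carrier K" and e: "a = hat V V (\<lambda>v. c \<odot>\<^bsub>V\<^esub> v)" "b = hat V V (\<lambda>v. d \<odot>\<^bsub>V\<^esub> v)"
      using ab unfolding vscal_def by blast
    have "a - b = hat V V (\<lambda>v. (c \<ominus> d) \<odot>\<^bsub>V\<^esub> v)" unfolding e by (rule vscal_diff[OF V c, symmetric])
    moreover have "c \<ominus> d \<in> carrier K" using c by simp
    ultimately show ?thesis unfolding vscal_def by blast
  qed
  moreover have "0 \<in> vscal K V"
  proof -
    have "hat V V (\<lambda>v. (\<zero> \<ominus> \<zero>) \<odot>\<^bsub>V\<^esub> v) = 0" unfolding vscal_diff[OF V zero_closed zero_closed] by simp
    moreover have "\<zero> \<ominus> \<zero> \<in> carrier K" by simp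
    ultimately show ?thesis unfolding vscal_def by (metis (no_types, lifting) image_eqI)
  qed
  ultimately show ?thesis using finite_K by (simp add: fsub_def vscal_def)
qed

lemma (in fin_field) vscal_one:
  assumes V: "fvs K V"
  shows "hat V V (\<lambda>v. \<one> \<odot>\<^bsub>V\<^esub> v) = vid V"
proof -
  interpret V: vectorspace K V by (rule fvsD(1)[OF V])
  show ?thesis using EM_dec(1)[OF V] by (auto simp: vid_def hat_def fun_eq_iff)
qed

lemma vid_nonzero:
  assumes V: "fvs K V" and n: "carrier V \<noteq> {\<zero>\<^bsub>V\<^esub>}"
  shows "vid V \<noteq> 0"
proof
  assume z: "vid V = 0"
  interpret V: vectorspace K V by (rule fvsD(1)[OF V])
  have "v = \<zero>\<^bsub>V\<^esub>" if v: "v \<in> carrier V" for v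
  proof (rule enc_eqD[OF V _ v])
    have "enc V v = vid V (enc V v)" unfolding vid_def by (rule hat_enc[OF V v, symmetric])
    then show "enc V v = enc V \<zero>\<^bsub>V\<^esub>" using z by (simp add: enc_zero[OF fvsD(3)[OF V]])
  qed simp
  then show False using n by auto
qed

text \<open>The scalars 0 and 1 give different maps, because \<open>V\<close> is nonzero.\<close>

lemma (in fin_field) vscal_card:
  assumes V: "fvs K V" and n: "carrier V \<noteq> {\<zero>\<^bsub>V\<^esub>}"
  shows "2 \<le> card (vscal K V)"
proof -
  have "{0, vid V} \<subseteq> vscal K V"
    using fsub_0[OF vscal_fsub[OF V]] vscal_one[OF V] unfolding vscal_def by (metis empty_subsetI image_eqI insert_subset one_closed)
  then have "card {0, vid V} \<le> card (vscal K V)" by (rule card_mono[OF fsub_finite[OF vscal_fsub[OF V]]])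
  then show ?thesis using vid_nonzero[OF V n] by simp
qed

lemma (in fin_field) vscal_inv:
  assumes V: "fvs K V" and s: "s \<in> vscal K V" "s \<noteq> 0"
  shows "\<exists>t\<in>vhom K V V. t \<circ> s = vid V \<and> s \<circ> t = vid V"
proof -
  obtain c where c: "c \<in> carrier K" and s_def: "s = hat V V (\<lambda>v. c \<odot>\<^bsub>V\<^esub> v)" using s(1) unfolding vscal_def by blast
  have "c \<noteq> \<zero>"
  proof
    assume "c = \<zero>"
    then have "c = c \<ominus> c" using c by (simp add: a_minus_def)
    then have "s = s - s" using vscal_diff[OF V c c] unfolding s_def by simp
    then show False using s(2) by simp
  qed
  then have i: "inv c \<in> carrier K" "inv c \<otimes> c = \<one>" "c \<otimes> inv c = \<one>" using c by (auto simp: field_Units)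
  show ?thesis
  proof (intro bexI[of _ "hat V V (\<lambda>v. inv c \<odot>\<^bsub>V\<^esub> v)"] conjI)
    show "hat V V (\<lambda>v. inv c \<odot>\<^bsub>V\<^esub> v) \<in> vhom K V V" by (rule hat_vhom[OF V V scalar_module_hom[OF V i(1)]])
  qed (simp_all add: s_def vscal_mult[OF V] c i vscal_one[OF V])
qed

lemma NVecD: "V \<in> NVec K \<Longrightarrow> V \<in> Vec K" "V \<in> NVec K \<Longrightarrow> carrier V \<noteq> {\<zero>\<^bsub>V\<^esub>}"
  by (simp_all add: NVec_def)

lemma nhomD: "F \<in> nhom K U V \<Longrightarrow> U \<in> NVec K" "F \<in> nhom K U V \<Longrightarrow> V \<in> NVec K" "F \<in> nhom K U V \<Longrightarrow> F \<in> vhom K U V"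
  by (simp_all add: nhom_def split: if_splits)

lemma nhomI: "U \<in> NVec K \<Longrightarrow> V \<in> NVec K \<Longrightarrow> F \<in> vhom K U V \<Longrightarrow> F \<in> nhom K U V"
  by (simp add: nhom_def)

section \<open>Biproducts and the line among the nonzero spaces\<close>

context fin_field
begin

lemma NVec_fvs: "V \<in> NVec K \<Longrightarrow> fvs K V"
  using NVecD(1) fvs_Vec by blast

definition is_biprod :: "('a, 'v) module \<Rightarrow> ('a, 'v) module \<Rightarrow> ('a, 'v) module \<Rightarrow> _ \<Rightarrow> _ \<Rightarrow> _ \<Rightarrow> _ \<Rightarrow> bool" where
  "is_biprod U V W i1 i2 q1 q2 \<longleftrightarrow> W \<in> NVec K \<and> i1 \<in> vhom K U W \<and> i2 \<in> vhom K V W \<and> q1 \<in> vhom K W U \<and> q2 \<in> vhom K W V \<and>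
     q1 \<circ> i1 = vid U \<and> q2 \<circ> i2 = vid V \<and> q1 \<circ> i2 = 0 \<and> q2 \<circ> i1 = 0 \<and> (i1 \<circ> q1) + (i2 \<circ> q2) = vid W"

lemma is_biprod_exists:
  assumes U: "U \<in> NVec K" and V: "V \<in> (NVec K :: ('a, 'v) module set)" and inf: "infinite (UNIV :: 'v set)"
  shows "\<exists>W i1 i2 q1 q2. is_biprod U V W i1 i2 q1 q2"
proof -
  have fU: "fvs K U" and fV: "fvs K V" using NVec_fvs U V by auto
  obtain W i1 i2 q1 q2 where W: "W \<in> (Vec K :: ('a, 'v) module set)" and i1: "i1 \<in> module_hom K U W" and i2: "i2 \<in> module_hom K V W"
    and q1: "q1 \<in> module_hom K W U" and q2: "q2 \<in> module_hom K W V"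
    and a: "\<forall>x\<in>carrier U. q1 (i1 x) = x \<and> q2 (i1 x) = \<zero>\<^bsub>V\<^esub>" and b: "\<forall>x\<in>carrier V. q2 (i2 x) = x \<and> q1 (i2 x) = \<zero>\<^bsub>U\<^esub>"
    and c: "\<forall>w\<in>carrier W. i1 (q1 w) \<oplus>\<^bsub>W\<^esub> i2 (q2 w) = w"
    using biproduct_exists[OF NVecD(1)[OF U] NVecD(1)[OF V] inf] by (elim exE conjE)
  have fW: "fvs K W" using W fvs_Vec by blast
  have i1c: "i1 x \<in> carrier W" if "x \<in> carrier U" for x using module_hom_closed[OF i1] that by auto
  have i2c: "i2 x \<in> carrier W" if "x \<in> carrier V" for x using module_hom_closed[OF i2] that by auto
  have q1c: "q1 x \<in> carrier U" if "x \<in> carrier W" for x using module_hom_closed[OF q1] that by auto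
  have q2c: "q2 x \<in> carrier V" if "x \<in> carrier W" for x using module_hom_closed[OF q2] that by auto
  interpret U: vectorspace K U by (rule fvsD(1)[OF fU])
  obtain x where x: "x \<in> carrier U" "x \<noteq> \<zero>\<^bsub>U\<^esub>" using NVecD(2)[OF U] U.M.zero_closed by blast
  have z: "q1 \<zero>\<^bsub>W\<^esub> = \<zero>\<^bsub>U\<^esub>"
  proof -
    interpret mod_hom K W U q1 using q1 fvsD(2)[OF fW] fvsD(2)[OF fU] by (simp add: mod_hom_def mod_hom_axioms_def)
    show ?thesis by (rule f0_is_0)
  qed
  \<comment> \<open>\<open>U\<close> is nonzero and embeds into \<open>W\<close>, so the biproduct
    stays in the category.\<close>
  have "carrier W \<noteq> {\<zero>\<^bsub>W\<^esub>}"
  proof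
    assume "carrier W = {\<zero>\<^bsub>W\<^esub>}"
    then have "i1 x = \<zero>\<^bsub>W\<^esub>" using i1c[OF x(1)] by blast
    then have "q1 \<zero>\<^bsub>W\<^esub> = x" using a x(1) by metis
    then show False using z x(2) by simp
  qed
  then have WN: "W \<in> NVec K" using W by (simp add: NVec_def)
  note h = hat_vhom[OF fU fW i1] hat_vhom[OF fV fW i2] hat_vhom[OF fW fU q1] hat_vhom[OF fW fV q2]
  have "is_biprod U V W (hat U W i1) (hat V W i2) (hat W U q1) (hat W V q2)"
    unfolding is_biprod_def
  proof (intro conjI WN h)
    show "hat W U q1 \<circ> hat U W i1 = vid U"
    proof (rule vhom_eqI[OF vhom_comp[OF h(1,3)] hat_vhom[OF fU fU id_module_hom, folded vid_def]])
      fix u assume u: "u \<in> carrier U"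
      show "(hat W U q1 \<circ> hat U W i1) (enc U u) = vid U (enc U u)"
        using a u by (simp add: vid_def hat_enc[OF fU u] hat_enc[OF fW i1c[OF u]])
    qed
    show "hat W V q2 \<circ> hat V W i2 = vid V"
    proof (rule vhom_eqI[OF vhom_comp[OF h(2,4)] hat_vhom[OF fV fV id_module_hom, folded vid_def]])
      fix u assume u: "u \<in> carrier V"
      show "(hat W V q2 \<circ> hat V W i2) (enc V u) = vid V (enc V u)"
        using b u by (simp add: vid_def hat_enc[OF fV u] hat_enc[OF fW i2c[OF u]])
    qed
    show "hat W U q1 \<circ> hat V W i2 = 0"
    proof (rule vhom_eqI[OF vhom_comp[OF h(2,3)] fsub_0[OF vhom_fsub[OF fV fU]]])
      fix u assume u: "u \<in> carrier V"
      show "(hat W U q1 \<circ> hat V W i2) (enc V u) = 0 (enc V u)"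
        using b u by (simp add: hat_enc[OF fV u] hat_enc[OF fW i2c[OF u]] enc_zero[OF fvsD(3)[OF fU]])
    qed
    show "hat W V q2 \<circ> hat U W i1 = 0"
    proof (rule vhom_eqI[OF vhom_comp[OF h(1,4)] fsub_0[OF vhom_fsub[OF fU fV]]])
      fix u assume u: "u \<in> carrier U"
      show "(hat W V q2 \<circ> hat U W i1) (enc U u) = 0 (enc U u)"
        using a u by (simp add: hat_enc[OF fU u] hat_enc[OF fW i1c[OF u]] enc_zero[OF fvsD(3)[OF fV]])
    qed
    show "(hat U W i1 \<circ> hat W U q1) + (hat V W i2 \<circ> hat W V q2) = vid W"
    proof -
      have S: "(hat U W i1 \<circ> hat W U q1) + (hat V W i2 \<circ> hat W V q2) \<in> vhom K W W"
        by (rule fsub_add[OF vhom_fsub[OF fW fW] vhom_comp[OF h(3,1)] vhom_comp[OF h(4,2)]])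
      show ?thesis
    proof (rule vhom_eqI[OF S hat_vhom[OF fW fW id_module_hom, folded vid_def]])
      fix w assume w: "w \<in> carrier W"
      have "((hat U W i1 \<circ> hat W U q1) + (hat V W i2 \<circ> hat W V q2)) (enc W w) = enc W (i1 (q1 w)) + enc W (i2 (q2 w))"
        by (simp add: hat_enc[OF fW w] hat_enc[OF fU q1c[OF w]] hat_enc[OF fV q2c[OF w]])
      also have "\<dots> = enc W (i1 (q1 w) \<oplus>\<^bsub>W\<^esub> i2 (q2 w))"
        by (rule enc_add[OF i1c[OF q1c[OF w]] i2c[OF q2c[OF w]], symmetric])
      also have "\<dots> = vid W (enc W w)" using c w by (simp add: vid_def hat_enc[OF fW w])
      finally show "((hat U W i1 \<circ> hat W U q1) + (hat V W i2 \<circ> hat W V q2)) (enc W w) = vid W (enc W w)" .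
    qed
    qed
  qed
  then show ?thesis by (intro exI)
qed

lemma line_exists:
  assumes inf: "infinite (UNIV :: 'v set)"
  shows "\<exists>I \<in> (NVec K :: ('a, 'v) module set). \<forall>V\<in>NVec K. \<exists>(n::nat) a b.
    (\<forall>i. a i \<in> nhom K V I \<and> b i \<in> nhom K I V) \<and> vid V = (\<Sum>i<n. b i \<circ> a i)"
proof -
  obtain I j j' where I: "I \<in> (Vec K :: ('a, 'v) module set)" and j: "j \<in> module_hom K self_module I" and j': "j' \<in> module_hom K I self_module"
    and jj: "\<forall>x\<in>carrier self_module. j' (j x) = x" "\<forall>y\<in>carrier I. j (j' y) = y"
    using transport[OF fvs_self_module inf] by (elim exE conjE)
  have fI: "fvs K I" using I fvs_Vec by blast
  have jc: "j x \<in> carrier I" if "x \<in> carrier K" for x using module_hom_closed[OF j] that by (auto simp: self_module_def)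
  have j'c: "j' x \<in> carrier K" if "x \<in> carrier I" for x using module_hom_closed[OF j'] that by (auto simp: self_module_def)
  have j'j: "j' (j x) = x" if "x \<in> carrier K" for x using jj(1) that by (simp add: self_module_def)
  have "carrier I \<noteq> {\<zero>\<^bsub>I\<^esub>}"
  proof
    assume "carrier I = {\<zero>\<^bsub>I\<^esub>}"
    then have "j \<zero> = j \<one>" using jc[OF zero_closed] jc[OF one_closed] by simp
    then have "\<zero> = \<one>" using j'j[OF zero_closed] j'j[OF one_closed] by metis
    then show False by simp
  qed
  then have IN: "I \<in> NVec K" using I by (simp add: NVec_def)
  have "\<exists>(n::nat) a b. (\<forall>i. a i \<in> nhom K V I \<and> b i \<in> nhom K I V) \<and> vid V = (\<Sum>i<n. b i \<circ> a i)" if V: "V \<in> NVec K" for V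
  proof -
    have fV: "fvs K V" by (rule NVec_fvs[OF V])
    interpret V: vectorspace K V by (rule fvsD(1)[OF fV])
    obtain n :: nat and x b where bx: "\<forall>i<n. b i \<in> carrier V \<and> x i \<in> module_hom K V self_module"
      and dec: "\<forall>v\<in>carrier V. v = (\<Oplus>\<^bsub>V\<^esub>i\<in>{..<n}. x i v \<odot>\<^bsub>V\<^esub> b i)"
      using coordinates_exist[OF fV] by (elim exE conjE)
    \<comment> \<open>The interface asks for maps at every natural index, so the families are
      continued by 0 beyond \<open>n\<close>.\<close>
    define A where "A i = (if i < n then hat V I (\<lambda>v. j (x i v)) else 0)" for i
    define B where "B i = (if i < n then hat I V (\<lambda>y. j' y \<odot>\<^bsub>V\<^esub> b i) else 0)" for i
    have xc: "x i v \<in> carrier K" if "i < n" "v \<in> carrier V" for i v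
      using bx that module_hom_closed[of "x i" K V self_module] by (auto simp: self_module_def)
    have Am: "(\<lambda>v. j (x i v)) \<in> module_hom K V I" if "i < n" for i
      by (rule module_hom_comp[OF _ j]) (use bx that in blast)
    have Bm: "(\<lambda>y. j' y \<odot>\<^bsub>V\<^esub> b i) \<in> module_hom K I V" if i: "i < n" for i
    proof -
      have "(\<lambda>k. k \<odot>\<^bsub>V\<^esub> b i) \<in> module_hom K self_module V"
        using bx i by (auto simp: module_hom_def self_module_def V.smult_l_distr V.smult_assoc1)
      then show ?thesis by (rule module_hom_comp[OF j'])
    qed
    have A: "A i \<in> vhom K V I" for i
      unfolding A_def using hat_vhom[OF fV fI Am] fsub_0[OF vhom_fsub[OF fV fI]] by simp
    have B: "B i \<in> vhom K I V" for i
      unfolding B_def using hat_vhom[OF fI fV Bm] fsub_0[OF vhom_fsub[OF fI fV]] by simp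
    have S: "(\<Sum>i<n. B i \<circ> A i) \<in> vhom K V V"
      by (rule fsub_sum[OF vhom_fsub[OF fV fV] vhom_comp[OF A B]])
    have "vid V = (\<Sum>i<n. B i \<circ> A i)"
    proof (rule vhom_eqI[OF hat_vhom[OF fV fV id_module_hom, folded vid_def] S])
      fix v assume v: "v \<in> carrier V"
      have "(B i \<circ> A i) (enc V v) = enc V (x i v \<odot>\<^bsub>V\<^esub> b i)" if i: "i < n" for i
        using i by (simp add: A_def B_def hat_enc[OF fV v] hat_enc[OF fI jc[OF xc[OF i v]]] j'j[OF xc[OF i v]])
      then have "(\<Sum>i<n. B i \<circ> A i) (enc V v) = (\<Sum>i<n. enc V (x i v \<odot>\<^bsub>V\<^esub> b i))"
        by (subst sum_fun_apply) (intro sum.cong, auto)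
      also have "\<dots> = enc V (\<Oplus>\<^bsub>V\<^esub>i\<in>{..<n}. x i v \<odot>\<^bsub>V\<^esub> b i)"
        using bx xc v by (intro enc_finsum[OF fvsD(3)[OF fV], symmetric]) auto
      also have "\<dots> = enc V v" using dec v by metis
      finally show "vid V (enc V v) = (\<Sum>i<n. B i \<circ> A i) (enc V v)" by (simp add: vid_def hat_enc[OF fV v])
    qed
    then show ?thesis using A B by (intro exI[of _ n] exI[of _ A] exI[of _ B]) (simp add: nhomI V IN)
  qed
  then show ?thesis using IN by blast
qed

lemma NVec_additive_cat:
  assumes inf: "infinite (UNIV :: 'v set)"
  shows "\<exists>su i1 i2 q1 q2 I0. additive_cat (NVec K :: ('a, 'v) module set) (nhom K) (\<circ>) vid su i1 i2 q1 q2 (vscal K) I0"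
proof -
  \<comment> \<open>The five components are bundled into one tuple so that a single choice keeps
    them together.\<close>
  have "\<exists>t. U \<in> NVec K \<longrightarrow> V \<in> (NVec K :: ('a, 'v) module set) \<longrightarrow>
      is_biprod U V (fst t) (fst (snd t)) (fst (snd (snd t))) (fst (snd (snd (snd t)))) (snd (snd (snd (snd t))))" for U V
  proof (cases "U \<in> NVec K \<and> V \<in> NVec K")
    case True
    then obtain W i1 i2 q1 q2 where "is_biprod U V W i1 i2 q1 q2" using is_biprod_exists[OF _ _ inf] by blast
    then show ?thesis by (intro exI[of _ "(W, i1, i2, q1, q2)"]) simp
  qed blast
  then have "\<exists>T. \<forall>U V. U \<in> NVec K \<longrightarrow> V \<in> (NVec K :: ('a, 'v) module set) \<longrightarrow>
      is_biprod U V (fst (T U V)) (fst (snd (T U V))) (fst (snd (snd (T U V)))) (fst (snd (snd (snd (T U V))))) (snd (snd (snd (snd (T U V)))))"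
    by (intro choice allI)
  then obtain T where T: "\<forall>U V. U \<in> NVec K \<longrightarrow> V \<in> (NVec K :: ('a, 'v) module set) \<longrightarrow>
      is_biprod U V (fst (T U V)) (fst (snd (T U V))) (fst (snd (snd (T U V)))) (fst (snd (snd (snd (T U V))))) (snd (snd (snd (snd (T U V)))))" ..
  define su i1 i2 q1 q2 where "su U V = fst (T U V)" and "i1 U V = fst (snd (T U V))" and "i2 U V = fst (snd (snd (T U V)))"
    and "q1 U V = fst (snd (snd (snd (T U V))))" and "q2 U V = snd (snd (snd (snd (T U V))))" for U V
  have bp: "is_biprod U V (su U V) (i1 U V) (i2 U V) (q1 U V) (q2 U V)"
    if "U \<in> NVec K" "V \<in> (NVec K :: ('a, 'v) module set)" for U V
    using T that by (simp add: su_def i1_def i2_def q1_def q2_def)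
  obtain I where I: "I \<in> (NVec K :: ('a, 'v) module set)" and gen: "\<forall>V\<in>NVec K. \<exists>(n::nat) a b.
    (\<forall>i. a i \<in> nhom K V I \<and> b i \<in> nhom K I V) \<and> vid V = (\<Sum>i<n. b i \<circ> a i)"
    using line_exists[OF inf] by (elim bexE)
  have vidh: "vid V \<in> vhom K V V" if "V \<in> NVec K" for V :: "('a, 'v) module"
    unfolding vid_def by (rule hat_vhom[OF NVec_fvs NVec_fvs id_module_hom]) (rule that)+
  have "additive_cat (NVec K :: ('a, 'v) module set) (nhom K) (\<circ>) vid su i1 i2 q1 q2 (vscal K) I"
  proof
    fix U V :: "('a, 'v) module" assume O: "U \<in> NVec K" "V \<in> NVec K"
    note b = bp[OF O, unfolded is_biprod_def]
    show "fsub (nhom K U V)" using vhom_fsub[OF NVec_fvs[OF O(1)] NVec_fvs[OF O(2)]] O by (simp add: nhom_def)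
    show "su U V \<in> NVec K" using b by blast
    then show "i1 U V \<in> nhom K U (su U V)" "i2 U V \<in> nhom K V (su U V)" "q1 U V \<in> nhom K (su U V) U" "q2 U V \<in> nhom K (su U V) V"
      using b O by (auto intro!: nhomI)
    show "q1 U V \<circ> i1 U V = vid U" "q2 U V \<circ> i2 U V = vid V" "q1 U V \<circ> i2 U V = 0" "q2 U V \<circ> i1 U V = 0"
      "(i1 U V \<circ> q1 U V) + (i2 U V \<circ> q2 U V) = vid (su U V)" using b by blast+
  next
    fix U :: "('a, 'v) module" assume O: "U \<in> NVec K"
    note f = NVec_fvs[OF O]
    show "vid U \<in> nhom K U U" by (rule nhomI[OF O O vidh[OF O]])
    show "fsub (vscal K U)" by (rule vscal_fsub[OF f])
    show "2 \<le> card (vscal K U)" by (rule vscal_card[OF f NVecD(2)[OF O]])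
    show "vscal K U \<subseteq> nhom K U U"
      unfolding vscal_def using hat_vhom[OF f f scalar_module_hom[OF f]] by (auto intro!: nhomI O)
    show "\<exists>t\<in>nhom K U U. t \<circ> s = vid U \<and> s \<circ> t = vid U" if "s \<in> vscal K U" "s \<noteq> 0" for s
      using vscal_inv[OF f that] nhomI[OF O O] by blast
    show "\<exists>(n::nat) a b. (\<forall>i. a i \<in> nhom K U I \<and> b i \<in> nhom K I U) \<and> vid U = (\<Sum>i<n. b i \<circ> a i)"
      using gen O by blast
  next
    fix U V W X :: "('a, 'v) module" and f f' g g' h
    show "g \<circ> f \<in> nhom K U W" if "f \<in> nhom K U V" "g \<in> nhom K V W"
      using that by (intro nhomI vhom_comp) (auto dest: nhomD)
    show "U \<in> NVec K \<and> V \<in> NVec K" if "f \<in> nhom K U V" using nhomD[OF that] by simp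
    show "(h \<circ> g) \<circ> f = h \<circ> (g \<circ> f)" by (rule comp_assoc)
    show "(g - g') \<circ> f = (g \<circ> f) - (g' \<circ> f)" by (simp add: fun_eq_iff)
    show "g \<circ> (f - f') = (g \<circ> f) - (g \<circ> f')" if f: "f \<in> nhom K U V" "f' \<in> nhom K U V" and g: "g \<in> nhom K V W"
    proof (rule ext)
      fix x
      note V = NVec_fvs[OF nhomD(2)[OF f(1)]]
      show "(g \<circ> (f - f')) x = ((g \<circ> f) - (g \<circ> f')) x"
        using vhomD(3)[OF nhomD(3)[OF g] vhom_in[OF V nhomD(3)[OF f(1)]] vhom_in[OF V nhomD(3)[OF f(2)]]] by simp
    qed
    show "vid V \<circ> f = f" "f \<circ> vid U = f" if "f \<in> nhom K U V"
      using vid_left[OF NVec_fvs[OF nhomD(2)[OF that]] nhomD(3)[OF that]]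
        vid_right[OF NVec_fvs[OF nhomD(1)[OF that]] nhomD(3)[OF that]] by auto
  next
    show "I \<in> NVec K" by (rule I)
  qed
  then show ?thesis by (intro exI)
qed

end

section \<open>Polynomial maps have finite additive degree\<close>

lemma pdeg_Suc_mono: "fsub A \<Longrightarrow> fsub N \<Longrightarrow> pdeg e A N \<Phi> \<Longrightarrow> pdeg (Suc e) A N \<Phi>"
proof (induction e arbitrary: \<Phi>)
  case 0
  then show ?case by (auto intro: fsub_diff fsub_add)
next
  case (Suc e)
  have "pdeg (Suc e) A N (\<lambda>x. \<Phi> (x + h) - \<Phi> x)" if "h \<in> A" for h
    by (rule Suc.IH[OF Suc.prems(1,2)]) (use Suc.prems(3) that in simp)
  then show ?case by simp
qed

lemma pdeg_le:
  assumes "fsub A" "fsub N"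
  shows "e \<le> e' \<Longrightarrow> pdeg e A N \<Phi> \<Longrightarrow> pdeg e' A N \<Phi>"
  by (induction e' rule: dec_induct) (auto simp del: pdeg.simps intro: pdeg_Suc_mono[OF assms])

lemma pdeg_add: "fsub N \<Longrightarrow> pdeg e A N \<Phi> \<Longrightarrow> pdeg e A N \<Psi> \<Longrightarrow> pdeg e A N (\<lambda>x. \<Phi> x + \<Psi> x)"
proof (induction e arbitrary: \<Phi> \<Psi>)
  case 0
  then show ?case by (auto intro: fsub_add)
next
  case (Suc e)
  have "pdeg e A N (\<lambda>x. (\<Phi> (x + h) + \<Psi> (x + h)) - (\<Phi> x + \<Psi> x))" if h: "h \<in> A" for h
  proof -
    have "pdeg e A N (\<lambda>x. (\<Phi> (x + h) - \<Phi> x) + (\<Psi> (x + h) - \<Psi> x))"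
      using Suc.prems(2,3) h by (intro Suc.IH[OF Suc.prems(1)]) simp_all
    then show ?thesis by (simp add: algebra_simps)
  qed
  then show ?case by simp
qed

lemma pdeg_0: "fsub N \<Longrightarrow> pdeg e A N (\<lambda>x. 0)"
  by (induction e) (auto simp: fsub_0)

lemma pdeg_sum: "fsub N \<Longrightarrow> (\<And>i. i \<in> F \<Longrightarrow> pdeg e A N (\<Phi> i)) \<Longrightarrow> pdeg e A N (\<lambda>x. \<Sum>i\<in>F. \<Phi> i x)"
proof (induction F rule: infinite_finite_induct)
  case (insert i F)
  then show ?case by (simp add: pdeg_add)
qed (simp_all add: pdeg_0)

lemma pdeg_translate:
  assumes A: "fsub A" and h: "h \<in> A" and d: "pdeg e A N \<Phi>"
  shows "pdeg e A N (\<lambda>x. \<Phi> (x + h))"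
  using pdeg_affine[OF A A h, of "\<lambda>x. x", OF _ _ d] by (simp add: add.commute)

lemma fsub_zero: "fsub {0}"
  by (simp add: fsub_def)

lemma pdeg_additive_comp:
  assumes B: "fsub B" and \<Psi>: "\<And>x y. x \<in> B \<Longrightarrow> y \<in> B \<Longrightarrow> \<Psi> (x - y) = \<Psi> x - \<Psi> y"
    and A: "fsub A"
  shows "(\<And>x. x \<in> A \<Longrightarrow> \<Phi> x \<in> B) \<Longrightarrow> pdeg e A {0} \<Phi> \<Longrightarrow> pdeg e A {0} (\<lambda>x. \<Psi> (\<Phi> x))"
proof (induction e arbitrary: \<Phi>)
  case 0
  have "\<Psi> 0 = 0" using \<Psi>[OF fsub_0[OF B] fsub_0[OF B]] by simp
  then show ?case using 0 by simp
next
  case (Suc e)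
  have "pdeg e A {0} (\<lambda>x. \<Psi> (\<Phi> (x + h)) - \<Psi> (\<Phi> x))" if h: "h \<in> A" for h
  proof -
    have "pdeg e A {0} (\<lambda>x. \<Psi> (\<Phi> (x + h) - \<Phi> x))"
      using Suc.prems h by (intro Suc.IH) (auto intro!: fsub_diff[OF B] fsub_add[OF A])
    then show ?thesis
      by (subst pdeg_cong[OF A, where \<Psi> = "\<lambda>x. \<Psi> (\<Phi> (x + h) - \<Phi> x)"])
        (use \<Psi> Suc.prems(1) h fsub_add[OF A] in auto)
  qed
  then show ?case by simp
qed

text \<open>Leibniz rule: the difference of the product is
  \<open>\<beta> (f' x) (g (x + h)) + \<beta> (f x) (g' x)\<close>, and in both terms one degree has
  dropped. Degrees are shifted by one, \<open>pdeg (Suc a)\<close> being degree at most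
  \<open>a\<close>; for \<open>a = 0\<close> the first term vanishes instead of being a smaller
  instance, and likewise the second for \<open>b = 0\<close>.\<close>

lemma pdeg_biadditive:
  assumes A: "fsub A" and B: "fsub B" and C: "fsub C"
    and \<beta>1: "\<And>b b' c. b \<in> B \<Longrightarrow> b' \<in> B \<Longrightarrow> c \<in> C \<Longrightarrow> \<beta> (b - b') c = \<beta> b c - \<beta> b' c"
    and \<beta>2: "\<And>b c c'. b \<in> B \<Longrightarrow> c \<in> C \<Longrightarrow> c' \<in> C \<Longrightarrow> \<beta> b (c - c') = \<beta> b c - \<beta> b c'"
  shows "(\<And>x. x \<in> A \<Longrightarrow> f x \<in> B) \<Longrightarrow> (\<And>x. x \<in> A \<Longrightarrow> g x \<in> C) \<Longrightarrow>
    pdeg (Suc a) A {0} f \<Longrightarrow> pdeg (Suc b) A {0} g \<Longrightarrow> n = a + b \<Longrightarrow> pdeg (Suc n) A {0} (\<lambda>x. \<beta> (f x) (g x))"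
proof (induction n arbitrary: a b f g rule: less_induct)
  case (less n)
  note fB = less.prems(1) and gC = less.prems(2)
  have z: "\<beta> 0 c = 0" "\<beta> b 0 = 0" if "c \<in> C" "b \<in> B" for b c
    using \<beta>1[OF fsub_0[OF B] fsub_0[OF B] that(1)] \<beta>2[OF that(2) fsub_0[OF C] fsub_0[OF C]] by auto
  have "pdeg n A {0} (\<lambda>x. \<beta> (f (x + h)) (g (x + h)) - \<beta> (f x) (g x))" if h: "h \<in> A" for h
  proof -
    define f' where "f' x = f (x + h) - f x" for x
    define g' where "g' x = g (x + h) - g x" for x
    define gh where "gh x = g (x + h)" for x
    have xh: "x + h \<in> A" if "x \<in> A" for x using fsub_add[OF A that h] .
    have f'B: "f' x \<in> B" if "x \<in> A" for x unfolding f'_def by (rule fsub_diff[OF B fB[OF xh[OF that]] fB[OF that]])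
    have g'C: "g' x \<in> C" if "x \<in> A" for x unfolding g'_def by (rule fsub_diff[OF C gC[OF xh[OF that]] gC[OF that]])
    have ghC: "gh x \<in> C" if "x \<in> A" for x unfolding gh_def by (rule gC[OF xh[OF that]])
    have f'd: "pdeg a A {0} f'" using less.prems(3) h by (simp add: f'_def[abs_def])
    have g'd: "pdeg b A {0} g'" using less.prems(4) h by (simp add: g'_def[abs_def])
    have ghd: "pdeg (Suc b) A {0} gh" unfolding gh_def[abs_def] by (rule pdeg_translate[OF A h less.prems(4)])
    have 1: "pdeg n A {0} (\<lambda>x. \<beta> (f' x) (gh x))"
    proof (cases a)
      case 0
      then have "\<beta> (f' x) (gh x) = 0" if "x \<in> A" for x using f'd that z(1)[OF ghC[OF that] f'B[OF that]] by simp
      then show ?thesis using pdeg_0[OF fsub_zero, of n A] by (subst pdeg_cong[OF A, where \<Psi> = "\<lambda>x. 0"]) auto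
    next
      case (Suc a')
      then have n: "n = Suc (a' + b)" using less.prems(5) by simp
      show ?thesis unfolding n
        by (rule less.IH[of "a' + b" f' gh a' b]) (use n Suc f'B ghC f'd ghd in \<open>simp_all del: pdeg.simps\<close>)
    qed
    have 2: "pdeg n A {0} (\<lambda>x. \<beta> (f x) (g' x))"
    proof (cases b)
      case 0
      then have "\<beta> (f x) (g' x) = 0" if "x \<in> A" for x using g'd that z(2)[OF g'C[OF that] fB[OF that]] by simp
      then show ?thesis using pdeg_0[OF fsub_zero, of n A] by (subst pdeg_cong[OF A, where \<Psi> = "\<lambda>x. 0"]) auto
    next
      case (Suc b')
      then have n: "n = Suc (a + b')" using less.prems(5) by simp
      show ?thesis unfolding n
        by (rule less.IH[of "a + b'" f g' a b']) (use n Suc fB g'C g'd less.prems(3) in \<open>simp_all del: pdeg.simps\<close>)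
    qed
    have "\<beta> (f (x + h)) (g (x + h)) - \<beta> (f x) (g x) = \<beta> (f' x) (gh x) + \<beta> (f x) (g' x)" if x: "x \<in> A" for x
      unfolding f'_def g'_def gh_def
      using \<beta>1[OF fB[OF xh[OF x]] fB[OF x] gC[OF xh[OF x]]] \<beta>2[OF fB[OF x] gC[OF xh[OF x]] gC[OF x]] by simp
    then show ?thesis using pdeg_add[OF fsub_zero 1 2]
      by (subst pdeg_cong[OF A, where \<Psi> = "\<lambda>x. \<beta> (f' x) (gh x) + \<beta> (f x) (g' x)"]) auto
  qed
  then show ?case by simp
qed

context fin_field
begin

lemma self_simps [simp]: "carrier self_module = carrier K" "(\<oplus>\<^bsub>self_module\<^esub>) = (\<oplus>)" "\<zero>\<^bsub>self_module\<^esub> = \<zero>"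
  by (simp_all add: self_module_def)

definition eK :: "'a \<Rightarrow> ('a \<Rightarrow> circle) \<Rightarrow> circle" where
  "eK = enc self_module"

lemma self_minus: "x \<ominus>\<^bsub>self_module\<^esub> y = x \<ominus> y"
  by (simp add: a_minus_def a_inv_def m_inv_def self_module_def)

text \<open>Degree at most \<open>n\<close>, hence \<open>Suc n\<close> differences; values are
  encoded because differences are formed in a type of class \<open>ab_group_add\<close>.\<close>

definition kdeg :: "nat \<Rightarrow> 'h::ab_group_add set \<Rightarrow> ('h \<Rightarrow> 'a) \<Rightarrow> bool" where
  "kdeg n A y \<longleftrightarrow> (\<forall>x\<in>A. y x \<in> carrier K) \<and> pdeg (Suc n) A {0} (\<lambda>x. eK (y x))"

lemma kdeg_closed: "kdeg n A y \<Longrightarrow> x \<in> A \<Longrightarrow> y x \<in> carrier K"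
  by (simp add: kdeg_def)

lemma eK_EM: "x \<in> carrier K \<Longrightarrow> eK x \<in> EM self_module"
  by (simp add: eK_def EM_def)

lemma dK_eK: "x \<in> carrier K \<Longrightarrow> dec self_module (eK x) = x"
  using dec_enc'[OF fvs_self_module, of x] by (simp add: eK_def)

lemma dK_in: "x \<in> EM self_module \<Longrightarrow> dec self_module x \<in> carrier K"
  using EM_dec(1)[OF fvs_self_module, of x] by simp

lemma eK_minus: "x \<in> carrier K \<Longrightarrow> y \<in> carrier K \<Longrightarrow> eK (x \<ominus> y) = eK x - eK y"
  using enc_minus[OF fvsD(3)[OF fvs_self_module], of x y] by (simp add: eK_def self_minus)

lemma eK_add: "x \<in> carrier K \<Longrightarrow> y \<in> carrier K \<Longrightarrow> eK (x \<oplus> y) = eK x + eK y"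
  using enc_add[of x self_module y] by (simp add: eK_def)

lemma dK_diff: "x \<in> EM self_module \<Longrightarrow> y \<in> EM self_module \<Longrightarrow> dec self_module (x - y) = dec self_module x \<ominus> dec self_module y"
  using dec_diff[OF fvs_self_module, of x y] by (simp add: self_minus)

lemma minus_mult_left: "a \<in> carrier K \<Longrightarrow> b \<in> carrier K \<Longrightarrow> c \<in> carrier K \<Longrightarrow> (a \<ominus> b) \<otimes> c = a \<otimes> c \<ominus> b \<otimes> c"
  by (simp add: a_minus_def l_distr l_minus)

lemma minus_mult_right: "a \<in> carrier K \<Longrightarrow> b \<in> carrier K \<Longrightarrow> c \<in> carrier K \<Longrightarrow> c \<otimes> (a \<ominus> b) = c \<otimes> a \<ominus> c \<otimes> b"
  by (simp add: a_minus_def r_distr r_minus)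

lemma kdeg_mult:
  assumes A: "fsub A" and y: "kdeg a A y" and z: "kdeg b A z"
  shows "kdeg (a + b) A (\<lambda>x. y x \<otimes> z x)"
proof -
  define \<beta> where "\<beta> s t = eK (dec self_module s \<otimes> dec self_module t)" for s t
  note E = EM_fsub[OF fvs_self_module]
  have yz: "y x \<in> carrier K" "z x \<in> carrier K" if "x \<in> A" for x using kdeg_closed[OF y that] kdeg_closed[OF z that] by auto
  have "pdeg (Suc (a + b)) A {0} (\<lambda>x. \<beta> (eK (y x)) (eK (z x)))"
  proof (rule pdeg_biadditive[where \<beta> = \<beta> and f = "\<lambda>x. eK (y x)" and g = "\<lambda>x. eK (z x)" and a = a and b = b, OF A E E])
    show "\<beta> (s - s') t = \<beta> s t - \<beta> s' t" if "s \<in> EM self_module" "s' \<in> EM self_module" "t \<in> EM self_module" for s s' t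
      unfolding \<beta>_def dK_diff[OF that(1,2)] using that
      by (simp add: minus_mult_left dK_in eK_minus)
    show "\<beta> s (t - t') = \<beta> s t - \<beta> s t'" if "s \<in> EM self_module" "t \<in> EM self_module" "t' \<in> EM self_module" for s t t'
      unfolding \<beta>_def dK_diff[OF that(2,3)] using that
      by (simp add: minus_mult_right dK_in eK_minus)
  qed (use y z yz eK_EM in \<open>simp_all add: kdeg_def del: pdeg.simps\<close>)
  then have "pdeg (Suc (a + b)) A {0} (\<lambda>x. eK (y x \<otimes> z x))"
    by (subst pdeg_cong[OF A, where \<Psi> = "\<lambda>x. \<beta> (eK (y x)) (eK (z x))"]) (simp_all add: \<beta>_def dK_eK yz del: pdeg.simps)
  then show ?thesis using yz by (simp add: kdeg_def del: pdeg.simps)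
qed

lemma kdeg_const: "c \<in> carrier K \<Longrightarrow> kdeg 0 A (\<lambda>x. c)"
  by (simp add: kdeg_def)

text \<open>Second differences of an additive map vanish.\<close>

lemma kdeg_additive:
  assumes A: "fsub A" and y: "\<And>x. x \<in> A \<Longrightarrow> y x \<in> carrier K" "\<And>x x'. x \<in> A \<Longrightarrow> x' \<in> A \<Longrightarrow> y (x + x') = y x \<oplus> y x'"
  shows "kdeg 1 A y"
proof -
  have "eK (y (x + h)) = eK (y x) + eK (y h)" if "x \<in> A" "h \<in> A" for x h
    using that by (simp add: y eK_add)
  then have "pdeg (Suc 1) A {0} (\<lambda>x. eK (y x))" using fsub_add[OF A] by simp
  then show ?thesis using y(1) by (simp add: kdeg_def del: pdeg.simps)
qed

lemma kdeg_mono: "fsub A \<Longrightarrow> a \<le> b \<Longrightarrow> kdeg a A y \<Longrightarrow> kdeg b A y"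
  unfolding kdeg_def by (meson Suc_le_mono fsub_zero pdeg_le)

lemma kdeg_pow:
  assumes A: "fsub A" and y: "kdeg 1 A y"
  shows "kdeg m A (\<lambda>x. y x [^] m)"
proof (induction m)
  case 0
  show ?case using kdeg_const[OF one_closed] by simp
next
  case (Suc m)
  show ?case using kdeg_mult[OF A Suc y] by simp
qed

lemma kdeg_prod:
  assumes A: "fsub A"
  shows "finite I \<Longrightarrow> (\<And>i. i \<in> I \<Longrightarrow> kdeg (d i) A (y i)) \<Longrightarrow> kdeg (\<Sum>i\<in>I. d i) A (\<lambda>x. \<Otimes>i\<in>I. y i x)"
proof (induction I rule: finite_induct)
  case empty
  show ?case using kdeg_const[OF one_closed] by simp
next
  case (insert i I)
  have c: "y j x \<in> carrier K" if "j \<in> insert i I" "x \<in> A" for j x by (rule kdeg_closed[OF insert.prems[OF that(1)] that(2)])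
  have p: "(\<Otimes>j\<in>insert i I. y j x) = y i x \<otimes> (\<Otimes>j\<in>I. y j x)" if "x \<in> A" for x
    using c[OF _ that] insert.hyps by (intro finprod_insert) auto
  have "kdeg (d i + (\<Sum>j\<in>I. d j)) A (\<lambda>x. y i x \<otimes> (\<Otimes>j\<in>I. y j x))"
    by (rule kdeg_mult[OF A insert.prems insert.IH]) (use insert.prems in auto)
  then have "kdeg (d i + (\<Sum>j\<in>I. d j)) A (\<lambda>x. \<Otimes>j\<in>insert i I. y j x)"
    unfolding kdeg_def using p
    by (subst pdeg_cong[OF A, where \<Psi> = "\<lambda>x. eK (y i x \<otimes> (\<Otimes>j\<in>I. y j x))"]) (simp_all del: pdeg.simps)
  then show ?case using insert.hyps by simp
qed

lemma kdeg_sum: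
  assumes A: "fsub A" and y: "\<And>i. i \<in> I \<Longrightarrow> kdeg d A (y i)"
  shows "kdeg d A (\<lambda>x. \<Oplus>i\<in>I. y i x)"
proof (cases "finite I")
  case True
  have c: "y i x \<in> carrier K" if "i \<in> I" "x \<in> A" for i x by (rule kdeg_closed[OF y[OF that(1)] that(2)])
  have fs: "(\<Oplus>\<^bsub>self_module\<^esub>i\<in>I. z i) = (\<Oplus>i\<in>I. z i)" for z
    by (simp add: finsum_def finprod_def self_module_def)
  have "eK (\<Oplus>i\<in>I. y i x) = (\<Sum>i\<in>I. eK (y i x))" if "x \<in> A" for x
    using enc_finsum[OF fvsD(3)[OF fvs_self_module] True, of "\<lambda>i. y i x"] c[OF _ that] by (simp add: eK_def fs)
  moreover have "pdeg (Suc d) A {0} (\<lambda>x. \<Sum>i\<in>I. eK (y i x))"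
    by (rule pdeg_sum[OF fsub_zero]) (use y in \<open>simp add: kdeg_def del: pdeg.simps\<close>)
  ultimately have "pdeg (Suc d) A {0} (\<lambda>x. eK (\<Oplus>i\<in>I. y i x))"
    by (subst pdeg_cong[OF A, where \<Psi> = "\<lambda>x. \<Sum>i\<in>I. eK (y i x)"]) (simp_all del: pdeg.simps)
  then show ?thesis unfolding kdeg_def using c by (auto intro!: finsum_closed simp del: pdeg.simps)
next
  case False
  then have "(\<Oplus>i\<in>I. y i x) = \<zero>" for x by (simp add: finsum_def finprod_def)
  then show ?thesis using kdeg_mono[OF A _ kdeg_const[OF zero_closed]] by simp
qed

text \<open>Coordinates are additive, so of degree at most 1, and \<open>kdeg_mult\<close> turns a
  monomial into a map of degree at most its exponent sum. The substitution \<open>T\<close> will be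
  the decoding of linear maps. For negative \<open>d\<close> there are no exponents, and
  \<open>nat d = 0\<close> covers the zero function.\<close>

lemma kdeg_polynomial_function:
  assumes A: "fsub A" and f: "f \<in> polynomial_functions K V d"
    and T: "\<And>x. x \<in> A \<Longrightarrow> T x \<in> carrier V" "\<And>x x'. x \<in> A \<Longrightarrow> x' \<in> A \<Longrightarrow> T (x + x') = T x \<oplus>\<^bsub>V\<^esub> T x'"
  shows "kdeg (nat d) A (\<lambda>x. f (T x))"
proof -
  obtain n x c where lc: "linear_coordinates K V n x" and c: "c \<in> exponents n d \<rightarrow> carrier K"
    and fv: "\<forall>v\<in>carrier V. f v = (\<Oplus>e\<in>exponents n d. c e \<otimes> (\<Otimes>i\<in>{..<n}. x v i [^] e i))"
    using f unfolding polynomial_functions_def by blast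
  have xh: "x \<in> module_hom K V (func_space {..<n})" using lc by (simp add: linear_coordinates_def)
  have xi: "kdeg 1 A (\<lambda>a. x (T a) i)" if i: "i < n" for i
  proof (rule kdeg_additive[OF A])
    show "x (T a) i \<in> carrier K" if "a \<in> A" for a
      using module_hom_closed[OF xh] T(1)[OF that] i by (auto simp: func_space_def)
    show "x (T (a + b)) i = x (T a) i \<oplus> x (T b) i" if "a \<in> A" "b \<in> A" for a b
      using module_hom_add[OF xh T(1)[OF that(1)] T(1)[OF that(2)]] i T(2)[OF that] by (simp add: func_space_def)
  qed
  have "kdeg (nat d) A (\<lambda>a. \<Oplus>e\<in>exponents n d. c e \<otimes> (\<Otimes>i\<in>{..<n}. x (T a) i [^] e i))"
  proof (rule kdeg_sum[OF A])
    fix e assume e: "e \<in> exponents n d"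
    have "kdeg (0 + (\<Sum>i<n. e i)) A (\<lambda>a. c e \<otimes> (\<Otimes>i\<in>{..<n}. x (T a) i [^] e i))"
      by (intro kdeg_mult[OF A] kdeg_const kdeg_prod[OF A] kdeg_pow[OF A] xi) (use c e in auto)
    moreover have "0 + (\<Sum>i<n. e i) \<le> nat d"
    proof -
      have "int (\<Sum>i<n. e i) \<le> d" using e by (simp add: exponents_def del: of_nat_sum)
      from nat_mono[OF this] show ?thesis by (simp del: of_nat_sum)
    qed
    ultimately show "kdeg (nat d) A (\<lambda>a. c e \<otimes> (\<Otimes>i\<in>{..<n}. x (T a) i [^] e i))" by (rule kdeg_mono[OF A, rotated])
  qed
  then show ?thesis
    using T(1) fv unfolding kdeg_def
    by (subst pdeg_cong[OF A, where \<Psi> = "\<lambda>a. eK (\<Oplus>e\<in>exponents n d. c e \<otimes> (\<Otimes>i\<in>{..<n}. x (T a) i [^] e i))"])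
      (simp_all del: pdeg.simps)
qed

lemma Hom_space_abelian_monoid:
  assumes U: "fvs K U" and V: "fvs K V"
  shows "abelian_monoid (Hom_space K U V)"
proof -
  interpret U: vectorspace K U by (rule fvsD(1)[OF U])
  interpret V: vectorspace K V by (rule fvsD(1)[OF V])
  have fc: "f x \<in> carrier V" if "f \<in> Hom K U V" "x \<in> carrier U" for f x using that by (auto simp: Hom_def module_hom_def)
  show ?thesis
  proof (rule abelian_monoidI)
    fix f g assume f: "f \<in> carrier (Hom_space K U V)" and g: "g \<in> carrier (Hom_space K U V)"
    show "f \<oplus>\<^bsub>Hom_space K U V\<^esub> g \<in> carrier (Hom_space K U V)"
      using f g by (auto simp: Hom_space_def Hom_def module_hom_def V.smult_r_distr Pi_iff V.M.a_ac)
    show "f \<oplus>\<^bsub>Hom_space K U V\<^esub> g = g \<oplus>\<^bsub>Hom_space K U V\<^esub> f"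
      using f g fc by (auto simp: Hom_space_def V.M.a_comm intro!: restrict_ext)
  next
    show "\<zero>\<^bsub>Hom_space K U V\<^esub> \<in> carrier (Hom_space K U V)"
      by (auto simp: Hom_space_def Hom_def module_hom_def)
  next
    fix f assume f: "f \<in> carrier (Hom_space K U V)"
    then have f': "f \<in> Hom K U V" by (simp add: Hom_space_def)
    have "\<zero>\<^bsub>Hom_space K U V\<^esub> \<oplus>\<^bsub>Hom_space K U V\<^esub> f = restrict f (carrier U)"
      using fc[OF f'] by (auto simp: Hom_space_def intro!: restrict_ext)
    also have "\<dots> = f" using f' by (simp add: Hom_def extensional_restrict)
    finally show "\<zero>\<^bsub>Hom_space K U V\<^esub> \<oplus>\<^bsub>Hom_space K U V\<^esub> f = f" .
  next
    fix f g h assume "f \<in> carrier (Hom_space K U V)" "g \<in> carrier (Hom_space K U V)" "h \<in> carrier (Hom_space K U V)"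
    then show "f \<oplus>\<^bsub>Hom_space K U V\<^esub> g \<oplus>\<^bsub>Hom_space K U V\<^esub> h = f \<oplus>\<^bsub>Hom_space K U V\<^esub> (g \<oplus>\<^bsub>Hom_space K U V\<^esub> h)"
      using fc by (auto simp: Hom_space_def V.M.a_assoc intro!: restrict_ext)
  qed
qed

lemma Hom_space_finsum_apply:
  assumes U: "fvs K U" and V: "fvs K V" and p: "p \<in> carrier U"
  shows "finite F \<Longrightarrow> (\<And>j. j \<in> F \<Longrightarrow> g j \<in> Hom K U V) \<Longrightarrow> (\<Oplus>\<^bsub>Hom_space K U V\<^esub>j\<in>F. g j) p = (\<Oplus>\<^bsub>V\<^esub>j\<in>F. g j p)"
proof (induction F rule: finite_induct)
  case empty
  interpret H: abelian_monoid "Hom_space K U V" by (rule Hom_space_abelian_monoid[OF U V])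
  interpret V: vectorspace K V by (rule fvsD(1)[OF V])
  show ?case unfolding H.finsum_empty V.M.finsum_empty using p by (simp add: Hom_space_def)
next
  case (insert j F)
  interpret H: abelian_monoid "Hom_space K U V" by (rule Hom_space_abelian_monoid[OF U V])
  interpret V: vectorspace K V by (rule fvsD(1)[OF V])
  have c: "g i p \<in> carrier V" if "i \<in> insert j F" for i using insert.prems[OF that] p by (auto simp: Hom_def module_hom_def)
  have "(\<Oplus>\<^bsub>Hom_space K U V\<^esub>i\<in>insert j F. g i) = g j \<oplus>\<^bsub>Hom_space K U V\<^esub> (\<Oplus>\<^bsub>Hom_space K U V\<^esub>i\<in>F. g i)"
    using insert.prems insert.hyps by (intro H.finsum_insert) (auto simp: Hom_space_def)
  then have "(\<Oplus>\<^bsub>Hom_space K U V\<^esub>i\<in>insert j F. g i) p = g j p \<oplus>\<^bsub>V\<^esub> (\<Oplus>\<^bsub>Hom_space K U V\<^esub>i\<in>F. g i) p"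
    using p by (simp add: Hom_space_def)
  also have "\<dots> = g j p \<oplus>\<^bsub>V\<^esub> (\<Oplus>\<^bsub>V\<^esub>i\<in>F. g i p)" using insert by simp
  also have "\<dots> = (\<Oplus>\<^bsub>V\<^esub>i\<in>insert j F. g i p)" using c insert.hyps by (intro V.M.finsum_insert[symmetric]) auto
  finally show ?case .
qed

lemma smult_Hom:
  assumes U: "fvs K U" and V: "fvs K V" and c: "c \<in> carrier K" and w: "w \<in> Hom K U V"
  shows "c \<odot>\<^bsub>Hom_space K U V\<^esub> w \<in> Hom K U V"
proof -
  interpret U: vectorspace K U by (rule fvsD(1)[OF U])
  have "(\<lambda>u. c \<odot>\<^bsub>V\<^esub> w u) \<in> module_hom K U V"
    by (rule module_hom_comp[OF _ scalar_module_hom[OF V c]]) (use w in \<open>simp add: Hom_def\<close>)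
  from restrict_in_Hom[OF this fvsD(2)[OF U]] show ?thesis by (simp add: Hom_space_def)
qed

lemma unh_add:
  assumes U: "fvs K U" and V: "fvs K V" and F: "F \<in> vhom K U V" and G: "G \<in> vhom K U V"
  shows "unh U V (F + G) = unh U V F \<oplus>\<^bsub>Hom_space K U V\<^esub> unh U V G"
  using dec_add[OF V vhom_in[OF V F] vhom_in[OF V G]] by (auto simp: unh_def Hom_space_def fun_eq_iff)

text \<open>At a fixed \<open>p\<close> the map is a sum of scalar functions times fixed vectors
  \<open>w j p\<close>, and multiplying a vector by a scalar is additive in the scalar, so it keeps
  the degree.\<close>

lemma polynomial_maps_pdeg:
  assumes U: "fvs K U" and V: "fvs K V" and M: "fvs K M" and N: "fvs K N"
    and f: "\<Theta> \<in> polynomial_maps K (Hom_space K U V) (Hom_space K M N) d" and p: "p \<in> carrier M"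
  shows "pdeg (Suc (nat d)) (vhom K U V) {0} (\<lambda>F. enc N (\<Theta> (unh U V F) p))"
proof -
  interpret N: vectorspace K N by (rule fvsD(1)[OF N])
  note A = vhom_fsub[OF U V]
  obtain n :: nat and g w where gw: "\<forall>j<n. g j \<in> polynomial_functions K (Hom_space K U V) d \<and> w j \<in> carrier (Hom_space K M N)"
    and \<Theta>: "\<forall>v\<in>carrier (Hom_space K U V). \<Theta> v = (\<Oplus>\<^bsub>Hom_space K M N\<^esub>j\<in>{..<n}. g j v \<odot>\<^bsub>Hom_space K M N\<^esub> w j)"
    using f unfolding polynomial_maps_def by blast
  have wH: "w j \<in> Hom K M N" if "j < n" for j using gw that by (simp add: Hom_space_def)
  have wp: "w j p \<in> carrier N" if "j < n" for j using wH[OF that] p by (auto simp: Hom_def module_hom_def)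
  have uc: "unh U V F \<in> carrier (Hom_space K U V)" if "F \<in> vhom K U V" for F
    using unh_Hom[OF U V that] by (simp add: Hom_space_def)
  have kd: "kdeg (nat d) (vhom K U V) (\<lambda>F. g j (unh U V F))" if "j < n" for j
  proof (rule kdeg_polynomial_function[where T = "unh U V" and V = "Hom_space K U V", OF A])
    show "g j \<in> polynomial_functions K (Hom_space K U V) d" using gw that by blast
  qed (rule uc unh_add[OF U V], assumption+)+
  have gc: "g j (unh U V F) \<in> carrier K" if "j < n" "F \<in> vhom K U V" for j F by (rule kdeg_closed[OF kd[OF that(1)] that(2)])
  define \<Psi> where "\<Psi> j k = enc N (dec self_module k \<odot>\<^bsub>N\<^esub> w j p)" for j k
  have "pdeg (Suc (nat d)) (vhom K U V) {0} (\<lambda>F. \<Sum>j<n. \<Psi> j (eK (g j (unh U V F))))"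
  proof (rule pdeg_sum[OF fsub_zero])
    fix j assume "j \<in> {..<n}"
    then have j: "j < n" by simp
    show "pdeg (Suc (nat d)) (vhom K U V) {0} (\<lambda>F. \<Psi> j (eK (g j (unh U V F))))"
    proof (rule pdeg_additive_comp[where \<Psi> = "\<Psi> j" and \<Phi> = "\<lambda>F. eK (g j (unh U V F))", OF EM_fsub[OF fvs_self_module] _ A])
      show "\<Psi> j (x - y) = \<Psi> j x - \<Psi> j y" if "x \<in> EM self_module" "y \<in> EM self_module" for x y
      proof -
        have "(dec self_module x \<ominus> dec self_module y) \<odot>\<^bsub>N\<^esub> w j p = dec self_module x \<odot>\<^bsub>N\<^esub> w j p \<ominus>\<^bsub>N\<^esub> dec self_module y \<odot>\<^bsub>N\<^esub> w j p"
          using dK_in[OF that(1)] dK_in[OF that(2)] wp[OF j] by (simp add: a_minus_def N.smult_l_distr N.smult_l_minus)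
        then show ?thesis
          unfolding \<Psi>_def dK_diff[OF that] using dK_in[OF that(1)] dK_in[OF that(2)] wp[OF j]
          by (simp add: enc_minus[OF fvsD(3)[OF N]])
      qed
      show "eK (g j (unh U V F)) \<in> EM self_module" if "F \<in> vhom K U V" for F by (rule eK_EM[OF gc[OF j that]])
      show "pdeg (Suc (nat d)) (vhom K U V) {0} (\<lambda>F. eK (g j (unh U V F)))"
        using kd[OF j] by (simp add: kdeg_def del: pdeg.simps)
    qed
  qed
  moreover have "enc N (\<Theta> (unh U V F) p) = (\<Sum>j<n. \<Psi> j (eK (g j (unh U V F))))" if F: "F \<in> vhom K U V" for F
  proof -
    have "\<Theta> (unh U V F) p = (\<Oplus>\<^bsub>N\<^esub>j\<in>{..<n}. (g j (unh U V F) \<odot>\<^bsub>Hom_space K M N\<^esub> w j) p)"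
      using \<Theta> uc[OF F] Hom_space_finsum_apply[OF M N p, of "{..<n}" "\<lambda>j. g j (unh U V F) \<odot>\<^bsub>Hom_space K M N\<^esub> w j"]
        smult_Hom[OF M N gc[OF _ F] wH] by simp
    also have "enc N \<dots> = (\<Sum>j<n. enc N ((g j (unh U V F) \<odot>\<^bsub>Hom_space K M N\<^esub> w j) p))"
      by (rule enc_finsum[OF fvsD(3)[OF N]]) (use gc F wp p in \<open>simp_all add: Hom_space_def\<close>)
    also have "\<dots> = (\<Sum>j<n. \<Psi> j (eK (g j (unh U V F))))"
      by (rule sum.cong) (use gc F p in \<open>simp_all add: Hom_space_def \<Psi>_def dK_eK\<close>)
    finally show ?thesis .
  qed
  ultimately show ?thesis
    by (subst pdeg_cong[OF A, where \<Psi> = "\<lambda>F. \<Sum>j<n. \<Psi> j (eK (g j (unh U V F)))"]) (simp_all del: pdeg.simps)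
qed

end

section \<open>Well-quasi-order and irreducible decomposition\<close>

lemma compose_in_Hom:
  assumes U: "fvs K U" and f: "f \<in> Hom K U V" and g: "g \<in> Hom K V W"
  shows "compose (carrier U) g f \<in> Hom K U W"
proof -
  have "(\<lambda>x. g (f x)) \<in> module_hom K U W"
    by (rule module_hom_comp[of f K U V]) (use f g in \<open>auto simp: Hom_def\<close>)
  from restrict_in_Hom[OF this fvsD(2)[OF U]] show ?thesis by (simp add: compose_def)
qed

lemma Hom_closed: "f \<in> Hom K U V \<Longrightarrow> x \<in> carrier U \<Longrightarrow> f x \<in> carrier V"
  by (auto simp: Hom_def module_hom_def)

locale finite_polynomial_representation = fin_field K + polynomial_representation K P
  for K :: "('a, 'b) ring_scheme" (structure) and P :: "('a, 'v) vec_functor" +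
  assumes infinite_universe: "infinite (UNIV :: 'v set)"
begin

lemma Obj_fvs: "V \<in> Vec K \<Longrightarrow> fvs K (Obj P V)"
  using Obj_closed fvs_Vec by blast

lemma Vec_fvs: "V \<in> Vec K \<Longrightarrow> fvs K V"
  using fvs_Vec by blast

lemma Arr_apply_compose:
  assumes "U \<in> Vec K" "V \<in> Vec K" "W \<in> Vec K" "\<phi> \<in> Hom K U V" "\<psi> \<in> Hom K V W" "p \<in> carrier (Obj P U)"
  shows "Arr P U W (compose (carrier U) \<psi> \<phi>) p = Arr P V W \<psi> (Arr P U V \<phi> p)"
  using Arr_compose[OF assms(1-5)] assms(6) by (simp add: compose_def)

lemma Arr_in: "U \<in> Vec K \<Longrightarrow> V \<in> Vec K \<Longrightarrow> \<phi> \<in> Hom K U V \<Longrightarrow> p \<in> carrier (Obj P U) \<Longrightarrow> Arr P U V \<phi> p \<in> carrier (Obj P V)"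
  by (rule Hom_closed[OF Arr_closed])

definition ract :: "('a, 'v) module \<Rightarrow> ('a, 'v) module \<Rightarrow> ((('v \<Rightarrow> circle) \<Rightarrow> circle) \<Rightarrow> ('v \<Rightarrow> circle) \<Rightarrow> circle) \<Rightarrow>
    (('v \<Rightarrow> circle) \<Rightarrow> circle) \<Rightarrow> ('v \<Rightarrow> circle) \<Rightarrow> circle" where
  "ract U V F = hat (Obj P U) (Obj P V) (Arr P U V (unh U V F))"

lemma ract_vhom: "U \<in> Vec K \<Longrightarrow> V \<in> Vec K \<Longrightarrow> F \<in> vhom K U V \<Longrightarrow> ract U V F \<in> vhom K (Obj P U) (Obj P V)"
proof -
  assume O: "U \<in> Vec K" "V \<in> Vec K" and F: "F \<in> vhom K U V"
  have "Arr P U V (unh U V F) \<in> Hom K (Obj P U) (Obj P V)"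
    by (rule Arr_closed[OF O unh_Hom[OF Vec_fvs[OF O(1)] Vec_fvs[OF O(2)] F]])
  then show ?thesis unfolding ract_def by (intro hat_vhom Obj_fvs O) (simp add: Hom_def)
qed

lemma ract_enc: "U \<in> Vec K \<Longrightarrow> p \<in> carrier (Obj P U) \<Longrightarrow>
    ract U V F (enc (Obj P U) p) = enc (Obj P V) (Arr P U V (unh U V F) p)"
  unfolding ract_def by (rule hat_enc[OF Obj_fvs])

lemma ract_id:
  assumes V: "V \<in> Vec K" and p: "p \<in> carrier (Obj P V)"
  shows "ract V V (vid V) (enc (Obj P V) p) = enc (Obj P V) p"
proof -
  note f = Vec_fvs[OF V]
  have "unh V V (vid V) = (\<lambda>v\<in>carrier V. v)"
    unfolding unh_def vid_def by (rule restrict_ext) (simp add: hat_enc[OF f] dec_enc'[OF f])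
  then show ?thesis using p Arr_id[OF V] by (simp add: ract_enc[OF V p])
qed

lemma ract_comp:
  assumes O: "U \<in> Vec K" "V \<in> Vec K" "W \<in> Vec K" and F: "F \<in> vhom K U V" and G: "G \<in> vhom K V W" and p: "p \<in> carrier (Obj P U)"
  shows "ract U W (G \<circ> F) (enc (Obj P U) p) = ract V W G (ract U V F (enc (Obj P U) p))"
proof -
  note f = Vec_fvs[OF O(1)] Vec_fvs[OF O(2)] Vec_fvs[OF O(3)]
  note uF = unh_Hom[OF f(1,2) F] and uG = unh_Hom[OF f(2,3) G]
  show ?thesis
    unfolding ract_enc[OF O(1) p] unh_comp[OF f F G] Arr_apply_compose[OF O uF uG p]
    by (rule ract_enc[OF O(2) Arr_in[OF O(1,2) uF p], symmetric])
qed

text \<open>The general theorem is applied modulo the zero subfunctor, where the relation becomes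
  equality. Polynomials of degree at most \<open>d\<close> give
  \<open>pol_degree (Suc (nat d))\<close>.\<close>

lemma wqo_nonzero:
  fixes V :: "nat \<Rightarrow> ('a, 'v) module"
  assumes V: "\<And>i. V i \<in> NVec K" and p: "\<And>i. p i \<in> carrier (Obj P (V i))"
  shows "\<exists>i j. i < j \<and> (\<exists>\<phi>\<in>Hom K (V j) (V i). Arr P (V j) (V i) \<phi> (p j) = p i)"
proof -
  obtain su i1 i2 q1 q2 I0 where
    "additive_cat (NVec K :: ('a, 'v) module set) (nhom K) (\<circ>) vid su i1 i2 q1 q2 (vscal K) I0"
    using NVec_additive_cat[OF infinite_universe] by (elim exE)
  then interpret C: additive_cat "NVec K :: ('a, 'v) module set" "nhom K" "(\<circ>)" vid su i1 i2 q1 q2 "vscal K" I0 .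
  define G where "G V = EM (Obj P V)" for V
  have GI: "\<exists>q\<in>carrier (Obj P V). x = enc (Obj P V) q" if "x \<in> G V" for x V using that by (auto simp: G_def EM_def)
  have F: "C.is_functor G ract"
    unfolding C.is_functor_def
  proof (intro conjI ballI allI impI)
    show "fsub (G V)" if "V \<in> NVec K" for V unfolding G_def by (rule EM_fsub[OF Obj_fvs[OF NVecD(1)[OF that]]])
    show "ract U V f x \<in> G V" if "f \<in> nhom K U V" "x \<in> G U" for U V f x
      using vhomD(2)[OF ract_vhom[OF NVecD(1)[OF nhomD(1)[OF that(1)]] NVecD(1)[OF nhomD(2)[OF that(1)]] nhomD(3)[OF that(1)]]] that(2)
      by (simp add: G_def)
    show "ract U V f (x - y) = ract U V f x - ract U V f y" if "f \<in> nhom K U V" "x \<in> G U" "y \<in> G U" for U V f x y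
      using vhomD(3)[OF ract_vhom[OF NVecD(1)[OF nhomD(1)[OF that(1)]] NVecD(1)[OF nhomD(2)[OF that(1)]] nhomD(3)[OF that(1)]]] that(2,3)
      by (simp add: G_def)
    show "ract V V (vid V) x = x" if "V \<in> NVec K" "x \<in> G V" for V x
      using GI[OF that(2)] ract_id[OF NVecD(1)[OF that(1)]] by auto
    show "ract U W (g \<circ> f) x = ract V W g (ract U V f x)" if fg: "f \<in> nhom K U V" "g \<in> nhom K V W" and x: "x \<in> G U" for U V W f g x
      using GI[OF x] ract_comp[OF NVecD(1)[OF nhomD(1)[OF fg(1)]] NVecD(1)[OF nhomD(2)[OF fg(1)]] NVecD(1)[OF nhomD(2)[OF fg(2)]]
          nhomD(3)[OF fg(1)] nhomD(3)[OF fg(2)]] by auto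
  qed
  have N: "C.is_sub G ract (\<lambda>_. {0})"
    unfolding C.is_sub_def
  proof (intro conjI ballI allI impI)
    show "fsub {0}" by (rule fsub_zero)
    show "{0} \<subseteq> G V" if "V \<in> NVec K" for V using fsub_0[OF C.functorD(1)[OF F that]] by simp
    show "ract U V f x \<in> {0}" if "f \<in> nhom K U V" "x \<in> {0}" for U V f x
      using C.functor_0[OF F that(1)] that(2) by simp
  qed
  obtain d where d: "\<forall>U\<in>Vec K. \<forall>V\<in>Vec K. Arr P U V \<in> polynomial_maps K (Hom_space K U V) (Hom_space K (Obj P U) (Obj P V)) d"
    using polynomial by blast
  have "C.pol_degree (Suc (nat d)) G ract (\<lambda>_. {0})"
    unfolding C.pol_degree_def
  proof (intro ballI)
    fix U V :: "('a, 'v) module" and x assume U: "U \<in> NVec K" and V: "V \<in> NVec K" and "x \<in> G U"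
    then obtain q where q: "q \<in> carrier (Obj P U)" and x: "x = enc (Obj P U) q" using GI by blast
    note UV = NVecD(1)[OF U] NVecD(1)[OF V]
    have "pdeg (Suc (nat d)) (vhom K U V) {0} (\<lambda>F. enc (Obj P V) (Arr P U V (unh U V F) q))"
      by (rule polynomial_maps_pdeg[OF Vec_fvs[OF UV(1)] Vec_fvs[OF UV(2)] Obj_fvs[OF UV(1)] Obj_fvs[OF UV(2)] _ q])
        (use d UV in blast)
    then show "pdeg (Suc (nat d)) (nhom K U V) {0} (\<lambda>F. ract U V F x)"
      using U V by (simp add: nhom_def x ract_enc[OF UV(1) q] del: pdeg.simps)
  qed
  from C.wqo_mod_pol_degree[OF F N this]
  have "\<exists>i j. i < j \<and> (\<exists>\<alpha>\<in>nhom K (V j) (V i). ract (V j) (V i) \<alpha> (enc (Obj P (V j)) (p j)) - enc (Obj P (V i)) (p i) \<in> {0})"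
    unfolding C.wqo_mod_def using V p by (auto simp: G_def EM_def)
  then obtain i j \<alpha> where ij: "i < j" and \<alpha>: "\<alpha> \<in> nhom K (V j) (V i)"
    and e: "ract (V j) (V i) \<alpha> (enc (Obj P (V j)) (p j)) = enc (Obj P (V i)) (p i)" by auto
  note Vj = NVecD(1)[OF V[of j]] and Vi = NVecD(1)[OF V[of i]]
  note u = unh_Hom[OF Vec_fvs[OF Vj] Vec_fvs[OF Vi] nhomD(3)[OF \<alpha>]]
  have "Arr P (V j) (V i) (unh (V j) (V i) \<alpha>) (p j) = p i"
    using e unfolding ract_enc[OF Vj p] by (rule enc_eqD[OF Obj_fvs[OF Vi] _ Arr_in[OF Vj Vi u p] p])
  then show ?thesis using ij u by blast
qed

text \<open>The direct sum with the line is nonzero and retracts onto \<open>V\<close>.\<close>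

lemma nonzero_summand:
  assumes V: "V \<in> (Vec K :: ('a, 'v) module set)"
  shows "\<exists>W f g. W \<in> (NVec K :: ('a, 'v) module set) \<and> f \<in> Hom K V W \<and> g \<in> Hom K W V \<and>
    compose (carrier V) g f = (\<lambda>v\<in>carrier V. v)"
proof -
  obtain I where I: "I \<in> (NVec K :: ('a, 'v) module set)" using line_exists[OF infinite_universe] by blast
  obtain W i1 i2 q1 q2 where W: "W \<in> (Vec K :: ('a, 'v) module set)" and i1: "i1 \<in> module_hom K V W" and i2: "i2 \<in> module_hom K I W"
    and q1: "q1 \<in> module_hom K W V"
    and a: "\<forall>x\<in>carrier V. q1 (i1 x) = x \<and> q2 (i1 x) = \<zero>\<^bsub>I\<^esub>" and b: "\<forall>x\<in>carrier I. q2 (i2 x) = x \<and> q1 (i2 x) = \<zero>\<^bsub>V\<^esub>"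
    using biproduct_exists[OF V NVecD(1)[OF I] infinite_universe] by (elim exE conjE)
  interpret I: vectorspace K I by (rule fvsD(1)[OF NVec_fvs[OF I]])
  have "carrier W \<noteq> {\<zero>\<^bsub>W\<^esub>}"
  proof
    assume W0: "carrier W = {\<zero>\<^bsub>W\<^esub>}"
    have i2W: "i2 x = \<zero>\<^bsub>W\<^esub>" if "x \<in> carrier I" for x using module_hom_closed[OF i2] that W0 by auto
    have "x = \<zero>\<^bsub>I\<^esub>" if x: "x \<in> carrier I" for x
    proof -
      have "x = q2 (i2 x)" using b x by metis
      also have "\<dots> = q2 (i2 \<zero>\<^bsub>I\<^esub>)" using i2W[OF x] i2W[OF I.M.zero_closed] by simp
      also have "\<dots> = \<zero>\<^bsub>I\<^esub>" using b I.M.zero_closed by metis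
      finally show ?thesis .
    qed
    then show False using NVecD(2)[OF I] I.M.zero_closed by blast
  qed
  then have "W \<in> NVec K" using W by (simp add: NVec_def)
  moreover have "restrict i1 (carrier V) \<in> Hom K V W" "restrict q1 (carrier W) \<in> Hom K W V"
    using restrict_in_Hom[OF i1 fvsD(2)[OF Vec_fvs[OF V]]] restrict_in_Hom[OF q1 fvsD(2)[OF Vec_fvs[OF W]]] by auto
  moreover have "compose (carrier V) (restrict q1 (carrier W)) (restrict i1 (carrier V)) = (\<lambda>v\<in>carrier V. v)"
    unfolding compose_def by (rule restrict_ext) (use a module_hom_closed[OF i1] in auto)
  ultimately show ?thesis by blast
qed

text \<open>The elements are moved into nonzero spaces by \<open>f i\<close>, compared there, and
  brought back by the retraction \<open>g i\<close>; functoriality makes \<open>g i\<close> after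
  \<open>f i\<close> act as the identity on \<open>p i\<close>.\<close>

theorem polynomial_representation_wqo:
  fixes V :: "nat \<Rightarrow> ('a, 'v) module"
  assumes V: "\<And>i. V i \<in> Vec K" and p: "\<And>i. p i \<in> carrier (Obj P (V i))"
  shows "\<exists>i j. i < j \<and> (\<exists>\<phi>\<in>Hom K (V j) (V i). Arr P (V j) (V i) \<phi> (p j) = p i)"
proof -
  have "\<forall>i. \<exists>W f g. W \<in> (NVec K :: ('a, 'v) module set) \<and> f \<in> Hom K (V i) W \<and> g \<in> Hom K W (V i) \<and>
      compose (carrier (V i)) g f = (\<lambda>v\<in>carrier (V i). v)"
    using nonzero_summand[OF V] by blast
  then obtain W f g where WN: "\<And>i. W i \<in> (NVec K :: ('a, 'v) module set)" and f: "\<And>i. f i \<in> Hom K (V i) (W i)" and g: "\<And>i. g i \<in> Hom K (W i) (V i)"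
    and gf: "\<And>i. compose (carrier (V i)) (g i) (f i) = (\<lambda>v\<in>carrier (V i). v)"
    by metis
  have W: "W i \<in> Vec K" for i by (rule NVecD(1)[OF WN])
  define p' where "p' i = Arr P (V i) (W i) (f i) (p i)" for i
  have p': "p' i \<in> carrier (Obj P (W i))" for i unfolding p'_def by (rule Arr_in[OF V W f p])
  obtain i j \<alpha> where ij: "i < j" and \<alpha>: "\<alpha> \<in> Hom K (W j) (W i)" and e: "Arr P (W j) (W i) \<alpha> (p' j) = p' i"
    using wqo_nonzero[of W p', OF WN p'] by blast
  define \<phi> where "\<phi> = compose (carrier (V j)) (g i) (compose (carrier (V j)) \<alpha> (f j))"
  note c1 = compose_in_Hom[OF Vec_fvs[OF V] f \<alpha>]
  have "\<phi> \<in> Hom K (V j) (V i)" unfolding \<phi>_def by (rule compose_in_Hom[OF Vec_fvs[OF V] c1 g])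
  moreover have "Arr P (V j) (V i) \<phi> (p j) = p i"
  proof -
    have "Arr P (V j) (V i) \<phi> (p j) = Arr P (W i) (V i) (g i) (Arr P (V j) (W i) (compose (carrier (V j)) \<alpha> (f j)) (p j))"
      unfolding \<phi>_def by (rule Arr_apply_compose[OF V W V c1 g p])
    also have "Arr P (V j) (W i) (compose (carrier (V j)) \<alpha> (f j)) (p j) = p' i"
      using Arr_apply_compose[OF V W W f \<alpha> p] e by (simp add: p'_def)
    also have "Arr P (W i) (V i) (g i) (p' i) = Arr P (V i) (V i) (compose (carrier (V i)) (g i) (f i)) (p i)"
      unfolding p'_def by (rule Arr_apply_compose[OF V W V f g p, symmetric])
    also have "\<dots> = p i" unfolding gf using Arr_id[OF V] p by simp
    finally show ?thesis .
  qed
  ultimately show ?thesis using ij by blast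
qed

section \<open>Subsets of the representation and their decomposition\<close>

lemma rep_subsetD:
  assumes "rep_subset K P X"
  shows "V \<in> Vec K \<Longrightarrow> X V \<subseteq> carrier (Obj P V)"
    and "V \<in> Vec K \<Longrightarrow> W \<in> Vec K \<Longrightarrow> \<phi> \<in> Hom K V W \<Longrightarrow> p \<in> X V \<Longrightarrow> Arr P V W \<phi> p \<in> X W"
    and "V \<notin> Vec K \<Longrightarrow> X V = {}"
  using assms unfolding rep_subset_def by blast+

text \<open>Subsets are empty outside \<open>Vec K\<close>, so containment is the pointwise order of
  functions and the lattice operations become available.\<close>

lemma rep_subset_le: "rep_subset K P X \<Longrightarrow> X \<le> Y \<longleftrightarrow> (\<forall>V\<in>Vec K. X V \<subseteq> Y V)"
  using rep_subsetD(3)[of X] unfolding le_fun_def by blast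

lemma rep_subsetI:
  assumes "\<And>V. V \<in> Vec K \<Longrightarrow> X V \<subseteq> carrier (Obj P V)"
    and "\<And>V W \<phi> p. V \<in> Vec K \<Longrightarrow> W \<in> Vec K \<Longrightarrow> \<phi> \<in> Hom K V W \<Longrightarrow> p \<in> X V \<Longrightarrow> Arr P V W \<phi> p \<in> X W"
    and "\<And>V. V \<notin> Vec K \<Longrightarrow> X V = {}"
  shows "rep_subset K P X"
  unfolding rep_subset_def using assms by (simp add: image_subset_iff)

lemma rep_subset_inf:
  assumes X: "rep_subset K P X" and Y: "rep_subset K P Y"
  shows "rep_subset K P (inf X Y)"
proof (rule rep_subsetI)
  show "inf X Y V \<subseteq> carrier (Obj P V)" if "V \<in> Vec K" for V
    using rep_subsetD(1)[OF X that] by (simp add: le_infI1)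
  show "Arr P V W \<phi> p \<in> inf X Y W" if h: "V \<in> Vec K" "W \<in> Vec K" "\<phi> \<in> Hom K V W" "p \<in> inf X Y V" for V W \<phi> p
    using rep_subsetD(2)[OF X h(1-3)] rep_subsetD(2)[OF Y h(1-3)] h(4) by simp
  show "inf X Y V = {}" if "V \<notin> Vec K" for V using rep_subsetD(3)[OF X that] by simp
qed

lemma rep_subset_Sup:
  assumes S: "\<And>X. X \<in> S \<Longrightarrow> rep_subset K P X"
  shows "rep_subset K P (Sup S)"
proof (rule rep_subsetI)
  show "Sup S V \<subseteq> carrier (Obj P V)" if "V \<in> Vec K" for V
    using rep_subsetD(1)[OF S that] by (simp add: SUP_le_iff)
  show "Arr P V W \<phi> p \<in> Sup S W" if h: "V \<in> Vec K" "W \<in> Vec K" "\<phi> \<in> Hom K V W" "p \<in> Sup S V" for V W \<phi> p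
  proof -
    obtain X where X: "X \<in> S" "p \<in> X V" using h(4) by auto
    from rep_subsetD(2)[OF S[OF X(1)] h(1-3) X(2)] show ?thesis using X(1) by auto
  qed
  show "Sup S V = {}" if "V \<notin> Vec K" for V using rep_subsetD(3)[OF S that] by simp
qed

text \<open>In a strictly descending chain pick \<open>p i\<close> in the \<open>i\<close>-th subset
  but not in the next. If a map sends \<open>p j\<close> to \<open>p i\<close> with
  \<open>i < j\<close>, then \<open>p i\<close> lies in the \<open>j\<close>-th subset and therefore
  in the one after the \<open>i\<close>-th.\<close>

lemma rep_subset_wf: "wf {(X, Y). rep_subset K P X \<and> rep_subset K P Y \<and> X < Y}"
  unfolding wf_iff_no_infinite_down_chain
proof
  assume "\<exists>X. \<forall>i. (X (Suc i), X i) \<in> {(X, Y). rep_subset K P X \<and> rep_subset K P Y \<and> X < Y}"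
  then obtain X :: "nat \<Rightarrow> ('a, 'v) module \<Rightarrow> 'v set" where X: "\<And>i. rep_subset K P (X i)" and less: "\<And>i. X (Suc i) < X i" by auto
  have anti: "X j \<le> X i" if "i \<le> j" for i j
    using lift_Suc_antimono_le[of X, OF less_imp_le[OF less] that] .
  have "\<exists>V p. V \<in> Vec K \<and> p \<in> X i V \<and> p \<notin> X (Suc i) V" for i
  proof -
    have "\<not> X i \<le> X (Suc i)" using less[of i] by (simp add: less_le_not_le)
    then show ?thesis unfolding rep_subset_le[OF X] by blast
  qed
  then obtain V p where V: "\<And>i. V i \<in> Vec K" and p: "\<And>i. p i \<in> X i (V i)" and np: "\<And>i. p i \<notin> X (Suc i) (V i)"
    by metis
  have pc: "p i \<in> carrier (Obj P (V i))" for i using p rep_subsetD(1)[OF X V] by blast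
  obtain i j \<phi> where ij: "i < j" and \<phi>: "\<phi> \<in> Hom K (V j) (V i)" and e: "Arr P (V j) (V i) \<phi> (p j) = p i"
    using polynomial_representation_wqo[of V p, OF V pc] by blast
  have "p i \<in> X j (V i)" using rep_subsetD(2)[OF X V V \<phi> p] e by simp
  then have "p i \<in> X (Suc i) (V i)" using anti[of "Suc i" j] ij by (auto simp: le_fun_def)
  then show False using np by blast
qed

lemma zero_space_exists: "\<exists>Z \<in> (Vec K :: ('a, 'v) module set). carrier Z = {\<zero>\<^bsub>Z\<^esub>}"
proof -
  define M :: "('a, unit) module" where "M = \<lparr>carrier = UNIV, mult = undefined, one = undefined, zero = (), add = (\<lambda>_ _. ()), smult = (\<lambda>_ _. ())\<rparr>"
  have "vectorspace K M" by (rule vs_criteria) (auto simp: M_def field_axioms)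
  then have M: "fvs K M" by (simp add: fvs_def M_def)
  obtain Z and j :: "unit \<Rightarrow> 'v" and j' where Z: "Z \<in> (Vec K :: ('a, 'v) module set)" and jj: "\<forall>y\<in>carrier Z. j (j' y) = y"
    using transport[OF M infinite_universe] by (elim exE conjE)
  interpret Z: vectorspace K Z by (rule fvsD(1)[OF Vec_fvs[OF Z]])
  have "y = z" if "y \<in> carrier Z" "z \<in> carrier Z" for y z
    using jj[rule_format, OF that(1)] jj[rule_format, OF that(2)] by simp
  then have "carrier Z = {\<zero>\<^bsub>Z\<^esub>}" using Z.M.zero_closed by blast
  then show ?thesis using Z by blast
qed

text \<open>The zero map carries a point over any \<open>V\<close> to a point over the zero
  space.\<close>

lemma rep_subset_zero_space:
  assumes X: "rep_subset K P X" "X \<noteq> bot" and Z: "Z \<in> Vec K" "carrier Z = {\<zero>\<^bsub>Z\<^esub>}"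
  shows "X Z \<noteq> {}"
proof -
  obtain V where "X V \<noteq> {}" using X(2) by (auto simp: fun_eq_iff)
  then have V: "V \<in> Vec K" "X V \<noteq> {}" using rep_subsetD(3)[OF X(1)] by auto
  interpret V: vectorspace K V by (rule fvsD(1)[OF Vec_fvs[OF V(1)]])
  interpret Z: vectorspace K Z by (rule fvsD(1)[OF Vec_fvs[OF Z(1)]])
  have "(\<lambda>v\<in>carrier V. \<zero>\<^bsub>Z\<^esub>) \<in> Hom K V Z" by (auto simp: Hom_def module_hom_def)
  then show ?thesis using rep_subsetD(2)[OF X(1) V(1) Z(1)] V(2) by blast
qed

text \<open>Irreducible subsets behave like primes: \<open>Y\<close> is the union of its
  intersections with the members of \<open>S\<close>, and one member can be split off at a time. The
  empty union is excluded by \<open>Y\<close> being nonempty at the zero space.\<close>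

lemma irreducible_le_Sup:
  assumes Y: "irreducible_rep_subset K P Y"
  shows "finite S \<Longrightarrow> (\<And>Z. Z \<in> S \<Longrightarrow> rep_subset K P Z) \<Longrightarrow> Y \<le> Sup S \<Longrightarrow> \<exists>Z\<in>S. Y \<le> Z"
proof (induction S rule: finite_induct)
  case empty
  obtain Z where Z: "Z \<in> (Vec K :: ('a, 'v) module set)" "carrier Z = {\<zero>\<^bsub>Z\<^esub>}" using zero_space_exists by blast
  then have "Y Z \<noteq> {}" using Y unfolding irreducible_rep_subset_def by blast
  moreover have "Y Z \<subseteq> {}" using empty(2) by (simp add: le_fun_def)
  ultimately show ?case by blast
next
  case (insert Z S)
  have Y': "rep_subset K P Y" using Y by (simp add: irreducible_rep_subset_def)
  note Z = insert.prems(1)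
  have "rep_subset K P (inf Y Z)" "rep_subset K P (inf Y (Sup S))"
    using rep_subset_inf[OF Y'] Z rep_subset_Sup[of S] by auto
  moreover have "\<forall>V\<in>Vec K. Y V = inf Y Z V \<union> inf Y (Sup S) V"
    using insert.prems(2) by (auto simp: le_fun_def)
  ultimately have "Y = inf Y Z \<or> Y = inf Y (Sup S)" using Y unfolding irreducible_rep_subset_def by blast
  then show ?case
  proof
    assume "Y = inf Y Z"
    then have "Y \<le> Z" by (metis inf.absorb_iff1)
    then show ?thesis by blast
  next
    assume "Y = inf Y (Sup S)"
    then have "Y \<le> Sup S" by (metis inf.absorb_iff1)
    then show ?thesis using insert.IH Z by blast
  qed
qed

text \<open>Noetherian induction: a nonempty reducible subset is a union of two strictly smaller
  ones. The empty subset is covered by the empty family.\<close>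

lemma finite_irreducible_cover:
  "rep_subset K P X \<Longrightarrow> \<exists>S. finite S \<and> (\<forall>Y\<in>S. irreducible_rep_subset K P Y) \<and> Sup S = X"
proof (induction X rule: wf_induct_rule[OF rep_subset_wf])
  case (1 X)
  note X = 1(2)
  have IH: "\<exists>S. finite S \<and> (\<forall>Y\<in>S. irreducible_rep_subset K P Y) \<and> Sup S = Z" if "rep_subset K P Z" "Z < X" for Z
    by (rule 1(1)[OF _ that(1)]) (use that X in blast)
  consider "X = bot" | "irreducible_rep_subset K P X" | "X \<noteq> bot" "\<not> irreducible_rep_subset K P X" by blast
  then show ?case
  proof cases
    case 1
    then show ?thesis by (intro exI[of _ "{}"]) simp
  next
    case 2
    then show ?thesis by (intro exI[of _ "{X}"]) simp
  next
    case 3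
    have "\<forall>Z\<in>Vec K. carrier Z = {\<zero>\<^bsub>Z\<^esub>} \<longrightarrow> X Z \<noteq> {}" using rep_subset_zero_space[OF X 3(1)] by blast
    then obtain X1 X2 where X12: "rep_subset K P X1" "rep_subset K P X2" and c: "\<forall>V\<in>Vec K. X V = X1 V \<union> X2 V" and n: "X \<noteq> X1" "X \<noteq> X2"
      using 3(2) X unfolding irreducible_rep_subset_def by blast
    have "X1 \<le> X" unfolding rep_subset_le[OF X12(1)] using c by simp
    moreover have "X2 \<le> X" unfolding rep_subset_le[OF X12(2)] using c by simp
    ultimately have le: "X1 \<le> X" "X2 \<le> X" and less: "X1 < X" "X2 < X" using n by auto
    obtain S1 where S1: "finite S1 \<and> (\<forall>Y\<in>S1. irreducible_rep_subset K P Y) \<and> Sup S1 = X1" using IH[OF X12(1) less(1)] ..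
    obtain S2 where S2: "finite S2 \<and> (\<forall>Y\<in>S2. irreducible_rep_subset K P Y) \<and> Sup S2 = X2" using IH[OF X12(2) less(2)] ..
    have "sup X1 X2 = X"
    proof (rule antisym)
      show "sup X1 X2 \<le> X" using le by simp
      show "X \<le> sup X1 X2" unfolding rep_subset_le[OF X] using c by simp
    qed
    then have "Sup (S1 \<union> S2) = X" using S1 S2 by (simp add: Sup_union_distrib)
    then show ?thesis using S1 S2 by (intro exI[of _ "S1 \<union> S2"] conjI ballI) blast+
  qed
qed

lemma irreducible_decomposition_set:
  assumes "irreducible_decomposition K P X Xs" and X: "rep_subset K P X"
  shows "distinct Xs" "\<And>Y. Y \<in> set Xs \<Longrightarrow> irreducible_rep_subset K P Y" "Sup (set Xs) = X"
    "\<And>Y Z. Y \<in> set Xs \<Longrightarrow> Z \<in> set Xs \<Longrightarrow> Y \<le> Z \<Longrightarrow> Y = Z"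
proof -
  note d = assms(1)[unfolded irreducible_decomposition_def]
  have anti: "i = j" if "i < length Xs" "j < length Xs" "Xs ! i \<le> Xs ! j" for i j
    using d that unfolding le_fun_def by blast
  show "distinct Xs" unfolding distinct_conv_nth using anti by (metis order_refl)
  show irr: "irreducible_rep_subset K P Y" if "Y \<in> set Xs" for Y using d that by (metis in_set_conv_nth)
  show "Y = Z" if "Y \<in> set Xs" "Z \<in> set Xs" "Y \<le> Z" for Y Z using anti that by (metis in_set_conv_nth)
  have rep: "rep_subset K P (Sup (set Xs))"
    using irr by (intro rep_subset_Sup) (simp add: irreducible_rep_subset_def)
  have e: "Sup (set Xs) V = X V" if "V \<in> Vec K" for V
  proof -
    have "X V = (\<Union>i<length Xs. (Xs ! i) V)" using d that by blast
    also have "\<dots> = (\<Union>Y\<in>set Xs. Y V)" unfolding set_conv_nth by blast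
    finally show ?thesis by simp
  qed
  show "Sup (set Xs) = X"
  proof
    fix V
    show "Sup (set Xs) V = X V"
      using e rep_subsetD(3)[OF X] rep_subsetD(3)[OF rep] by (cases "V \<in> Vec K") simp_all
  qed
qed

text \<open>A component \<open>a\<close> of one decomposition lies in a component \<open>b\<close>
  of the other, which lies in a component \<open>c\<close> of the first; incomparability gives
  \<open>a = c\<close>, so \<open>a = b\<close>.\<close>

lemma irreducible_decomposition_le:
  assumes X: "rep_subset K P X" and Xs: "irreducible_decomposition K P X Xs" and Ys: "irreducible_decomposition K P X Ys"
  shows "set Xs \<subseteq> set Ys"
proof
  note x = irreducible_decomposition_set[OF Xs X] and y = irreducible_decomposition_set[OF Ys X]
  have le: "\<exists>b\<in>set Bs. a \<le> b" if "a \<in> set As" "irreducible_decomposition K P X As" "irreducible_decomposition K P X Bs" for a As Bs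
  proof (rule irreducible_le_Sup)
    note as = irreducible_decomposition_set[OF that(2) X] and bs = irreducible_decomposition_set[OF that(3) X]
    show "irreducible_rep_subset K P a" by (rule as(2)[OF that(1)])
    show "rep_subset K P b" if "b \<in> set Bs" for b using bs(2)[OF that] by (simp add: irreducible_rep_subset_def)
    show "a \<le> Sup (set Bs)" unfolding bs(3) as(3)[symmetric] by (rule Sup_upper[OF that(1)])
  qed simp
  fix a assume a: "a \<in> set Xs"
  obtain b where b: "b \<in> set Ys" "a \<le> b" using le[OF a Xs Ys] by blast
  obtain c where c: "c \<in> set Xs" "b \<le> c" using le[OF b(1) Ys Xs] by blast
  have "a = c" by (rule x(4)[OF a c(1) order_trans[OF b(2) c(2)]])
  then have "a = b" using b(2) c(2) by simp
  then show "a \<in> set Ys" using b(1) by simp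
qed

theorem unique_irreducible_decomposition:
  assumes X: "rep_subset K P X"
  shows "\<exists>Xs. irreducible_decomposition K P X Xs \<and>
           (\<forall>Ys. irreducible_decomposition K P X Ys \<longrightarrow> mset Ys = mset Xs)"
proof -
  obtain S where S: "finite S" "\<forall>Y\<in>S. irreducible_rep_subset K P Y" "Sup S = X"
    using finite_irreducible_cover[OF X] by blast
  \<comment> \<open>The maximal members already cover, since every member of a finite family lies
    below a maximal one, and they are pairwise incomparable.\<close>
  define T where "T = {Y \<in> S. \<forall>Z\<in>S. Y \<le> Z \<longrightarrow> Y = Z}"
  have T: "finite T" "T \<subseteq> S" using S(1) by (auto simp: T_def)
  have "\<exists>Z\<in>T. Y \<le> Z" if "Y \<in> S" for Y
    using finite_has_maximal2[OF S(1) that] by (auto simp: T_def)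
  then have "Sup S \<le> Sup T" by (meson Sup_mono)
  then have ST: "Sup T = X" using Sup_subset_mono[OF T(2)] S(3) by (simp add: antisym)
  obtain Xs where Xs: "set Xs = T" "distinct Xs" using finite_distinct_list[OF T(1)] by blast
  have "irreducible_decomposition K P X Xs"
    unfolding irreducible_decomposition_def
  proof (intro conjI allI impI ballI)
    fix i assume i: "i < length Xs"
    then have iT: "Xs ! i \<in> T" using Xs by auto
    then show irr: "irreducible_rep_subset K P (Xs ! i)" using S T by blast
    fix j assume j: "j < length Xs" and ij: "i \<noteq> j"
    have jT: "Xs ! j \<in> T" using j Xs by auto
    have "rep_subset K P (Xs ! i)" using irr by (simp add: irreducible_rep_subset_def)
    moreover have "\<not> Xs ! i \<le> Xs ! j"
      using iT jT ij i j nth_eq_iff_index_eq[OF Xs(2) i j] by (auto simp: T_def)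
    ultimately show "\<not> (\<forall>V\<in>Vec K. (Xs ! i) V \<subseteq> (Xs ! j) V)" using rep_subset_le by blast
  next
    fix V :: "('a, 'v) module"
    have "X V = (\<Union>Y\<in>set Xs. Y V)" unfolding ST[symmetric] Xs(1) by simp
    also have "\<dots> = (\<Union>i<length Xs. (Xs ! i) V)" unfolding set_conv_nth by blast
    finally show "X V = (\<Union>i<length Xs. (Xs ! i) V)" .
  qed
  moreover have "mset Ys = mset Xs" if "irreducible_decomposition K P X Xs" "irreducible_decomposition K P X Ys" for Ys
    using irreducible_decomposition_le[OF X that] irreducible_decomposition_le[OF X that(2,1)]
      irreducible_decomposition_set(1)[OF that(1) X] irreducible_decomposition_set(1)[OF that(2) X]
    by (metis set_eq_iff_mset_eq_distinct subset_antisym)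
  ultimately show ?thesis by blast
qed

end

theorem theorem4p2p2:
  fixes K :: "('k, 'm) ring_scheme"
    and P :: "('k, 'v) vec_functor"
    and X :: "('k, 'v) module \<Rightarrow> 'v set"
  assumes "field K" and "finite (carrier K)"
    and "infinite (UNIV :: 'v set)"
    and "polynomial_representation K P"
    and "rep_subset K P X"
  shows "\<exists>Xs. irreducible_decomposition K P X Xs \<and>
           (\<forall>Ys. irreducible_decomposition K P X Ys \<longrightarrow> mset Ys = mset Xs)"
proof -
  interpret finite_polynomial_representation K P
    using assms(1-4) by (simp add: finite_polynomial_representation_def fin_field_def fin_field_axioms_def
        finite_polynomial_representation_axioms_def)
  show ?thesis by (rule unique_irreducible_decomposition[OF assms(5)])
qed

end
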